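(* The Banach space $\mathcal{X}_{cr}$ (constructed in the context) is quasi-minimal: any two infinite dimensional closed subspaces of $\mathcal{X}_{cr}$ have further infinite dimensional closed subspaces (one in each) which are isomorphic to each other.
   Context: Notation. For finitely supported $x$, $\operatorname{minsupp}x=\min\operatorname{supp}x$ and $\operatorname{maxsupp}x=\max\operatorname{supp}x$. $E<F$ means $\max E<\min F$. A block sequence is a sequence of finitely supported vectors with successive supports. The Schreier families are $\mathcal{S}_0=\{\{k\}:k\in\mathbb{N}\}\cup\{\emptyset\}$ and $\mathcal{S}_{n+1}=\{F_1\cup\dots\cup F_k:\ k\le F_1<\dots<F_k,\ F_1,\dots,F_k\in\mathcal{S}_n\}$. For a family $\mathcal{M}$ of finite subsets of $\mathbb{N}$, a finite sequence of sets $(E_i)$ is $\mathcal{M}$-admissible if $E_1<E_2<\dots$ and $\{\min E_i\}_i\in\mathcal{M}$, and $\mathcal{M}$-allowable if the $E_i$ are pairwise disjoint and $\{\min E_i\}_i\in\mathcal{M}$. A sequence of vectors is $\mathcal{M}$-admissible (allowable) if the sequence of its supports is. The $(\mathcal{M},\theta)$-operation sends $(x_1,\dots,x_k)$ with $\{\operatorname{minsupp}x_i\}_i\in\mathcal{M}$ to $\theta(x_1+\dots+x_k)$. Sequences. $m_1=2$, $m_{j+1}=m_j^5$; $n_1=4$, $n_{j+1}=15s_jn_j$, where $s_j=\log_2(m_{j+1}^3)$. Special convex combinations. In a space with basis $(e_i)$, for $\varepsilon>0$ and $n\in\mathbb{N}$, $\sum_{i\in F}a_ie_i$ is an $(n,\varepsilon)$-basic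 scc if $F\in\mathcal{S}_n$, $a_i\in[0,1]$, $\sum_{i\in F}a_i=1$ and $\sum_{i\in G}a_i<\varepsilon$ for every $G\in\mathcal{S}_{n-1}$. A vector $\sum_{i\in F}a_ix_i$, with $(x_i)$ a block sequence, is an $(n,\varepsilon)$-scc of $(x_i)$ if $\sum_{i\in F}a_ie_{\operatorname{minsupp}x_i}$ is an $(n,\varepsilon)$-basic scc. The function $l$. For all $n\in\mathbb{N}$, $\varepsilon>0$ there is $l(n,\varepsilon)\ge n$, depending only on $n,\varepsilon$ and the sequences $(n_j),(m_j)$, with the following property (a known fact): for every Banach space $X$ with a basis satisfying $\frac{1}{m_{2j}}\sum_i\|E_ix\|\le\|x\|$ for all $x\in X$, $j\in\mathbb{N}$ and $\mathcal{S}_{n_{2j}}$-admissible $(E_i)$ (where $Ex$ is the coordinate projection of $x$ on $E$), and for any block sequence $(x_i)$ in $X$, there are $F\in\mathcal{S}_{l(n,\varepsilon)}$ and an $(n,\varepsilon)$-scc $x$ of a normalized block sequence of $(x_i)_{i\in F}$ with $\|x\|\ge1/2$. Fix such a function $l$. For $n\in\mathbb{N}$ put $\rho(n)=l(n_{2s},m_{2s}^{-2})$, where $s\in\mathbb{N}$ is minimal with $n^2\le m_{2s}$. Coding function. Fix a partition of $\mathbb{N}$ into two infinite sets $L_1,L_2$. Let $\mathcal{G}$ be the set of all finite sequences $(E_1,\dots,E_n)$, $n\in\mathbb{N}$, of intervals of $\mathbb{N}$ with $E_1<\dots<E_n$. Fix an injective $\sigma:\mathcal{G}\to2L_2=\{2l:l\in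 L_2\}$ with $n_{\sigma(E_1,\dots,E_n)}\ge\rho(\max E_n)+\max E_n$ for every $(E_1,\dots,E_n)\in\mathcal{G}$, $n\ge2$. Norming set. $W$ is the smallest subset of $c_{00}(\mathbb{N})$ such that: ($\alpha$) $\pm e_n\in W$ for all $n$, where $(e_n)$ is the canonical basis of $c_{00}(\mathbb{N})$; ($\beta$) if $f\in W$, $g\in c_{00}(\mathbb{N})$ and $|f|=|g|$ (coordinatewise), then $g\in W$; ($\gamma$) for each $j\in\mathbb{N}$, $W$ is closed under the $(\mathcal{S}_{n_{2j}},m_{2j}^{-1})$-operation on $\mathcal{S}_{n_{2j}}$-allowable sequences; ($\delta$) for each $j\in\mathbb{N}$, $W$ is closed under the $(\mathcal{S}_{n_{2j+1}},m_{2j+1}^{-1})$-operation on $(2j+1)$-dependent sequences. Dependent sequences. A block sequence $(f_i)_{i\in F}$ of elements of $W$, with $F=\{1,\dots,d\}$, is $(2j+1)$-dependent if it is $\mathcal{S}_{n_{2j+1}}$-admissible, each $f_i$ has the form $f_i=m_{2j_i}^{-1}\sum_{k\in K_i}f_{i,k}$ (the weight of $f_i$ is $m_{2j_i}^{-1}$, and $(f_{i,k})_{k\in K_i}$ is an $\mathcal{S}_{n_{2j_i}}$-admissible sequence in $W$), and there is a sequence $(E_r)_{r\in A}\in\mathcal{G}$ whose index set $A\subset\mathbb{N}$ is the union of successive intervals $A_k$, $k\in K_i$, $i\in F$ (where $K_1<K_2<\dots<K_d$ are successive intervals of indices), such that (1) $j_1\in L_1$ and $m_{2j_1}>n_{2j+1}$;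 (2) $2j_{i+1}=\sigma(E_r:\ r\in A_k,\ k\in K_l,\ l\le i)$ for any $i<\max F$; (3) $\operatorname{supp}f_{i,k}\subset\bigcup_{r\in A_k}E_r$ for all $k\in K_i$, $i\in F$; (4) $A_{\min K_i}$ is a singleton for each $i\in F$, and $(E_r)_{r\in A_k}$ is $\mathcal{S}_{\rho(\max E_{\max A_{k-1}})}$-admissible for any $k\in K_i$, $k>\min K_i$, $i\in F$. Some of the $f_{i,k}$ (hence of the $f_i$) are allowed to be $0$ (zero terms are ignored in admissibility conditions), so that the restriction of $m_{2j+1}^{-1}\sum_{i\in F}f_i$ to any subset of $\mathbb{N}$ is of the same form. The space. $\mathcal{X}_{cr}$ is the completion of $c_{00}(\mathbb{N})$ under $\|x\|=\sup\{|f(x)|:f\in W\}$, where $f(x)=\sum_if_ix_i$. Its canonical basis is $(e_n)$. *)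

theory Defs
  imports "HOL-Analysis.Analysis"
begin

text \<open>
  Conventions. The natural numbers indexing coordinates and sequences start at 1; index 0 is never
  used. A vector is its coordinate function \<open>nat \<Rightarrow> real\<close>, with coordinate 0 equal to 0. Families and
  finite sequences are functions on an explicit index set of natural numbers, so they may be
  indexed by arbitrary intervals. All spaces are real.
\<close>

type_synonym vec = "nat \<Rightarrow> real"

definition supp :: "vec \<Rightarrow> nat set" where
  "supp x = {i. x i \<noteq> 0}"

definition c00 :: "vec set" where
  "c00 = {x. x 0 = 0 \<and> finite (supp x)}"

abbreviation unit_vec :: "nat \<Rightarrow> vec" where
  "unit_vec n \<equiv> indicat_real {n}"

abbreviation minsupp :: "vec \<Rightarrow> nat" where
  "minsupp x \<equiv> Min (supp x)"

definition lincomb :: "nat set \<Rightarrow> (nat \<Rightarrow> real) \<Rightarrow> (nat \<Rightarrow> vec) \<Rightarrow> vec" where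
  "lincomb I a x = (\<lambda>t. \<Sum>i\<in>I. a i * x i t)"

definition proj :: "nat set \<Rightarrow> vec \<Rightarrow> vec" where
  "proj E x = (\<lambda>i. if i \<in> E then x i else 0)"

definition set_less :: "nat set \<Rightarrow> nat set \<Rightarrow> bool" where
  "set_less E F \<longleftrightarrow> (\<forall>a\<in>E. \<forall>b\<in>F. a < b)"

definition interval :: "nat set \<Rightarrow> bool" where
  "interval E \<longleftrightarrow> (\<exists>a b. 1 \<le> a \<and> a \<le> b \<and> E = {a..b})"

definition successive :: "nat set \<Rightarrow> (nat \<Rightarrow> nat set) \<Rightarrow> bool" where
  "successive I E \<longleftrightarrow> (\<forall>i\<in>I. \<forall>j\<in>I. i < j \<longrightarrow> set_less (E i) (E j))"

definition block_seq :: "nat set \<Rightarrow> (nat \<Rightarrow> vec) \<Rightarrow> bool" where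
  "block_seq I x \<longleftrightarrow>
     (\<forall>i\<in>I. x i \<in> c00 \<and> supp (x i) \<noteq> {}) \<and> successive I (\<lambda>i. supp (x i))"


text \<open>
  Empty pieces are harmless in the recursion: \<^const>\<open>set_less\<close> is required for all pairs, and
  removing empty pieces only decreases their number.
\<close>

primrec schreier :: "nat \<Rightarrow> nat set set" where
  "schreier 0 = insert {} {{k} |k. 1 \<le> k}"
| "schreier (Suc n) = {\<Union>i\<in>{1..k}. F i |k F.
     (\<forall>i\<in>{1..k}. F i \<in> schreier n \<and> (\<forall>t\<in>F i. k \<le> t)) \<and> successive {1..k} F}"

text \<open>
  Empty sets, that is, supports of zero vectors, are ignored in both of the following notions.
\<close>

definition min_set :: "nat set \<Rightarrow> (nat \<Rightarrow> nat set) \<Rightarrow> nat set" where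
  "min_set I E = {Min (E i) |i. i \<in> I \<and> E i \<noteq> {}}"

definition admissible :: "nat set set \<Rightarrow> nat set \<Rightarrow> (nat \<Rightarrow> nat set) \<Rightarrow> bool" where
  "admissible M I E \<longleftrightarrow>
     finite I \<and> (\<forall>i\<in>I. finite (E i)) \<and> successive I E \<and> min_set I E \<in> M"

definition allowable :: "nat set set \<Rightarrow> nat set \<Rightarrow> (nat \<Rightarrow> nat set) \<Rightarrow> bool" where
  "allowable M I E \<longleftrightarrow>
     finite I \<and> (\<forall>i\<in>I. finite (E i)) \<and> disjoint_family_on E I \<and> min_set I E \<in> M"


fun mseq :: "nat \<Rightarrow> nat" where
  "mseq 0 = 0"
| "mseq (Suc 0) = 2"
| "mseq (Suc (Suc j)) = mseq (Suc j) ^ 5"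

definition sseq :: "nat \<Rightarrow> nat" where
  "sseq j = nat \<lfloor>log 2 (real (mseq (Suc j) ^ 3))\<rfloor>"

fun nseq :: "nat \<Rightarrow> nat" where
  "nseq 0 = 0"
| "nseq (Suc 0) = 4"
| "nseq (Suc (Suc j)) = 15 * sseq (Suc j) * nseq (Suc j)"

lemma mseq_Suc: "mseq (Suc j) = 2 ^ 5 ^ j"
  by (induction j) (simp_all add: power_mult [symmetric] mult.commute)

text \<open>The logarithm defining \<^const>\<open>sseq\<close> is an integer, so the rounding has no effect.\<close>

lemma sseq_eq_log: "real (sseq j) = log 2 (real (mseq (Suc j) ^ 3))"
proof -
  have "log 2 (real (mseq (Suc j) ^ 3)) = log 2 (2 ^ (5 ^ j * 3))"
    by (simp add: mseq_Suc power_mult)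
  also have "\<dots> = real (5 ^ j * 3)"
    by (subst log_nat_power) simp_all
  finally show ?thesis
    unfolding sseq_def by (metis floor_of_nat nat_int)
qed


definition basic_scc :: "nat \<Rightarrow> real \<Rightarrow> vec \<Rightarrow> bool" where
  "basic_scc n \<epsilon> v \<longleftrightarrow>
     (\<exists>F\<in>schreier n. supp v \<subseteq> F \<and> (\<forall>i\<in>F. 0 \<le> v i \<and> v i \<le> 1) \<and> (\<Sum>i\<in>F. v i) = 1) \<and>
     (\<forall>G\<in>schreier (n - 1). (\<Sum>i\<in>G. v i) < \<epsilon>)"

definition scc :: "nat \<Rightarrow> real \<Rightarrow> nat set \<Rightarrow> (nat \<Rightarrow> vec) \<Rightarrow> vec \<Rightarrow> bool" where
  "scc n \<epsilon> I x z \<longleftrightarrow> block_seq I x \<and>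
     (\<exists>F a. F \<subseteq> I \<and> finite F \<and> z = lincomb F a x \<and>
        basic_scc n \<epsilon> (lincomb F a (\<lambda>i. unit_vec (minsupp (x i)))))"


text \<open>
  A Banach space with a basis is represented by the set \<open>X\<close> of coefficient sequences of its
  elements, with the transported norm \<open>N\<close>; the basis becomes the sequence of unit vectors, and
  the partial sums of the series \<open>\<Sum>i. a i * e i\<close> become \<^term>\<open>proj {1..n} a\<close>. This loses no
  generality and allows quantification over all such spaces.
\<close>

definition banach_with_basis :: "vec set \<Rightarrow> (vec \<Rightarrow> real) \<Rightarrow> bool" where
  "banach_with_basis X N \<longleftrightarrow>
     (\<forall>x\<in>X. x 0 = 0) \<and>
     (\<forall>i\<ge>1. unit_vec i \<in> X) \<and>
     (\<forall>x\<in>X. \<forall>y\<in>X. (\<lambda>i. x i + y i) \<in> X) \<and>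
     (\<forall>x\<in>X. \<forall>c. (\<lambda>i. c * x i) \<in> X) \<and>
     (\<forall>x\<in>X. N x \<ge> 0 \<and> (N x = 0 \<longleftrightarrow> x = (\<lambda>i. 0))) \<and>
     (\<forall>x\<in>X. \<forall>y\<in>X. N (\<lambda>i. x i + y i) \<le> N x + N y) \<and>
     (\<forall>x\<in>X. \<forall>c. N (\<lambda>i. c * x i) = \<bar>c\<bar> * N x) \<and>
     (\<forall>u. (\<forall>p. u p \<in> X) \<and> (\<forall>\<epsilon>>0. \<exists>M. \<forall>p\<ge>M. \<forall>q\<ge>M. N (\<lambda>i. u p i - u q i) < \<epsilon>) \<longrightarrow>
        (\<exists>x\<in>X. (\<lambda>p. N (\<lambda>i. u p i - x i)) \<longlonglongrightarrow> 0)) \<and>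
     (\<forall>x\<in>X. (\<lambda>n. N (\<lambda>i. x i - proj {1..n} x i)) \<longlonglongrightarrow> 0) \<and>
     (\<forall>x\<in>X. \<forall>a. a 0 = 0 \<and> (\<lambda>n. N (\<lambda>i. x i - proj {1..n} a i)) \<longlonglongrightarrow> 0 \<longrightarrow> a = x)"

definition lower_estimates :: "vec set \<Rightarrow> (vec \<Rightarrow> real) \<Rightarrow> bool" where
  "lower_estimates X N \<longleftrightarrow>
     (\<forall>x\<in>X. \<forall>j\<ge>1. \<forall>I E. admissible (schreier (nseq (2 * j))) I E \<longrightarrow>
        1 / real (mseq (2 * j)) * (\<Sum>i\<in>I. N (proj (E i) x)) \<le> N x)"

definition block_seq_of ::
  "nat set \<Rightarrow> (nat \<Rightarrow> vec) \<Rightarrow> nat set \<Rightarrow> (nat \<Rightarrow> vec) \<Rightarrow> bool" where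
  "block_seq_of F x D y \<longleftrightarrow> block_seq D y \<and>
     (\<exists>B b. successive D B \<and> (\<forall>k\<in>D. B k \<subseteq> F \<and> finite (B k) \<and> y k = lincomb (B k) b x))"

definition scc_function :: "(nat \<Rightarrow> real \<Rightarrow> nat) \<Rightarrow> bool" where
  "scc_function l \<longleftrightarrow> (\<forall>n\<ge>1. \<forall>\<epsilon>>0. n \<le> l n \<epsilon> \<and>
     (\<forall>X N. banach_with_basis X N \<and> lower_estimates X N \<longrightarrow>
        (\<forall>x. block_seq {1..} x \<longrightarrow>
           (\<exists>F\<in>schreier (l n \<epsilon>). \<exists>d y z.
              block_seq_of F x {1..d} y \<and> (\<forall>k\<in>{1..d}. N (y k) = 1) \<and>
              scc n \<epsilon> {1..d} y z \<and> N z \<ge> 1 / 2))))"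

definition rho :: "(nat \<Rightarrow> real \<Rightarrow> nat) \<Rightarrow> nat \<Rightarrow> nat" where
  "rho l n = (let s = LEAST s. 1 \<le> s \<and> n\<^sup>2 \<le> mseq (2 * s)
              in l (nseq (2 * s)) (1 / (real (mseq (2 * s)))\<^sup>2))"


definition interval_seqs :: "nat set list set" where
  "interval_seqs = {Es. Es \<noteq> [] \<and> (\<forall>E\<in>set Es. interval E) \<and> sorted_wrt set_less Es}"

definition coding_function ::
  "(nat \<Rightarrow> real \<Rightarrow> nat) \<Rightarrow> nat set \<Rightarrow> (nat set list \<Rightarrow> nat) \<Rightarrow> bool" where
  "coding_function l L2 \<sigma> \<longleftrightarrow>
     inj_on \<sigma> interval_seqs \<and> \<sigma> ` interval_seqs \<subseteq> (\<lambda>i. 2 * i) ` L2 \<and>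
     (\<forall>Es\<in>interval_seqs. length Es \<ge> 2 \<longrightarrow>
        nseq (\<sigma> Es) \<ge> rho l (Max (last Es)) + Max (last Es))"

definition seq_list :: "nat set \<Rightarrow> (nat \<Rightarrow> nat set) \<Rightarrow> nat set list" where
  "seq_list A E = map E (sorted_list_of_set A)"


text \<open>
  \<open>dependent l L1 \<sigma> V j d f\<close>: the sequence \<open>f 1, \<dots>, f d\<close> is \<open>(2j+1)\<close>-dependent with respect to the
  set of functionals \<open>V\<close>. Here \<open>J i\<close>, \<open>g i k\<close> are the usual \<open>j\<^sub>i\<close> and \<open>f\<^sub>i\<^sub>,\<^sub>k\<close>. The \<open>g i k\<close>
  and the \<open>f i\<close> may be 0, whether or not \<open>0 \<in> V\<close>.
\<close>

definition dependent ::
  "(nat \<Rightarrow> real \<Rightarrow> nat) \<Rightarrow> nat set \<Rightarrow> (nat set list \<Rightarrow> nat) \<Rightarrow> vec set \<Rightarrow>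
   nat \<Rightarrow> nat \<Rightarrow> (nat \<Rightarrow> vec) \<Rightarrow> bool" where
  "dependent l L1 \<sigma> V j d f \<longleftrightarrow>
     1 \<le> d \<and> (\<forall>i\<in>{1..d}. f i \<in> insert (\<lambda>t. 0) V) \<and>
     admissible (schreier (nseq (2 * j + 1))) {1..d} (\<lambda>i. supp (f i)) \<and>
     (\<exists>J K g A E.
        (\<forall>i\<in>{1..d}. 1 \<le> J i \<and> interval (K i)) \<and> successive {1..d} K \<and>
        (\<forall>i\<in>{1..d}.
           f i = lincomb (K i) (\<lambda>k. 1 / real (mseq (2 * J i))) (g i) \<and>
           (\<forall>k\<in>K i. g i k \<in> insert (\<lambda>t. 0) V) \<and>
           admissible (schreier (nseq (2 * J i))) (K i) (\<lambda>k. supp (g i k))) \<and>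
        (\<forall>k\<in>(\<Union>i\<in>{1..d}. K i). interval (A k)) \<and> successive (\<Union>i\<in>{1..d}. K i) A \<and>
        seq_list (\<Union>i\<in>{1..d}. \<Union>k\<in>K i. A k) E \<in> interval_seqs \<and>
        J 1 \<in> L1 \<and> mseq (2 * J 1) > nseq (2 * j + 1) \<and>
        (\<forall>i\<in>{1..<d}. 2 * J (i + 1) = \<sigma> (seq_list (\<Union>i'\<in>{1..i}. \<Union>k\<in>K i'. A k) E)) \<and>
        (\<forall>i\<in>{1..d}. \<forall>k\<in>K i. supp (g i k) \<subseteq> (\<Union>r\<in>A k. E r)) \<and>
        (\<forall>i\<in>{1..d}. is_singleton (A (Min (K i))) \<and>
           (\<forall>k\<in>K i. k > Min (K i) \<longrightarrow>
              admissible (schreier (rho l (Max (E (Max (A (k - 1))))))) (A k) E)))"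

definition norming_closed ::
  "(nat \<Rightarrow> real \<Rightarrow> nat) \<Rightarrow> nat set \<Rightarrow> (nat set list \<Rightarrow> nat) \<Rightarrow> vec set \<Rightarrow> bool" where
  "norming_closed l L1 \<sigma> V \<longleftrightarrow>
     (\<forall>n\<ge>1. unit_vec n \<in> V \<and> (\<lambda>i. - unit_vec n i) \<in> V) \<and>
     (\<forall>f\<in>V. \<forall>g\<in>c00. (\<forall>i. \<bar>f i\<bar> = \<bar>g i\<bar>) \<longrightarrow> g \<in> V) \<and>
     (\<forall>j\<ge>1. \<forall>d\<ge>1. \<forall>f. (\<forall>i\<in>{1..d}. f i \<in> V) \<and>
        allowable (schreier (nseq (2 * j))) {1..d} (\<lambda>i. supp (f i)) \<longrightarrow>
        lincomb {1..d} (\<lambda>i. 1 / real (mseq (2 * j))) f \<in> V) \<and>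
     (\<forall>j\<ge>1. \<forall>d f. dependent l L1 \<sigma> V j d f \<longrightarrow>
        lincomb {1..d} (\<lambda>i. 1 / real (mseq (2 * j + 1))) f \<in> V)"

definition norming_set ::
  "(nat \<Rightarrow> real \<Rightarrow> nat) \<Rightarrow> nat set \<Rightarrow> (nat set list \<Rightarrow> nat) \<Rightarrow> vec set" where
  "norming_set l L1 \<sigma> = \<Inter> {V. V \<subseteq> c00 \<and> norming_closed l L1 \<sigma> V}"

lemma dependent_mono: "V \<subseteq> V' \<Longrightarrow> dependent l L1 \<sigma> V j d f \<Longrightarrow> dependent l L1 \<sigma> V' j d f"
  unfolding dependent_def
  apply (elim conjE exE)
  subgoal for J K g A E
    apply (intro conjI)
       apply assumption
      apply blast
     apply assumption
    apply (rule exI[of _ J], rule exI[of _ K], rule exI[of _ g], rule exI[of _ A], rule exI[of _ E])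
    apply (intro conjI; (assumption | blast))
    done
  done

text \<open>The intersection is itself closed, so it is the smallest closed set.\<close>

lemma norming_set_closed: "norming_closed l L1 \<sigma> (norming_set l L1 \<sigma>)"
proof -
  let ?W = "norming_set l L1 \<sigma>"
  have sub: "f \<in> V" if "V \<subseteq> c00" "norming_closed l L1 \<sigma> V" "f \<in> ?W" for V f
    using that unfolding norming_set_def by blast
  have mem: "f \<in> ?W" if "\<And>V. V \<subseteq> c00 \<Longrightarrow> norming_closed l L1 \<sigma> V \<Longrightarrow> f \<in> V" for f
    using that unfolding norming_set_def by blast
  note D = norming_closed_def [THEN iffD1]
  note D1 = D [THEN conjunct1, rule_format]
  note D2 = D [THEN conjunct2, THEN conjunct1, rule_format]
  note D3 = D [THEN conjunct2, THEN conjunct2, THEN conjunct1, rule_format]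
  note D4 = D [THEN conjunct2, THEN conjunct2, THEN conjunct2, rule_format]
  show ?thesis
    unfolding norming_closed_def
  proof (intro conjI allI ballI impI)
    fix n :: nat assume n: "1 \<le> n"
    show "unit_vec n \<in> ?W" by (rule mem) (rule D1 [OF _ n, THEN conjunct1])
    show "(\<lambda>i. - unit_vec n i) \<in> ?W" by (rule mem) (rule D1 [OF _ n, THEN conjunct2])
  next
    fix f g assume *: "f \<in> ?W" "g \<in> c00" "\<forall>i. \<bar>f i\<bar> = \<bar>g i\<bar>"
    show "g \<in> ?W"
    proof (rule mem)
      fix V assume V: "V \<subseteq> c00" "norming_closed l L1 \<sigma> V"
      show "g \<in> V"
        by (rule D2 [OF V(2) sub [OF V *(1)] *(2)]) (simp add: *(3))
    qed
  next
    fix j d :: nat and f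
    assume *: "1 \<le> j" "1 \<le> d" "(\<forall>i\<in>{1..d}. f i \<in> ?W) \<and>
      allowable (schreier (nseq (2 * j))) {1..d} (\<lambda>i. supp (f i))"
    show "lincomb {1..d} (\<lambda>i. 1 / real (mseq (2 * j))) f \<in> ?W"
    proof (rule mem)
      fix V assume V: "V \<subseteq> c00" "norming_closed l L1 \<sigma> V"
      show "lincomb {1..d} (\<lambda>i. 1 / real (mseq (2 * j))) f \<in> V"
      proof (rule D3 [OF V(2) *(1,2) conjI])
        show "\<forall>i\<in>{1..d}. f i \<in> V"
          using *(3) [THEN conjunct1] by (intro ballI sub [OF V]) (rule bspec)
      qed (rule *(3) [THEN conjunct2])
    qed
  next
    fix j d :: nat and f
    assume *: "1 \<le> j" "dependent l L1 \<sigma> ?W j d f"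
    show "lincomb {1..d} (\<lambda>i. 1 / real (mseq (2 * j + 1))) f \<in> ?W"
    proof (rule mem)
      fix V assume V: "V \<subseteq> c00" "norming_closed l L1 \<sigma> V"
      have "?W \<subseteq> V" using sub [OF V] by (rule subsetI)
      then show "lincomb {1..d} (\<lambda>i. 1 / real (mseq (2 * j + 1))) f \<in> V"
        by (rule D4 [OF V(2) *(1) dependent_mono [OF _ *(2)]])
    qed
  qed
qed

text \<open>
  Elements of the norming set are finitely supported with coordinates in \<open>[-1, 1]\<close>; in particular
  the supremum defining the norm is finite.
\<close>

lemma lincomb_disjoint:
  assumes "finite I" "disjoint_family_on (\<lambda>i. supp (f i)) I"
    and f: "\<And>i. i \<in> I \<Longrightarrow> f i \<in> c00 \<and> (\<forall>t. \<bar>f i t\<bar> \<le> 1)"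
  shows "lincomb I (\<lambda>i. 1 / real m) f \<in> c00 \<and> (\<forall>t. \<bar>lincomb I (\<lambda>i. 1 / real m) f t\<bar> \<le> 1)"
proof (intro conjI allI)
  have "supp (lincomb I (\<lambda>i. 1 / real m) f) \<subseteq> (\<Union>i\<in>I. supp (f i))"
  proof
    fix t assume "t \<in> supp (lincomb I (\<lambda>i. 1 / real m) f)"
    then have "(\<Sum>i\<in>I. 1 / real m * f i t) \<noteq> 0" unfolding supp_def lincomb_def by (rule CollectD)
    then obtain i where "i \<in> I" "1 / real m * f i t \<noteq> 0"
      by (rule sum.not_neutral_contains_not_neutral)
    then show "t \<in> (\<Union>i\<in>I. supp (f i))" by (auto simp: supp_def)
  qed
  then have "finite (supp (lincomb I (\<lambda>i. 1 / real m) f))"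
    by (rule finite_subset) (use f \<open>finite I\<close> in \<open>auto simp: c00_def\<close>)
  moreover have "lincomb I (\<lambda>i. 1 / real m) f 0 = 0"
    unfolding lincomb_def by (rule sum.neutral) (use f in \<open>auto simp: c00_def\<close>)
  ultimately show "lincomb I (\<lambda>i. 1 / real m) f \<in> c00"
    by (simp add: c00_def)
next
  fix t
  have m: "\<bar>1 / real m\<bar> \<le> 1"
    by (cases "m = 0") (auto simp: divide_simps)
  show "\<bar>lincomb I (\<lambda>i. 1 / real m) f t\<bar> \<le> 1"
  proof (cases "\<exists>i\<in>I. f i t \<noteq> 0")
    case True
    then obtain i where i: "i \<in> I" "f i t \<noteq> 0" by blast
    have "f k t = 0" if "k \<in> I" "k \<noteq> i" for k
    proof (rule ccontr)
      assume "f k t \<noteq> 0"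
      then have "t \<in> supp (f k) \<inter> supp (f i)" using i by (simp add: supp_def)
      then show False using assms(2) that i(1) unfolding disjoint_family_on_def by blast
    qed
    then have "lincomb I (\<lambda>i. 1 / real m) f t = (\<Sum>k\<in>{i}. 1 / real m * f k t)"
      unfolding lincomb_def using i \<open>finite I\<close> by (intro sum.mono_neutral_right) auto
    moreover have "\<bar>1 / real m * f i t\<bar> \<le> 1 * 1"
      unfolding abs_mult using m f[OF i(1)] by (intro mult_mono) auto
    ultimately show ?thesis by simp
  next
    case False
    then show ?thesis by (simp add: lincomb_def)
  qed
qed

lemma norming_set_bounded:
  assumes "f \<in> norming_set l L1 \<sigma>"
  shows "f \<in> c00" "\<bar>f t\<bar> \<le> 1"
proof -
  define V where "V = {f \<in> c00. \<forall>t. \<bar>f t\<bar> \<le> 1}"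
  have V_iff: "f \<in> V \<longleftrightarrow> f \<in> c00 \<and> (\<forall>t. \<bar>f t\<bar> \<le> 1)" for f
    by (simp add: V_def)
  have "norming_closed l L1 \<sigma> V"
    unfolding norming_closed_def
  proof (intro conjI allI ballI impI)
    fix n :: nat assume "1 \<le> n"
    moreover have "supp (unit_vec n) = {n}" "supp (\<lambda>i. - unit_vec n i) = {n}"
      by (auto simp: supp_def indicator_def)
    ultimately show "unit_vec n \<in> V" "(\<lambda>i. - unit_vec n i) \<in> V"
      by (simp_all add: V_iff c00_def indicator_def)
  next
    fix f g assume "f \<in> V" "g \<in> c00" "\<forall>i. \<bar>f i\<bar> = \<bar>g i\<bar>"
    then show "g \<in> V" by (simp add: V_iff)
  next
    fix j d :: nat and f
    assume *: "(\<forall>i\<in>{1..d}. f i \<in> V) \<and>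
      allowable (schreier (nseq (2 * j))) {1..d} (\<lambda>i. supp (f i))"
    show "lincomb {1..d} (\<lambda>i. 1 / real (mseq (2 * j))) f \<in> V"
      unfolding V_iff
    proof (rule lincomb_disjoint)
      show "disjoint_family_on (\<lambda>i. supp (f i)) {1..d}"
        using * unfolding allowable_def by (elim conjE)
    qed (use * in \<open>simp_all add: V_iff\<close>)
  next
    fix j d :: nat and f
    assume "dependent l L1 \<sigma> V j d f"
    note dep = this [unfolded dependent_def, THEN conjunct2]
    have "insert (\<lambda>t. 0) V = V" by (rule insert_absorb) (simp add: V_iff c00_def supp_def)
    with dep [THEN conjunct1] have f: "\<forall>i\<in>{1..d}. f i \<in> V" by (simp only:)
    have succ: "successive {1..d} (\<lambda>i. supp (f i))"
      using dep [THEN conjunct2, THEN conjunct1] by (simp only: admissible_def)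
    show "lincomb {1..d} (\<lambda>i. 1 / real (mseq (2 * j + 1))) f \<in> V"
      unfolding V_iff
    proof (rule lincomb_disjoint)
      show "disjoint_family_on (\<lambda>i. supp (f i)) {1..d}"
        unfolding disjoint_family_on_def
      proof (intro ballI impI)
        fix i k assume "i \<in> {1..d}" "k \<in> {1..d}" "i \<noteq> k"
        then have "set_less (supp (f i)) (supp (f k)) \<or> set_less (supp (f k)) (supp (f i))"
          using succ unfolding successive_def by (meson nat_neq_iff)
        then show "supp (f i) \<inter> supp (f k) = {}"
          unfolding set_less_def by (meson disjoint_iff less_asym)
      qed
    qed (use f in \<open>simp_all add: V_iff\<close>)
  qed
  moreover have "V \<subseteq> c00" by (simp add: V_def)
  ultimately have "norming_set l L1 \<sigma> \<subseteq> V"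
    unfolding norming_set_def by (intro Inter_lower CollectI conjI)
  then have "f \<in> V" using assms by (rule subsetD)
  then show "f \<in> c00" "\<bar>f t\<bar> \<le> 1" by (simp_all add: V_iff)
qed

definition cr_norm :: "vec set \<Rightarrow> vec \<Rightarrow> real" where
  "cr_norm W x = (SUP f\<in>W. \<bar>\<Sum>i\<in>supp x. f i * x i\<bar>)"

text \<open>
  \<open>X\<close> is a completion of \<^const>\<open>c00\<close> under the norm \<open>N\<close>, with the unit vectors sent to the
  sequence \<open>e\<close>: a closed subspace of some Banach space in which \<^const>\<open>c00\<close> embeds isometrically
  and densely.
\<close>

definition completion_c00 :: "(vec \<Rightarrow> real) \<Rightarrow> (nat \<Rightarrow> 'b::banach) \<Rightarrow> 'b set \<Rightarrow> bool" where
  "completion_c00 N e X \<longleftrightarrow>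
     (\<forall>x\<in>c00. norm (\<Sum>i\<in>supp x. x i *\<^sub>R e i) = N x) \<and> X = closure (span (e ` {1..}))"


definition infinite_dimensional :: "'b::real_vector set \<Rightarrow> bool" where
  "infinite_dimensional Y \<longleftrightarrow> \<not> (\<exists>B. finite B \<and> Y \<subseteq> span B)"

definition isomorphic_subspaces :: "'b::real_normed_vector set \<Rightarrow> 'b set \<Rightarrow> bool" where
  "isomorphic_subspaces Y Z \<longleftrightarrow>
     (\<exists>T S. homeomorphism Y Z T S \<and>
        (\<forall>x\<in>Y. \<forall>y\<in>Y. T (x + y) = T x + T y) \<and> (\<forall>x\<in>Y. \<forall>c. T (c *\<^sub>R x) = c *\<^sub>R T x))"

definition closed_inf_dim_subspace :: "'b::real_normed_vector set \<Rightarrow> 'b set \<Rightarrow> bool" where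
  "closed_inf_dim_subspace Y X \<longleftrightarrow>
     Y \<subseteq> X \<and> subspace Y \<and> closed Y \<and> infinite_dimensional Y"

definition quasi_minimal :: "'b::real_normed_vector set \<Rightarrow> bool" where
  "quasi_minimal X \<longleftrightarrow>
     (\<forall>Y Z. closed_inf_dim_subspace Y X \<and> closed_inf_dim_subspace Z X \<longrightarrow>
        (\<exists>Y' Z'. closed_inf_dim_subspace Y' Y \<and> closed_inf_dim_subspace Z' Z \<and>
           isomorphic_subspaces Y' Z'))"

end

theory Submission
  imports Defs
begin

text \<open>
  A functional of the norming set is encoded by a tree of operations. In the two subspaces one builds
  sequences \<open>x i\<close>, \<open>y i\<close> of iterated averages with a common skeleton: averages of weight \<open>wq\<close> of averages
  of larger weights \<open>wm\<close> of pairs of vectors in successive cells on which the norm is almost attained on both sides.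
  All these weights lie in \<open>2 L1\<close>, so that the coding function never selects them.
  Up to summable errors the value of a tree on \<open>x i\<close> is at most a constant times an average
  over the cells of its charge, a number which depends on the tree and the skeleton only. Conversely a tree can be rebuilt, with
  the norming trees of the cells in place of its charged parts, so that its average charge is at
  most the value of the new tree on \<open>x i\<close>, and likewise on \<open>y i\<close>. Hence the norms of all finite combinations
  of the \<open>x i\<close> and of the \<open>y i\<close> with the same coefficients are equivalent.
\<close>

text \<open>The obstacle is the rigidity of dependent nodes. The weights of their slots are computed
  from the intervals \<open>E\<close>, so such a node can be rebuilt only inside the intervals it
  already has: a cell may be charged only to a piece whose intervals contain it, and cells
  containing ends of relevant intervals have to be discarded. Condition (4) bounds the complexity of
  these ends by coordinates lying before the cells, so that averages chosen afterwards make the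
  discarded part small. The first slot is not computed by the coding and may carry the weight
  \<open>wq\<close>, yet no new pieces can be inserted there; this accounts for the second kind of
  charge, \<open>ch2\<close>. Each layer of averages removes one kind of node. The innermost one
  disposes of nodes starting inside a cell and of interval ends; the middle one of nodes with
  weights in the window of a cell, so that only the weight \<open>wm\<close> remains; the outer one
  of nodes of weight \<open>wm\<close> themselves, so that only \<open>wq\<close> remains. A node of
  weight \<open>wq\<close> then receives the norming trees of a whole macro average, and the order
  of the outer averages, at most n_q - 1, leaves room for them.\<close>

abbreviation rm :: "nat => real" where "rm w \<equiv> real (mseq w)"

abbreviation SN :: "nat => nat set set" where "SN w \<equiv> schreier (nseq w)"

section \<open>Schreier families and special convex combinations\<close>

text \<open>By \<open>schreier_Suc_iff\<close> the members of S_(n+1) are the sets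
  \<open>covered n k\<close> with \<open>k\<close> at most their minimum. Separating the number of
  blocks from the minimum allows the two to be estimated independently.\<close>

definition covered :: "nat => nat => nat set => bool" where
 "covered n k X \<longleftrightarrow> (EX F. X = (UN i:{1..k}. F i) & (ALL i:{1..k}. F i : schreier n) & successive {1..k} F)"

lemma schreier_Suc_iff: "X : schreier (Suc n) \<longleftrightarrow> (EX k. covered n k X & (ALL t:X. k <= t))" unfolding covered_def schreier.simps mem_Collect_eq
proof (intro iffI; elim exE conjE)
 fix k F assume "X = (UN i:{1..k}. F i)" "ALL i:{1..k}. F i : schreier n & (ALL t:F i. k <= t)" "successive {1..k} F"
 thus "EX k. (EX F. X = (UN i:{1..k}. F i) & (ALL i:{1..k}. F i : schreier n) & successive {1..k} F) & (ALL t:X. k <= t)"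
  by (intro exI[of _ k] conjI exI[of _ F]) auto
next
 fix k F assume "ALL t:X. k <= t" "X = (UN i:{1..k}. F i)" "ALL i:{1..k}. F i : schreier n" "successive {1..k} F"
 thus "EX k F. X = (UN i:{1..k}. F i) & (ALL i:{1..k}. F i : schreier n & (ALL t:F i. k <= t)) & successive {1..k} F"
  by (intro exI[of _ k] exI[of _ F]) auto
qed

declare schreier.simps(2) [simp del]

lemma schreier_0_iff: "X : schreier 0 \<longleftrightarrow> X = {} \<or> (EX k. X = {k} & 1 <= k)" by simp

lemma empty_in_schreier [simp]: "{} : schreier n"
proof (cases n)
 case (Suc m)
 have "covered m 0 {}" unfolding covered_def successive_def by auto
 thus ?thesis unfolding Suc schreier_Suc_iff by auto
qed simp

lemma schreier_finite: "X : schreier n ==> finite X" by (induction n arbitrary: X) (auto simp: schreier.simps(2))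

lemma schreier_pos: "X : schreier n ==> t : X ==> 1 <= t"
proof (induction n arbitrary: X)
 case (Suc n)
 thus ?case unfolding schreier.simps(2) by blast
qed auto

lemma covered_subset: 
 assumes "covered n k X" "Y \<subseteq> X" "\<And>A B. A : schreier n ==> B \<subseteq> A ==> B : schreier n"
 shows "covered n k Y"
proof -
 obtain F where F: "X = (UN i:{1..k}. F i)" "ALL i:{1..k}. F i : schreier n" "successive {1..k} F" using assms(1) unfolding covered_def by auto
 have "Y = (UN i:{1..k}. F i \<inter> Y)" using F(1) assms(2) by blast
 moreover have "successive {1..k} (%i. F i \<inter> Y)" using F(3) unfolding successive_def set_less_def by blast
 moreover have "ALL i:{1..k}. F i \<inter> Y : schreier n" using F(2) assms(3) by blast
 ultimately show ?thesis unfolding covered_def by (intro exI[of _ "%i. F i \<inter> Y"]) simp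
qed

lemma schreier_subset: "A : schreier n ==> B \<subseteq> A ==> B : schreier n"
proof (induction n arbitrary: A B)
 case 0
 thus ?case by auto
next
 case (Suc n)
 then obtain k where "covered n k A" "ALL t:A. k <= t" using schreier_Suc_iff by auto
 with Suc covered_subset[of n k A B] show ?case unfolding schreier_Suc_iff by blast
qed

lemma covered_mono: "covered n k X ==> Y \<subseteq> X ==> covered n k Y" using covered_subset schreier_subset by blast

lemma covered_le: assumes "covered n k X" "k <= k'" shows "covered n k' X"
proof -
 obtain F where F: "X = (UN i:{1..k}. F i)" "ALL i:{1..k}. F i : schreier n" "successive {1..k} F" using assms(1) unfolding covered_def by auto
 have "X = (UN i:{1..k'}. if i <= k then F i else {})" unfolding F(1) using assms(2) by (force split: if_splits)
 moreover have "successive {1..k'} (%i. if i <= k then F i else {})" unfolding successive_def set_less_def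
 proof (intro ballI impI)
  fix i j a b assume h: "i : {1..k'}" "j : {1..k'}" "i < j" "a : (if i <= k then F i else {})" "b : (if j <= k then F j else {})"
  hence "i : {1..k}" "j : {1..k}" "a : F i" "b : F j" by (auto split: if_splits)
  thus "a < b" using F(3) h(3) unfolding successive_def set_less_def by blast
 qed
 ultimately show ?thesis unfolding covered_def using F(2) by (intro exI[of _ "%i. if i <= k then F i else {}"]) auto
qed

lemma covered_1: "X : schreier n ==> covered n 1 X" unfolding covered_def successive_def by (intro exI[of _ "%_. X"]) auto

lemma covered_0 [simp]: "covered n 0 X \<longleftrightarrow> X = {}" unfolding covered_def successive_def by auto

lemma schreier_le_Suc: "schreier n \<subseteq> schreier (Suc n)" using schreier_Suc_iff covered_1 schreier_pos by blast

lemma schreier_mono: "n <= m ==> schreier n \<subseteq> schreier m" by (induction m rule: dec_induct) (use schreier_le_Suc in blast)+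

lemma singleton_in_schreier: "1 <= t ==> {t} : schreier n" using schreier_mono[of 0 n] by (auto simp: subset_iff)

lemma covered_prefix:
 assumes F: "(UN i:{1..k}. F i) = X" "ALL i:{1..k}. F i : schreier n" "successive {1..k} F"
  and t: "t : F j" "j : {1..k}"
 shows "covered n j (X \<inter> {..t})"
proof -
 have "X \<inter> {..t} \<subseteq> (UN i:{1..j}. F i)"
 proof
  fix u assume u: "u : X \<inter> {..t}"
  then obtain i where i: "i : {1..k}" "u : F i" using F(1) by auto
  have "\<not> j < i"
  proof
   assume "j < i"
   hence "t < u" using F(3) t i unfolding successive_def set_less_def by blast
   thus False using u by auto
  qed
  thus "u : (UN i:{1..j}. F i)" using i by auto
 qed
 moreover have "covered n j (UN i:{1..j}. F i)" unfolding covered_def using F(2,3) t(2) by (intro exI[of _ F]) (auto simp: successive_def)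
 ultimately show ?thesis using covered_mono by blast
qed

lemma set_eq_UN_nth: "set xs = (UN i:{1..length xs}. {xs ! (i - 1)})"
proof (intro equalityI subsetI)
 fix x assume "x : set xs"
 then obtain i where "i < length xs" "x = xs ! i" by (metis in_set_conv_nth)
 thus "x : (UN i:{1..length xs}. {xs ! (i - 1)})" by (intro UN_I[of "Suc i"]) simp_all
next
 fix x assume "x : (UN i:{1..length xs}. {xs ! (i - 1)})"
 then obtain i where "i : {1..length xs}" "x = xs ! (i - 1)" by blast
 thus "x : set xs" using nth_mem[of "i - 1" xs] by force
qed

lemma covered_Union_0:
 assumes "ALL C:set Cs. C : schreier 0" shows "covered 0 (length Cs) (\<Union>(set Cs))"
proof -
 let ?X = "\<Union>(set Cs)"
 have fin: "finite ?X" using assms schreier_finite by blast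
 have pos: "ALL t:?X. 1 <= t" using assms schreier_pos by blast
 have card: "card ?X <= length Cs" using assms
 proof (induction Cs)
  case (Cons C Cs)
  have "C : schreier 0" using Cons.prems by simp
  hence "card C <= 1" unfolding schreier_0_iff by (elim disjE exE conjE) simp_all
  moreover have "card (\<Union>(set (C # Cs))) <= card C + card (\<Union>(set Cs))" using card_Un_le[of C "\<Union>(set Cs)"] by simp
  moreover have "card (\<Union>(set Cs)) <= length Cs" using Cons by simp
  ultimately show ?case by simp
 qed simp
 let ?xs = "sorted_list_of_set ?X"
 have len: "length ?xs = card ?X" and sx: "set ?xs = ?X" "sorted_wrt (<) ?xs" using fin by auto
 have "covered 0 (card ?X) ?X" unfolding covered_def
 proof (intro exI[of _ "%i. {?xs ! (i - 1)}"] conjI ballI)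
  show "?X = (UN i:{1..card ?X}. {?xs ! (i - 1)})" using set_eq_UN_nth[of ?xs] unfolding sx(1) len .
  fix i assume i: "i : {1..card ?X}"
  hence "?xs ! (i - 1) : ?X" using sx(1) len nth_mem[of "i - 1" ?xs] by auto
  thus "{?xs ! (i - 1)} : schreier 0" using pos by auto
 next
  show "successive {1..card ?X} (%i. {?xs ! (i - 1)})" unfolding successive_def set_less_def
  proof (intro ballI impI)
   fix i j a b assume h: "i : {1..card ?X}" "j : {1..card ?X}" "i < j" "a : {?xs ! (i - 1)}" "b : {?xs ! (j - 1)}"
   hence "i - 1 < j - 1" "j - 1 < length ?xs" using len by auto
   thus "a < b" using sorted_wrt_nth_less[OF sx(2), of "i - 1" "j - 1"] h by auto
  qed
 qed
 thus ?thesis using card covered_le by blast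
qed

text \<open>
  The number of successive sets of a Schreier family needed to cover a set is subadditive under
  arbitrary, not only successive, unions. The blocks are read off from the values of that number
  on initial segments.
\<close>

lemma covered_Union: "ALL C:set Cs. C : schreier n ==> covered n (length Cs) (\<Union>(set Cs))"
proof (induction n arbitrary: Cs)
 case 0
 thus ?case by (rule covered_Union_0)
next
 case (Suc n)
 define key where "key = (%C::nat set. if C = {} then 0 else Min C)"
 \<comment> \<open>Ordering by minima: a set that starts strictly before another one precedes it in
   \<open>Ds\<close>. The proof of \<open>D_ge\<close> rests on this.\<close>
 define Ds where "Ds = sort_key key Cs"
 have Ds: "set Ds = set Cs" "length Ds = length Cs" "sorted (map key Ds)" unfolding Ds_def by auto
 have "ALL C:set Ds. EX k. covered n k C & (ALL t:C. k <= t)"  using Suc.prems Ds schreier_Suc_iff by auto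
 then obtain k' where k': "\<And>C. C : set Ds ==> covered n (k' C) C" "\<And>C t. C : set Ds ==> t : C ==> k' C <= t" by metis
 define k where "k = (%C. if C = {} then 0 else k' C)"
 have k: "\<And>C. C : set Ds ==> covered n (k C) C" "\<And>C t. C : set Ds ==> t : C ==> k C <= t" using k' by (auto simp: k_def)
 define U where "U = \<Union>(set Ds)"
 define K where "K = (%x. \<Sum>C\<leftarrow>take x Ds. k C)"
 have K_Suc: "K (Suc x) = K x + k (Ds ! x)" if "x < length Ds" for x unfolding K_def using that by (simp add: take_Suc_conv_app_nth)
 have K_mono: "x <= y ==> K x <= K y" for x y unfolding K_def by (metis le_add1 map_append sum_list_append take_add le_Suc_ex)
 have covK: "covered n (K x) (\<Union>(set (take x Ds)))" if "x <= length Ds" for x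
 proof -
  have "EX Es. (ALL E:set Es. E : schreier n) & length Es = K x & \<Union>(set Es) = \<Union>(set (take x Ds))" using that
  proof (induction x)
   case 0
   thus ?case unfolding K_def by auto
  next
   case (Suc x)
   then obtain Es where Es: "ALL E:set Es. E : schreier n" "length Es = K x" "\<Union>(set Es) = \<Union>(set (take x Ds))" by auto
   have "Ds ! x : set Ds" using Suc by auto
   from k(1)[OF this] obtain F where F: "Ds ! x = (UN i:{1..k (Ds ! x)}. F i)" "ALL i:{1..k (Ds ! x)}. F i : schreier n" unfolding covered_def by auto
   let ?Fs = "map F [1..<Suc (k (Ds ! x))]"
   have "\<Union>(set ?Fs) = Ds ! x" using F(1) by (metis atLeastAtMost_upt set_map)
   moreover have "ALL E:set ?Fs. E : schreier n" using F(2) by (auto simp: less_Suc_eq_le)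
   moreover have "take (Suc x) Ds = take x Ds @ [Ds ! x]" using Suc by (simp add: take_Suc_conv_app_nth)
   ultimately show ?case using Es K_Suc[of x] Suc by (intro exI[of _ "Es @ ?Fs"]) auto
  qed
  thus ?thesis using Suc.IH by metis
 qed
 define \<tau> where "\<tau> = (%t. LEAST j. covered n j (U \<inter> {..t}))"
 have covU: "covered n (K (length Ds)) U" using covK[of "length Ds"] unfolding U_def by simp
 have \<tau>cov: "covered n (\<tau> t) (U \<inter> {..t})" for t unfolding \<tau>_def by (rule LeastI[of _ "K (length Ds)"]) (rule covered_mono[OF covU], auto)
 have \<tau>le: "\<tau> t <= j" if "covered n j (U \<inter> {..t})" for t j unfolding \<tau>_def by (rule Least_le) (rule that)
 have \<tau>mono: "\<tau> s <= \<tau> t" if "s <= t" for s t by (rule \<tau>le, rule covered_mono[OF \<tau>cov[of t]]) (use that in auto)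
 have \<tau>pos: "0 < \<tau> t" if "t : U" for t using \<tau>cov[of t] that by (cases "\<tau> t") auto
 define D where "D = (%x. {t\<in>U. K (x - 1) < \<tau> t & \<tau> t <= K x})"
 have D_cov: "covered n (k (Ds ! (x - 1))) (D x)" if x: "x : {1..length Ds}" for x
 proof -
  let ?k = "k (Ds ! (x - 1))"
  have Kx: "K x = K (x - 1) + ?k" using K_Suc[of "x - 1"] x by auto
  obtain F where F: "U = (UN i:{1..K (length Ds)}. F i)" "ALL i:{1..K (length Ds)}. F i : schreier n" "successive {1..K (length Ds)} F" using covU unfolding covered_def by auto
  show ?thesis
  proof (cases "D x = {}")
   case True thus ?thesis using covered_le[of n 0 "D x" ?k] by simp
  next
   case False
   have finU: "finite U" using F(1,2) schreier_finite by auto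
   hence finD: "finite (D x)" unfolding D_def by auto
   define M where "M = Max (D x)"
   have M: "M : D x" "\<And>t. t : D x ==> t <= M" unfolding M_def using finD False by auto
   have "covered n (K x) (U \<inter> {..M})" using \<tau>cov[of M] M(1) covered_le unfolding D_def by blast
   then obtain H where H: "U \<inter> {..M} = (UN i:{1..K x}. H i)" "ALL i:{1..K x}. H i : schreier n" "successive {1..K x} H" unfolding covered_def by blast
   have "D x \<subseteq> (UN i:{1..?k}. H (K (x - 1) + i))"
   proof
    fix t assume t: "t : D x"
    hence "t : U \<inter> {..M}" using M D_def by auto
    then obtain j where j: "j : {1..K x}" "t : H j" using H(1) by auto
    have "covered n j ((U \<inter> {..M}) \<inter> {..t})" by (rule covered_prefix[OF H(1)[symmetric] H(2,3) j(2,1)])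
    moreover have "(U \<inter> {..M}) \<inter> {..t} = U \<inter> {..t}" using M(2)[OF t] by auto
    ultimately have "\<tau> t <= j" using \<tau>le by auto
    hence "K (x - 1) < j" using t D_def by auto
    thus "t : (UN i:{1..?k}. H (K (x - 1) + i))" using j Kx by (intro UN_I[of "j - K (x - 1)"]) auto
   qed
   moreover have "covered n ?k (UN i:{1..?k}. H (K (x - 1) + i))" unfolding covered_def using H Kx by (intro exI[of _ "%i. H (K (x - 1) + i)"]) (auto simp: successive_def)
   ultimately show ?thesis using covered_mono by blast
  qed
 qed
 \<comment> \<open>A point \<open>t\<close> below the bound \<open>k C\<close> of the set
   \<open>C\<close> in place \<open>x\<close> lies before the minimum of \<open>C\<close>. All
   points of \<open>U\<close> up to \<open>t\<close> then belong to sets preceding \<open>C\<close>,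
   which need at most \<open>K (x - 1)\<close> blocks, so \<open>t\<close> cannot have been put into
   \<open>D x\<close>.\<close>
 have D_ge: "k (Ds ! (x - 1)) <= t" if x: "x : {1..length Ds}" and t: "t : D x" for x t
 proof (rule ccontr)
  assume a: "\<not> k (Ds ! (x - 1)) <= t"
  let ?C = "Ds ! (x - 1)"
  have C: "?C : set Ds" using x by auto
  have CS: "?C ~= {} ==> k ?C <= key ?C" unfolding key_def using C k(2) Suc.prems Ds(1) schreier_finite by (auto intro!: k(2) Min_in)
  have "U \<inter> {..t} \<subseteq> \<Union>(set (take (x - 1) Ds))" if ne: "?C ~= {}"
  proof
   fix u assume u: "u : U \<inter> {..t}"
   then obtain y where y: "y < length Ds" "u : Ds ! y" unfolding U_def by (auto simp: in_set_conv_nth)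
   have "finite (Ds ! y)" using y Suc.prems Ds(1) schreier_finite nth_mem by metis
   hence "key (Ds ! y) <= u" using y unfolding key_def by auto
   hence "key (Ds ! y) < key ?C" using u a CS ne by auto
   hence "y < x - 1" using Ds(3) y x by (smt (verit, ccfv_threshold) atLeastAtMost_iff diff_Suc_less less_le_trans linorder_not_less nth_map length_map sorted_nth_mono not_gr_zero One_nat_def Suc_le_eq)
   hence "Ds ! y : set (take (x - 1) Ds)" using y(1) by (metis in_set_conv_nth length_take min_less_iff_conj nth_take)
   thus "u : \<Union>(set (take (x - 1) Ds))" using y by auto
  qed
  moreover have "?C ~= {}" using a by (auto simp: k_def)
  ultimately have "\<tau> t <= K (x - 1)" using \<tau>le covered_mono[OF covK[of "x - 1"]] x by auto
  thus False using t D_def by auto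
 qed
 have D_sch: "D x : schreier (Suc n)" if "x : {1..length Ds}" for x unfolding schreier_Suc_iff using D_cov[OF that] D_ge[OF that] by blast
 have "U = (UN x:{1..length Ds}. D x)"
 proof
  show "U \<subseteq> (UN x:{1..length Ds}. D x)"
  proof
   fix t assume t: "t : U"
   have tK: "\<tau> t <= K (length Ds)" by (rule \<tau>le, rule covered_mono[OF covU]) auto
   define x where "x = (LEAST x. \<tau> t <= K x)"
   have x1: "\<tau> t <= K x" unfolding x_def by (rule LeastI[of _ "length Ds"]) (rule tK)
   have x2: "x <= length Ds" unfolding x_def by (rule Least_le) (rule tK)
   have "K 0 = 0" unfolding K_def by simp
   hence x0: "x ~= 0" using x1 \<tau>pos[OF t] by (metis not_less)
   hence "\<not> \<tau> t <= K (x - 1)" unfolding x_def using not_less_Least[of "x - 1" "%x. \<tau> t <= K x"] x_def by auto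
   thus "t : (UN x:{1..length Ds}. D x)" using x0 x1 x2 t unfolding D_def by (intro UN_I[of x]) auto
  qed
 qed (auto simp: D_def)
 moreover have "successive {1..length Ds} D" unfolding successive_def set_less_def
 proof (intro ballI impI)
  fix i j a b assume h: "i : {1..length Ds}" "j : {1..length Ds}" "i < j" "a : D i" "b : D j"
  have "\<tau> a <= K (j - 1)" using h K_mono[of i "j - 1"] unfolding D_def by fastforce
  hence "\<tau> a < \<tau> b" using h unfolding D_def by auto
  thus "a < b" using \<tau>mono[of b a] by (metis not_less)
 qed
 ultimately have "covered (Suc n) (length Ds) U" unfolding covered_def using D_sch by blast
 thus ?case using Ds unfolding U_def by simp
qed

lemma covered_UN:
 assumes "finite I" "\<And>i. i : I ==> C i : schreier n" "card I <= k"
 shows "covered n k (UN i:I. C i)"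
proof -
 obtain xs where xs: "set xs = I" "distinct xs" using finite_distinct_list[OF assms(1)] by blast
 have "covered n (length (map C xs)) (\<Union>(set (map C xs)))" using xs assms(2) by (intro covered_Union) auto
 moreover have "length xs = card I" using xs distinct_card by fastforce
 ultimately show ?thesis using xs assms(3) covered_le by auto
qed

text \<open>Thanks to \<open>covered_Union\<close> no order between the pieces is required. This is
  what makes the Schreier estimates available for allowable families, which are merely
  disjoint.\<close>

lemma schreier_UN:
 assumes "finite I" "\<And>i. i : I ==> C i : schreier n" "card I <= k" "\<And>i t. i : I ==> t : C i ==> k <= t"
 shows "(UN i:I. C i) : schreier (Suc n)"
proof -
 have "covered n k (UN i:I. C i)" using covered_UN[of I C n k] assms(1-3) by blast
 thus ?thesis unfolding schreier_Suc_iff using assms(4) by blast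
qed

text \<open>
  For singletons \<open>A s\<close> and \<open>a = 0\<close> this is the spreading property.
\<close>

lemma schreier_compose:
 assumes "finite I" "\<And>s. s : I ==> A s : schreier a" "\<And>s t. s : I ==> t : A s ==> \<beta> s <= t"
  "inj_on \<beta> I" "\<beta> ` I : schreier b"
 shows "(UN s:I. A s) : schreier (a + b)" using assms
proof (induction b arbitrary: I)
 case 0
 hence "\<beta> ` I = {} \<or> (EX k. \<beta> ` I = {k})" unfolding schreier_0_iff by blast
 hence "card (\<beta> ` I) <= 1" by (elim disjE exE) simp_all
 hence "card I <= 1" using card_image[OF 0(4)] by simp
 then consider "I = {}" | s where "I = {s}" using 0(1) by (metis card_1_singletonE card_0_eq le_Suc_eq One_nat_def le_zero_eq)
 thus ?case
 proof cases
  case (2 s)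
  thus ?thesis using 0(2)[of s] by simp
 qed simp
next
 case (Suc b)
 then obtain k where k: "covered b k (\<beta> ` I)" "ALL t:\<beta> ` I. k <= t" using schreier_Suc_iff by auto
 then obtain F where F: "\<beta> ` I = (UN i:{1..k}. F i)" "ALL i:{1..k}. F i : schreier b" unfolding covered_def by blast
 have "(UN i:{1..k}. UN s:{s\<in>I. \<beta> s : F i}. A s) : schreier (Suc (a + b))"
 proof (rule schreier_UN)
  fix i assume i: "i : {1..k}"
  show "(UN s:{s\<in>I. \<beta> s : F i}. A s) : schreier (a + b)"
  proof (rule Suc.IH)
   show "\<beta> ` {s : I. \<beta> s : F i} : schreier b" by (rule schreier_subset[of "F i"]) (use F i in auto)
  qed (use Suc.prems in "auto intro: inj_on_subset")
  fix t assume "t : (UN s:{s\<in>I. \<beta> s : F i}. A s)"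
  thus "k <= t" using Suc.prems(3) k(2) by force
 qed auto
 moreover have "(UN i:{1..k}. UN s:{s\<in>I. \<beta> s : F i}. A s) = (UN s:I. A s)"
 proof
  show "(UN s:I. A s) \<subseteq> (UN i:{1..k}. UN s:{s\<in>I. \<beta> s : F i}. A s)"
  proof
   fix t assume "t : (UN s:I. A s)"
   then obtain s where s: "s : I" "t : A s" by blast
   hence "\<beta> s : (UN i:{1..k}. F i)" using F(1) by blast
   thus "t : (UN i:{1..k}. UN s:{s\<in>I. \<beta> s : F i}. A s)" using s by blast
  qed
 qed blast
 ultimately show ?case by simp
qed

lemma schreier_spread:
 assumes "finite I" "inj_on \<beta> I" "\<beta> ` I : schreier b" "\<And>s. s : I ==> \<beta> s <= x s"
 shows "x ` I : schreier b"
proof -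
 have "(UN s:I. {x s}) : schreier (0 + b)"
 proof (rule schreier_compose[OF assms(1) _ _ assms(2,3)])
  fix s assume s: "s : I"
  have "1 <= \<beta> s" using schreier_pos[OF assms(3)] s by auto
  thus "{x s} : schreier 0" using assms(4)[OF s] by auto
 qed (use assms(4) in auto)
 thus ?thesis by (simp add: UNION_singleton_eq_range)
qed

lemma schreier_1I:
 assumes "finite X" "\<And>t. t : X ==> card X <= t" 
 shows "X : schreier (Suc n)"
proof -
 have "(UN i:X. {i}) : schreier (Suc 0)"
 proof (rule schreier_UN[OF assms(1)])
  fix i assume "i : X"
  hence "1 <= i" using assms by (metis One_nat_def Suc_leI card_gt_0_iff empty_iff less_le_trans)
  thus "{i} : schreier 0" by auto
 qed (use assms in auto)
 moreover have "(UN i:X. {i}) = X" by blast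
 ultimately show ?thesis using schreier_mono[of "Suc 0" "Suc n"] by (metis Suc_le_mono le0 subsetD)
qed

section \<open>Special convex combinations along a sequence of positions\<close>

lemma sum_UN_le:
 fixes b :: "'a => real"
 assumes "finite I" "\<And>i. i : I ==> finite (X i)" "\<And>i k. i : I ==> k : X i ==> 0 <= b k"
 shows "(SUM k:(UN i:I. X i). b k) <= (SUM i:I. SUM k:X i. b k)" using assms
proof (induction I rule: finite_induct)
 case (insert i I)
 have "(SUM k:(UN i:insert i I. X i). b k) <= (SUM k:X i. b k) + (SUM k:(UN i:I. X i). b k)"
  unfolding UN_insert by (subst sum_Un) (use insert in "auto intro!: sum_nonneg")
 thus ?case using insert by force
qed simp

lemma covered_append:
 assumes "covered n k X" "Y : schreier n" "set_less X Y"
 shows "covered n (Suc k) (X \<union> Y)"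
proof -
 obtain F where F: "X = (UN i:{1..k}. F i)" "ALL i:{1..k}. F i : schreier n" "successive {1..k} F" using assms(1) unfolding covered_def by auto
 let ?G = "%i. if i = Suc k then Y else F i"
 have "X \<union> Y = (UN i:{1..Suc k}. ?G i)" unfolding F(1) by (auto simp: atLeastAtMostSuc_conv)
 moreover have "ALL i:{1..Suc k}. ?G i : schreier n" using F(2) assms(2) by auto
 moreover have "successive {1..Suc k} ?G" unfolding successive_def
 proof (intro ballI impI)
  fix i j assume h: "i : {1..Suc k}" "j : {1..Suc k}" "i < j"
  show "set_less (?G i) (?G j)"
  proof (cases "j = Suc k")
   case True
   hence "i : {1..k}" using h by simp
   hence "F i \<subseteq> X" unfolding F(1) by blast
   thus ?thesis using True h assms(3) unfolding set_less_def by auto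
  next
   case False
   thus ?thesis using h F(3) unfolding successive_def by auto
  qed
 qed
 ultimately show ?thesis unfolding covered_def by blast
qed

text \<open>A basic special convex combination pulled back along the positions \<open>p\<close>. The
  coefficients are attached to indices rather than coordinates, so the same notion serves for slots,
  micro and meso averages, with \<open>p\<close> giving their left ends.\<close>

definition scc_on :: "nat => real => (nat => nat) => nat set => (nat => real) => bool" where
 "scc_on n eps p F b \<longleftrightarrow> finite F & (ALL k:F. 0 <= b k) & (SUM k:F. b k) = 1 & p ` F : schreier n &
   (ALL G:schreier (n - 1). (SUM k:{k\<in>F. p k : G}. b k) < eps)"

lemma scc_on_nonempty: "scc_on n eps p F b ==> F ~= {}" unfolding scc_on_def by auto

text \<open>
  Each new block is chosen relative to the position of the last one, so that a set of the family
  which meets an earlier block is almost invisible in the new one.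
\<close>

lemma scc_blocks:
 fixes p :: "nat => nat"
 assumes p: "strict_mono p"
  and blk: "\<And>(eps::real) s P. eps > 0 ==> EX F (b::nat => real). finite F & F ~= {} & F \<subseteq> {s..} & (ALL k:F. 0 <= b k) & (SUM k:F. b k) = 1 & p ` F : schreier n &
    (ALL G:schreier n. (EX t:G. t <= P & t < p s) --> (SUM k:{k\<in>F. p k : G}. b k) < eps)"
  and "\<delta> > (0::real)"
 shows "EX F (b::nat => real). finite F & F \<subseteq> {s..} & (ALL k:F. 0 <= b k) & (SUM k:F. b k) = real r & covered n r (p ` F) &
    (ALL G:schreier n. (SUM k:{k\<in>F. p k : G}. b k) <= 1 + real r * \<delta>)"
proof (induction r)
 case 0
 show ?case by (intro exI[of _ "{}"]) auto
next
 case (Suc r)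
 then obtain F b where F: "finite F" "F \<subseteq> {s..}" "ALL k:F. 0 <= b k" "(SUM k:F. b k) = real r" "covered n r (p ` F)"
    "\<And>G. G\<in>schreier n ==> (SUM k:{k\<in>F. p k : G}. b k) <= 1 + real r * \<delta>" by blast
 define P where "P = Max (insert 0 (p ` F))"
 define s' where "s' = Suc (Max (insert s F))"
 obtain F' b' where F': "finite F'" "F' ~= {}" "F' \<subseteq> {s'..}" "ALL k:F'. 0 <= b' k" "(SUM k:F'. b' k) = 1" "p ` F' : schreier n"
    "ALL G:schreier n. (EX t:G. t <= P & t < p s') --> (SUM k:{k\<in>F'. p k : G}. b' k) < \<delta>"
  using blk[OF \<open>\<delta> > 0\<close>, of s' P] by (elim exE conjE) (rule that)
 have lt: "k < k'" if "k : F" "k' : F'" for k k'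
 proof -
  have "k <= Max (insert s F)" using F(1) that by auto
  thus ?thesis using F'(3) that unfolding s'_def by fastforce
 qed
 have disj: "F \<inter> F' = {}" using lt by blast
 define c where "c = (%k. if k : F then b k else b' k)"
 have sum_c: "(SUM k:{k\<in>F\<union>F'. Q k}. c k) = (SUM k:{k\<in>F. Q k}. b k) + (SUM k:{k\<in>F'. Q k}. b' k)" for Q
 proof -
  have "{k\<in>F\<union>F'. Q k} = {k\<in>F. Q k} \<union> {k\<in>F'. Q k}" by auto
  moreover have "(SUM k:{k\<in>F. Q k} \<union> {k\<in>F'. Q k}. c k) = (SUM k:{k\<in>F. Q k}. c k) + (SUM k:{k\<in>F'. Q k}. c k)"
   by (rule sum.union_disjoint) (use F F' disj in auto)
  moreover have "(SUM k:{k\<in>F. Q k}. c k) = (SUM k:{k\<in>F. Q k}. b k)" by (rule sum.cong) (auto simp: c_def)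
  moreover have "(SUM k:{k\<in>F'. Q k}. c k) = (SUM k:{k\<in>F'. Q k}. b' k)" by (rule sum.cong) (use disj in "auto simp: c_def")
  ultimately show ?thesis by simp
 qed
 have bnd: "(SUM k:{k\<in>F\<union>F'. p k : G}. c k) <= 1 + real (Suc r) * \<delta>" if G: "G : schreier n" for G
 proof (cases "{k\<in>F. p k : G} = {}")
  case True
  have "(SUM k:{k\<in>F'. p k : G}. b' k) <= (SUM k:F'. b' k)" by (rule sum_mono2) (use F' in auto)
  hence "(SUM k:{k\<in>F\<union>F'. p k : G}. c k) <= 1" unfolding sum_c True using F'(5) by simp
  thus ?thesis using \<open>\<delta> > 0\<close> by (smt (verit) mult_nonneg_nonneg of_nat_0_le_iff)
 next
  case False
  then obtain k where k: "k : F" "p k : G" by auto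
  have "k < s'" using F(1) k unfolding s'_def by (simp add: less_Suc_eq_le)
  hence "p k < p s'" using p by (simp add: strict_monoD)
  moreover have "p k <= P" using k F(1) unfolding P_def by auto
  ultimately have "(SUM k:{k\<in>F'. p k : G}. b' k) < \<delta>" using F'(7) G k(2) by blast
  thus ?thesis unfolding sum_c using F(6)[OF G] by (simp add: algebra_simps)
 qed
 have "covered n (Suc r) (p ` F \<union> p ` F')"
 proof (rule covered_append[OF F(5) F'(6)])
  show "set_less (p ` F) (p ` F')" unfolding set_less_def using lt p by (auto simp: strict_mono_less)
 qed
 hence "covered n (Suc r) (p ` (F \<union> F'))" by (simp add: image_Un)
 moreover have "F \<union> F' \<subseteq> {s..}"
 proof -
  have "s <= Max (insert s F)" using F(1) by simp
  thus ?thesis using F(2) F'(3) unfolding s'_def by fastforce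
 qed
 moreover have "(SUM k:F\<union>F'. c k) = real (Suc r)" using sum_c[of "%_. True"] F(4) F'(5) by (simp add: Un_def)
 moreover have "ALL k:F\<union>F'. 0 <= c k" using F(3) F'(4) by (auto simp: c_def)
 ultimately show ?case using F(1) F'(1) bnd by (intro exI[of _ "F \<union> F'"] exI[of _ c]) blast
qed

lemma ex_scc_on:
 fixes p :: "nat => nat"
 assumes p: "strict_mono p" "\<And>k. 1 <= p k" and "eps > 0" "n >= 1"
 shows "EX F b. scc_on n eps p F b & F \<subseteq> {s..}" using assms(3,4)
proof (induction n arbitrary: s eps)
 case 0
 thus ?case by simp
next
 case (Suc n)
 obtain r where r: "2 / eps < real r" using reals_Archimedean2 by blast
 have r0: "0 < r" using r Suc.prems by (metis divide_pos_pos of_nat_0_less_iff less_trans zero_less_numeral)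
 have p_ge: "k <= p k" for k using p(1) by (rule strict_mono_imp_increasing)
 \<comment> \<open>There will be \<open>r\<close> blocks of mass 1, divided by \<open>r\<close> in
   the end. With tolerance \<open>1 / r\<close> per block a member of S_n catches at most 2 of the
   total, hence less than \<open>eps\<close> after the division; starting beyond \<open>r\<close>
   puts the union of the blocks into the next family.\<close>
 have "EX F b. finite F & F \<subseteq> {max s r..} & (ALL k:F. 0 <= b k) & (SUM k:F. b k) = real r & covered n r (p ` F) &
    (ALL G:schreier n. (SUM k:{k\<in>F. p k : G}. b k) <= 1 + real r * (1 / real r))"
 proof (rule scc_blocks[OF p(1)])
  fix \<delta> :: real and s P :: nat assume \<delta>: "\<delta> > 0"
  show "EX F b. finite F & F ~= {} & F \<subseteq> {s..} & (ALL k:F. 0 <= b k) & (SUM k:F. b k) = 1 & p ` F : schreier n &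
    (ALL G:schreier n. (EX t:G. t <= P & t < p s) --> (SUM k:{k\<in>F. p k : G}. b k) < \<delta>)"
  proof (cases n)
   case 0
   have "(SUM k:{k\<in>{s}. p k : G}. (1::real)) < \<delta>" if G: "G : schreier 0" and t: "EX t:G. t <= P & t < p s" for G
   proof -
    have "p s \<notin> G" using G t unfolding schreier_0_iff by auto
    hence e: "{k\<in>{s}. p k : G} = {}" by auto
    show ?thesis unfolding e using \<delta> by simp
   qed
   thus ?thesis using p(2)[of s] unfolding 0 by (intro exI[of _ "{s}"] exI[of _ "%_. 1"]) (auto simp: schreier_0_iff)
  next
   case (Suc m)
   \<comment> \<open>A set \<open>G\<close> in S_n with a point at most \<open>P\<close> is a union
     of at most \<open>P\<close> members of S_(n-1), each of which sees less than
     \<open>\<delta> / (P + 1)\<close>.\<close>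
   obtain F b where F: "scc_on n (\<delta> / (real P + 1)) p F b" "F \<subseteq> {s..}" using Suc.IH[of "\<delta> / (real P + 1)" s] \<delta> Suc by auto
   have "(SUM k:{k\<in>F. p k : G}. b k) < \<delta>" if G: "G : schreier n" and t: "EX t:G. t <= P & t < p s" for G
   proof -
    obtain j where j: "covered m j G" "ALL t:G. j <= t" using G unfolding Suc schreier_Suc_iff by blast
    hence jP: "j <= P" using t by force
    obtain H where H: "G = (UN i:{1..j}. H i)" "ALL i:{1..j}. H i : schreier m" using j(1) unfolding covered_def by blast
    have "(SUM k:{k\<in>F. p k : G}. b k) <= (SUM i:{1..j}. SUM k:{k\<in>F. p k : H i}. b k)"
    proof -
     have "{k\<in>F. p k : G} = (UN i:{1..j}. {k\<in>F. p k : H i})" unfolding H(1) by blast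
     moreover have "sum b (UN i:{1..j}. {k\<in>F. p k : H i}) <= (SUM i:{1..j}. SUM k:{k\<in>F. p k : H i}. b k)"
      by (rule sum_UN_le) (use F(1) in "auto simp: scc_on_def")
     ultimately show ?thesis by simp
    qed
    also have "... <= (SUM i:{1..j}. \<delta> / (real P + 1))"
    proof (rule sum_mono)
     fix i assume "i : {1..j}"
     hence "H i : schreier (n - 1)" using H(2) Suc by simp
     thus "(SUM k:{k\<in>F. p k : H i}. b k) <= \<delta> / (real P + 1)" using F(1) unfolding scc_on_def by (simp add: less_imp_le)
    qed
    also have "... = real j * (\<delta> / (real P + 1))" by simp
    also have "... <= real P * (\<delta> / (real P + 1))" using jP \<delta> by (intro mult_right_mono) auto
    also have "... < \<delta>" using \<delta> by (simp add: field_simps)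
    finally show ?thesis .
   qed
   thus ?thesis using F scc_on_nonempty[OF F(1)] unfolding scc_on_def by blast
  qed
 qed (use r0 in simp)
 then obtain F b where F: "finite F" "F \<subseteq> {max s r..}" "ALL k:F. 0 <= b k" "(SUM k:F. b k) = real r" "covered n r (p ` F)"
    "\<And>G. G\<in>schreier n ==> (SUM k:{k\<in>F. p k : G}. b k) <= 2" using r0 by auto
 have "scc_on (Suc n) eps p F (%k. b k / real r)" unfolding scc_on_def
 proof (intro conjI ballI)
  show "(SUM k:F. b k / real r) = 1" using F(4) r0 by (simp add: sum_divide_distrib[symmetric])
  have "ALL t:p ` F. r <= t"
  proof
   fix t assume "t : p ` F"
   then obtain k where k: "k : F" "t = p k" by blast
   thus "r <= t" using F(2) p_ge[of k] by fastforce
  qed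
  thus "p ` F : schreier (Suc n)" using F(5) schreier_Suc_iff by blast
  fix G assume "G : schreier (Suc n - 1)"
  hence "(SUM k:{k\<in>F. p k : G}. b k) <= 2" using F(6) by simp
  hence "(SUM k:{k\<in>F. p k : G}. b k / real r) <= 2 / real r" by (simp add: sum_divide_distrib[symmetric] divide_right_mono)
  also have "... < eps" using r r0 Suc.prems by (simp add: field_simps)
  finally show "(SUM k:{k\<in>F. p k : G}. b k / real r) < eps" .
 qed (use F(1,3) in auto)
 moreover have "F \<subseteq> {s..}" using F(2) by auto
 ultimately show ?case by blast
qed

text \<open>
  Shifting the injection to the predecessor turns \<open>\<phi> k \<le> e k\<close> into \<open>\<phi> k' < p k\<close>, so that apart from its
  first element the selected set of positions is a spread of a member of the family.
\<close>

lemma scc_on_selection: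
 assumes scc: "scc_on n eps p F b" and e: "\<And>k k'. k : F ==> k' : F ==> k < k' ==> e k < p k'"
  and X: "X \<subseteq> F" "inj_on \<phi> X" "\<phi> ` X : schreier m" "m <= n - 1" "\<And>k. k : X ==> \<phi> k <= e k"
 shows "(SUM k:X. b k) <= 2 * eps"
proof -
 have fin: "finite F" "finite X" using scc X(1) finite_subset unfolding scc_on_def by auto
 have small: "(SUM k:{k\<in>F. p k : G}. b k) < eps" if "G : schreier m" for G using scc that X(4) schreier_mono[of m "n - 1"] unfolding scc_on_def by blast
 have small': "(SUM k:Y. b k) < eps" if "Y \<subseteq> F" "p ` Y : schreier m" for Y
 proof -
  have "(SUM k:Y. b k) <= (SUM k:{k\<in>F. p k : p ` Y}. b k)" by (rule sum_mono2) (use fin that scc in "auto simp: scc_on_def")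
  thus ?thesis using small[OF that(2)] by simp
 qed
 show ?thesis
 proof (cases "X = {}")
  case True
  thus ?thesis using small[of "{}"] by simp
 next
  case False
  define k0 where "k0 = Min X"
  define Y where "Y = X - {k0}"
  have k0: "k0 : X" unfolding k0_def using False fin by simp
  define pr where "pr = (%k. Max {k'\<in>X. k' < k})"
  have ne: "{k'\<in>X. k' < k} ~= {}" if "k : Y" for k
  proof -
   have "k0 <= k" "k ~= k0" using that fin unfolding Y_def k0_def by auto
   thus ?thesis using k0 by auto
  qed
  have pr: "pr k : X" "pr k < k" if "k : Y" for k using Max_in[OF _ ne[OF that]] fin unfolding pr_def by auto
  have pr_ge: "k' <= pr k" if "k' : X" "k' < k" for k k' unfolding pr_def using that fin by auto
  have "inj_on pr Y"
  proof (rule linorder_inj_onI')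
   fix k k' assume "k : Y" "k' : Y" "k < k'"
   hence "k <= pr k'" "pr k < k" using pr_ge pr unfolding Y_def by auto
   thus "pr k ~= pr k'" by simp
  qed
  hence inj: "inj_on (\<phi> \<circ> pr) Y" using pr(1) X(2) by (auto intro!: comp_inj_on inj_on_subset[OF X(2)])
  have "p ` Y : schreier m"
  proof (rule schreier_spread[OF _ inj])
   show "finite Y" unfolding Y_def using fin by simp
   show "(\<phi> \<circ> pr) ` Y : schreier m" by (rule schreier_subset[OF X(3)]) (use pr(1) in auto)
   fix k assume k: "k : Y"
   have "\<phi> (pr k) <= e (pr k)" using X(5) pr(1)[OF k] .
   moreover have "e (pr k) < p k" using e pr[OF k] k X(1) unfolding Y_def by blast
   ultimately show "(\<phi> \<circ> pr) k <= p k" by simp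
  qed
  hence "(SUM k:Y. b k) < eps" by (rule small'[rotated]) (use X(1) Y_def in auto)
  moreover have "(SUM k:{k0}. b k) < eps"
  proof (rule small')
   show "{k0} \<subseteq> F" using k0 X(1) by auto
   have "p k0 : p ` F" using k0 X(1) by auto
   hence "1 <= p k0" using scc schreier_pos unfolding scc_on_def by blast
   thus "p ` {k0} : schreier m" using singleton_in_schreier by simp
  qed
  moreover have "(SUM k:X. b k) = (SUM k:{k0}. b k) + (SUM k:Y. b k)" unfolding Y_def using sum.remove[OF fin(2) k0, of b] by simp
  ultimately show ?thesis by simp
 qed
qed

section \<open>The norming set as a set of trees\<close>

lemma mseq_ge_2: "1 <= w ==> 2 <= mseq w"
proof -
 assume "1 <= w"
 then obtain j where "w = Suc j" by (cases w) auto
 moreover have "(2::nat) ^ 1 <= 2 ^ 5 ^ j" by (intro power_increasing) auto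
 ultimately show ?thesis by (simp add: mseq_Suc)
qed

lemma mseq_pos: "1 <= w ==> 0 < mseq w" using mseq_ge_2[of w] by simp

lemma mseq_mono: "v <= w ==> mseq v <= mseq w" by (cases v; cases w) (auto simp: mseq_Suc intro!: power_increasing)

lemma mseq_Suc': "1 <= w ==> mseq (Suc w) = mseq w ^ 5" by (cases w) auto

lemma less_mseq: assumes "1 <= w" shows "w < mseq w"
proof -
 obtain j where j: "w = Suc j" using assms by (cases w) auto
 have "j < 2 ^ j" by (rule less_exp)
 also have "(2::nat) ^ j <= 5 ^ j" by (rule power_mono) simp_all
 finally have "j < 5 ^ j" .
 moreover have "5 ^ j < (2::nat) ^ 5 ^ j" by (rule less_exp)
 ultimately have "Suc j < 2 ^ 5 ^ j" by linarith
 thus ?thesis unfolding j mseq_Suc .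
qed

text \<open>Since m_(w+1) is 2 to the power 5^w, the logarithm of its cube is 3 * 5^w, and the
  factor 15 in the recursion becomes 45 * 5^w. It exceeds the binary logarithm 5^w of m_(w+1), which
  is the source of every numerical gain below.\<close>

lemma nseq_Suc: assumes "1 <= w" shows "nseq (Suc w) = 45 * 5 ^ w * nseq w"
proof -
 obtain j where j: "w = Suc j" using assms by (cases w) auto
 have "real (sseq w) = log 2 (2 ^ (5 ^ w * 3))" unfolding sseq_eq_log by (simp add: mseq_Suc power_mult)
 also have "... = real (5 ^ w * 3)" by (subst log_nat_power) simp_all
 finally have "sseq w = 5 ^ w * 3" by linarith
 thus ?thesis unfolding j by simp
qed

lemma nseq_pos: "1 <= w ==> 4 <= nseq w"
proof (induction w rule: nat_induct_at_least)
 case (Suc w)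
 have "1 * nseq w <= (45 * 5 ^ w) * nseq w" by (rule mult_right_mono) simp_all
 thus ?case unfolding nseq_Suc[OF Suc.hyps] using Suc.IH by linarith
qed simp

lemma nseq_le_Suc: "nseq w <= nseq (Suc w)"
proof (cases "1 <= w")
 case True
 have "1 * nseq w <= (45 * 5 ^ w) * nseq w" by (intro mult_right_mono) auto
 thus ?thesis using True by (simp add: nseq_Suc)
next
 case False
 hence "w = 0" by simp
 thus ?thesis by simp
qed

lemma nseq_mono: "v <= w ==> nseq v <= nseq w" by (rule lift_Suc_mono_le[of nseq]) (auto intro: nseq_le_Suc)

section \<open>Pairings, supports and admissibility\<close>

definition dot :: "vec => vec => real" where
 "dot f x = (SUM i:supp x. f i * x i)"

lemma dot_superset: "finite S ==> supp x \<subseteq> S ==> dot f x = (SUM i:S. f i * x i)" unfolding dot_def by (rule sum.mono_neutral_left) (auto simp: supp_def)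

lemma supp_lincomb: "supp (lincomb I a x) \<subseteq> (UN i:I. supp (x i))"
proof
 fix t assume "t : supp (lincomb I a x)"
 hence "(SUM i:I. a i * x i t) ~= 0" unfolding supp_def lincomb_def by simp
 then obtain i where "i : I" "a i * x i t ~= 0" by (rule sum.not_neutral_contains_not_neutral)
 thus "t : (UN i:I. supp (x i))" by (auto simp: supp_def)
qed

lemma c00_finite: "x : c00 ==> finite (supp x)" by (simp add: c00_def)

lemma c00_zero [simp]: "(%t. 0) : c00" by (simp add: c00_def supp_def)

lemma c00_lincomb: "finite I ==> (\<And>i. i : I ==> x i : c00) ==> lincomb I a x : c00"
proof -
 assume h: "finite I" "\<And>i. i : I ==> x i : c00"
 hence "finite (supp (lincomb I a x))" by (intro finite_subset[OF supp_lincomb]) (auto simp: c00_def)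
 moreover have "lincomb I a x 0 = 0" unfolding lincomb_def using h by (auto simp: c00_def intro!: sum.neutral)
 ultimately show ?thesis by (simp add: c00_def)
qed

lemma dot_lincomb: 
 assumes "finite I" "\<And>i. i : I ==> x i : c00"
 shows "dot f (lincomb I a x) = (SUM i:I. a i * dot f (x i))"
proof -
 define S where "S = (UN i:I. supp (x i))"
 have S: "finite S" unfolding S_def using assms by (auto simp: c00_def)
 have "dot f (lincomb I a x) = (SUM t:S. f t * (SUM i:I. a i * x i t))" using dot_superset[OF S, of "lincomb I a x" f] supp_lincomb unfolding S_def lincomb_def by metis
 also have "... = (SUM t:S. SUM i:I. a i * (f t * x i t))" by (simp add: sum_distrib_left algebra_simps)
 also have "... = (SUM i:I. SUM t:S. a i * (f t * x i t))" by (rule sum.swap)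
 also have "... = (SUM i:I. a i * dot f (x i))"
 proof (rule sum.cong[OF refl])
  fix i assume "i : I"
  hence "dot f (x i) = (SUM t:S. f t * x i t)" by (intro dot_superset[OF S]) (auto simp: S_def)
  thus "(SUM t:S. a i * (f t * x i t)) = a i * dot f (x i)" by (simp add: sum_distrib_left)
 qed
 finally show ?thesis .
qed

lemma dot_lincomb_left: "dot (lincomb I a f) x = (SUM i:I. a i * dot (f i) x)"
proof -
 have "dot (lincomb I a f) x = (SUM t:supp x. SUM i:I. a i * (f i t * x t))" unfolding dot_def lincomb_def by (simp add: sum_distrib_right mult.assoc)
 also have "... = (SUM i:I. SUM t:supp x. a i * (f i t * x t))" by (rule sum.swap)
 finally show ?thesis by (simp add: dot_def sum_distrib_left)
qed

lemma supp_proj: "supp (proj G f) = supp f \<inter> G" by (auto simp: supp_def proj_def)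

lemma proj_c00: "x : c00 ==> proj G x : c00" unfolding c00_def using supp_proj by (auto simp: proj_def)

lemma proj_lincomb: "proj G (lincomb I a f) = lincomb I a (%i. proj G (f i))" by (auto simp: proj_def lincomb_def)

lemma successive_disjoint: "successive I E ==> disjoint_family_on E I" unfolding disjoint_family_on_def successive_def set_less_def by (metis disjoint_iff less_irrefl linorder_neqE_nat)

lemma admissible_allowable: "admissible M I E ==> allowable M I E" unfolding admissible_def allowable_def using successive_disjoint by blast

lemma Min_inj_disjoint:
 fixes E :: "'i => nat set"
 assumes "\<And>i. i : I ==> finite (E i)" "disjoint_family_on E I"
 shows "inj_on (%i. Min (E i)) {i\<in>I. E i ~= {}}"
proof (rule inj_onI)
 fix i j assume h: "i : {i\<in>I. E i ~= {}}" "j : {i\<in>I. E i ~= {}}" "Min (E i) = Min (E j)"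
 hence "Min (E i) : E i \<inter> E j" using assms(1) by (metis (mono_tags, lifting) IntI Min_in mem_Collect_eq)
 thus "i = j" using assms(2) h unfolding disjoint_family_on_def by blast
qed

lemma min_set_eq: "min_set I E = (%i. Min (E i)) ` {i\<in>I. E i ~= {}}" unfolding min_set_def by auto

lemma admissible_cong:
 assumes "\<And>i. i : I ==> E i = E' i"
 shows "admissible M I E \<longleftrightarrow> admissible M I E'"
proof -
 have "{i\<in>I. E i ~= {}} = {i\<in>I. E' i ~= {}}" using assms by auto
 hence "min_set I E = min_set I E'" unfolding min_set_eq by (rule image_cong) (use assms in auto)
 moreover have "successive I E \<longleftrightarrow> successive I E'" unfolding successive_def using assms by simp
 moreover have "(ALL i:I. finite (E i)) \<longleftrightarrow> (ALL i:I. finite (E' i))" using assms by simp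
 ultimately show ?thesis unfolding admissible_def by simp
qed

text \<open>Schreier families are spreading and hereditary, so pieces may vanish or start later
  without harm. Every replacement of functionals below preserves its admissibility conditions in
  this way.\<close>

lemma min_set_spread:
 assumes "finite I" "\<And>i. i : I ==> finite (E i)" "disjoint_family_on E I" "min_set I E : schreier n"
  and E': "\<And>i. i : I ==> E' i ~= {} ==> E i ~= {} & Min (E i) <= Min (E' i)"
 shows "min_set I E' : schreier n" unfolding min_set_eq
proof (rule schreier_spread[where \<beta> = "%i. Min (E i)"])
 show "inj_on (%i. Min (E i)) {i : I. E' i ~= {}}" by (rule inj_on_subset[OF Min_inj_disjoint[OF assms(2,3)]]) (use E' in auto)
 show "(%i. Min (E i)) ` {i : I. E' i ~= {}} : schreier n" by (rule schreier_subset[OF assms(4)]) (use E' in "auto simp: min_set_eq")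
qed (use assms in auto)

lemma seq_list_successive:
 assumes "finite A" "seq_list A E : interval_seqs"
 shows "successive A E" "\<And>r. r : A ==> interval (E r)"
proof -
 let ?xs = "sorted_list_of_set A"
 have s: "sorted_wrt set_less (map E ?xs)" and i: "ALL X:set (map E ?xs). interval X" using assms(2) unfolding seq_list_def interval_seqs_def by auto
 show "successive A E" unfolding successive_def
 proof (intro ballI impI)
  fix r r' assume h: "r : A" "r' : A" "r < r'"
  have "set ?xs = A" using assms(1) by simp
  then obtain a b where ab: "a < length ?xs" "b < length ?xs" "?xs ! a = r" "?xs ! b = r'" using h by (metis in_set_conv_nth)
  have "a < b" using h(3) ab strict_sorted_list_of_set[of A] by (metis linorder_neqE_nat not_less_iff_gr_or_eq sorted_wrt_nth_less)
  thus "set_less (E r) (E r')" using s ab sorted_wrt_nth_less[OF s, of a b] by simp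
 qed
 show "\<And>r. r : A ==> interval (E r)" using i assms(1) by auto
qed

lemma interval_finite: "interval E ==> finite E" "interval E ==> E ~= {}" unfolding interval_def by auto

text \<open>Trees record absolute values only: W is closed under changes of signs, and by
  \<open>valid_in_W\<close> and \<open>W_tree\<close> the absolute values of its elements are
  exactly the values of valid trees. \<open>Gam\<close> is the even operation, with any finite index
  set; the empty one gives the zero functional. Besides the pieces \<open>h\<close>,
  \<open>Del j d J K h A E\<close> keeps the witnesses of dependence: slot weights
  \<open>2 * J s\<close>, index intervals \<open>K s\<close>, and the intervals \<open>E r\<close>
  for \<open>r\<close> in \<open>A k\<close>.\<close>

datatype tree = Leaf nat | Gam nat "nat set" "nat => tree"
 | Del nat nat "nat => nat" "nat => nat set" "nat => nat => tree" "nat => nat set" "nat => nat set"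

primrec eval :: "tree => vec" where
 "eval (Leaf n) = unit_vec n"
| "eval (Gam j I c) = lincomb I (%_. 1 / rm (2 * j)) (%i. eval (c i))"
| "eval (Del j d J K h A E) = lincomb {1..d} (%_. 1 / rm (2 * j + 1))
   (%s. lincomb (K s) (%_. 1 / rm (2 * J s)) (%k. eval (h s k)))"

locale cr_space =
 fixes l :: "nat => real => nat" and L1 L2 :: "nat set" and \<sigma> :: "nat set list => nat"
 assumes L12: "L1 \<union> L2 = {1..}" "L1 \<inter> L2 = {}" "infinite L1"
  and coding: "coding_function l L2 \<sigma>"
begin

abbreviation W :: "vec set" where "W \<equiv> norming_set l L1 \<sigma>"

abbreviation tsupp :: "tree => nat set" where "tsupp T \<equiv> supp (eval T)"

text \<open>The conditions of \<open>dependent\<close> with the functionals replaced by the supports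
  \<open>S s k\<close> of their pieces. In this form it is visible that pieces can be exchanged
  while \<open>J\<close>, \<open>K\<close>, \<open>A\<close>, \<open>E\<close>, and with them the
  coding, stay fixed (\<open>depc_spread\<close>).\<close>

definition depc :: "nat => nat => (nat => nat) => (nat => nat set) => (nat => nat set) => (nat => nat set) => (nat => nat => nat set) => bool" where
 "depc j d J K A E S \<longleftrightarrow> 1 <= d &
   admissible (SN (2 * j + 1)) {1..d} (%s. UN k:K s. S s k) &
   (ALL i:{1..d}. 1 <= J i & interval (K i)) & successive {1..d} K &
   (ALL i:{1..d}. admissible (SN (2 * J i)) (K i) (S i)) &
   (ALL k:(UN i:{1..d}. K i). interval (A k)) & successive (UN i:{1..d}. K i) A &
   seq_list (UN i:{1..d}. UN k:K i. A k) E : interval_seqs &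
   J 1 : L1 & mseq (2 * J 1) > nseq (2 * j + 1) &
   (ALL i:{1..<d}. 2 * J (i + 1) = \<sigma> (seq_list (UN i':{1..i}. UN k:K i'. A k) E)) &
   (ALL i:{1..d}. ALL k:K i. S i k \<subseteq> (UN r:A k. E r)) &
   (ALL i:{1..d}. is_singleton (A (Min (K i))) &
    (ALL k:K i. k > Min (K i) -->
      admissible (schreier (rho l (Max (E (Max (A (k - 1))))))) (A k) E))"

lemma depcD:
 assumes "depc j d J K A E S"
 shows "1 <= d" "admissible (SN (2 * j + 1)) {1..d} (%s. UN k:K s. S s k)"
  "ALL i:{1..d}. 1 <= J i & interval (K i)" "successive {1..d} K"
  "ALL i:{1..d}. admissible (SN (2 * J i)) (K i) (S i)"
  "ALL k:(UN i:{1..d}. K i). interval (A k)" "successive (UN i:{1..d}. K i) A"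
  "seq_list (UN i:{1..d}. UN k:K i. A k) E : interval_seqs"
  "J 1 : L1" "mseq (2 * J 1) > nseq (2 * j + 1)"
  "ALL i:{1..<d}. 2 * J (i + 1) = \<sigma> (seq_list (UN i':{1..i}. UN k:K i'. A k) E)"
  "ALL i:{1..d}. ALL k:K i. S i k \<subseteq> (UN r:A k. E r)"
  "ALL i:{1..d}. is_singleton (A (Min (K i))) &
    (ALL k:K i. k > Min (K i) -->
      admissible (schreier (rho l (Max (E (Max (A (k - 1))))))) (A k) E)" using assms unfolding depc_def by - (elim conjE, assumption)+

inductive valid :: "tree => bool" where
 Leaf: "1 <= n ==> valid (Leaf n)"
| Gam: "1 <= j ==> finite I ==> (\<And>i. i : I ==> valid (c i)) ==>
  allowable (SN (2 * j)) I (%i. tsupp (c i)) ==> valid (Gam j I c)"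
| Del: "1 <= j ==> (\<And>s k. s : {1..d} ==> k : K s ==> valid (h s k)) ==>
  depc j d J K A E (%s k. tsupp (h s k)) ==> valid (Del j d J K h A E)"

lemmas W_closed = norming_set_closed[of l L1 \<sigma>, unfolded norming_closed_def]

lemma W_unit: "1 <= n ==> unit_vec n : W" using W_closed[THEN conjunct1] by blast

lemma W_abs: "f : W ==> g : c00 ==> (\<And>i. \<bar>f i\<bar> = \<bar>g i\<bar>) ==> g : W" using W_closed[THEN conjunct2, THEN conjunct1] by blast

lemma W_dep: "1 <= j ==> dependent l L1 \<sigma> W j d f ==> lincomb {1..d} (%i. 1 / rm (2 * j + 1)) f : W" using W_closed[THEN conjunct2, THEN conjunct2, THEN conjunct2] by blast

lemma W_gam1: "1 <= j ==> 1 <= d ==> (\<And>i. i : {1..d} ==> f i : W) ==>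
  allowable (SN (2 * j)) {1..d} (%i. supp (f i)) ==>
  lincomb {1..d} (%i. 1 / rm (2 * j)) f : W" using W_closed[THEN conjunct2, THEN conjunct2, THEN conjunct1] by blast

lemma W_c00: "f : W ==> f : c00"
 and W_le_1: "f : W ==> \<bar>f t\<bar> <= 1" using norming_set_bounded by blast+

lemma W_least: "V \<subseteq> c00 ==> norming_closed l L1 \<sigma> V ==> f : W ==> f : V" unfolding norming_set_def by blast

lemma depc_dependent:
 assumes "depc j d J K A E (%s k. supp (g s k))" "\<And>s k. s : {1..d} ==> k : K s ==> g s k : insert (%t. 0) V"
  and f: "\<And>s. s : {1..d} ==> f s = lincomb (K s) (%k. 1 / rm (2 * J s)) (g s)"
  "\<And>s. s : {1..d} ==> f s : insert (%t. 0) V"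
 shows "dependent l L1 \<sigma> V j d f"
proof -
 note D = depcD[OF assms(1)]
 have adm: "admissible (SN (2 * j + 1)) {1..d} (%i. supp (f i))"
 proof -
  note a = D(2)
  have sub: "supp (f s) \<subseteq> (UN k:K s. supp (g s k))" if "s : {1..d}" for s unfolding f(1)[OF that] by (rule supp_lincomb)
  have suc: "successive {1..d} (%i. supp (f i))" unfolding successive_def set_less_def
  proof (intro ballI impI)
   fix i i' t t' assume h: "i : {1..d}" "i' : {1..d}" "i < i'" "t : supp (f i)" "t' : supp (f i')"
   have "set_less (UN k:K i. supp (g i k)) (UN k:K i'. supp (g i' k))" using a h unfolding admissible_def successive_def by blast
   moreover have "t : (UN k:K i. supp (g i k))" "t' : (UN k:K i'. supp (g i' k))" using sub[OF h(1), THEN subsetD, OF h(4)] sub[OF h(2), THEN subsetD, OF h(5)] .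
   ultimately show "t < t'" unfolding set_less_def by (elim ballE[of _ _ t] ballE[of _ _ t']) simp_all
  qed
  have fin: "finite (UN k:K s. supp (g s k))" if "s : {1..d}" for s using a that unfolding admissible_def by blast
  have "min_set {1..d} (%i. supp (f i)) : SN (2 * j + 1)"
  proof (rule min_set_spread[where E = "%s. UN k:K s. supp (g s k)"])
   show "disjoint_family_on (%s. UN k:K s. supp (g s k)) {1..d}" by (rule successive_disjoint) (use a in "simp add: admissible_def")
   show "min_set {1..d} (%s. UN k:K s. supp (g s k)) : SN (2 * j + 1)" using a by (simp add: admissible_def)
   fix i assume i: "i : {1..d}" "supp (f i) ~= {}"
   show "(UN k:K i. supp (g i k)) ~= {} & Min (UN k:K i. supp (g i k)) <= Min (supp (f i))" using sub[OF i(1)] Min_antimono[OF sub[OF i(1)] i(2) fin[OF i(1)]] i(2) by blast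
  qed (use fin in simp_all)
  moreover have "ALL i:{1..d}. finite (supp (f i))" using fin sub finite_subset by blast
  ultimately show ?thesis unfolding admissible_def using suc by simp
 qed
 have fs: "ALL i:{1..d}. f i : insert (%t. 0) V" using f(2) by blast
 have gs: "ALL i:{1..d}. f i = lincomb (K i) (%k. 1 / rm (2 * J i)) (g i) &
    (ALL k:K i. g i k : insert (%t. 0) V) &
    admissible (SN (2 * J i)) (K i) (%k. supp (g i k))" using D(5) f(1) assms(2) by blast
 show ?thesis unfolding dependent_def
  apply (intro conjI)
    apply (rule D(1))
   apply (rule fs)
   apply (rule adm)
  apply (rule exI[of _ J], rule exI[of _ K], rule exI[of _ g], rule exI[of _ A], rule exI[of _ E])
  apply (intro conjI)
       apply (rule D(3))
       apply (rule D(4))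
      apply (rule gs)
      apply (rule D(6))
     apply (rule D(7))
     apply (rule D(8))
    apply (rule D(9))
    apply (rule D(10))
   apply (rule D(11))
   apply (rule D(12))
  apply (rule D(13))
  done
qed

lemma ex_L1_gt: "EX j:L1. N < j" using L12(3) infinite_nat_iff_unbounded by blast

lemma L1_pos: "j : L1 ==> 1 <= j" using L12(1) by auto

text \<open>Zero arises as a dependent sequence of length 1 whose only term is 0; the weight is
  taken from L1 beyond n_3 to meet condition (1). It serves as the value of empty families.\<close>

lemma W_zero: "(%t. 0) : W"
proof -
 obtain j1 where j1: "j1 : L1" "nseq 3 < j1" using ex_L1_gt by blast
 have m: "nseq 3 < mseq (2 * j1)" using less_mseq[of "2 * j1"] j1 by simp
 have i1: "interval {1..1::nat}" unfolding interval_def by blast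
 have "depc 1 1 (%_. j1) (%_. {1..1::nat}) (%_. {1..1::nat}) (%_. {1..1::nat}) (%s k. supp (%t. 0))" unfolding depc_def
 proof (intro conjI)
  show "admissible (SN (2 * 1 + 1)) {1..1::nat} (%s. UN k:{1..1::nat}. supp (%t. 0))"
   "ALL i:{1..1::nat}. admissible (SN (2 * j1)) {1..1::nat} (%k. supp (%t. 0))" by (simp_all add: admissible_def successive_def min_set_def supp_def)
  show "mseq (2 * j1) > nseq (2 * 1 + 1)" using m by (simp add: numeral_3_eq_3)
  show "seq_list (UN i:{1..1::nat}. UN k:{1..1::nat}. {1..1::nat}) (%_. {1..1::nat}) : interval_seqs" using i1 by (simp add: seq_list_def interval_seqs_def)
  show "ALL i:{1..1::nat}. is_singleton {1..1::nat} & (ALL k:{1..1::nat}. Min {1..1::nat} < k -->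
    admissible (schreier (rho l (Max {1..1::nat}))) {1..1::nat} (%_. {1..1::nat}))" by (simp add: is_singleton_altdef)
 qed (use i1 j1 L1_pos[OF j1(1)] in "simp_all add: successive_def supp_def")
 from depc_dependent[OF this, of W "%_ t. 0"] have "dependent l L1 \<sigma> W 1 1 (%_ t. 0)" by (simp add: lincomb_def)
 from W_dep[OF _ this] show ?thesis by (simp add: lincomb_def)
qed

lemma W_gam:
 assumes "1 <= j" "finite I" "\<And>i. i : I ==> f i : W" "allowable (SN (2 * j)) I (%i. supp (f i))"
 shows "lincomb I (%i. 1 / rm (2 * j)) f : W"
proof (cases "I = {}")
 case True
 thus ?thesis using W_zero by (simp add: lincomb_def)
next
 case False
 obtain h where h: "bij_betw h {1..card I} I" using ex_bij_betw_nat_finite_1[OF assms(2)] by blast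
 have "lincomb {1..card I} (%i. 1 / rm (2 * j)) (%i. f (h i)) : W"
 proof (rule W_gam1)
  show "1 <= card I" using False assms(2) by (simp add: Suc_leI card_gt_0_iff)
  fix i assume "i : {1..card I}"
  thus "f (h i) : W" using assms(3) h bij_betwE by blast
 next
  have im: "h ` {1..card I} = I" "inj_on h {1..card I}" using h unfolding bij_betw_def by auto
  have "min_set {1..card I} (%i. supp (f (h i))) = min_set I (%i. supp (f i))"
  proof -
   have "{i\<in>I. supp (f i) ~= {}} = h ` {i\<in>{1..card I}. supp (f (h i)) ~= {}}"
   proof (intro equalityI subsetI)
    fix i assume "i : {i\<in>I. supp (f i) ~= {}}"
    hence "i : h ` {1..card I}" "supp (f i) ~= {}" using im(1) by simp_all
    thus "i : h ` {i\<in>{1..card I}. supp (f (h i)) ~= {}}" by (elim imageE) simp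
   next
    fix i assume "i : h ` {i\<in>{1..card I}. supp (f (h i)) ~= {}}"
    then obtain i' where "i' : {1..card I}" "supp (f (h i')) ~= {}" "i = h i'" by blast
    thus "i : {i\<in>I. supp (f i) ~= {}}" using im(1) by blast
   qed
   thus ?thesis unfolding min_set_eq by (simp add: image_image)
  qed
  moreover have "disjoint_family_on (%i. supp (f (h i))) {1..card I}" using assms(4) im unfolding allowable_def disjoint_family_on_def by (metis imageI inj_on_eq_iff)
  ultimately show "allowable (SN (2 * j)) {1..card I} (%i. supp (f (h i)))" using assms(4) im(1) unfolding allowable_def by auto
 qed (rule assms(1))
 moreover have "lincomb {1..card I} (%i. 1 / rm (2 * j)) (%i. f (h i)) = lincomb I (%i. 1 / rm (2 * j)) f"
  unfolding lincomb_def using sum.reindex_bij_betw[OF h, of "%i. 1 / rm (2 * j) * f i _"] by simp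
 ultimately show ?thesis by simp
qed

lemma valid_in_W: "valid T ==> eval T : W"
proof (induction T rule: valid.induct)
 case (Gam j I c)
 thus ?case by (simp add: W_gam)
next
 case (Del j d K h J A E)
 note D = depcD[OF Del.hyps(3)]
 let ?f = "%s. lincomb (K s) (%_. 1 / rm (2 * J s)) (%k. eval (h s k))"
 have f: "?f s : W" if s: "s : {1..d}" for s
 proof (rule W_gam)
  show "1 <= J s" using D(3) s by blast
  have a: "admissible (SN (2 * J s)) (K s) (%k. tsupp (h s k))" using D(5) s by blast
  thus "finite (K s)" unfolding admissible_def by blast
  show "allowable (SN (2 * J s)) (K s) (%k. tsupp (h s k))" using a by (rule admissible_allowable)
 qed (use Del.IH s in blast)
 have "dependent l L1 \<sigma> W j d ?f" by (rule depc_dependent[OF Del.hyps(3)]) (use Del.IH f in blast)+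
 thus ?case using W_dep[OF Del.hyps(1)] by simp
qed (simp add: W_unit)

lemma eval_nonneg: "0 <= eval T t"
proof (induction T)
 case (Del j d J K h A E)
 thus ?case unfolding eval.simps lincomb_def by (intro sum_nonneg mult_nonneg_nonneg) auto
qed (auto simp: lincomb_def intro!: sum_nonneg)

lemma depc_finite: 
 assumes "depc j d J K A E S"
 shows "s : {1..d} ==> finite (K s)" "s : {1..d} ==> K s ~= {}" "s : {1..d} ==> k : K s ==> finite (A k)" 
  "finite (UN i:{1..d}. UN k:K i. A k)"
  "s : {1..d} ==> k : K s ==> finite (S s k)"
proof -
 note D = depcD[OF assms]
 show K: "finite (K s)" "K s ~= {}" if "s : {1..d}" for s using D(3) that interval_finite by blast+
 show A: "finite (A k)" if "s : {1..d}" "k : K s" for s k using D(6) that interval_finite by blast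
 show "finite (UN i:{1..d}. UN k:K i. A k)" using K A by blast
 show "finite (S s k)" if "s : {1..d}" "k : K s" for s k using D(5) that unfolding admissible_def by blast
qed

lemma depc_E_succ:
 assumes "depc j d J K A E S"
 shows "successive (UN i:{1..d}. UN k:K i. A k) E" "r : (UN i:{1..d}. UN k:K i. A k) ==> interval (E r)"
 using seq_list_successive[OF depc_finite(4)[OF assms] depcD(8)[OF assms]] by blast+

lemma depc_order:
 assumes D: "depc j d J K A E S" and s: "s : {1..d}" "s' : {1..d}" "k : K s" "k' : K s'" "k < k'"
  and t: "t : (UN r:A k. E r)" "t' : (UN r:A k'. E r)"
 shows "t < t'"
proof -
 obtain r r' where r: "r : A k" "t : E r" "r' : A k'" "t' : E r'" using t by blast
 have "successive (UN i:{1..d}. K i) A" by (rule depcD(7)[OF D])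
 hence "r < r'" using r s unfolding successive_def set_less_def by blast
 thus ?thesis using depc_E_succ(1)[OF D] r s unfolding successive_def set_less_def by blast
qed

lemma depc_K_less:
 assumes "depc j d J K A E S" "s : {1..d}" "s' : {1..d}" "s < s'" "k : K s" "k' : K s'" shows "k < k'"
 using depcD(4)[OF assms(1)] assms(2-) unfolding successive_def set_less_def by blast

text \<open>The pieces enter the conditions only through their inclusion in the intervals
  \<open>E\<close> and through the set of their starting points. Pieces that stay inside these
  intervals and start no earlier therefore leave the sequence dependent, with unchanged slot
  weights.\<close>

lemma depc_spread:
 assumes D: "depc j d J K A E S"
  and S': "\<And>s k. s : {1..d} ==> k : K s ==> finite (S' s k) & S' s k \<subseteq> (UN r:A k. E r)"
   "\<And>s k. s : {1..d} ==> k : K s ==> S' s k ~= {} ==> S s k ~= {} & Min (S s k) <= Min (S' s k)"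
 shows "depc j d J K A E S'"
proof -
 note D' = depcD[OF D]
 have suc: "successive (K s) (S' s)" if "s : {1..d}" for s unfolding successive_def set_less_def
 proof (intro ballI impI)
  fix k k' t t' assume h: "k : K s" "k' : K s" "k < k'" "t : S' s k" "t' : S' s k'"
  have "t : (UN r:A k. E r)" "t' : (UN r:A k'. E r)" using S'(1)[OF that h(1)] S'(1)[OF that h(2)] h(4,5) by blast+
  thus "t < t'" by (rule depc_order[OF D that that h(1-3)])
 qed
 have adm: "admissible (SN (2 * J s)) (K s) (S' s)" if s: "s : {1..d}" for s
 proof -
  have a: "admissible (SN (2 * J s)) (K s) (S s)" using D'(5) s by blast
  have "min_set (K s) (S' s) : SN (2 * J s)"
  proof (rule min_set_spread[where E = "S s"])
   show "disjoint_family_on (S s) (K s)" by (rule successive_disjoint) (use a in "simp add: admissible_def")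
  qed (use a S'(2)[OF s] in "simp_all add: admissible_def")
  thus ?thesis unfolding admissible_def using suc[OF s] S'(1)[OF s] depc_finite(1)[OF D s] by blast
 qed
 have "admissible (SN (2 * j + 1)) {1..d} (%s. UN k:K s. S' s k)"
 proof -
  have a: "admissible (SN (2 * j + 1)) {1..d} (%s. UN k:K s. S s k)" by (rule D'(2))
  have fin': "finite (UN k:K s. S' s k)" "finite (UN k:K s. S s k)" if "s : {1..d}" for s using S'(1)[OF that] depc_finite[OF D] that by blast+
  have "successive {1..d} (%s. UN k:K s. S' s k)" unfolding successive_def set_less_def
  proof (intro ballI impI)
   fix s s' t t' assume h: "s : {1..d}" "s' : {1..d}" "s < s'" "t : (UN k:K s. S' s k)" "t' : (UN k:K s'. S' s' k)"
   then obtain k k' where k: "k : K s" "t : S' s k" "k' : K s'" "t' : S' s' k'" by blast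
   hence "k < k'" using depc_K_less[OF D h(1-3)] by blast
   moreover have "t : (UN r:A k. E r)" "t' : (UN r:A k'. E r)" using S'(1)[OF h(1) k(1)] S'(1)[OF h(2) k(3)] k(2,4) by blast+
   ultimately show "t < t'" using depc_order[OF D h(1,2) k(1,3)] by blast
  qed
  moreover have "min_set {1..d} (%s. UN k:K s. S' s k) : SN (2 * j + 1)"
  proof (rule min_set_spread[where E = "%s. UN k:K s. S s k"])
   fix s assume s: "s : {1..d}" "(UN k:K s. S' s k) ~= {}"
   hence "Min (UN k:K s. S' s k) : (UN k:K s. S' s k)" using fin' by (meson Min_in)
   then obtain k where k: "k : K s" "Min (UN k:K s. S' s k) : S' s k" by blast
   hence k2: "S s k ~= {}" "Min (S s k) <= Min (S' s k)" using S'(2)[OF s(1) k(1)] by auto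
   hence "Min (S s k) : (UN k:K s. S s k)" using k(1) depc_finite(5)[OF D s(1) k(1)] by (meson Min_in UN_I)
   hence "Min (UN k:K s. S s k) <= Min (S s k)" using fin'(2)[OF s(1)] by simp
   moreover have "Min (S' s k) <= Min (UN k:K s. S' s k)" using k S'(1)[OF s(1) k(1)] by simp
   ultimately show "(UN k:K s. S s k) ~= {} & Min (UN k:K s. S s k) <= Min (UN k:K s. S' s k)"
    using k k2 by (metis UN_I Min_in depc_finite(5)[OF D s(1) k(1)] empty_iff order_trans)
  next
   show "disjoint_family_on (%s. UN k:K s. S s k) {1..d}" by (rule successive_disjoint) (use a in "simp add: admissible_def")
  qed (use a fin' in "simp_all add: admissible_def")
  ultimately show ?thesis unfolding admissible_def using fin' by blast
 qed
 moreover have "ALL i:{1..d}. ALL k:K i. S' i k \<subseteq> (UN r:A k. E r)" using S'(1) by blast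
 moreover have "ALL i:{1..d}. admissible (SN (2 * J i)) (K i) (S' i)" using adm by blast
 ultimately show ?thesis unfolding depc_def by (intro conjI D'(1) D'(3) D'(4) D'(6) D'(7) D'(8) D'(9) D'(10) D'(11) D'(13))
qed

lemma sum_one_nonzero:
 fixes g :: "'i => real"
 assumes "finite I" "\<And>i. i : I ==> i ~= i0 ==> g i = 0"
 shows "(SUM i:I. g i) = (if i0 : I then g i0 else 0)"
proof (cases "i0 : I")
 case True
 hence "(SUM i:I. g i) = g i0 + (SUM i:I - {i0}. g i)" by (rule sum.remove[OF assms(1)])
 moreover have "(SUM i:I - {i0}. g i) = 0" by (rule sum.neutral) (use assms(2) in auto)
 ultimately show ?thesis using True by simp
next
 case False
 thus ?thesis using assms(2) by (metis (no_types, lifting) sum.neutral)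
qed

lemma disjoint_one_nonzero:
 assumes "disjoint_family_on (%i. supp (f i)) I"
 shows "EX i0. ALL i:I. i ~= i0 --> f i t = 0"
proof (cases "EX i:I. f i t ~= 0")
 case True
 then obtain i0 where i0: "i0 : I" "f i0 t ~= 0" by blast
 have "f i t = 0" if "i : I" "i ~= i0" for i
 proof (rule ccontr)
  assume "f i t ~= 0"
  hence "t : supp (f i) \<inter> supp (f i0)" using i0(2) by (simp add: supp_def)
  thus False using assms that i0(1) unfolding disjoint_family_on_def by blast
 qed
 thus ?thesis by blast
qed blast

lemma abs_lincomb_disjoint:
 assumes "finite I" "disjoint_family_on (%i. supp (f i)) I" "0 <= c"
 shows "\<bar>lincomb I (%_. c) f t\<bar> = lincomb I (%_. c) (%i t. \<bar>f i t\<bar>) t"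
proof -
 obtain i0 where i0: "\<And>i. i : I ==> i ~= i0 ==> f i t = 0" using disjoint_one_nonzero[OF assms(2)] by blast
 show ?thesis unfolding lincomb_def by (subst (1 2) sum_one_nonzero[OF assms(1), of i0]) (use i0 assms(3) in "auto simp: abs_mult")
qed

lemma supp_lincomb_disjoint:
 assumes "finite I" "disjoint_family_on (%i. supp (f i)) I" "c ~= 0"
 shows "supp (lincomb I (%_. c) f) = (UN i:I. supp (f i))"
proof
 show "(UN i:I. supp (f i)) \<subseteq> supp (lincomb I (%_. c) f)"
 proof
  fix t assume "t : (UN i:I. supp (f i))"
  then obtain i where i: "i : I" "f i t ~= 0" by (auto simp: supp_def)
  obtain i0 where i0: "\<And>i. i : I ==> i ~= i0 ==> f i t = 0" using disjoint_one_nonzero[OF assms(2)] by blast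
  hence "i = i0" using i by blast
  hence "lincomb I (%_. c) f t = c * f i t" unfolding lincomb_def by (subst sum_one_nonzero[OF assms(1), of i0]) (use i0 i in auto)
  thus "t : supp (lincomb I (%_. c) f)" using i assms(3) by (simp add: supp_def)
 qed
qed (rule supp_lincomb)

lemma valid_zero: "valid (Gam 1 {} c)" by (rule valid.Gam) (auto simp: allowable_def min_set_def disjoint_family_on_def)

lemma eval_zero [simp]: "eval (Gam j {} c) = (%t. 0)" by (simp add: lincomb_def)

lemma supp_zero [simp]: "supp (%t. 0) = {}" by (simp add: supp_def)

lemma supp_abs: "supp (%t. \<bar>x t\<bar>) = supp x" by (simp add: supp_def)

text \<open>By minimality of W it is enough that the functionals whose absolute value is given by a
  tree are closed under the four rules. Disjoint supports let the absolute value pass through the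
  sums.\<close>

lemma W_tree: 
 assumes "f : W" shows "EX T. valid T & eval T = (%t. \<bar>f t\<bar>)"
proof -
 define V where "V = {f : c00. EX T. valid T & eval T = (%t. \<bar>f t\<bar>)}"
 have VI: "f : V" if "valid T" "eval T = (%t. \<bar>f t\<bar>)" "f : c00" for f T unfolding V_def using that by blast
 have VE: "EX T. valid T & eval T = (%t. \<bar>f t\<bar>)" if "f : insert (%t. 0) V" for f
  using that valid_zero[of undefined] eval_zero[of 1 undefined] unfolding V_def by fastforce
 have "norming_closed l L1 \<sigma> V" unfolding norming_closed_def
 proof (intro conjI allI ballI impI)
  fix n :: nat assume n: "1 <= n"
  have *: "supp (unit_vec n) = {n}" "supp (%i. - unit_vec n i) = {n}" by (auto simp: supp_def indicator_def)
  have "valid (Leaf n)" using n by (rule valid.Leaf)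
  moreover have "eval (Leaf n) = (%t. \<bar>unit_vec n t\<bar>)" "eval (Leaf n) = (%t. \<bar>- unit_vec n t\<bar>)" by auto
  moreover have "unit_vec n : c00" "(%i. - unit_vec n i) : c00" using n * by (auto simp: c00_def indicator_def)
  ultimately show "unit_vec n : V" "(%i. - unit_vec n i) : V" using VI[of "Leaf n" "unit_vec n"] VI[of "Leaf n" "%i. - unit_vec n i"] by simp_all
 next
  fix f g assume fg: "f : V" "g : c00" "ALL i. \<bar>f i\<bar> = \<bar>g i\<bar>"
  hence "(%t. \<bar>f t\<bar>) = (%t. \<bar>g t\<bar>)" by auto
  thus "g : V" using fg unfolding V_def by auto
 next
  fix j d :: nat and f
  assume j: "1 <= j" "1 <= d" and f: "(ALL i:{1..d}. f i : V) & allowable (SN (2 * j)) {1..d} (%i. supp (f i))"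
  hence "ALL i:{1..d}. EX T. valid T & eval T = (%t. \<bar>f i t\<bar>)" using VE by blast
  then obtain c where c: "\<And>i. i : {1..d} ==> valid (c i)" "\<And>i. i : {1..d} ==> eval (c i) = (%t. \<bar>f i t\<bar>)" by metis
  have sc: "tsupp (c i) = supp (f i)" if "i : {1..d}" for i using c(2)[OF that] supp_abs by simp
  have "{Min (tsupp (c i)) |i. i : {1..d} & tsupp (c i) ~= {}} = {Min (supp (f i)) |i. i : {1..d} & supp (f i) ~= {}}" using sc by metis
  hence "allowable (SN (2 * j)) {1..d} (%i. tsupp (c i))" using f sc unfolding allowable_def min_set_def disjoint_family_on_def by simp
  hence "valid (Gam j {1..d} c)" using j c by (intro valid.Gam) auto
  moreover have "eval (Gam j {1..d} c) = (%t. \<bar>lincomb {1..d} (%i. 1 / rm (2 * j)) f t\<bar>)"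
  proof
   fix t
   have "\<bar>lincomb {1..d} (%i. 1 / rm (2 * j)) f t\<bar> = lincomb {1..d} (%_. 1 / rm (2 * j)) (%i t. \<bar>f i t\<bar>) t"
    by (rule abs_lincomb_disjoint) (use f in "auto simp: allowable_def")
   thus "eval (Gam j {1..d} c) t = \<bar>lincomb {1..d} (%i. 1 / rm (2 * j)) f t\<bar>" using c(2) by (simp add: lincomb_def)
  qed
  moreover have "lincomb {1..d} (%i. 1 / rm (2 * j)) f : c00" by (rule c00_lincomb) (use f V_def in auto)
  ultimately show "lincomb {1..d} (%i. 1 / rm (2 * j)) f : V" by (rule VI)
 next
  fix j d :: nat and f
  assume j: "1 <= j" and dep: "dependent l L1 \<sigma> V j d f"
  let ?c = "1 / rm (2 * j + 1)"
  note P = dep[unfolded dependent_def]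
  from P obtain J K g A E where
    JK: "(ALL i:{1..d}. 1 <= J i & interval (K i)) & successive {1..d} K &
    (ALL i:{1..d}.
      f i = lincomb (K i) (%k. 1 / rm (2 * J i)) (g i) &
      (ALL k:K i. g i k : insert (%t. 0) V) &
      admissible (SN (2 * J i)) (K i) (%k. supp (g i k))) &
    (ALL k:(UN i:{1..d}. K i). interval (A k)) & successive (UN i:{1..d}. K i) A &
    seq_list (UN i:{1..d}. UN k:K i. A k) E : interval_seqs &
    J 1 : L1 & mseq (2 * J 1) > nseq (2 * j + 1) &
    (ALL i:{1..<d}. 2 * J (i + 1) = \<sigma> (seq_list (UN i':{1..i}. UN k:K i'. A k) E)) &
    (ALL i:{1..d}. ALL k:K i. supp (g i k) \<subseteq> (UN r:A k. E r)) &
    (ALL i:{1..d}. is_singleton (A (Min (K i))) &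
      (ALL k:K i. k > Min (K i) -->
       admissible (schreier (rho l (Max (E (Max (A (k - 1))))))) (A k) E))" by (elim conjE exE) blast
  have f: "f i = lincomb (K i) (%k. 1 / rm (2 * J i)) (g i)" if "i : {1..d}" for i using JK that by blast
  have g: "g i k : insert (%t. 0) V" if "i : {1..d}" "k : K i" for i k using JK that by blast
  have adm: "admissible (SN (2 * J i)) (K i) (%k. supp (g i k))" if "i : {1..d}" for i using JK that by blast
  have finK: "finite (K i)" if "i : {1..d}" for i using adm[OF that] unfolding admissible_def by blast
  have disj: "disjoint_family_on (%k. supp (g i k)) (K i)" if "i : {1..d}" for i using adm[OF that] unfolding admissible_def by (intro successive_disjoint) blast
  have mJ: "0 < 1 / rm (2 * J i)" if "i : {1..d}" for i using JK that mseq_pos[of "2 * J i"] by force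
  have sf: "supp (f i) = (UN k:K i. supp (g i k))" if "i : {1..d}" for i unfolding f[OF that] using mJ[OF that] by (intro supp_lincomb_disjoint finK disj that) simp
  have admf: "admissible (SN (2 * j + 1)) {1..d} (%i. supp (f i))" using P by (elim conjE)
  have "admissible (SN (2 * j + 1)) {1..d} (%s. UN k:K s. supp (g s k))"
   using admf sf admissible_cong[of "{1..d}" "%i. supp (f i)" "%s. UN k:K s. supp (g s k)"] by blast
  note admS = this
  have D: "depc j d J K A E (%s k. supp (g s k))" unfolding depc_def
  proof (intro conjI)
   show "1 <= d" by (rule P[THEN conjunct1])
   show "ALL i:{1..d}. admissible (SN (2 * J i)) (K i) (%k. supp (g i k))" using adm by blast
  qed (insert admS JK, (elim conjE, assumption)+)
  have "ALL i:{1..d}. ALL k:K i. EX T. valid T & eval T = (%t. \<bar>g i k t\<bar>)" using VE g by blast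
  then obtain h where h: "\<And>i k. i : {1..d} ==> k : K i ==> valid (h i k)" "\<And>i k. i : {1..d} ==> k : K i ==> eval (h i k) = (%t. \<bar>g i k t\<bar>)" by metis
  have sh: "tsupp (h s k) = supp (g s k)" if "s : {1..d}" "k : K s" for s k using h(2)[OF that] supp_abs by simp
  have "depc j d J K A E (%s k. tsupp (h s k))" by (rule depc_spread[OF D]) (use sh depc_finite(5)[OF D] depcD(12)[OF D] in simp_all)
  hence "valid (Del j d J K h A E)" using j h by (intro valid.Del) auto
  moreover have "eval (Del j d J K h A E) = (%t. \<bar>lincomb {1..d} (%i. ?c) f t\<bar>)"
  proof
   fix t
   have "\<bar>lincomb {1..d} (%i. ?c) f t\<bar> = lincomb {1..d} (%_. ?c) (%i t. \<bar>f i t\<bar>) t"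
    by (rule abs_lincomb_disjoint) (use admf successive_disjoint in "auto simp: admissible_def")
   also have "... = lincomb {1..d} (%_. ?c) (%s. lincomb (K s) (%_. 1 / rm (2 * J s)) (%k. eval (h s k))) t"
   proof -
    have "\<bar>f s t\<bar> = lincomb (K s) (%_. 1 / rm (2 * J s)) (%k. eval (h s k)) t" if s: "s : {1..d}" for s
    proof -
     have "\<bar>f s t\<bar> = lincomb (K s) (%_. 1 / rm (2 * J s)) (%k t. \<bar>g s k t\<bar>) t" unfolding f[OF s] by (rule abs_lincomb_disjoint[OF finK[OF s] disj[OF s]]) simp
     thus ?thesis using h(2)[OF s] by (simp add: lincomb_def)
    qed
    thus ?thesis by (simp add: lincomb_def)
   qed
   finally show "eval (Del j d J K h A E) t = \<bar>lincomb {1..d} (%i. ?c) f t\<bar>" by simp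
  qed
  moreover have "lincomb {1..d} (%i. ?c) f : c00"
  proof (rule c00_lincomb)
   fix i assume i: "i : {1..d}"
   have "g i k : c00" if "k : K i" for k using g[OF i that] V_def by auto
   thus "f i : c00" unfolding f[OF i] by (rule c00_lincomb[OF finK[OF i]])
  qed simp
  ultimately show "lincomb {1..d} (%i. ?c) f : V" by (rule VI)
 qed
 moreover have "V \<subseteq> c00" unfolding V_def by blast
 ultimately have "f : V" using W_least assms by blast
 thus ?thesis unfolding V_def by blast
qed

lemma valid_finite: "valid T ==> finite (tsupp T)" using valid_in_W W_c00 c00_finite by blast

lemma Min_subset: "finite X ==> Y \<subseteq> X ==> Y ~= {} ==> X ~= {} & Min X <= Min (Y::nat set)" using Min_antimono by auto

text \<open>Restriction only removes or postpones starting points, so \<open>min_set_spread\<close>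
  and \<open>depc_spread\<close> apply at every node.\<close>

lemma valid_proj: "valid T ==> EX T'. valid T' & eval T' = proj G (eval T)"
proof (induction T rule: valid.induct)
 case (Leaf n)
 show ?case
 proof (cases "n : G")
  case True
  hence "proj G (eval (Leaf n)) = eval (Leaf n)" by (auto simp: proj_def indicator_def)
  thus ?thesis using valid.Leaf[OF Leaf] by metis
 next
  case False
  hence "proj G (eval (Leaf n)) = (%t. 0)" by (auto simp: proj_def indicator_def)
  thus ?thesis using valid_zero eval_zero by metis
 qed
next
 case (Gam j I c)
 then obtain c' where c': "\<And>i. i : I ==> valid (c' i)" "\<And>i. i : I ==> eval (c' i) = proj G (eval (c i))" by metis
 have sub: "tsupp (c' i) \<subseteq> tsupp (c i)" if "i : I" for i using c'(2)[OF that] by (simp add: supp_proj)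
 have al: "allowable (SN (2 * j)) I (%i. tsupp (c i))" by fact
 have "min_set I (%i. tsupp (c' i)) : SN (2 * j)"
 proof (rule min_set_spread[where E = "%i. tsupp (c i)"])
  fix i assume i: "i : I" "tsupp (c' i) ~= {}"
  have "finite (tsupp (c i))" using al i(1) by (simp add: allowable_def)
  thus "tsupp (c i) ~= {} & Min (tsupp (c i)) <= Min (tsupp (c' i))" by (rule Min_subset[OF _ sub[OF i(1)] i(2)])
 qed (use al in "simp_all add: allowable_def")
 moreover have "disjoint_family_on (%i. tsupp (c' i)) I" using al sub unfolding allowable_def disjoint_family_on_def by blast
 ultimately have "valid (Gam j I c')" using Gam.hyps c'(1) valid_finite by (intro valid.Gam) (auto simp: allowable_def)
 moreover have "eval (Gam j I c') = proj G (eval (Gam j I c))" unfolding eval.simps proj_lincomb unfolding lincomb_def using c'(2) by simp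
 ultimately show ?case by blast
next
 case (Del j d K h J A E)
 hence "ALL s:{1..d}. ALL k:K s. EX T'. valid T' & eval T' = proj G (eval (h s k))" by blast
 then obtain h' where h': "\<And>s k. s : {1..d} ==> k : K s ==> valid (h' s k)" "\<And>s k. s : {1..d} ==> k : K s ==> eval (h' s k) = proj G (eval (h s k))" by metis
 note D = Del.hyps(3)
 have sub: "tsupp (h' s k) \<subseteq> tsupp (h s k)" if "s : {1..d}" "k : K s" for s k using h'(2)[OF that] by (simp add: supp_proj)
 have "depc j d J K A E (%s k. tsupp (h' s k))"
 proof (rule depc_spread[OF D])
  fix s k assume sk: "s : {1..d}" "k : K s"
  show "finite (tsupp (h' s k)) & tsupp (h' s k) \<subseteq> (UN r:A k. E r)" using valid_finite[OF h'(1)[OF sk]] sub[OF sk] depcD(12)[OF D] sk by blast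
  show "tsupp (h' s k) ~= {} ==> tsupp (h s k) ~= {} & Min (tsupp (h s k)) <= Min (tsupp (h' s k))" by (rule Min_subset[OF depc_finite(5)[OF D sk] sub[OF sk]])
 qed
 hence "valid (Del j d J K h' A E)" using Del.hyps h'(1) by (intro valid.Del) auto
 moreover have "eval (Del j d J K h' A E) = proj G (eval (Del j d J K h A E))" unfolding eval.simps proj_lincomb unfolding lincomb_def using h'(2) by simp
 ultimately show ?case by blast
qed

section \<open>The norm and its evaluation by trees\<close>

abbreviation N :: "vec => real" where "N \<equiv> cr_norm W"

lemma N_eq: "N x = (SUP f\<in>W. \<bar>dot f x\<bar>)" unfolding cr_norm_def dot_def ..

lemma dot_bound: "f : W ==> \<bar>dot f x\<bar> <= (SUM i:supp x. \<bar>x i\<bar>)" unfolding dot_def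
 by (rule order_trans[OF sum_abs]) (auto intro!: sum_mono simp: abs_mult mult_left_le_one_le W_le_1)

lemma N_upper: "f : W ==> \<bar>dot f x\<bar> <= N x" unfolding N_eq by (rule cSUP_upper) (use dot_bound in "auto intro!: bdd_aboveI")

lemma N_least: "(\<And>f. f : W ==> \<bar>dot f x\<bar> <= B) ==> N x <= B" unfolding N_eq by (rule cSUP_least) (use W_zero in auto)

lemma N_nonneg: "0 <= N x" using N_upper[OF W_zero, of x] by linarith

lemma dot_abs_le:
 assumes "x : c00" "y : c00" "\<And>t. \<bar>x t\<bar> <= \<bar>y t\<bar>"
 shows "\<bar>dot f x\<bar> <= dot (%t. \<bar>f t\<bar>) (%t. \<bar>y t\<bar>)"
proof -
 have s: "supp x \<subseteq> supp y"
 proof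
  fix t assume "t : supp x"
  thus "t : supp y" using assms(3)[of t] by (auto simp: supp_def)
 qed
 have "\<bar>dot f x\<bar> = \<bar>SUM t:supp y. f t * x t\<bar>" using dot_superset[OF c00_finite[OF assms(2)] s] by simp
 also have "... <= (SUM t:supp y. \<bar>f t\<bar> * \<bar>y t\<bar>)" by (rule order_trans[OF sum_abs]) (auto intro!: sum_mono mult_left_mono simp: abs_mult assms(3))
 finally show ?thesis by (simp add: dot_def supp_abs)
qed

text \<open>Rule (beta) allows the signs of \<open>f\<close> to be adapted to those of
  \<open>y\<close>. Hence the unit vectors are 1-unconditional, and it suffices to compare
  nonnegative vectors and coefficients.\<close>

lemma dot_abs_N: assumes "f : W" "y : c00" shows "dot (%t. \<bar>f t\<bar>) (%t. \<bar>y t\<bar>) <= N y"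
proof -
 let ?g = "%t. if y t < 0 then - \<bar>f t\<bar> else \<bar>f t\<bar>"
 have "supp ?g = supp f" by (auto simp: supp_def)
 hence "?g : c00" using W_c00[OF assms(1)] by (auto simp: c00_def)
 hence g: "?g : W" by (rule W_abs[OF assms(1)]) auto
 have "dot (%t. \<bar>f t\<bar>) (%t. \<bar>y t\<bar>) = dot ?g y" unfolding dot_def supp_abs by (rule sum.cong) auto
 thus ?thesis using N_upper[OF g, of y] by linarith
qed

lemma N_mono_abs: "x : c00 ==> y : c00 ==> (\<And>t. \<bar>x t\<bar> <= \<bar>y t\<bar>) ==> N x <= N y" by (rule N_least) (meson dot_abs_le dot_abs_N order_trans)

lemma c00_abs: "x : c00 ==> (%t. \<bar>x t\<bar>) : c00" by (simp add: c00_def supp_abs)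

lemma N_abs: "x : c00 ==> N (%t. \<bar>x t\<bar>) = N x" by (intro antisym N_mono_abs c00_abs) auto

lemma N_tree_upper: "valid T ==> dot (eval T) x <= N x" using N_upper[OF valid_in_W, of T x] by linarith

lemma N_tree_approx: 
 assumes "x : c00" "c < N x" shows "EX T. valid T & c < dot (eval T) (%t. \<bar>x t\<bar>)"
proof -
 obtain f where f: "f : W" "c < \<bar>dot f x\<bar>" using assms(2) N_least[of x c] by (meson not_less)
 obtain T where T: "valid T" "eval T = (%t. \<bar>f t\<bar>)" using W_tree[OF f(1)] by blast
 have "\<bar>dot f x\<bar> <= dot (eval T) (%t. \<bar>x t\<bar>)" unfolding T(2) by (rule dot_abs_le) (use assms in auto)
 thus ?thesis using T f(2) by (intro exI[of _ T]) simp
qed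

lemma N_lincomb_le:
 assumes "finite I" "\<And>i. i : I ==> x i : c00"
 shows "N (lincomb I a x) <= (SUM i:I. \<bar>a i\<bar> * N (x i))"
proof (rule N_least)
 fix f assume f: "f : W"
 have "\<bar>dot f (lincomb I a x)\<bar> = \<bar>SUM i:I. a i * dot f (x i)\<bar>" by (subst dot_lincomb[OF assms]) simp_all
 also have "... <= (SUM i:I. \<bar>a i\<bar> * N (x i))" by (rule order_trans[OF sum_abs]) (auto intro!: sum_mono mult_left_mono simp: abs_mult N_upper f)
 finally show "\<bar>dot f (lincomb I a x)\<bar> <= (SUM i:I. \<bar>a i\<bar> * N (x i))" .
qed

lemma N_scale_le: assumes "x : c00" shows "N (%t. c * x t) <= \<bar>c\<bar> * N x"
proof -
 have e: "(%t. c * x t) = lincomb {0::nat} (%_. c) (%_. x)" by (simp add: lincomb_def)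
 show ?thesis unfolding e using N_lincomb_le[of "{0}" "%_. x" "%_. c"] assms by simp
qed

lemma c00_scale: assumes "x : c00" shows "(%t. c * x t) : c00"
proof -
 have e: "(%t. c * x t) = lincomb {0::nat} (%_. c) (%_. x)" by (simp add: lincomb_def)
 show ?thesis unfolding e by (rule c00_lincomb) (use assms in auto)
qed

lemma N_scale: assumes "x : c00" shows "N (%t. c * x t) = \<bar>c\<bar> * N x"
proof (cases "c = 0")
 case True
 thus ?thesis using N_scale_le[OF assms, of 0] N_nonneg[of "%t. 0 * x t"] by auto
next
 case False
 have "N x = N (%t. (1 / c) * (c * x t))" using False by simp
 also have "... <= \<bar>1 / c\<bar> * N (%t. c * x t)" by (rule N_scale_le[OF c00_scale[OF assms]])
 finally have "\<bar>c\<bar> * N x <= N (%t. c * x t)" using False by (simp add: field_simps)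
 thus ?thesis using N_scale_le[OF assms, of c] by simp
qed

lemma coord_le_N: assumes "x : c00" shows "\<bar>x i\<bar> <= N x"
proof (cases "x i = 0")
 case False
 hence "1 <= i" using assms by (cases i) (auto simp: c00_def)
 hence u: "unit_vec i : W" by (rule W_unit)
 have "dot (unit_vec i) x = x i" unfolding dot_def by (subst sum_one_nonzero[of _ i]) (use False assms in "auto simp: c00_def supp_def indicator_def")
 thus ?thesis using N_upper[OF u, of x] by simp
qed (simp add: N_nonneg)

lemma N_pos: "x : c00 ==> supp x ~= {} ==> 0 < N x" using coord_le_N by (smt (verit) Collect_empty_eq supp_def)

end

section \<open>Frontiers of trees\<close>

primrec wt :: "tree => nat" where
 "wt (Leaf n) = 0"
| "wt (Gam j I c) = 2 * j"
| "wt (Del j d J K h A E) = 2 * j + 1"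

text \<open>The slots of a dependent node count as its children, namely as even nodes of weight
  \<open>2 * J s\<close>. In this way every node other than a leaf is the sum of its children
  divided by its own weight, and the two operations can be treated alike.\<close>

primrec chs :: "tree => tree set" where
 "chs (Leaf n) = {}"
| "chs (Gam j I c) = c ` I"
| "chs (Del j d J K h A E) = (%s. Gam (J s) (K s) (h s)) ` {1..d}"

text \<open>Passing from an indexed family to the set of its members loses nothing, because two
  equal members with disjoint supports vanish.\<close>

lemma sum_image_disjoint:
 assumes "finite I" "disjoint_family_on (%i. supp (f (g i))) I"
 shows "(SUM i:I. f (g i) t) = (SUM c:g ` I. f c t)"
proof -
 have "(SUM c:g ` I. f c t) = (SUM c:{c\<in>g ` I. f c t ~= 0}. f c t)" by (rule sum.mono_neutral_right) (use assms(1) in auto)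
 also have "{c\<in>g ` I. f c t ~= 0} = g ` {i\<in>I. f (g i) t ~= 0}" by auto
 also have "(SUM c:g ` {i\<in>I. f (g i) t ~= 0}. f c t) = (SUM i:{i\<in>I. f (g i) t ~= 0}. f (g i) t)"
 proof (rule sum.reindex_cong[OF _ refl refl], rule inj_onI)
  fix i i' assume h: "i : {i\<in>I. f (g i) t ~= 0}" "i' : {i\<in>I. f (g i) t ~= 0}"
  hence "t : supp (f (g i)) \<inter> supp (f (g i'))" by (simp add: supp_def)
  thus "i = i'" using h assms(2) unfolding disjoint_family_on_def by blast
 qed
 also have "... = (SUM i:I. f (g i) t)" by (rule sum.mono_neutral_left) (use assms(1) in auto)
 finally show ?thesis ..
qed

context cr_space begin

lemma s_node_adm: "depc j d J K A E (%s k. tsupp (h s k)) ==> s : {1..d} ==>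
  allowable (SN (2 * J s)) (K s) (%k. tsupp (h s k))" using depcD(5) admissible_allowable by blast

lemma valid_s_node:
 assumes "valid (Del j d J K h A E)" "s : {1..d}" shows "valid (Gam (J s) (K s) (h s))" using assms(1)
proof cases
 case Del
 show ?thesis
 proof (rule valid.Gam)
  show "1 <= J s" using depcD(3)[OF Del(3)] assms(2) by blast
  show "finite (K s)" by (rule depc_finite(1)[OF Del(3) assms(2)])
  show "allowable (SN (2 * J s)) (K s) (%k. tsupp (h s k))" by (rule s_node_adm[OF Del(3) assms(2)])
 qed (use Del(2) assms(2) in blast)
qed

lemma chs_valid: "valid T ==> c : chs T ==> valid c"
proof (cases T)
 case (Gam j I c')
 thus "valid T ==> c : chs T ==> valid c" by (auto elim: valid.cases)
next
 case (Del j d J K h A E)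
 thus "valid T ==> c : chs T ==> valid c" using valid_s_node by auto
qed simp

lemma wt_pos: "valid T ==> (\<And>n. T ~= Leaf n) ==> 2 <= wt T" by (cases T) (auto elim: valid.cases)

lemma chs_family:
 assumes "valid T" "2 <= wt T"
 obtains I g where "finite (I::nat set)" "chs T = g ` I" "disjoint_family_on (%i. tsupp (g i)) I"
  "min_set I (%i. tsupp (g i)) : SN (wt T)" "eval T = lincomb I (%_. 1 / rm (wt T)) (%i. eval (g i))" using assms(1)
proof cases
 case (Leaf n)
 thus ?thesis using assms(2) by simp
next
 case (Gam j I c)
 show ?thesis by (rule that[of I c]) (use Gam in "simp_all add: allowable_def")
next
 case (Del j d K h J A E)
 let ?g = "%s. Gam (J s) (K s) (h s)"
 have a: "admissible (SN (2 * j + 1)) {1..d} (%s. UN k:K s. tsupp (h s k))" by (rule depcD(2)[OF Del(4)])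
 have e: "(UN k:K s. tsupp (h s k)) = tsupp (?g s)" if s: "s : {1..d}" for s
 proof -
  have "1 <= J s" using depcD(3)[OF Del(4)] s by blast
  hence m: "1 / rm (2 * J s) ~= 0" using mseq_pos[of "2 * J s"] by simp
  have "disjoint_family_on (%k. tsupp (h s k)) (K s)" using s_node_adm[OF Del(4) s] by (simp add: allowable_def)
  thus ?thesis using supp_lincomb_disjoint[OF depc_finite(1)[OF Del(4) s] _ m, of "%k. eval (h s k)"] by simp
 qed
 hence a': "admissible (SN (2 * j + 1)) {1..d} (%s. tsupp (?g s))" using a admissible_cong[of "{1..d}" "%s. UN k:K s. tsupp (h s k)" "%s. tsupp (?g s)"] by blast
 show ?thesis
 proof (rule that[of "{1..d}" ?g])
  show "disjoint_family_on (%i. tsupp (?g i)) {1..d}" by (rule successive_disjoint) (use a' in "simp add: admissible_def")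
  show "min_set {1..d} (%i. tsupp (?g i)) : SN (wt T)" using a' Del by (simp add: admissible_def)
 qed (use Del in simp_all)
qed

lemma chs_finite: "valid T ==> finite (chs T)"
proof (cases "2 <= wt T")
 case True
 thus "valid T ==> finite (chs T)" by (metis chs_family finite_imageI)
next
 case False
 assume "valid T"
 then obtain n where "T = Leaf n" using False wt_pos by metis
 thus ?thesis by simp
qed

lemma chs_disjoint: "valid T ==> c : chs T ==> c' : chs T ==> c ~= c' ==> tsupp c \<inter> tsupp c' = {}"
proof -
 assume h: "valid T" "c : chs T" "c' : chs T" "c ~= c'"
 have "2 <= wt T" using wt_pos[OF h(1)] h(2) by (cases T) auto
 then obtain I g where I: "finite (I::nat set)" "chs T = g ` I" "disjoint_family_on (%i. tsupp (g i)) I" using chs_family[OF h(1)] by metis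
 thus ?thesis using h unfolding disjoint_family_on_def by (metis imageE)
qed

lemma chs_eval: 
 assumes "valid T" "2 <= wt T" shows "eval T t = (SUM c:chs T. eval c t) / rm (wt T)"
proof -
 obtain I g where I: "finite (I::nat set)" "chs T = g ` I" "disjoint_family_on (%i. tsupp (g i)) I"
  "eval T = lincomb I (%_. 1 / rm (wt T)) (%i. eval (g i))" using chs_family[OF assms] by metis
 have "eval T t = (SUM i:I. eval (g i) t) / rm (wt T)" unfolding I(4) lincomb_def by (simp add: sum_divide_distrib)
 thus ?thesis using sum_image_disjoint[of I eval g t] I by simp
qed

lemma chs_supp: assumes "valid T" "2 <= wt T" shows "tsupp T = (UN c:chs T. tsupp c)"
proof -
 obtain I g where I: "finite (I::nat set)" "chs T = g ` I" "disjoint_family_on (%i. tsupp (g i)) I"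
  "eval T = lincomb I (%_. 1 / rm (wt T)) (%i. eval (g i))" using chs_family[OF assms] by metis
 have "1 / rm (wt T) ~= 0" using mseq_pos[of "wt T"] assms(2) by simp
 thus ?thesis using supp_lincomb_disjoint[OF I(1,3)] I by simp
qed

lemma chs_sub: "valid T ==> c : chs T ==> tsupp c \<subseteq> tsupp T" using chs_supp[of T] wt_pos[of T] by (cases T) auto

lemma chs_eval_child:
 assumes "valid T" "c : chs T" "n : tsupp c" shows "eval T n = eval c n / rm (wt T)"
proof -
 have w: "2 <= wt T" using wt_pos[OF assms(1)] assms(2) by (cases T) auto
 have "(SUM c:chs T. eval c n) = eval c n"
 proof (subst sum_one_nonzero[OF chs_finite[OF assms(1)], of c])
  fix c' assume "c' : chs T" "c' ~= c"
  hence "n \<notin> tsupp c'" using chs_disjoint[OF assms(1)] assms by blast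
  thus "eval c' n = 0" by (simp add: supp_def)
 qed (use assms(2) in simp)
 thus ?thesis using chs_eval[OF assms(1) w] by simp
qed

lemma chs_min: 
 assumes "valid T" "2 <= wt T" shows "(%c. Min (tsupp c)) ` {c\<in>chs T. tsupp c ~= {}} : SN (wt T)"
proof -
 obtain I g where I: "chs T = g ` I"
  "min_set I (%i. tsupp (g i)) : SN (wt T)" using chs_family[OF assms] by metis
 have "(%c. Min (tsupp c)) ` {c\<in>chs T. tsupp c ~= {}} = min_set I (%i. tsupp (g i))" unfolding min_set_def I(1) by blast
 thus ?thesis using I(2) by simp
qed

lemma valid_supp_pos: "valid T ==> n : tsupp T ==> 1 <= n" using W_c00[OF valid_in_W] unfolding c00_def supp_def by (cases n) auto

lemma eval_le_1: "valid T ==> eval T n <= 1" using W_le_1[OF valid_in_W, of T n] by simp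

section \<open>Frontiers and the starting points of their nodes\<close>

definition good_step :: "(tree => tree set) => nat => bool" where
 "good_step step n \<longleftrightarrow> (ALL T. valid T --> finite (step T) &
   (ALL c:step T. valid c & tsupp c \<subseteq> tsupp T) &
   (ALL c:step T. ALL c':step T. c ~= c' --> tsupp c \<inter> tsupp c' = {}) &
   (%c. Min (tsupp c)) ` {c\<in>step T. tsupp c ~= {}} : schreier n)"

definition below :: "nat => tree => tree set" where
 "below q T = (if wt T < q then chs T else {})"

text \<open>A node at which \<open>step\<close> is empty is kept. A frontier node has thus either
  been reached through \<open>L\<close> steps or is a place where the descent stops; the first case
  will be worth a factor 2^(-L).\<close>

primrec Fr :: "(tree => tree set) => nat => tree => tree set" where
 "Fr step 0 T = {T}"
| "Fr step (Suc L) T = (if step T = {} then {T} else (UN c:step T. Fr step L c))"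

lemma good_below: "good_step (below q) (nseq (q - 1))" unfolding good_step_def
proof (intro allI impI)
 fix T assume T: "valid T"
 show "finite (below q T) &
   (ALL c:below q T. valid c & tsupp c \<subseteq> tsupp T) &
   (ALL c:below q T. ALL c':below q T. c ~= c' --> tsupp c \<inter> tsupp c' = {}) &
   (%c. Min (tsupp c)) ` {c\<in>below q T. tsupp c ~= {}} : SN (q - 1)"
 proof (cases "wt T < q")
  case True
  hence b: "below q T = chs T" by (simp add: below_def)
  have "(%c. Min (tsupp c)) ` {c\<in>chs T. tsupp c ~= {}} : SN (q - 1)"
  proof (cases "2 <= wt T")
   case w: True
   have "SN (wt T) \<subseteq> SN (q - 1)" by (rule schreier_mono, rule nseq_mono) (use True in simp)
   thus ?thesis using chs_min[OF T w] by blast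
  next
   case False
   then obtain n where "T = Leaf n" using wt_pos[OF T] by metis
   thus ?thesis by simp
  qed
  thus ?thesis unfolding b using T chs_finite chs_valid chs_sub chs_disjoint by blast
 qed (simp add: below_def)
qed

text \<open>The starting points below a child come no earlier than the starting point of the child
  itself, so \<open>schreier_compose\<close> adds the order \<open>n\<close> once per level.\<close>

lemma Fr_props:
 assumes g: "good_step step n" and T: "valid T"
 shows "finite (Fr step L T) & (ALL t:Fr step L T. valid t & tsupp t \<subseteq> tsupp T) &
  (ALL t:Fr step L T. ALL t':Fr step L T. t ~= t' --> tsupp t \<inter> tsupp t' = {}) &
  (%t. Min (tsupp t)) ` {t\<in>Fr step L T. tsupp t ~= {}} : schreier (L * n)" using T
proof (induction L arbitrary: T)
 case 0
 have "(%t. Min (tsupp t)) ` {t\<in>{T}. tsupp t ~= {}} : schreier 0"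
 proof (cases "tsupp T = {}")
  case True
  hence "{t\<in>{T}. tsupp t ~= {}} = {}" by auto
  thus ?thesis by (metis image_empty empty_in_schreier)
 next
  case False
  hence e: "{t\<in>{T}. tsupp t ~= {}} = {T}" by auto
  have "1 <= Min (tsupp T)" using valid_supp_pos[OF 0] Min_in[OF valid_finite[OF 0] False] by blast
  thus ?thesis unfolding e by (simp add: schreier_0_iff)
 qed
 thus ?case using 0 by simp
next
 case (Suc L)
 note G = g[unfolded good_step_def, rule_format, OF Suc.prems]
 show ?case
 proof (cases "step T = {}")
  case True
  have "(%t. Min (tsupp t)) ` {t\<in>{T}. tsupp t ~= {}} : schreier (Suc L * n)"
  proof (cases "tsupp T = {}")
   case True
   hence "{t\<in>{T}. tsupp t ~= {}} = {}" by auto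
   thus ?thesis by (metis image_empty empty_in_schreier)
  next
   case False
   hence e: "{t\<in>{T}. tsupp t ~= {}} = {T}" by auto
   have "1 <= Min (tsupp T)" using valid_supp_pos[OF Suc.prems] Min_in[OF valid_finite[OF Suc.prems] False] by blast
   thus ?thesis unfolding e using singleton_in_schreier by simp
  qed
  thus ?thesis using True Suc.prems by simp
 next
  case False
  hence F: "Fr step (Suc L) T = (UN c:step T. Fr step L c)" by simp
  have V: "valid c" "tsupp c \<subseteq> tsupp T" if "c : step T" for c using G that by blast+
  note IH = Suc.IH[OF V(1)]
  have fin: "finite (Fr step (Suc L) T)" unfolding F using G IH by blast
  have sub: "ALL t:Fr step (Suc L) T. valid t & tsupp t \<subseteq> tsupp T" unfolding F using IH V(2) by blast
  have disj: "tsupp t \<inter> tsupp t' = {}" if "t : Fr step (Suc L) T" "t' : Fr step (Suc L) T" "t ~= t'" for t t'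
  proof -
   from that(1) obtain c where c1: "c : step T" "t : Fr step L c" unfolding F by (rule UN_E)
   from that(2) obtain c' where c2: "c' : step T" "t' : Fr step L c'" unfolding F by (rule UN_E)
   note c = c1 c2
   show ?thesis
   proof (cases "c = c'")
    case True
    thus ?thesis using c IH[OF c(1)] that(3) by blast
   next
    case False
    hence "tsupp c \<inter> tsupp c' = {}" using G c by blast
    thus ?thesis using IH[OF c(1)] IH[OF c(3)] c by blast
   qed
  qed
  let ?M = "%t. Min (tsupp t)"
  have "?M ` {t\<in>Fr step (Suc L) T. tsupp t ~= {}} = (UN c:{c\<in>step T. tsupp c ~= {}}. ?M ` {t\<in>Fr step L c. tsupp t ~= {}})" unfolding F
  proof (intro equalityI subsetI)
   fix m assume "m : ?M ` {t : \<Union> (Fr step L ` step T). tsupp t ~= {}}"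
   then obtain c t where ct: "c : step T" "t : Fr step L c" "tsupp t ~= {}" "m = ?M t" by blast
   moreover have "tsupp t \<subseteq> tsupp c" using IH[OF ct(1)] ct(2) by blast
   ultimately show "m : (UN c:{c\<in>step T. tsupp c ~= {}}. ?M ` {t\<in>Fr step L c. tsupp t ~= {}})" by blast
  qed blast
  moreover have "(UN c:{c\<in>step T. tsupp c ~= {}}. ?M ` {t\<in>Fr step L c. tsupp t ~= {}}) : schreier (L * n + n)"
  proof (rule schreier_compose[where \<beta> = ?M])
   show "finite {c\<in>step T. tsupp c ~= {}}" using G by simp
   show "?M ` {t\<in>Fr step L c. tsupp t ~= {}} : schreier (L * n)" if "c : {c\<in>step T. tsupp c ~= {}}" for c using IH that by blast
   show "?M ` {c\<in>step T. tsupp c ~= {}} : schreier n" using G by blast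
   show "inj_on ?M {c\<in>step T. tsupp c ~= {}}"
   proof (rule Min_inj_disjoint)
    show "disjoint_family_on tsupp (step T)" using G unfolding disjoint_family_on_def by blast
   qed (use V valid_finite in blast)
   fix c t assume h: "c : {c\<in>step T. tsupp c ~= {}}" "t : ?M ` {t\<in>Fr step L c. tsupp t ~= {}}"
   then obtain u where u: "u : Fr step L c" "tsupp u ~= {}" "t = ?M u" by blast
   have "tsupp u \<subseteq> tsupp c" using IH h u by blast
   thus "?M c <= t" unfolding u(3) using u(2) h V valid_finite by (intro Min_antimono) auto
  qed
  ultimately show ?thesis using fin sub disj by (simp add: add.commute)
 qed
qed

lemma Fr_stop: "step T = {} ==> Fr step L T = {T}" by (cases L) auto

text \<open>The maximum over all branches of the product of the reciprocal weights met before the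
  first node of weight at least \<open>\<theta>\<close>, times the score \<open>s\<close> of that
  node; a branch ending in a leaf counts 0. The clause for \<open>Del\<close> spells out the layer
  of slots, since slots are not subtrees of the datatype; \<open>pmx_chs\<close> restores the
  uniform description.\<close>

primrec pmx :: "nat => (nat => nat set => real) => tree => real" where
 "pmx \<theta> s (Leaf n) = 0"
| "pmx \<theta> s (Gam j I c) = (if 2 * j < \<theta> then Max (insert 0 ((%i. pmx \<theta> s (c i)) ` I)) / rm (2 * j)
   else s (2 * j) (supp (eval (Gam j I c))))"
| "pmx \<theta> s (Del j d J K h A E) = (if 2 * j + 1 < \<theta> then Max (insert 0 ((%i. 
    (if 2 * J i < \<theta> then Max (insert 0 ((%k. pmx \<theta> s (h i k)) ` K i)) / rm (2 * J i)
     else s (2 * J i) (supp (eval (Gam (J i) (K i) (h i)))))) ` {1..d})) / rm (2 * j + 1)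
   else s (2 * j + 1) (supp (eval (Del j d J K h A E))))"

lemma pmx_stop: "2 <= wt T ==> \<theta> <= wt T ==> pmx \<theta> s T = s (wt T) (tsupp T)" by (cases T) auto

lemma pmx_chs: "2 <= wt T ==> wt T < \<theta> ==> pmx \<theta> s T = Max (insert 0 (pmx \<theta> s ` chs T)) / rm (wt T)" by (cases T) (simp_all add: image_image)

lemma pmx_leaf: "valid T ==> wt T < 2 ==> pmx \<theta> s T = 0" by (metis not_less pmx.simps(1) wt_pos)

lemma pmx_child_le:
 assumes "valid T" "wt T < \<theta>" "c : chs T" shows "pmx \<theta> s c / rm (wt T) <= pmx \<theta> s T"
proof -
 have w: "2 <= wt T" using wt_pos[OF assms(1)] assms(3) by (cases T) auto
 have "pmx \<theta> s c <= Max (insert 0 (pmx \<theta> s ` chs T))" using assms chs_finite by (intro Max_ge) auto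
 thus ?thesis unfolding pmx_chs[OF w assms(2)] by (simp add: divide_right_mono)
qed

lemma pmx_attained:
 assumes "valid T" "2 <= wt T" "wt T < \<theta>" "pmx \<theta> s T ~= 0" 
 shows "EX c:chs T. pmx \<theta> s T = pmx \<theta> s c / rm (wt T) & pmx \<theta> s c > 0"
proof -
 let ?M = "Max (insert 0 (pmx \<theta> s ` chs T))"
 have e: "pmx \<theta> s T = ?M / rm (wt T)" by (rule pmx_chs[OF assms(2,3)])
 have M: "?M : insert 0 (pmx \<theta> s ` chs T)" "0 <= ?M" using chs_finite[OF assms(1)] by (intro Max_in Max_ge; simp)+
 hence "?M ~= 0" using assms(4) e by auto
 thus ?thesis using M e by auto
qed

lemma real_mseq_ge: "2 <= w ==> 32 <= rm w"
proof -
 assume "2 <= w"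
 hence "mseq 2 <= mseq w" by (rule mseq_mono)
 moreover have "mseq 2 = 32" using mseq_Suc[of 1] by (simp add: numeral_2_eq_2[symmetric])
 ultimately show ?thesis by simp
qed

text \<open>Slots are children without being immediate subtrees; this induction visits them as nodes
  of their own.\<close>

lemma valid_chs_induct [consumes 1, case_names step]:
 assumes "valid T" and P: "\<And>T. valid T ==> (\<And>c. c : chs T ==> P c) ==> P T"
 shows "P T" using assms(1)
proof (induction T rule: valid.induct)
 case (Leaf n)
 thus ?case using P[OF valid.Leaf] by simp
next
 case (Gam j I c)
 thus ?case using P[OF valid.Gam[of j I c]] by auto
next
 case (Del j d K h J A E)
 have v: "valid (Del j d J K h A E)" using Del.hyps by (intro valid.Del) auto
 show ?case
 proof (rule P[OF v])
  fix c assume "c : chs (Del j d J K h A E)"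
  then obtain s where s: "s : {1..d}" "c = Gam (J s) (K s) (h s)" by auto
  show "P c" unfolding s(2) by (rule P[OF valid_s_node[OF v s(1)]]) (use Del.IH s(1) in auto)
 qed
qed

lemma pmx_range:
 assumes "valid T" "\<And>w S. 0 <= s w S & s w S <= 1"
 shows "0 <= pmx \<theta> s T & pmx \<theta> s T <= 1" using assms(1)
proof (induction T rule: valid_chs_induct)
 case (step T)
 consider "wt T < 2" | "2 <= wt T" "\<theta> <= wt T" | "2 <= wt T" "wt T < \<theta>" by linarith
 thus ?case
 proof cases
  case 1
  thus ?thesis using pmx_leaf[OF step.hyps] by simp
 next
  case 2
  thus ?thesis using pmx_stop assms(2) by simp
 next
  case 3
  show ?thesis
  proof (cases "pmx \<theta> s T = 0")
   case False
   obtain c where c: "c : chs T" "pmx \<theta> s T = pmx \<theta> s c / rm (wt T)" using pmx_attained[OF step.hyps 3 False] by blast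
   have "0 <= pmx \<theta> s c" "pmx \<theta> s c <= 1" using step.IH[OF c(1)] by auto
   moreover have "32 <= rm (wt T)" using real_mseq_ge 3 by blast
   ultimately show ?thesis unfolding c(2) by (simp add: field_simps)
  qed simp
 qed
qed

text \<open>Smaller thresholds stop earlier: the factors between the thresholds are at most \<open>1 / m\<^sub>\<theta>\<close>.\<close>

lemma pmx_threshold:
 assumes "valid T" and s: "\<And>w S. 0 <= s w S & s w S <= 1" and \<theta>: "2 <= \<theta>" "\<theta> <= \<theta>'"
 shows "pmx \<theta>' s T <= max (pmx \<theta> s T) (1 / rm \<theta>)" using assms(1)
proof (induction T rule: valid_chs_induct)
 case (step T)
 have r: "0 <= pmx \<eta> s U & pmx \<eta> s U <= 1" if "valid U" for \<eta> U by (rule pmx_range[OF that]) (rule s)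
 consider "wt T < 2" | "2 <= wt T" "\<theta>' <= wt T" | "2 <= wt T" "wt T < \<theta>'" "pmx \<theta>' s T = 0" |
  "2 <= wt T" "wt T < \<theta>'" "pmx \<theta>' s T ~= 0" by linarith
 thus ?case
 proof cases
  case 1
  thus ?thesis using pmx_leaf[OF step.hyps] by simp
 next
  case 2
  thus ?thesis using pmx_stop \<theta> by simp
 next
  case 3
  have "0 <= pmx \<theta> s T" using r[OF step.hyps] by blast
  thus ?thesis unfolding 3(3) by (simp add: le_max_iff_disj)
 next
  case 4
  obtain c where c: "c : chs T" "pmx \<theta>' s T = pmx \<theta>' s c / rm (wt T)" using pmx_attained[OF step.hyps 4] by blast
  have m: "32 <= rm (wt T)" using real_mseq_ge 4 by blast
  show ?thesis
  proof (cases "wt T < \<theta>")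
   case True
   have "pmx \<theta>' s T <= max (pmx \<theta> s c) (1 / rm \<theta>) / rm (wt T)" unfolding c(2) using step.IH[OF c(1)] m by (intro divide_right_mono) auto
   also have "... = max (pmx \<theta> s c / rm (wt T)) (1 / rm \<theta> / rm (wt T))" using m by (simp add: max_divide_distrib_right)
   also have "... <= max (pmx \<theta> s T) (1 / rm \<theta>)"
   proof (rule max.mono)
    show "pmx \<theta> s c / rm (wt T) <= pmx \<theta> s T" by (rule pmx_child_le[OF step.hyps True c(1)])
    have "1 / rm \<theta> / rm (wt T) <= 1 / rm \<theta> / 1" using m by (intro divide_left_mono) auto
    thus "1 / rm \<theta> / rm (wt T) <= 1 / rm \<theta>" by simp
   qed
   finally show ?thesis .
  next
   case False
   have "0 <= pmx \<theta>' s c" "pmx \<theta>' s c <= 1" using r[OF chs_valid[OF step.hyps c(1)], of \<theta>'] by auto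
   hence "pmx \<theta>' s T <= 1 / rm (wt T)" unfolding c(2) using m by (intro divide_right_mono) auto
   also have "... <= 1 / rm \<theta>" using mseq_mono[of \<theta> "wt T"] False mseq_pos[of \<theta>] \<theta> by (intro divide_left_mono) auto
   finally show ?thesis by simp
  qed
 qed
qed

text \<open>A coordinate of the support is carried by a single branch, since siblings are disjoint.
  The factor \<open>x\<close> is the product of the reciprocal weights along it; each is at most
  1/32, so \<open>L\<close> steps give much less than 2^(-L), and the same product bounds the share
  of the branch in \<open>pmx\<close>.\<close>

lemma Fr_path:
 assumes "valid T" "n : tsupp T" and s: "\<And>w S. 0 <= s w S & s w S <= 1"
 shows "EX t:Fr (below q) L T. EX x. n : tsupp t & eval T n = x * eval t n & 0 <= x & x <= 1 &
  (x <= (1/2)^L \<or> below q t = {}) & x * pmx q s t <= pmx q s T" using assms(1,2)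
proof (induction L arbitrary: T)
 case 0
 thus ?case by (intro bexI[of _ T] exI[of _ 1]) auto
next
 case (Suc L)
 show ?case
 proof (cases "below q T = {}")
  case True
  thus ?thesis using Suc.prems by (intro bexI[of _ T] exI[of _ 1]) auto
 next
  case False
  hence b: "below q T = chs T" "wt T < q" unfolding below_def by (auto split: if_splits)
  have w: "2 <= wt T" using wt_pos[OF Suc.prems(1)] False b by (cases T) auto
  then obtain c where c: "c : chs T" "n : tsupp c" using chs_supp Suc.prems by blast
  have m: "32 <= rm (wt T)" using real_mseq_ge w by blast
  obtain t x where t: "t : Fr (below q) L c" "n : tsupp t" "eval c n = x * eval t n" "0 <= x" "x <= 1"
   "x <= (1/2)^L \<or> below q t = {}" "x * pmx q s t <= pmx q s c" using Suc.IH[OF chs_valid[OF Suc.prems(1) c(1)] c(2)] by blast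
  let ?x = "x / rm (wt T)"
  have "eval T n = ?x * eval t n" using chs_eval_child[OF Suc.prems(1) c] t(3) by simp
  moreover have x2: "?x <= x / 2" using m t(4) by (intro divide_left_mono) auto
  moreover have "?x <= 1" using x2 t(4,5) by linarith
  moreover have "?x * pmx q s t <= pmx q s T"
  proof -
   have "?x * pmx q s t = x * pmx q s t / rm (wt T)" by simp
   also have "... <= pmx q s c / rm (wt T)" using t(7) by (intro divide_right_mono) auto
   also have "... <= pmx q s T" by (rule pmx_child_le[OF Suc.prems(1) b(2) c(1)])
   finally show ?thesis .
  qed
  moreover have "t : Fr (below q) (Suc L) T" using t(1) c(1) b False by auto
  moreover have "0 <= ?x" using t(4) by simp
  ultimately show ?thesis using t by (intro bexI[of _ t] exI[of _ ?x] conjI) auto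
 qed
qed

text \<open>The nodes meeting \<open>R\<close> have distinct starting points below \<open>p\<close>,
  so there are at most \<open>p\<close> of them, while \<open>R\<close> lies to the right of
  \<open>p\<close>. Their restrictions to \<open>R\<close> therefore form an S_1-allowable family,
  and one node of weight 2 dominates each of them up to the factor m_2 = 32.\<close>

lemma S1_average:
 assumes F: "finite F" "\<And>t. t : F ==> valid t" "\<And>t t'. t : F ==> t' : F ==> t ~= t' ==> tsupp t \<inter> tsupp t' = {}"
  and R: "\<And>n. n : R ==> p <= n" and st: "\<And>t. t : F ==> tsupp t \<inter> R ~= {} ==> Min (tsupp t) < p"
 shows "EX T. valid T & tsupp T \<subseteq> R & (ALL t:F. ALL n:R. eval t n <= 32 * eval T n)"
proof -
 define F' where "F' = {t\<in>F. tsupp t \<inter> R ~= {}}"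
 have fin: "finite F'" unfolding F'_def using F(1) by simp
 obtain h where h: "bij_betw h {1..card F'} F'" using ex_bij_betw_nat_finite_1[OF fin] by blast
 have hF: "h i : F'" if "i : {1..card F'}" for i using h that bij_betwE by blast
 have "ALL i:{1..card F'}. EX T'. valid T' & eval T' = proj R (eval (h i))" using valid_proj F(2) hF unfolding F'_def by blast
 then obtain c where c: "\<And>i. i : {1..card F'} ==> valid (c i)" "\<And>i. i : {1..card F'} ==> eval (c i) = proj R (eval (h i))" by metis
 have sc: "tsupp (c i) = tsupp (h i) \<inter> R" if "i : {1..card F'}" for i using c(2)[OF that] by (simp add: supp_proj)
 let ?M = "%t. Min (tsupp t)"
 have card: "card F' <= p"
 proof -
  have "inj_on ?M F'"
  proof (rule inj_on_subset[OF Min_inj_disjoint[of F tsupp]])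
   show "disjoint_family_on tsupp F" using F(3) unfolding disjoint_family_on_def by blast
  qed (use F(2) valid_finite F'_def in auto)
  hence "card F' = card (?M ` F')" by (simp add: card_image)
  also have "... <= card {..<p}" by (rule card_mono) (use st F'_def in auto)
  finally show ?thesis by simp
 qed
 have "allowable (SN (2 * 1)) {1..card F'} (%i. tsupp (c i))" unfolding allowable_def
 proof (intro conjI ballI)
  show "disjoint_family_on (%i. tsupp (c i)) {1..card F'}" unfolding disjoint_family_on_def
  proof (intro ballI impI)
   fix i i' assume i: "i : {1..card F'}" "i' : {1..card F'}" "i ~= i'"
   hence "h i ~= h i'" using h unfolding bij_betw_def inj_on_def by blast
   hence "tsupp (h i) \<inter> tsupp (h i') = {}" using F(3) hF i F'_def by blast
   thus "tsupp (c i) \<inter> tsupp (c i') = {}" using sc i by blast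
  qed
  let ?X = "min_set {1..card F'} (%i. tsupp (c i))"
  have fX: "finite ?X" unfolding min_set_eq by simp
  have "card ?X <= card {i\<in>{1..card F'}. tsupp (c i) ~= {}}" unfolding min_set_eq by (rule card_image_le) simp
  also have "... <= card {1..card F'}" by (rule card_mono) auto
  finally have cX: "card ?X <= p" using card by simp
  have "p <= t" if "t : ?X" for t
  proof -
   obtain i where i: "i : {1..card F'}" "tsupp (c i) ~= {}" "t = Min (tsupp (c i))" using \<open>t : ?X\<close> unfolding min_set_def by blast
   hence "t : tsupp (c i)" using valid_finite[OF c(1)] by (metis Min_in)
   thus "p <= t" using sc[OF i(1)] R by blast
  qed
  hence "?X : schreier (Suc 0)" using fX cX by (intro schreier_1I) force+
  moreover have "schreier (Suc 0) \<subseteq> SN (2 * 1)" by (rule schreier_mono) (use nseq_pos[of 2] in simp)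
  ultimately show "?X : SN (2 * 1)" by blast
 next
  show "finite (tsupp (c i))" if "i : {1..card F'}" for i by (rule valid_finite[OF c(1)[OF that]])
 qed simp
 hence v: "valid (Gam 1 {1..card F'} c)" using c(1) by (intro valid.Gam) auto
 have e: "eval (Gam 1 {1..card F'} c) n = (SUM i:{1..card F'}. eval (c i) n) / 32" for n using mseq_Suc[of 1] by (simp add: lincomb_def sum_divide_distrib numeral_2_eq_2)
 have "eval t n <= 32 * eval (Gam 1 {1..card F'} c) n" if t: "t : F" and n: "n : R" for t n
 proof (cases "t : F'")
  case True
  hence "t : h ` {1..card F'}" using bij_betw_imp_surj_on[OF h] by simp
  then obtain i where i: "i : {1..card F'}" "t = h i" by (rule imageE)
  have "eval (c i) n <= (SUM i:{1..card F'}. eval (c i) n)" by (rule member_le_sum[OF i(1)]) (auto simp: eval_nonneg)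
  moreover have "eval (c i) n = eval t n" using c(2)[OF i(1)] i(2) n by (simp add: proj_def)
  ultimately show ?thesis unfolding e by simp
 next
  case False
  hence "eval t n = 0" using t n unfolding F'_def by (auto simp: supp_def)
  thus ?thesis using eval_nonneg[of "Gam 1 {1..card F'} c" n] by (simp del: eval.simps)
 qed
 moreover have "tsupp (Gam 1 {1..card F'} c) \<subseteq> R" using supp_lincomb[of "{1..card F'}" "%_. 1 / rm (2 * 1)" "%i. eval (c i)"] sc by auto
 ultimately show ?thesis using v by blast
qed

lemma sum_affine:
 fixes C d :: real
 shows "(SUM n:A. (C * g n + d) * y n) = C * (SUM n:A. g n * y n) + d * (SUM n:A. y n)" by (simp add: sum.distrib sum_distrib_left algebra_simps)

lemma dot_nonneg_mono:
 assumes "\<And>n. 0 <= y n" "\<And>n. n : supp y ==> f n <= g n" shows "dot f y <= dot g y" unfolding dot_def by (rule sum_mono) (use assms in "simp add: mult_right_mono")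

text \<open>
  The estimate on a single cell. A frontier node of weight above the window is bounded coordinatewise;
  a leaf cannot meet the cell, because it would start there.
\<close>

lemma cell_estimate:
 assumes T: "valid T" and y: "y : c00" "\<And>n. 0 <= y n" "supp y \<subseteq> {p..e}" "N y <= 1"
  and st: "\<And>t. t : Fr (below lo) L T ==> tsupp t \<inter> {p..e} ~= {} ==> Min (tsupp t) < p"
  and lo: "2 <= lo" "lo <= hi"
 shows "dot (eval T) y <= 32 * ((1/2)^L + pmx lo (%w S. if w <= hi & S \<inter> {p..e} ~= {} then 1 else 0) T)
   + (SUM n:supp y. y n) / rm (Suc hi)"
proof -
 let ?s = "%w S. if w <= hi & S \<inter> {p..e} ~= {} then 1 else (0::real)"
 let ?P = "pmx lo ?s T" let ?M = "rm (Suc hi)"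
 note FP = Fr_props[OF good_below[of lo] T, of L]
 have sr: "0 <= ?s w S & ?s w S <= 1" for w S by simp
 have P: "0 <= ?P" using pmx_range[OF T, of ?s lo] sr by blast
 have M: "0 < ?M" using mseq_pos[of "Suc hi"] by simp
 obtain G where G: "valid G" "\<And>t n. t : Fr (below lo) L T ==> n : {p..e} ==> eval t n <= 32 * eval G n"
 proof -
  have "EX G. valid G & tsupp G \<subseteq> {p..e} & (ALL t:Fr (below lo) L T. ALL n:{p..e}. eval t n <= 32 * eval G n)"
  proof (rule S1_average)
   show "finite (Fr (below lo) L T)" using FP by blast
   show "t : Fr (below lo) L T ==> valid t" for t using FP by blast
   show "t : Fr (below lo) L T ==> t' : Fr (below lo) L T ==> t ~= t' ==> tsupp t \<inter> tsupp t' = {}" for t t' using FP by blast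
   show "t : Fr (below lo) L T ==> tsupp t \<inter> {p..e} ~= {} ==> Min (tsupp t) < p" for t by (rule st)
  qed simp
  thus ?thesis using that by blast
 qed
 have pt: "eval T n <= 32 * ((1/2)^L + ?P) * eval G n + 1 / ?M" if n: "n : {p..e}" for n
 proof (cases "n : tsupp T")
  case False
  hence "eval T n = 0" by (simp add: supp_def)
  thus ?thesis using P M eval_nonneg[of G n] by (simp add: add_nonneg_nonneg)
 next
  case True
  obtain t x where t: "t : Fr (below lo) L T" "n : tsupp t" "eval T n = x * eval t n" "0 <= x" "x <= 1"
   "x <= (1/2)^L \<or> below lo t = {}" "x * pmx lo ?s t <= ?P" using Fr_path[OF T True, of ?s lo L] sr by blast
  have vt: "valid t" using FP t(1) by blast
  have G': "eval t n <= 32 * eval G n" by (rule G(2)[OF t(1) n])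
  have nl: "2 <= wt t"
  proof (rule ccontr)
   assume "\<not> 2 <= wt t"
   then obtain k where k: "t = Leaf k" using wt_pos[OF vt] by metis
   hence "tsupp t = {k}" by (auto simp: supp_def indicator_def)
   hence "k = n" "Min (tsupp t) = k" using t(2) by auto
   thus False using st[OF t(1)] \<open>tsupp t = {k}\<close> n by auto
  qed
  have G0: "0 <= eval G n" by (rule eval_nonneg)
  \<comment> \<open>Either the branch is long, or it stopped at a node of weight at least
    \<open>lo\<close>, lying in the window or above it. Leaves are excluded, and a node of smaller
    weight with a nonempty support has children.\<close>
  consider "x <= (1/2)^L" | "lo <= wt t" "wt t <= hi" | "hi < wt t"
  proof -
   have "lo <= wt t" if "below lo t = {}"
   proof (rule ccontr)
    assume "\<not> lo <= wt t"
    hence "chs t = {}" using that by (simp add: below_def)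
    hence "tsupp t = {}" using chs_supp[OF vt nl] by simp
    thus False using t(2) by simp
   qed
   thus ?thesis using t(6) that(1) that(2) that(3) by (meson not_le)
  qed
  thus ?thesis
  proof cases
   case 1
   have "x * eval t n <= (1/2)^L * (32 * eval G n)" using 1 G' t(4) eval_nonneg by (intro mult_mono) auto
   also have "... <= 32 * ((1/2)^L + ?P) * eval G n" using P G0 by (simp add: algebra_simps)
   finally show ?thesis using t(3) M by (simp add: add_increasing2)
  next
   case 2
   hence "pmx lo ?s t = 1" using pmx_stop[OF nl 2(1), of ?s] t(2) n by auto
   hence "x <= ?P" using t(7) by simp
   hence "x * eval t n <= ?P * (32 * eval G n)" using G' t(4) eval_nonneg P by (intro mult_mono) auto
   also have "... <= 32 * ((1/2)^L + ?P) * eval G n" using G0 by (simp add: algebra_simps)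
   finally show ?thesis using t(3) M by (simp add: add_increasing2)
  next
   case 3
   obtain c where c: "c : chs t" "n : tsupp c" using chs_supp[OF vt nl] t(2) by blast
   have "eval t n = eval c n / rm (wt t)" by (rule chs_eval_child[OF vt c])
   also have "... <= 1 / rm (wt t)" using eval_le_1[OF chs_valid[OF vt c(1)]] by (intro divide_right_mono) auto
   also have "... <= 1 / ?M" using mseq_mono[of "Suc hi" "wt t"] 3 M by (intro divide_left_mono) auto
   finally have "x * eval t n <= 1 * (1 / ?M)" using t(4,5) eval_nonneg by (intro mult_mono) auto
   moreover have "0 <= 32 * ((1/2)^L + ?P) * eval G n" using P G0 by simp
   ultimately show ?thesis using t(3) by simp
  qed
 qed
 let ?C = "32 * ((1/2)^L + ?P)"
 have "dot (eval T) y <= (SUM n:supp y. (?C * eval G n + 1 / ?M) * y n)" unfolding dot_def by (rule sum_mono) (use pt y in "intro mult_right_mono, auto")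
 also have "... = ?C * dot (eval G) y + (SUM n:supp y. y n) / ?M" unfolding dot_def sum_affine by simp
 also have "... <= ?C * 1 + (SUM n:supp y. y n) / ?M" using N_tree_upper[OF G(1), of y] y(4) P by (intro add_right_mono mult_left_mono) auto
 finally show ?thesis by simp
qed

section \<open>Windows of weights and hits of a single weight\<close>

lemma pmx_pos_up:
 assumes "valid T" "0 < pmx \<theta> s T" and s: "\<And>w S. 0 < s w S ==> Q S"
  and up: "\<And>S S'. Q S ==> S \<subseteq> S' ==> finite S' ==> Q S'"
 shows "Q (tsupp T)" using assms(1,2)
proof (induction T rule: valid_chs_induct)
 case (step T)
 consider "wt T < 2" | "2 <= wt T" "\<theta> <= wt T" | "2 <= wt T" "wt T < \<theta>" by linarith
 thus ?case
 proof cases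
  case 1
  thus ?thesis using pmx_leaf[OF step.hyps] step.prems by simp
 next
  case 2
  thus ?thesis using pmx_stop s step.prems by metis
 next
  case 3
  then obtain c where c: "c : chs T" "0 < pmx \<theta> s c" using pmx_attained[OF step.hyps 3] step.prems by force
  show ?thesis by (rule up[OF step.IH[OF c] chs_sub[OF step.hyps c(1)] valid_finite[OF step.hyps]])
 qed
qed

text \<open>Scores for \<open>pmx\<close>. With the threshold \<open>lo\<close> the score
  \<open>win hi R\<close> detects branches whose stopping node has its weight in the window
  \<open>{lo..hi}\<close> and meets \<open>R\<close>. The score \<open>hit r R p\<close> asks for
  the exact weight \<open>r\<close> and a start before \<open>p\<close>; a replacement supported
  from \<open>p\<close> on then starts later than the node it replaces.\<close>

definition win :: "nat => nat set => nat => nat set => real" where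
 "win hi R = (%w S. if w <= hi & S \<inter> R ~= {} then 1 else 0)"

definition hit :: "nat => nat set => nat => nat => nat set => real" where
 "hit r R p = (%w S. if w = r & S \<inter> R ~= {} & Min S < p then 1 else 0)"

lemma win_range: "0 <= win hi R w S & win hi R w S <= 1" by (simp add: win_def)
lemma hit_range: "0 <= hit r R p w S & hit r R p w S <= 1" by (simp add: hit_def)

lemma win_pos: "valid T ==> 0 < pmx \<theta> (win hi R) T ==> tsupp T \<inter> R ~= {}" by (rule pmx_pos_up[where Q = "%S. S \<inter> R ~= {}"]) (auto simp: win_def split: if_splits)

lemma hit_pos: "valid T ==> 0 < pmx \<theta> (hit r R p) T ==> tsupp T \<inter> R ~= {} & Min (tsupp T) < p"
proof (erule pmx_pos_up[where Q = "%S. S \<inter> R ~= {} & Min S < p"], assumption)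
 show "\<And>w S. 0 < hit r R p w S ==> S \<inter> R ~= {} & Min S < p" by (auto simp: hit_def split: if_splits)
 fix S S' :: "nat set" assume h: "S \<inter> R ~= {} & Min S < p" "S \<subseteq> S'" "finite S'"
 hence "Min S' <= Min S" by (intro Min_antimono) auto
 thus "S' \<inter> R ~= {} & Min S' < p" using h by auto
qed

lemma pmx_le_inv: 
 assumes "valid T" "2 <= wt T" "wt T < \<theta>" "\<And>w S. 0 <= s w S & s w S <= 1"
 shows "pmx \<theta> s T <= 1 / rm (wt T)"
proof (cases "pmx \<theta> s T = 0")
 case False
 then obtain c where c: "c : chs T" "pmx \<theta> s T = pmx \<theta> s c / rm (wt T)" using pmx_attained[OF assms(1-3)] by blast
 have "pmx \<theta> s c <= 1" using pmx_range[OF chs_valid[OF assms(1) c(1)], of s] assms(4) by blast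
 thus ?thesis unfolding c(2) by (intro divide_right_mono) auto
qed simp

lemma inv_mseq_antimono: "1 <= v ==> v <= w ==> 1 / rm w <= 1 / rm v" using mseq_mono[of v w] mseq_pos[of v] by (intro divide_left_mono) auto

text \<open>A branch cannot enter the window directly: \<open>h1\<close> excludes this within the
  frontier of weights below \<open>r\<close>. Hence it first passes a node of weight
  \<open>r\<close>, which costs 1/m_r and is a hit because of \<open>h2\<close>, or a node of larger
  weight, which costs 1/m_(r+1), or it survives \<open>L\<close> steps.\<close>

lemma window_to_hit:
 assumes "valid T" and r: "2 <= r" "r < lo"
  and h1: "\<And>t. t : Fr (below r) L T ==> lo <= wt t ==> wt t <= hi ==> tsupp t \<inter> R = {}"
  and h2: "\<And>t. t : Fr (below r) L T ==> tsupp t \<inter> R ~= {} ==> Min (tsupp t) < p"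
 shows "pmx lo (win hi R) T <= max (pmx r (hit r R p) T / rm r) (max (1 / rm (Suc r)) ((1/2)^L))" using assms(1,4,5)
proof (induction L arbitrary: T)
 case 0
 thus ?case using pmx_range[OF 0(1), of "win hi R"] win_range by (simp add: le_max_iff_disj)
next
 case (Suc L)
 let ?p = "pmx lo (win hi R)"
 note T = Suc.prems(1)
 show ?case
 proof (cases "?p T <= 0")
  case True
  have "0 <= 1 / rm (Suc r)" by simp
  hence "?p T <= 1 / rm (Suc r)" using True by linarith
  thus ?thesis by (simp only: le_max_iff_disj) simp
 next
  case False
  have w: "2 <= wt T"
  proof (rule ccontr)
   assume "\<not> 2 <= wt T"
   thus False using pmx_leaf[OF T] False by (metis not_le order_refl)
  qed
  show ?thesis
  proof (cases "wt T < r")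
   case True
   hence wl: "wt T < lo" using r by simp
   obtain c where c: "c : chs T" "?p T = ?p c / rm (wt T)" using pmx_attained[OF T w wl] False by force
   have b: "below r T = chs T" using True by (simp add: below_def)
   have Fr: "Fr (below r) L c \<subseteq> Fr (below r) (Suc L) T" using b c(1) by auto
   have IH: "?p c <= max (pmx r (hit r R p) c / rm r) (max (1 / rm (Suc r)) ((1/2)^L))" by (rule Suc.IH[OF chs_valid[OF T c(1)]]) (use Suc.prems(2,3) Fr in blast)+
   have m: "32 <= rm (wt T)" by (rule real_mseq_ge[OF w])
   have "?p T <= max (pmx r (hit r R p) c / rm r) (max (1 / rm (Suc r)) ((1/2)^L)) / rm (wt T)" unfolding c(2) using IH m by (intro divide_right_mono) auto
   also have "... = max (pmx r (hit r R p) c / rm (wt T) / rm r) (max (1 / rm (Suc r) / rm (wt T)) ((1/2)^L / rm (wt T)))" using m by (simp add: max_divide_distrib_right mult.commute)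
   also have "... <= max (pmx r (hit r R p) T / rm r) (max (1 / rm (Suc r)) ((1/2)^Suc L))"
   proof (intro max.mono)
    show "pmx r (hit r R p) c / rm (wt T) / rm r <= pmx r (hit r R p) T / rm r" by (rule divide_right_mono[OF pmx_child_le[OF T True c(1)]]) simp
    have "1 / rm (Suc r) / rm (wt T) <= 1 / rm (Suc r) / 1" using m by (intro divide_left_mono) auto
    thus "1 / rm (Suc r) / rm (wt T) <= 1 / rm (Suc r)" by simp
    have "(1/2::real)^L / rm (wt T) <= (1/2)^L / 2" using m by (intro divide_left_mono) auto
    thus "(1/2::real)^L / rm (wt T) <= (1/2)^Suc L" by simp
   qed
   finally show ?thesis .
  next
   case ge: False
   hence "below r T = {}" by (simp add: below_def)
   hence F: "T : Fr (below r) (Suc L) T" by simp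
   have touch: "tsupp T \<inter> R ~= {}" by (rule win_pos[OF T, of lo hi]) (use False in simp)
   show ?thesis
   proof (cases "lo <= wt T")
    case True
    have "?p T = win hi R (wt T) (tsupp T)" by (rule pmx_stop[OF w True])
    moreover have "\<not> wt T <= hi" using Suc.prems(2)[OF F True] touch by blast
    ultimately show ?thesis using False by (simp add: win_def)
   next
    case False
    hence le: "?p T <= 1 / rm (wt T)" using pmx_le_inv[OF T w] win_range by simp
    show ?thesis
    proof (cases "wt T = r")
     case True
     have "Min (tsupp T) < p" by (rule Suc.prems(3)[OF F touch])
     hence "pmx r (hit r R p) T = 1" using pmx_stop[OF w, of r "hit r R p"] True touch by (simp add: hit_def)
     thus ?thesis using le True by simp
    next
     case False
     hence "1 / rm (wt T) <= 1 / rm (Suc r)" using ge by (intro inv_mseq_antimono) auto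
     thus ?thesis using le by linarith
    qed
   qed
  qed
 qed
qed

text \<open>The descent below weight \<open>q\<close>, modified at a first slot of weight
  \<open>q\<close>. Pieces of such a slot that end by \<open>P\<close> can be charged inside the
  slot, so the slot is left out of the frontier; a piece crossing \<open>P\<close> cannot, and the
  descent continues through it instead.\<close>

definition xstep :: "nat => nat => tree => tree set" where
 "xstep q P T = (if wt T < q then (case T of
   Del j d J K h A E => if 2 * J 1 = q then (chs T - {Gam (J 1) (K 1) (h 1)}) \<union>
     {h 1 k |k. k : K 1 & tsupp (h 1 k) \<inter> {..P} ~= {} & \<not> tsupp (h 1 k) \<subseteq> {..P}} else chs T
  | _ => chs T) else {})"

lemma slot_exception_unique:
 assumes D: "depc j d J K A E (%s k. tsupp (h s k))" and s: "s : {1..d}"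
  and k: "k : K s" "k' : K s" "tsupp (h s k') \<inter> {..P} ~= {}" "\<not> tsupp (h s k) \<subseteq> {..P}"
 shows "\<not> k < k'"
proof
 assume "k < k'"
 moreover have "successive (K s) (%k. tsupp (h s k))" using depcD(5)[OF D] s unfolding admissible_def by blast
 ultimately have "set_less (tsupp (h s k)) (tsupp (h s k'))" using k unfolding successive_def by blast
 moreover obtain n n' where "n : tsupp (h s k)" "P < n" "n' : tsupp (h s k')" "n' <= P" using k(3,4) by (auto simp: not_le)
 ultimately show False unfolding set_less_def by fastforce
qed

text \<open>A slot has successive pieces, so at most one of them crosses \<open>P\<close>. It takes
  the place of the slot and starts no earlier, hence the starting points are a spread of part of
  those of the ordinary children.\<close>

lemma good_xstep: "good_step (xstep q P) (nseq (q - 1))" unfolding good_step_def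
proof (intro allI impI)
 fix T assume T: "valid T"
 note B = good_below[of q, unfolded good_step_def, rule_format, OF T]
 show "finite (xstep q P T) &
   (ALL c:xstep q P T. valid c & tsupp c \<subseteq> tsupp T) &
   (ALL c:xstep q P T. ALL c':xstep q P T. c ~= c' --> tsupp c \<inter> tsupp c' = {}) &
   (%c. Min (tsupp c)) ` {c\<in>xstep q P T. tsupp c ~= {}} : SN (q - 1)"
 proof (cases "EX j d J K h A E. T = Del j d J K h A E & wt T < q & 2 * J 1 = q")
  case False
  hence "xstep q P T = below q T" by (auto simp: xstep_def below_def split: tree.split)
  thus ?thesis using B by simp
 next
  case True
  then obtain j d J K h A E where D: "T = Del j d J K h A E" "wt T < q" "2 * J 1 = q" by blast
  have v: "\<And>s k. s : {1..d} ==> k : K s ==> valid (h s k)" and dc: "depc j d J K A E (%s k. tsupp (h s k))" using T D(1) by (auto elim: valid.cases)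
  have d1: "1 : {1..d}" using depcD(1)[OF dc] by simp
  let ?s = "Gam (J 1) (K 1) (h 1)"
  have sT: "?s : chs T" unfolding D(1) using d1 by auto
  have vs: "valid ?s" by (rule chs_valid[OF T sT])
  define X where "X = {h 1 k |k. k : K 1 & tsupp (h 1 k) \<inter> {..P} ~= {} & \<not> tsupp (h 1 k) \<subseteq> {..P}}"
  have xs: "xstep q P T = (chs T - {?s}) \<union> X" using D unfolding xstep_def X_def by simp
  have bl: "below q T = chs T" using D(2) by (simp add: below_def)
  have Xc: "X \<subseteq> chs ?s" unfolding X_def by auto
  have Xu: "u = u'" if "u : X" "u' : X" for u u'
  proof -
   from that(1) obtain k where k: "u = h 1 k" "k : K 1" "tsupp (h 1 k) \<inter> {..P} ~= {}" "\<not> tsupp (h 1 k) \<subseteq> {..P}" unfolding X_def by blast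
   from that(2) obtain k' where k': "u' = h 1 k'" "k' : K 1" "tsupp (h 1 k') \<inter> {..P} ~= {}" "\<not> tsupp (h 1 k') \<subseteq> {..P}" unfolding X_def by blast
   have "\<not> k < k'" by (rule slot_exception_unique[OF dc d1 k(2) k'(2,3) k(4)])
   moreover have "\<not> k' < k" by (rule slot_exception_unique[OF dc d1 k'(2) k(2,3) k'(4)])
   ultimately show ?thesis using k k' by simp
  qed
  have "finite X" using finite_subset[OF Xc chs_finite[OF vs]] .
  hence fin: "finite (xstep q P T)" unfolding xs using chs_finite[OF T] by simp
  have Xv: "valid u" "tsupp u \<subseteq> tsupp ?s" "tsupp u ~= {}" if "u : X" for u using chs_valid[OF vs] chs_sub[OF vs] Xc that X_def by blast+
  have sub: "valid c & tsupp c \<subseteq> tsupp T" if "c : xstep q P T" for c using that chs_valid[OF T] chs_sub[OF T] Xv chs_sub[OF T sT] unfolding xs by blast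
  have disj: "tsupp c \<inter> tsupp c' = {}" if c: "c : xstep q P T" "c' : xstep q P T" "c ~= c'" for c c'
  proof -
   have CX: "tsupp c \<inter> tsupp u = {}" if "c : chs T" "c ~= ?s" "u : X" for c u using chs_disjoint[OF T that(1) sT that(2)] Xv(2)[OF that(3)] by blast
   consider "c : chs T" "c' : chs T" | "c : X" "c' : X" | "c : chs T" "c ~= ?s" "c' : X" | "c' : chs T" "c' ~= ?s" "c : X" using c(1,2) unfolding xs by blast
   thus ?thesis
   proof cases
    case 1 thus ?thesis using chs_disjoint[OF T] c(3) by blast
   next
    case 2 thus ?thesis using Xu c(3) by blast
   next
    case 3 thus ?thesis by (rule CX)
   next
    case 4 thus ?thesis using CX[OF 4] by blast
   qed
  qed
  let ?M = "%c. Min (tsupp c)"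
  have bm: "?M ` {c\<in>chs T. tsupp c ~= {}} : SN (q - 1)" using B unfolding bl by blast
  have "?M ` {c\<in>xstep q P T. tsupp c ~= {}} : SN (q - 1)"
  proof (cases "X = {}")
   case True
   thus ?thesis unfolding xs by (intro schreier_subset[OF bm]) auto
  next
   case False
   then obtain u where u: "u : X" "X = {u}" using Xu by blast
   let ?I = "{c\<in>chs T. tsupp c ~= {}}"
   have sI: "?s : ?I" using sT Xv(2,3)[OF u(1)] by blast
   have "(%c. if c = ?s then ?M u else ?M c) ` ?I : SN (q - 1)"
   proof (rule schreier_spread[OF _ _ bm])
    show "inj_on ?M ?I"
    proof (rule Min_inj_disjoint)
     show "disjoint_family_on tsupp (chs T)" using chs_disjoint[OF T] unfolding disjoint_family_on_def by blast
    qed (use chs_valid[OF T] valid_finite in blast)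
    fix c assume "c : ?I"
    have "?M ?s <= ?M u" by (rule Min_antimono[OF Xv(2,3)[OF u(1)] valid_finite[OF vs]])
    thus "?M c <= (if c = ?s then ?M u else ?M c)" by simp
   qed (use chs_finite[OF T] in simp)
   moreover have "?M ` {c\<in>xstep q P T. tsupp c ~= {}} \<subseteq> (%c. if c = ?s then ?M u else ?M c) ` ?I"
   proof
    fix m assume "m : ?M ` {c\<in>xstep q P T. tsupp c ~= {}}"
    then obtain c where c: "c : xstep q P T" "tsupp c ~= {}" "m = ?M c" by blast
    show "m : (%c. if c = ?s then ?M u else ?M c) ` ?I"
    proof (cases "c : chs T & c ~= ?s")
     case True
     thus ?thesis using c by (intro image_eqI[of _ _ c]) auto
    next
     case False
     hence "c = u" using c(1) u(2) unfolding xs by blast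
     thus ?thesis using c sI by (intro image_eqI[of _ _ ?s]) auto
    qed
   qed
   ultimately show ?thesis using schreier_subset by blast
  qed
  thus ?thesis using fin sub disj by blast
 qed
qed

end

section \<open>Charges of cells\<close>

lemma covered_Un: assumes "covered n k X" "covered n k' Y" shows "covered n (k + k') (X \<union> Y)"
proof -
 obtain F where F: "X = (UN i:{1..k}. F i)" "ALL i:{1..k}. F i : schreier n" using assms(1) unfolding covered_def by blast
 obtain G where G: "Y = (UN i:{1..k'}. G i)" "ALL i:{1..k'}. G i : schreier n" using assms(2) unfolding covered_def by blast
 let ?xs = "map F [1..<Suc k] @ map G [1..<Suc k']"
 have s: "set [1..<Suc k] = {1..k}" "set [1..<Suc k'] = {1..k'}" by auto
 have "covered n (length ?xs) (\<Union>(set ?xs))" by (rule covered_Union) (use F(2) G(2) s in "simp add: ball_Un del: upt_Suc")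
 moreover have "\<Union>(set ?xs) = X \<union> Y" unfolding F(1) G(1) set_append set_map s by blast
 moreover have "length ?xs = k + k'" by (simp del: upt_Suc)
 ultimately show ?thesis by metis
qed

lemma covered_UN_sum:
 assumes "finite I" "\<And>i. i : I ==> covered n (k i) (X i)"
 shows "covered n (SUM i:I. k i) (UN i:I. X i)" using assms by (induction I rule: finite_induct) (auto intro: covered_Un)

text \<open>The k^2 sets are grouped into k groups of k, and each of the two unions raises the order
  by one.\<close>

lemma covered_square:
 assumes "covered n (k * k) X" "\<And>t. t : X ==> k <= t" shows "X : schreier (n + 2)"
proof -
 obtain F where F: "X = (UN i:{1..k * k}. F i)" "ALL i:{1..k * k}. F i : schreier n" using assms(1) unfolding covered_def by blast
 let ?B = "%j. {j * k + 1..j * k + k}"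
 have sub: "?B j \<subseteq> {1..k * k}" if "j < k" for j
 proof -
  have "j * k + k = Suc j * k" by simp
  also have "... <= k * k" using that by (intro mult_right_mono) auto
  finally show ?thesis by auto
 qed
 have B: "{1..k * k} = (UN j:{..<k}. ?B j)"
 proof
  show "{1..k * k} \<subseteq> (UN j:{..<k}. ?B j)"
  proof
   fix i assume i: "i : {1..k * k}"
   hence k: "0 < k" by (cases k) auto
   have "(i - 1) div k < k"  by (rule less_mult_imp_div_less) (use i k in "simp, linarith")
   moreover have "i - 1 = (i - 1) div k * k + (i - 1) mod k" "(i - 1) mod k < k" using k by simp_all
   moreover have "i = (i - 1) + 1" using i by simp
   ultimately have "(i - 1) div k < k" "(i - 1) div k * k + 1 <= i" "i <= (i - 1) div k * k + k" by linarith+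
   thus "i : (UN j:{..<k}. ?B j)" by (intro UN_I[of "(i - 1) div k"]) auto
  qed
 qed (use sub in blast)
 have "(UN j:{..<k}. UN i:?B j. F i) : schreier (Suc (Suc n))"
 proof (rule schreier_UN)
  fix j assume "j : {..<k}"
  hence s: "?B j \<subseteq> {1..k * k}" using sub by simp
  show "(UN i:?B j. F i) : schreier (Suc n)"
  proof (rule schreier_UN)
   fix i t assume i: "i : ?B j" "t : F i"
   hence "t : X" unfolding F(1) using s by blast
   thus "k <= t" by (rule assms(2))
  qed (use F(2) s in auto)
  fix t assume "t : (UN i:?B j. F i)"
  hence "t : X" unfolding F(1) using s by blast
  thus "k <= t" by (rule assms(2))
 qed auto
 moreover have "(UN j:{..<k}. UN i:?B j. F i) = X" unfolding F(1) B by blast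
 ultimately show ?thesis by simp
qed

lemma sorted_last_Max:
 fixes xs :: "nat list"
 assumes "sorted xs" "xs ~= []" shows "last xs = Max (set xs)"
proof (rule Max_eqI[symmetric])
 have "y <= last xs" if "y : set xs" for y using assms that by (induction xs) (auto split: if_splits)
 thus "\<And>y. y : set xs ==> y <= last xs" .
qed (use assms in auto)

lemma interval_pred: "interval K ==> k : K ==> Min K < k ==> k - 1 : K"
proof -
 assume h: "interval K" "k : K" "Min K < k"
 then obtain a b where ab: "a <= b" "K = {a..b}" unfolding interval_def by blast
 hence "Min K = a" by (intro Min_eqI) auto
 thus ?thesis using h ab by auto
qed

context cr_space begin

text \<open>If the piece \<open>k\<close> starts before \<open>p\<close>, the intervals of the
  preceding piece of its slot end before \<open>p\<close> as well, so the bound on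
  \<open>rho\<close> applies to condition (4). The first piece of a slot has only one interval. The
  right ends are a spread of the left ends.\<close>

lemma ES_schreier:
 assumes D: "depc j d J K A E S" and sk: "s : {1..d}" "k : K s" and p: "S s k ~= {}" "Min (S s k) < p"
  and \<rho>: "\<And>e. e < p ==> rho l e <= \<rho>"
 shows "(%r. Min (E r)) ` A k : schreier \<rho>" "(%r. Max (E r)) ` A k : schreier \<rho>"
proof -
 have iE: "interval (E r)" if "r : A k" for r using depc_E_succ(2)[OF D] that sk by blast
 have suc: "successive (A k) E" using depc_E_succ(1)[OF D] sk unfolding successive_def by blast
 have fA: "finite (A k)" by (rule depc_finite(3)[OF D sk])
 have minE: "(%r. Min (E r)) ` A k = min_set (A k) E" unfolding min_set_eq using iE interval_finite(2) by (metis (mono_tags, lifting) Collect_cong Collect_mem_eq)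
 show m: "(%r. Min (E r)) ` A k : schreier \<rho>"
 proof (cases "Min (K s) < k")
  case True
  have iK: "interval (K s)" using depcD(3)[OF D] sk(1) by blast
  have k1: "k - 1 : K s" by (rule interval_pred[OF iK sk(2) True])
  have adm: "admissible (schreier (rho l (Max (E (Max (A (k - 1))))))) (A k) E" using depcD(13)[OF D] sk True by blast
  let ?r = "Max (A (k - 1))" let ?e = "Max (E ?r)"
  have "interval (A (k - 1))" using depcD(6)[OF D] sk(1) k1 by blast
  hence r: "?r : A (k - 1)" using interval_finite by (intro Max_in) auto
  have "interval (E ?r)" using depc_E_succ(2)[OF D] r sk(1) k1 by blast
  hence e: "?e : E ?r" using interval_finite by (intro Max_in) auto
  have ms: "Min (S s k) : S s k" using depc_finite(5)[OF D sk] p(1) by (rule Min_in)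
  hence "Min (S s k) : (UN r:A k. E r)" using depcD(12)[OF D] sk by blast
  moreover have "?e : (UN r:A (k - 1). E r)" using r e by blast
  moreover have "k - 1 < k" using True by simp
  ultimately have "?e < Min (S s k)" using depc_order[OF D sk(1) sk(1) k1 sk(2)] by blast
  hence "rho l ?e <= \<rho>" using \<rho> p(2) by simp
  hence "schreier (rho l ?e) \<subseteq> schreier \<rho>" by (rule schreier_mono)
  thus ?thesis using adm unfolding minE admissible_def by blast
 next
  case False
  have "Min (K s) <= k" using depc_finite(1)[OF D sk(1)] sk(2) by simp
  hence "is_singleton (A k)" using depcD(13)[OF D] sk False by (metis nless_le)
  then obtain r where r: "A k = {r}" by (metis is_singletonE)
  have "1 <= Min (E r)" using iE[of r] r unfolding interval_def by auto
  thus ?thesis unfolding r using singleton_in_schreier by simp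
 qed
 show "(%r. Max (E r)) ` A k : schreier \<rho>"
 proof (rule schreier_spread[OF fA _ m])
  have "inj_on (%r. Min (E r)) {r\<in>A k. E r ~= {}}" by (rule Min_inj_disjoint[OF _ successive_disjoint[OF suc]]) (use iE interval_finite in blast)
  moreover have "{r\<in>A k. E r ~= {}} = A k" using iE interval_finite(2) by blast
  ultimately show "inj_on (%r. Min (E r)) (A k)" by simp
  show "Min (E r) <= Max (E r)" if "r : A k" for r using iE[OF that] interval_finite by (metis Max_ge Min_in)
 qed
qed

section \<open>Ends of the intervals of dependent nodes\<close>

primrec ends :: "nat => tree => nat set" where
 "ends p (Leaf n) = {}"
| "ends p (Gam j I c) = {}"
| "ends p (Del j d J K h A E) = (UN s:{1..d}. UN k:{k\<in>K s. supp (eval (h s k)) ~= {} & Min (supp (eval (h s k))) < p}.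
   (%r. Min (E r)) ` A k \<union> (%r. Max (E r)) ` A k)"

text \<open>All interval ends belonging to pieces that start before \<open>p\<close>, collected over
  \<open>L\<close> levels of nodes of weight below \<open>r\<close>. A cell without such an end is
  contained in every one of these intervals that it meets.\<close>

primrec Ends :: "nat => nat => nat => tree => nat set" where
 "Ends r p 0 T = {}"
| "Ends r p (Suc L) T = ends p T \<union> (UN c:below r T. Ends r p L c)"

definition cnt :: "nat => tree => nat" where "cnt p T = card (tsupp T \<inter> {..<p})"

lemma cnt_children:
 assumes "valid T" shows "(SUM c:below r T. cnt p c) <= cnt p T"
proof (cases "below r T = {}")
 case False
 hence b: "below r T = chs T" unfolding below_def by (auto split: if_splits)
 have "(SUM c:chs T. cnt p c) = card (UN c:chs T. tsupp c \<inter> {..<p})" unfolding cnt_def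
  by (rule card_UN_disjoint[symmetric]) (use chs_finite[OF assms] chs_disjoint[OF assms] in auto)
 also have "... <= cnt p T" unfolding cnt_def by (rule card_mono) (use chs_sub[OF assms] in auto)
 finally show ?thesis unfolding b .
qed simp

text \<open>The relevant pieces start at distinct points of the support below \<open>p\<close>,
  which bounds their number by \<open>cnt p T\<close>; each contributes its left and its right
  interval ends.\<close>

lemma ends_covered:
 assumes T: "valid T" and \<rho>: "\<And>e. e < p ==> rho l e <= \<rho>"
 shows "covered \<rho> (2 * cnt p T) (ends p T)"
proof (cases T)
 case (Leaf n)
 have "covered \<rho> 0 {}" by simp
 thus ?thesis unfolding Leaf using covered_le by fastforce
next
 case (Gam j I c)
 have "covered \<rho> 0 {}" by simp
 thus ?thesis unfolding Gam using covered_le by fastforce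
next
 case (Del j d J K h A E)
 have dc: "depc j d J K A E (%s k. tsupp (h s k))" using T Del by (auto elim: valid.cases)
 define P where "P = (SIGMA s:{1..d}. {k\<in>K s. tsupp (h s k) ~= {} & Min (tsupp (h s k)) < p})"
 have fP: "finite P" unfolding P_def using depc_finite(1)[OF dc] by (intro finite_SigmaI) auto
 let ?X = "%(s::nat, k). (%r. Min (E r)) ` A k \<union> (%r. Max (E r)) ` A k"
 have e: "ends p T = (UN z:P. ?X z)" unfolding Del ends.simps P_def by blast
 have "covered \<rho> (SUM z:P. 2) (UN z:P. ?X z)"
 proof (rule covered_UN_sum[OF fP])
  fix z assume "z : P"
  then obtain s k where z: "z = (s, k)" "s : {1..d}" "k : K s" "tsupp (h s k) ~= {}" "Min (tsupp (h s k)) < p" unfolding P_def by blast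
  have "covered \<rho> (1 + 1) ((%r. Min (E r)) ` A k \<union> (%r. Max (E r)) ` A k)" by (intro covered_Un covered_1 ES_schreier[OF dc z(2,3) z(4,5) \<rho>])
  thus "covered \<rho> 2 (?X z)" unfolding z(1) by (simp add: numeral_2_eq_2)
 qed
 moreover have "card P <= cnt p T" unfolding cnt_def
 proof (rule card_inj_on_le)
  let ?m = "%(s, k). Min (tsupp (h s k))"
  have mem: "?m (s, k) : tsupp (h s k)" if "(s, k) : P" for s k using that depc_finite(5)[OF dc] unfolding P_def by (auto intro!: Min_in)
  show "inj_on ?m P"
  proof (rule inj_onI, clarify)
   fix s k s' k' assume h: "(s, k) : P" "(s', k') : P" "Min (tsupp (h s k)) = Min (tsupp (h s' k'))"
   hence i: "s : {1..d}" "k : K s" "s' : {1..d}" "k' : K s'" unfolding P_def by auto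
   let ?n = "Min (tsupp (h s k))"
   have n: "?n : tsupp (h s k)" "?n : tsupp (h s' k')" using mem[OF h(1)] mem[OF h(2)] h(3) by auto
   hence n': "?n : (UN r:A k. E r)" "?n : (UN r:A k'. E r)" using depcD(12)[OF dc] i by blast+
   have "\<not> k < k'" "\<not> k' < k" using depc_order[OF dc i(1,3,2,4) _ n'] depc_order[OF dc i(3,1,4,2) _ n'(2,1)] by auto
   hence kk: "k = k'" by simp
   moreover have "\<not> s < s'" "\<not> s' < s" using depc_K_less[OF dc i(1,3) _ i(2,4)] depc_K_less[OF dc i(3,1) _ i(4,2)] kk by auto
   ultimately show "s = s' & k = k'" by simp
  qed
  show "?m ` P \<subseteq> tsupp T \<inter> {..<p}"
  proof
   fix n assume "n : ?m ` P"
   then obtain s k where z: "(s, k) : P" "n = Min (tsupp (h s k))" by auto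
   hence i: "s : {1..d}" "k : K s" "n < p" unfolding P_def by auto
   have "n : tsupp (h s k)" using mem[OF z(1)] z(2) by simp
   moreover have "tsupp (h s k) \<subseteq> tsupp (Gam (J s) (K s) (h s))" by (rule chs_sub) (use valid_s_node[of j d J K h A E s] T Del i in auto)
   moreover have "tsupp (Gam (J s) (K s) (h s)) \<subseteq> tsupp T" by (rule chs_sub[OF T]) (use Del i in auto)
   ultimately show "n : tsupp T \<inter> {..<p}" using i(3) by blast
  qed
 qed simp
 ultimately show ?thesis unfolding e using covered_le[of \<rho> "SUM z:P. 2" "UN z:P. ?X z" "2 * cnt p T"] by simp
qed

lemma Ends_covered:
 assumes "valid T" and \<rho>: "\<And>e. e < p ==> rho l e <= \<rho>"
 shows "covered \<rho> (2 * L * cnt p T) (Ends r p L T)" using assms(1)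
proof (induction L arbitrary: T)
 case (Suc L)
 have b: "valid c" if "c : below r T" for c using that chs_valid[OF Suc.prems] unfolding below_def by (auto split: if_splits)
 have fb: "finite (below r T)" using chs_finite[OF Suc.prems] unfolding below_def by simp
 have "covered \<rho> (SUM c:below r T. 2 * L * cnt p c) (UN c:below r T. Ends r p L c)" by (rule covered_UN_sum[OF fb]) (rule Suc.IH[OF b])
 from covered_Un[OF ends_covered[OF Suc.prems \<rho>] this]
 have "covered \<rho> (2 * cnt p T + (SUM c:below r T. 2 * L * cnt p c)) (Ends r p (Suc L) T)" by simp
 moreover have "(SUM c:below r T. 2 * L * cnt p c) <= 2 * L * cnt p T" unfolding sum_distrib_left[symmetric] by (rule mult_left_mono[OF cnt_children[OF Suc.prems]]) simp
 ultimately show ?case using covered_le by fastforce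
qed simp

text \<open>Over \<open>L\<close> levels at most 2 L p sets of S_\<rho> occur, which is at most p^2
  of them. Only points from \<open>p\<close> on are kept, so two more Schreier levels absorb this
  number.\<close>

lemma Ends_schreier:
 assumes "valid T" "\<And>e. e < p ==> rho l e <= \<rho>" "2 * L <= p"
 shows "Ends r p L T \<inter> {p..} : schreier (\<rho> + 2)"
proof (rule covered_square)
 have "cnt p T <= card {..<p}" unfolding cnt_def by (rule card_mono) auto
 hence "2 * L * cnt p T <= p * p" using assms(3) by (intro mult_mono) auto
 thus "covered \<rho> (p * p) (Ends r p L T \<inter> {p..})" using covered_mono[OF covered_le[OF Ends_covered[OF assms(1,2)]]] by blast
qed auto

text \<open>
  The charge of a cell \<open>R\<close>, which lies in a block of weight \<open>r\<close> in a block of weight \<open>q\<close> ending at \<open>P\<close>.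
  At a first slot of weight \<open>q\<close> of a dependent node the replacement must stay inside that slot, so
  the charge is then looked for below the slot, and only in pieces which end before \<open>P\<close>.
\<close>

primrec ch :: "nat => nat => nat => nat => nat set => tree => real" where
 "ch q r P p R (Leaf n) = 0"
| "ch q r P p R (Gam j I c) = (if 2 * j < q then Max (insert 0 ((%i. ch q r P p R (c i)) ` I)) / rm (2 * j)
   else hit q R p (2 * j) (supp (eval (Gam j I c))))"
| "ch q r P p R (Del j d J K h A E) = (if 2 * j + 1 < q then Max (insert 0 ((%s.
    (if s = 1 & 2 * J 1 = q then
     Max (insert 0 ((%k. if R \<subseteq> (UN r:A k. E r) & supp (eval (h 1 k)) \<subseteq> {..P} then pmx q (hit r R p) (h 1 k) else 0) ` K 1))
    else if 2 * J s < q then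
     Max (insert 0 ((%k. if R \<subseteq> (UN r:A k. E r) then ch q r P p R (h s k) else 0) ` K s)) / rm (2 * J s)
    else 0)) ` {1..d})) / rm (2 * j + 1)
   else 0)"

text \<open>Such weights yield at most 1/m_(q+1), a fifth power of 1/m_q. The square is what is
  needed: after multiplication by m_q in \<open>macro_estimate\<close> the error is still
  1/m_q.\<close>

lemma above_q:
 assumes "valid T" "2 <= wt T" "q < wt T" "2 <= q" "wt T = r ==> tsupp T \<inter> R = {}"
 shows "pmx r (hit r R p) T <= 1 / (rm q)\<^sup>2"
proof (cases "wt T < r")
 case True
 have "pmx r (hit r R p) T <= 1 / rm (wt T)" by (rule pmx_le_inv[OF assms(1,2) True hit_range])
 also have "... <= 1 / rm (Suc q)" using assms(3) by (intro inv_mseq_antimono) auto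
 also have "... = 1 / rm q ^ 5" using assms(4) by (simp add: mseq_Suc')
 also have "... <= 1 / (rm q)\<^sup>2" using real_mseq_ge[OF assms(4)] by (intro divide_left_mono power_increasing) auto
 finally show ?thesis .
next
 case False
 hence "pmx r (hit r R p) T = hit r R p (wt T) (tsupp T)" using pmx_stop[OF assms(2)] by simp
 also have "... = 0" using assms(5) by (simp add: hit_def)
 finally show ?thesis by simp
qed

text \<open>The induction step for bounds along a branch: division by the weight of the node turns
  the charge of the child into that of the parent, keeps the fixed error, and halves the power of
  1/2.\<close>

lemma child_bound:
 assumes "c1 / m <= A1" "0 <= B1" "0 <= c2" "(2::real) <= m" "x <= max c1 (max B1 c2)"
 shows "x / m <= max A1 (max B1 (c2 / 2))"
proof -
 have "x / m <= max c1 (max B1 c2) / m" using assms by (intro divide_right_mono) auto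
 also have "... = max (c1 / m) (max (B1 / m) (c2 / m))" using assms(4) by (simp add: max_divide_distrib_right)
 also have "... <= max A1 (max B1 (c2 / 2))"
 proof (intro max.mono)
  have "B1 / m <= B1 / 1" using assms(2,4) by (intro divide_left_mono) auto
  thus "B1 / m <= B1" by simp
  show "c2 / m <= c2 / 2" using assms(3,4) by (intro divide_left_mono) auto
 qed (rule assms(1))
 finally show ?thesis .
qed

text \<open>To be used below a piece crossing \<open>P\<close> in a first slot of weight
  \<open>q\<close>. The bound 1/m_q, instead of its square, is enough there because the slot
  supplies the second factor.\<close>

lemma xstep_slot_lemma:
 assumes "valid T" and q: "2 <= q" "q < r"
  and h: "\<And>t. t : Fr (xstep q P) L T ==> wt t = r ==> tsupp t \<inter> R = {}"
 shows "pmx r (hit r R p) T <= max (1 / rm q) ((1/2)^L)" using assms(1,4)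
proof (induction L arbitrary: T)
 case 0
 thus ?case using pmx_range[OF 0(1), of "hit r R p" r] hit_range by (simp add: le_max_iff_disj)
next
 case (Suc L)
 let ?p = "pmx r (hit r R p)" let ?m = "rm q"
 note T = Suc.prems(1)
 have m1: "32 <= ?m" by (rule real_mseq_ge[OF q(1)])
 show ?case
 proof (cases "?p T <= 0")
  case True
  have "0 <= 1 / ?m" by simp
  hence "?p T <= 1 / ?m" using True by linarith
  thus ?thesis by (simp only: le_max_iff_disj) simp
 next
  case False
  have w: "2 <= wt T"
  proof (rule ccontr)
   assume "\<not> 2 <= wt T"
   thus False using pmx_leaf[OF T] False by (metis not_le order_refl)
  qed
  have sq: "1 / ?m\<^sup>2 <= 1 / ?m" using m1 by (intro divide_left_mono) (auto simp: power2_eq_square)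
  show ?thesis
  proof (cases "wt T < q")
   case True
   hence wl: "wt T < r" using q by simp
   obtain c where c: "c : chs T" "?p T = ?p c / rm (wt T)" using pmx_attained[OF T w wl] False by force
   have m: "32 <= rm (wt T)" by (rule real_mseq_ge[OF w])
   show ?thesis
   proof (cases "c : xstep q P T")
    case True
    hence "Fr (xstep q P) L c \<subseteq> Fr (xstep q P) (Suc L) T" by auto
    hence "?p c <= max (1 / ?m) ((1/2)^L)" by (intro Suc.IH[OF chs_valid[OF T c(1)]]) (use Suc.prems(2) in blast)
    hence "?p T <= max 0 (max (1 / ?m) ((1/2)^L / 2))" unfolding c(2) using m by (intro child_bound[of 0]) auto
    thus ?thesis by (simp add: max_def split: if_splits)
   next
    case False
    \<comment> \<open>A child missing from the step can only be the first slot, and that slot has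
      weight \<open>q\<close>.\<close>
    hence "wt c = q" using c(1) True unfolding xstep_def by (auto split: tree.splits if_splits)
    hence "?p c <= 1 / ?m" using pmx_le_inv[OF chs_valid[OF T c(1)], of r "hit r R p"] hit_range q by simp
    moreover have "?p T <= ?p c"
    proof -
     have "0 <= ?p c" using pmx_range[OF chs_valid[OF T c(1)], of "hit r R p" r] hit_range by blast
     hence "?p c / rm (wt T) <= ?p c / 1" using m by (intro divide_left_mono) auto
     thus ?thesis unfolding c(2) by simp
    qed
    ultimately show ?thesis by linarith
   qed
  next
   case False
   hence "xstep q P T = {}" by (simp add: xstep_def)
   hence F: "T : Fr (xstep q P) (Suc L) T" by simp
   show ?thesis
   proof (cases "wt T = q")
    case True
    hence "?p T <= 1 / ?m" using pmx_le_inv[OF T w, of r "hit r R p"] hit_range q by simp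
    thus ?thesis by simp
   next
    case False
    have "?p T <= 1 / ?m\<^sup>2" by (rule above_q[OF T w _ q(1)]) (use False \<open>\<not> wt T < q\<close> Suc.prems(2)[OF F] in auto)
    thus ?thesis using sq by linarith
   qed
  qed
 qed
qed

section \<open>Slots of dependent nodes and the coding function\<close>

lemma successive_subset: "successive Y E ==> X \<subseteq> Y ==> successive X E" unfolding successive_def by blast

lemma seq_listI:
 assumes "finite A" "A ~= {}" "successive A E" "\<And>r. r : A ==> interval (E r)"
 shows "seq_list A E : interval_seqs"
proof -
 let ?xs = "sorted_list_of_set A"
 have "sorted_wrt (%x y. set_less (E x) (E y)) ?xs" by (rule sorted_wrt_mono_rel[OF _ strict_sorted_list_of_set[of A]])
    (use assms(1,3) in "auto simp: successive_def")
 hence "sorted_wrt set_less (map E ?xs)" by (simp add: sorted_wrt_map)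
 thus ?thesis using assms unfolding seq_list_def interval_seqs_def by auto
qed

lemma initial_seq:
 assumes D: "depc j d J K A E S" and s: "s : {1..d}" "s ~= 1"
 shows "seq_list (UN i:{1..s - 1}. UN k:K i. A k) E : interval_seqs"
  "2 * J s = \<sigma> (seq_list (UN i:{1..s - 1}. UN k:K i. A k) E)"
proof -
 let ?X = "UN i:{1..s - 1}. UN k:K i. A k" and ?Y = "UN i:{1..d}. UN k:K i. A k"
 have sub: "?X \<subseteq> ?Y" using s by (intro UN_mono) auto
 have one: "1 : {1..s - 1}" "1 : {1..d}" using s by auto
 obtain k where k: "k : K 1" using depc_finite(2)[OF D one(2)] by blast
 hence "interval (A k)" using depcD(6)[OF D] one(2) by blast
 hence "A k ~= {}" by (rule interval_finite(2))
 hence "?X ~= {}" using k one(1) by blast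
 moreover have "finite ?X" using finite_subset[OF sub depc_finite(4)[OF D]] .
 moreover have "successive ?X E" by (rule successive_subset[OF depc_E_succ(1)[OF D] sub])
 ultimately show "seq_list ?X E : interval_seqs" by (intro seq_listI) (assumption+, rule depc_E_succ(2)[OF D], rule subsetD[OF sub])
 have "s - 1 : {1..<d}" "s - 1 + 1 = s" using s by auto
 thus "2 * J s = \<sigma> (seq_list ?X E)" using depcD(11)[OF D] by metis
qed

lemma slot_L2:
 assumes "depc j d J K A E S" "s : {1..d}" "s ~= 1" shows "J s : L2"
proof -
 have "\<sigma> (seq_list (UN i:{1..s - 1}. UN k:K i. A k) E) : (%i. 2 * i) ` L2" using coding initial_seq(1)[OF assms] unfolding coding_function_def by blast
 thus ?thesis using initial_seq(2)[OF assms] by auto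
qed

text \<open>The growth condition of the coding function concerns sequences of at least two
  intervals. Two earlier slots guarantee two intervals, hence the assumption \<open>3 <= s\<close>.
  All earlier coordinates are then bounded by the order belonging to the weight of the slot.\<close>

lemma slot_growth:
 assumes D: "depc j d J K A E S" and s: "s : {1..d}" "3 <= s" "s' : {1..d}" "s' < s" 
  and x: "k : K s'" "x : (UN r:A k. E r)"
 shows "x <= nseq (2 * J s)"
proof -
 let ?X = "UN i:{1..s - 1}. UN k:K i. A k" and ?Y = "UN i:{1..d}. UN k:K i. A k"
 let ?Es = "seq_list ?X E"
 have s1: "s ~= 1" using s by simp
 note I = initial_seq[OF D s(1) s1]
 have sub: "?X \<subseteq> ?Y" using s by (intro UN_mono) auto
 have fX: "finite ?X" using finite_subset[OF sub depc_finite(4)[OF D]] .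
 have in12: "1 : {1..d}" "2 : {1..d}" "1 : {1..s-1}" "2 : {1..s - 1}" using s by auto
 obtain k1 where k1: "k1 : K 1" using depc_finite(2)[OF D in12(1)] by blast
 obtain k2 where k2: "k2 : K 2" using depc_finite(2)[OF D in12(2)] by blast
 have "k1 < k2" by (rule depc_K_less[OF D in12(1,2) _ k1 k2]) simp
 moreover obtain r1 where r1: "r1 : A k1" using depcD(6)[OF D] k1 in12(1) interval_finite(2) by blast
 moreover obtain r2 where r2: "r2 : A k2" using depcD(6)[OF D] k2 in12(2) interval_finite(2) by blast
 moreover have k12: "k1 : (UN i:{1..d}. K i)" "k2 : (UN i:{1..d}. K i)" using k1 k2 in12 by blast+
 ultimately have "r1 < r2" using depcD(7)[OF D] unfolding successive_def set_less_def by blast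
 have rX: "r1 : ?X" "r2 : ?X" using r1 r2 k1 k2 in12(3,4) by blast+
 have "card {r1, r2} <= card ?X" by (rule card_mono[OF fX]) (use rX in blast)
 hence len: "length ?Es >= 2" using \<open>r1 < r2\<close> by (simp add: seq_list_def)
 have neX: "?X ~= {}" using rX by blast
 have gr: "nseq (\<sigma> ?Es) >= rho l (Max (last ?Es)) + Max (last ?Es)" using coding I(1) len unfolding coding_function_def by blast
 have le: "last ?Es = E (Max ?X)"
 proof -
  have "sorted_list_of_set ?X ~= []" using fX neX by simp
  moreover from this have "last (sorted_list_of_set ?X) = Max ?X" using sorted_last_Max[of "sorted_list_of_set ?X"] fX by simp
  ultimately show ?thesis unfolding seq_list_def using last_map[of "sorted_list_of_set ?X" E] by simp
 qed
 have g: "Max (E (Max ?X)) <= nseq (2 * J s)" using add_leD2[OF gr] unfolding I(2) le .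
 obtain r where r: "r : A k" "x : E r" using x(2) by blast
 have "s' : {1..s - 1}" using s by auto
 hence rX': "r : ?X" using r x(1) by blast
 have M: "Max ?X : ?X" "r <= Max ?X" by (rule Max_in[OF fX neX], rule Max_ge[OF fX rX'])
 have MY: "Max ?X : ?Y" "r : ?Y" by (rule subsetD[OF sub M(1)], rule subsetD[OF sub rX'])
 have iM: "interval (E (Max ?X))" by (rule depc_E_succ(2)[OF D MY(1)])
 have "x <= Max (E (Max ?X))"
 proof (cases "r = Max ?X")
  case True
  thus ?thesis using r(2) interval_finite(1)[OF iM] by simp
 next
  case False
  hence "r < Max ?X" using M(2) by simp
  have "set_less (E r) (E (Max ?X))" by (rule depc_E_succ(1)[OF D, unfolded successive_def, rule_format, OF MY(2,1) \<open>r < Max ?X\<close>])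
  moreover have "Max (E (Max ?X)) : E (Max ?X)" using interval_finite[OF iM] by simp
  ultimately show ?thesis using r(2) unfolding set_less_def by (simp add: less_imp_le)
 qed
 thus ?thesis using g by simp
qed

lemma Max_insert_ge: "finite X ==> x : X ==> (x::real) <= Max (insert 0 X)" by simp

lemma ch_Gam_ge:
 assumes "valid (Gam j I c)" "2 * j < q" "i : I"
 shows "ch q r P p R (c i) / rm (2 * j) <= ch q r P p R (Gam j I c)"
proof -
 have "finite I" using assms(1) by (auto elim: valid.cases)
 thus ?thesis using assms(2,3) by (auto intro!: divide_right_mono Max_insert_ge)
qed

lemma ch_Del_ge:
 assumes D: "valid (Del j d J K h A E)" and w: "2 * j + 1 < q" and s: "s : {1..d}" "k : K s" and unc: "R \<subseteq> (UN r:A k. E r)"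
 shows "s = 1 ==> 2 * J 1 = q ==> tsupp (h 1 k) \<subseteq> {..P} ==>
   pmx q (hit r R p) (h 1 k) / rm (2 * j + 1) <= ch q r P p R (Del j d J K h A E)"
  "2 * J s < q ==> ch q r P p R (h s k) / rm (2 * J s) / rm (2 * j + 1) <= ch q r P p R (Del j d J K h A E)"
proof -
 have dc: "depc j d J K A E (%s k. tsupp (h s k))" using D by (auto elim: valid.cases)
 have fK: "finite (K s)" by (rule depc_finite(1)[OF dc s(1)])
 let ?f = "%s. (if s = 1 & 2 * J 1 = q then
     Max (insert 0 ((%k. if R \<subseteq> (UN r:A k. E r) & tsupp (h 1 k) \<subseteq> {..P} then pmx q (hit r R p) (h 1 k) else 0) ` K 1))
    else if 2 * J s < q then
     Max (insert 0 ((%k. if R \<subseteq> (UN r:A k. E r) then ch q r P p R (h s k) else 0) ` K s)) / rm (2 * J s)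
    else 0)"
 have e: "ch q r P p R (Del j d J K h A E) = Max (insert 0 (?f ` {1..d})) / rm (2 * j + 1)" using w by simp
 have f: "?f s / rm (2 * j + 1) <= ch q r P p R (Del j d J K h A E)" unfolding e by (rule divide_right_mono[OF Max_insert_ge]) (use s in auto)
 { assume a: "s = 1" "2 * J 1 = q" "tsupp (h 1 k) \<subseteq> {..P}"
  have "pmx q (hit r R p) (h 1 k) <= ?f s" using a unc s(2) fK by (auto intro!: Max_insert_ge rev_image_eqI[of k])
  hence "pmx q (hit r R p) (h 1 k) / rm (2 * j + 1) <= ?f s / rm (2 * j + 1)" by (rule divide_right_mono) simp
  thus "pmx q (hit r R p) (h 1 k) / rm (2 * j + 1) <= ch q r P p R (Del j d J K h A E)" using f by linarith }
 { assume a: "2 * J s < q"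
  have "ch q r P p R (h s k) / rm (2 * J s) <= ?f s"
  proof -
   have fs: "?f s = Max (insert 0 ((%k. if R \<subseteq> (UN r:A k. E r) then ch q r P p R (h s k) else 0) ` K s)) / rm (2 * J s)" using a by auto
   moreover have "ch q r P p R (h s k) <= Max (insert 0 ((%k. if R \<subseteq> (UN r:A k. E r) then ch q r P p R (h s k) else 0) ` K s))"
    using unc s(2) fK by (intro Max_insert_ge) (auto intro!: rev_image_eqI[of k])
   ultimately show ?thesis unfolding fs by (intro divide_right_mono) simp_all
  qed
  hence "ch q r P p R (h s k) / rm (2 * J s) / rm (2 * j + 1) <= ?f s / rm (2 * j + 1)" by (rule divide_right_mono) simp
  thus "ch q r P p R (h s k) / rm (2 * J s) / rm (2 * j + 1) <= ch q r P p R (Del j d J K h A E)" using f by linarith }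
qed

text \<open>On its way to a node of weight \<open>r\<close> a branch must leave the frontier of
  \<open>xstep\<close>. It stops there at an even node of weight \<open>q\<close>, which is charged
  1, or at a larger weight, or it descends through \<open>L\<close> steps. Dependent nodes of
  smaller weight pass the charge on because the cell, which contains no interval end, lies in the
  intervals of the piece followed. Passing a node and its slot uses two levels, so the induction on
  \<open>L\<close> is a strong one.\<close>

lemma hit_to_charge:
 assumes "valid T" and q: "q = 2 * j0" "j0 : L1" "q < r" and R: "R = {a..e}" "e <= P"
  and h: "\<And>t. t : Fr (xstep q P) L T ==> wt t = r ==> tsupp t \<inter> R = {}"
  and cut: "Ends r p L T \<inter> R = {}"
 shows "pmx r (hit r R p) T <= max (ch q r P p R T / rm q) (max (1 / (rm q)\<^sup>2) ((1/2)^L))" using assms(1) h cut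
proof (induction L arbitrary: T rule: less_induct)
 case (less L)
 let ?p = "pmx r (hit r R p)" let ?m = "rm q" let ?c = "ch q r P p R"
 note T = less.prems(1)
 have q2: "2 <= q" using q L1_pos[of j0] by simp
 have m1: "32 <= ?m" by (rule real_mseq_ge[OF q2])
 have p01: "0 <= ?p U" "?p U <= 1" if "valid U" for U using pmx_range[OF that, of "hit r R p" r] hit_range by blast+
 show ?case
 proof (cases "?p T <= 0")
  case True
  have "0 <= 1 / ?m\<^sup>2" by simp
  hence "?p T <= 1 / ?m\<^sup>2" using True by linarith
  thus ?thesis by (simp only: le_max_iff_disj) simp
 next
  case False
  hence pos: "0 < ?p T" by simp
  note Q = hit_pos[OF T pos]
  have w: "2 <= wt T"
  proof (rule ccontr)
   assume "\<not> 2 <= wt T"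
   thus False using pmx_leaf[OF T] False by (metis not_le order_refl)
  qed
  show ?thesis
  proof (cases "wt T < q")
   case ge: False
   hence "xstep q P T = {}" by (simp add: xstep_def)
   hence F: "T : Fr (xstep q P) L T" by (simp add: Fr_stop)
   show ?thesis
   proof (cases "wt T = q")
    case True
    then obtain j I c where G: "T = Gam j I c" using q(1) w by (cases T) (auto, presburger)
    have "?p T <= 1 / ?m" using pmx_le_inv[OF T w, of r "hit r R p"] hit_range q True by simp
    moreover have "?c T = 1" using True Q unfolding G by (simp add: hit_def)
    ultimately show ?thesis by simp
   next
    case False
    have "?p T <= 1 / ?m\<^sup>2" by (rule above_q[OF T w _ q2]) (use False ge less.prems(2)[OF F] in auto)
    thus ?thesis by simp
   qed
  next
   case wq: True
   hence wl: "wt T < r" using q by simp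
   have mT: "32 <= rm (wt T)" by (rule real_mseq_ge[OF w])
   have bl: "below r T = chs T" using wl by (simp add: below_def)
   obtain c where c: "c : chs T" "?p T = ?p c / rm (wt T)" "0 < ?p c" using pmx_attained[OF T w wl] False by force
   have vc: "valid c" by (rule chs_valid[OF T c(1)])
   consider "L = 0" | L' where "L = Suc L'" by (cases L) auto
   thus ?thesis
   proof cases
    case 1
    thus ?thesis using p01[OF T] by (simp add: le_max_iff_disj)
   next
    case (2 L')
    have EndsC: "Ends r p L' u \<subseteq> Ends r p L T" if "u : chs T" for u using that bl unfolding 2 by auto
    have FrX: "Fr (xstep q P) L' u \<subseteq> Fr (xstep q P) L T" if "u : xstep q P T" for u using that unfolding 2 by auto
    have pow: "(1/2::real)^L = (1/2)^L' / 2" unfolding 2 by simp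
    have fin: "?thesis" if "?p c <= max x (max (1 / ?m\<^sup>2) ((1/2)^L'))" "x / rm (wt T) <= ?c T / ?m" for x unfolding c(2) pow by (rule child_bound[OF that(2) _ _ _ that(1)]) (use mT in auto)
    show ?thesis
    proof (cases T)
     case (Leaf n)
     thus ?thesis using w by simp
    next
     case (Gam j I g)
     then obtain i where i: "i : I" "c = g i" using c(1) by auto
     have cx: "c : xstep q P T" using c(1) wq Gam by (simp add: xstep_def)
     have IH: "?p c <= max (?c c / ?m) (max (1 / ?m\<^sup>2) ((1/2)^L'))" by (rule less.IH[OF _ vc]) (use 2 less.prems(2) FrX[OF cx] less.prems(3) EndsC[OF c(1)] in auto)
     have "?c c / rm (wt T) <= ?c T" using ch_Gam_ge[of j I g q i r P p R] T wq i unfolding Gam by simp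
     hence "?c c / rm (wt T) / ?m <= ?c T / ?m" by (rule divide_right_mono) simp
     hence "?c c / ?m / rm (wt T) <= ?c T / ?m" by (simp add: mult.commute)
     thus ?thesis by (rule fin[OF IH])
    next
     case (Del j d J K h A E)
     have v: "valid (Del j d J K h A E)" using T Del by simp
     have dc: "depc j d J K A E (%s k. tsupp (h s k))" using v by (auto elim: valid.cases)
     have vh: "valid (h s k)" if "s : {1..d}" "k : K s" for s k using v that by (auto elim: valid.cases)
     have wD: "2 * j + 1 < q" using wq Del by simp
     \<comment> \<open>The interval \<open>E r0\<close> meets \<open>R\<close> but has neither end
       in it, and \<open>R\<close> is an interval; so \<open>E r0\<close> contains
       \<open>R\<close>.\<close>
     have unc: "R \<subseteq> (UN r:A k. E r)" if sk: "s : {1..d}" "k : K s" and u: "0 < ?p (h s k)" for s k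
     proof -
      have Qk: "tsupp (h s k) \<inter> R ~= {}" "Min (tsupp (h s k)) < p" using hit_pos[OF vh[OF sk] u] by auto
      then obtain x where x: "x : tsupp (h s k)" "x : R" by blast
      then obtain r0 where r0: "r0 : A k" "x : E r0" using depcD(12)[OF dc] sk by blast
      have "interval (E r0)" using depc_E_succ(2)[OF dc] r0(1) sk by blast
      then obtain u v where uv: "u <= v" "E r0 = {u..v}" unfolding interval_def by blast
      have mm: "Min (E r0) = u" "Max (E r0) = v" unfolding uv(2) using uv(1) by (auto intro: Min_eqI Max_eqI)
      have "Min (E r0) : ends p T" "Max (E r0) : ends p T" unfolding Del ends.simps using sk Qk(2) x(1) r0(1) by blast+
      hence "u : Ends r p L T" "v : Ends r p L T" unfolding 2 mm by auto
      hence "u \<notin> R" "v \<notin> R" using less.prems(3) by blast+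
      hence "R \<subseteq> {u..v}" using x(2) r0(2) unfolding uv(2) R(1) by auto
      thus ?thesis using r0(1) uv(2) by blast
     qed
     show ?thesis
     proof (cases "2 * J 1 = q & c = Gam (J 1) (K 1) (h 1)")
      case True
      have d1: "1 : {1..d}" using depcD(1)[OF dc] by simp
      have wc: "2 <= wt c" "wt c < r" "wt c = q" using True q2 q by auto
      obtain u where u: "u : chs c" "?p c = ?p u / ?m" "0 < ?p u" using pmx_attained[OF vc wc(1,2)] c(3) wc(3) by force
      then obtain k where k: "k : K 1" "u = h 1 k" using True by auto
      have uk: "R \<subseteq> (UN r:A k. E r)" using unc[OF d1 k(1)] u(3) k(2) by simp
      have vu: "valid u" using vh[OF d1 k(1)] k(2) by simp
      show ?thesis
      proof (cases "tsupp u \<subseteq> {..P}")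
       case True
       \<comment> \<open>Below a first slot the charge is computed with the threshold
         \<open>q\<close> instead of \<open>r\<close>. The loss 1/m_q becomes 1/m_q^2 through the
         weight of the slot.\<close>
       have "?p u <= max (pmx q (hit r R p) u) (1 / ?m)" by (rule pmx_threshold[OF vu hit_range q2]) (use q in simp)
       hence "?p c <= max (pmx q (hit r R p) u) (1 / ?m) / ?m" unfolding u(2) by (intro divide_right_mono) auto
       also have "... = max (pmx q (hit r R p) u / ?m) (1 / ?m\<^sup>2)" using m1 by (simp add: max_divide_distrib_right power2_eq_square)
       also have "... <= max (pmx q (hit r R p) u / ?m) (max (1 / ?m\<^sup>2) ((1/2)^L'))" by simp
       finally have le: "?p c <= max (pmx q (hit r R p) u / ?m) (max (1 / ?m\<^sup>2) ((1/2)^L'))" .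
       have "pmx q (hit r R p) u / rm (2 * j + 1) <= ?c T" using ch_Del_ge(1)[OF v wD d1 k(1) uk] k(2) \<open>2 * J 1 = q & c = Gam (J 1) (K 1) (h 1)\<close> True unfolding Del by blast
       hence "pmx q (hit r R p) u / rm (wt T) / ?m <= ?c T / ?m" unfolding Del by (intro divide_right_mono) auto
       thus ?thesis by (intro fin[OF le]) (simp add: mult.commute)
      next
       case nP: False
       have "tsupp u \<inter> R ~= {}" using hit_pos[OF vu u(3)] by blast
       moreover have "R \<subseteq> {..P}" using R by auto
       ultimately have "tsupp (h 1 k) \<inter> {..P} ~= {}" using k(2) by blast
       hence ux: "u : xstep q P T" unfolding xstep_def using Del True k nP wD by auto
       have "?p u <= max (1 / ?m) ((1/2)^L')" by (rule xstep_slot_lemma[OF vu q2 q(3)]) (use less.prems(2) FrX[OF ux] in blast)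
       hence "?p c <= max (1 / ?m) ((1/2)^L') / ?m" unfolding u(2) by (intro divide_right_mono) auto
       also have "... = max (1 / ?m\<^sup>2) ((1/2)^L' / ?m)" using m1 by (simp add: max_divide_distrib_right power2_eq_square)
       also have "... <= max (1 / ?m\<^sup>2) ((1/2)^L')"
       proof (rule max.mono)
        have "(1/2::real)^L' / ?m <= (1/2)^L' / 1" using m1 by (intro divide_left_mono) auto
        thus "(1/2::real)^L' / ?m <= (1/2)^L'" by simp
       qed simp
       also have "... <= max 0 (max (1 / ?m\<^sup>2) ((1/2)^L'))" by simp
       finally have le: "?p c <= max 0 (max (1 / ?m\<^sup>2) ((1/2)^L'))" .
       have "?p T <= max 0 (max (1 / ?m\<^sup>2) ((1/2)^L' / 2))" unfolding c(2) by (rule child_bound[OF _ _ _ _ le]) (use mT in auto)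
       also have "... = max (1 / ?m\<^sup>2) ((1/2)^L)" unfolding pow by (simp add: max_def)
       finally show ?thesis by simp
      qed
     next
      case nslot: False
      have cx: "c : xstep q P T" using c(1) wq nslot unfolding xstep_def Del by auto
      obtain s where s: "s : {1..d}" "c = Gam (J s) (K s) (h s)" using c(1) Del by auto
      show ?thesis
      proof (cases "2 * J s < q")
       case True
       \<comment> \<open>The slot itself takes a level. If none is left, the weight of the dependent
         node alone already gives the factor 1/2.\<close>
       consider "L' = 0" | L'' where "L' = Suc L''" by (cases L') auto
       thus ?thesis
       proof cases
        case 1
        have "?p T <= 1 / rm (wt T)" unfolding c(2) using p01[OF vc] by (intro divide_right_mono) auto
        also have "... <= 1 / 2" using mT by (intro divide_left_mono) auto
        also have "... = (1/2)^L" unfolding 2 1 by simp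
        finally show ?thesis by simp
       next
        case L'': (2 L'')
        have wc: "2 <= wt c" "wt c < r" using s depcD(3)[OF dc] True q by auto
        have mc: "32 <= rm (wt c)" by (rule real_mseq_ge[OF wc(1)])
        obtain u where u: "u : chs c" "?p c = ?p u / rm (wt c)" "0 < ?p u" using pmx_attained[OF vc wc] c(3) by force
        then obtain k where k: "k : K s" "u = h s k" using s by auto
        have vu: "valid u" using vh[OF s(1) k(1)] k(2) by simp
        have uk: "R \<subseteq> (UN r:A k. E r)" using unc[OF s(1) k(1)] u(3) k(2) by simp
        have ux: "u : xstep q P c" using u(1) True s(2) unfolding xstep_def by simp
        have bc: "below r c = chs c" using wc(2) by (simp add: below_def)
        have F2: "Fr (xstep q P) L'' u \<subseteq> Fr (xstep q P) L' c" using ux unfolding L'' by auto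
        have E2: "Ends r p L'' u \<subseteq> Ends r p L' c" using u(1) bc unfolding L'' by auto
        have IH: "?p u <= max (?c u / ?m) (max (1 / ?m\<^sup>2) ((1/2)^L''))"
        proof (rule less.IH[OF _ vu])
         show "L'' < L" using 2 L'' by simp
         show "tsupp t \<inter> R = {}" if "t : Fr (xstep q P) L'' u" "wt t = r" for t using less.prems(2)[OF subsetD[OF FrX[OF cx] subsetD[OF F2 that(1)]] that(2)] .
         show "Ends r p L'' u \<inter> R = {}" using less.prems(3) EndsC[OF c(1)] E2 by blast
        qed
        have "?p c <= max (?c u / ?m / rm (wt c)) (max (1 / ?m\<^sup>2) ((1/2)^L'' / 2))" unfolding u(2) by (rule child_bound[OF _ _ _ _ IH]) (use mc in auto)
        hence le: "?p c <= max (?c u / ?m / rm (wt c)) (max (1 / ?m\<^sup>2) ((1/2)^L'))" unfolding L'' by simp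
        have "?c u / rm (2 * J s) / rm (2 * j + 1) <= ?c T" using ch_Del_ge(2)[OF v wD s(1) k(1) uk True] k(2) unfolding Del by blast
        hence "?c u / rm (wt c) / rm (wt T) / ?m <= ?c T / ?m" unfolding Del s(2) by (intro divide_right_mono) auto
        thus ?thesis by (intro fin[OF le]) (simp add: mult_ac)
       qed
      next
       case ge: False
       \<comment> \<open>The weight of a slot other than the first lies in 2 L2, whereas
         \<open>q\<close> is in 2 L1. The remaining slots of weight above \<open>q\<close> carry no
         charge, and the induction hypothesis leaves only the error terms.\<close>
       have "2 * J s ~= q"
       proof
        assume a: "2 * J s = q"
        show False
        proof (cases "s = 1")
         case True
         thus False using nslot s(2) a by simp
        next
         case False
         hence "J s : L2" by (rule slot_L2[OF dc s(1)])
         thus False using a q L12(2) by auto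
        qed
       qed
       hence "?c c = 0" using ge s(2) by (simp add: hit_def)
       have IH: "?p c <= max (?c c / ?m) (max (1 / ?m\<^sup>2) ((1/2)^L'))" by (rule less.IH[OF _ vc]) (use 2 less.prems(2) FrX[OF cx] less.prems(3) EndsC[OF c(1)] in auto)
       hence le: "?p c <= max 0 (max (1 / ?m\<^sup>2) ((1/2)^L'))" using \<open>?c c = 0\<close> by simp
       have "?p T <= max 0 (max (1 / ?m\<^sup>2) ((1/2)^L' / 2))" unfolding c(2) by (rule child_bound[OF _ _ _ _ le]) (use mT in auto)
       also have "... = max (1 / ?m\<^sup>2) ((1/2)^L)" unfolding pow by (simp add: max_def)
       finally show ?thesis by simp
      qed
     qed
    qed
   qed
  qed
 qed
qed

end

section \<open>Trees dominating charges\<close>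

lemma covered_spread:
 assumes "finite I" "inj_on \<beta> I" "covered n k (\<beta> ` I)" "\<And>s. s : I ==> \<beta> s <= x s"
 shows "covered n k (x ` I)"
proof -
 obtain F where F: "\<beta> ` I = (UN i:{1..k}. F i)" "ALL i:{1..k}. F i : schreier n" using assms(3) unfolding covered_def by blast
 let ?X = "%i. x ` {s\<in>I. \<beta> s : F i}"
 have "covered n k (UN i:{1..k}. ?X i)"
 proof (rule covered_UN)
  fix i assume i: "i : {1..k}"
  show "?X i : schreier n"
  proof (rule schreier_spread[where \<beta> = \<beta>])
   show "\<beta> ` {s\<in>I. \<beta> s : F i} : schreier n" by (rule schreier_subset[of "F i"]) (use F(2) i in auto)
  qed (use assms in "auto intro: inj_on_subset")
 qed auto
 moreover have "(UN i:{1..k}. ?X i) = x ` I"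
 proof
  show "x ` I \<subseteq> (UN i:{1..k}. ?X i)"
  proof
   fix t assume "t : x ` I"
   then obtain s where s: "s : I" "t = x s" by blast
   hence "\<beta> s : (UN i:{1..k}. F i)" using F(1) by blast
   thus "t : (UN i:{1..k}. ?X i)" using s by blast
  qed
 qed blast
 ultimately show ?thesis by simp
qed

lemma Max_insert_attained:
 assumes "finite A" "0 < Max (insert (0::real) (f ` A))" shows "EX a:A. Max (insert 0 (f ` A)) = f a & 0 < f a"
proof -
 have "Max (insert 0 (f ` A)) : insert 0 (f ` A)" by (rule Max_in) (use assms in auto)
 hence "Max (insert 0 (f ` A)) : f ` A" using assms(2) by auto
 then obtain a where "a : A" "Max (insert 0 (f ` A)) = f a" by (elim imageE)
 thus ?thesis using assms(2) by (intro bexI[of _ a]) simp_all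
qed

context cr_space begin

lemma chs_eval_ge: assumes "valid T" "c : chs T" shows "eval c n / rm (wt T) <= eval T n"
proof (cases "n : tsupp c")
 case True
 thus ?thesis using chs_eval_child[OF assms] by simp
next
 case False
 thus ?thesis using eval_nonneg by (simp add: supp_def)
qed

lemma touch_up:
 assumes T: "valid T" and c: "c : chs T" and h: "tsupp c \<inter> R ~= {} & Min (tsupp c) < p"
 shows "tsupp T \<inter> R ~= {} & Min (tsupp T) < p"
proof -
 have "Min (tsupp T) <= Min (tsupp c)" by (rule Min_antimono[OF chs_sub[OF T c]]) (use h valid_finite[OF T] in auto)
 thus ?thesis using chs_sub[OF T c] h by auto
qed

lemma ch_Gam_attained:
 assumes "finite I" "0 < ch q r P p R (Gam j I c)"
 shows "(2 * j < q & (EX i:I. ch q r P p R (Gam j I c) = ch q r P p R (c i) / rm (2 * j) & 0 < ch q r P p R (c i))) \<or>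
  (2 * j = q & ch q r P p R (Gam j I c) = 1 & tsupp (Gam j I c) \<inter> R ~= {} & Min (tsupp (Gam j I c)) < p)"
proof (cases "2 * j < q")
 case True
 let ?M = "Max (insert 0 ((%i. ch q r P p R (c i)) ` I))"
 have e: "ch q r P p R (Gam j I c) = ?M / rm (2 * j)" using True by simp
 hence "0 < ?M" using assms(2) by (simp only: zero_less_divide_iff) auto
 from Max_insert_attained[OF assms(1) this] obtain i where i: "i : I" "?M = ch q r P p R (c i)" "0 < ch q r P p R (c i)" by blast
 show ?thesis unfolding e i(2) using True i(1,3) by blast
next
 case False
 hence e: "ch q r P p R (Gam j I c) = hit q R p (2 * j) (tsupp (Gam j I c))" by simp
 show ?thesis using assms(2) unfolding e hit_def by (simp only: split: if_splits) auto
qed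

lemma ch_Del_attained:
 assumes D: "depc j d J K A E (%s k. tsupp (h s k))" and pos: "0 < ch q r P p R (Del j d J K h A E)"
 shows "EX s:{1..d}. EX k:K s. R \<subseteq> (UN r:A k. E r) &
   ((s = 1 & 2 * J 1 = q & tsupp (h 1 k) \<subseteq> {..P} & 0 < pmx q (hit r R p) (h 1 k) &
    ch q r P p R (Del j d J K h A E) = pmx q (hit r R p) (h 1 k) / rm (2 * j + 1)) \<or>
   (2 * J s < q & 0 < ch q r P p R (h s k) &
    ch q r P p R (Del j d J K h A E) = ch q r P p R (h s k) / rm (2 * J s) / rm (2 * j + 1)))"
proof -
 let ?f = "%s. (if s = 1 & 2 * J 1 = q then
     Max (insert 0 ((%k. if R \<subseteq> (UN r:A k. E r) & tsupp (h 1 k) \<subseteq> {..P} then pmx q (hit r R p) (h 1 k) else 0) ` K 1))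
    else if 2 * J s < q then
     Max (insert 0 ((%k. if R \<subseteq> (UN r:A k. E r) then ch q r P p R (h s k) else 0) ` K s)) / rm (2 * J s)
    else 0)"
 have w: "2 * j + 1 < q" using pos by (auto split: if_splits)
 have e: "ch q r P p R (Del j d J K h A E) = Max (insert 0 (?f ` {1..d})) / rm (2 * j + 1)" using w by simp
 hence M: "0 < Max (insert 0 (?f ` {1..d}))" using pos by (simp only: zero_less_divide_iff) auto
 have "finite {1..d}" by simp
 from Max_insert_attained[OF this M] obtain s where s: "s : {1..d}" "Max (insert 0 (?f ` {1..d})) = ?f s" "0 < ?f s" by (elim bexE conjE)
 note fK = depc_finite(1)[OF D s(1)]
 show ?thesis
 proof (cases "s = 1 & 2 * J 1 = q")
  case True
  let ?g = "%k. if R \<subseteq> (UN r:A k. E r) & tsupp (h 1 k) \<subseteq> {..P} then pmx q (hit r R p) (h 1 k) else 0"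
  have fs: "?f s = Max (insert 0 (?g ` K 1))" by (rule if_P[OF True])
  have M1: "0 < Max (insert 0 (?g ` K 1))" using s(3) unfolding fs .
  have fK1: "finite (K 1)" using fK True by simp
  from Max_insert_attained[OF fK1 M1] obtain k where k: "k : K 1" "Max (insert 0 (?g ` K 1)) = ?g k" "0 < ?g k" by (elim bexE conjE)
  have c: "R \<subseteq> (UN r:A k. E r) & tsupp (h 1 k) \<subseteq> {..P}"
  proof (rule ccontr)
   assume "\<not> ?thesis"
   hence "?g k = 0" by (rule if_not_P)
   thus False using k(3) by linarith
  qed
  have g: "?g k = pmx q (hit r R p) (h 1 k)" by (rule if_P[OF c])
  have v: "ch q r P p R (Del j d J K h A E) = pmx q (hit r R p) (h 1 k) / rm (2 * j + 1)" unfolding e trans[OF s(2) trans[OF fs trans[OF k(2) g]]] ..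
  have p: "0 < pmx q (hit r R p) (h 1 k)" using k(3) unfolding g .
  show ?thesis by (rule bexI[of _ 1], rule bexI[of _ k], intro conjI disjI1)
    (use True c k(1) s(1) p v in simp_all)
 next
  case False
  let ?g = "%k. if R \<subseteq> (UN r:A k. E r) then ch q r P p R (h s k) else 0"
  have sq: "2 * J s < q" using s(3) unfolding if_not_P[OF False] by (rule contrapos_pp) simp
  have fs: "?f s = Max (insert 0 (?g ` K s)) / rm (2 * J s)" unfolding if_not_P[OF False] by (rule if_P[OF sq])
  have M1: "0 < Max (insert 0 (?g ` K s))" using s(3) unfolding fs by (simp only: zero_less_divide_iff) auto
  from Max_insert_attained[OF fK M1] obtain k where k: "k : K s" "Max (insert 0 (?g ` K s)) = ?g k" "0 < ?g k" by (elim bexE conjE)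
  have c: "R \<subseteq> (UN r:A k. E r)" using k(3) by (rule contrapos_pp) simp
  have g: "?g k = ch q r P p R (h s k)" by (rule if_P[OF c])
  have v: "ch q r P p R (Del j d J K h A E) = ch q r P p R (h s k) / rm (2 * J s) / rm (2 * j + 1)"
  proof -
   have "?f s = ch q r P p R (h s k) / rm (2 * J s)" by (rule trans[OF fs arg_cong[OF trans[OF k(2) g], of "%x. x / rm (2 * J s)"]])
   from trans[OF s(2) this] show ?thesis unfolding e by (rule arg_cong)
  qed
  have p: "0 < ch q r P p R (h s k)" using k(3) unfolding g .
  show ?thesis by (rule bexI[of _ s], rule bexI[of _ k], intro conjI disjI2)
    (rule c, rule sq, rule p, rule v, rule k(1), rule s(1))
 qed
qed

lemma ch_range_pos:
 assumes "valid T" shows "0 < ch q r P p R T ==> tsupp T \<inter> R ~= {} & Min (tsupp T) < p" using assms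
proof (induction T rule: valid.induct)
 case (Leaf n)
 thus ?case by simp
next
 case (Gam j I c)
 have v: "valid (Gam j I c)" using Gam by (intro valid.Gam) auto
 from ch_Gam_attained[OF Gam.hyps(2) Gam.prems] show ?case
 proof
  assume "2 * j < q & (EX i:I. ch q r P p R (Gam j I c) = ch q r P p R (c i) / rm (2 * j) & 0 < ch q r P p R (c i))"
  then obtain i where i: "i : I" "0 < ch q r P p R (c i)" by blast
  have "c i : chs (Gam j I c)" using i(1) by simp
  thus ?thesis by (rule touch_up[OF v _ Gam.IH[OF i]])
 qed blast
next
 case (Del j d K h J A E)
 have v: "valid (Del j d J K h A E)" using Del by (intro valid.Del) auto
 from ch_Del_attained[OF Del.hyps(3) Del.prems] obtain s k where s: "s : {1..d}" "k : K s"
  and pos: "(s = 1 & 0 < pmx q (hit r R p) (h 1 k)) \<or> 0 < ch q r P p R (h s k)" by blast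
 have "tsupp (h s k) \<inter> R ~= {} & Min (tsupp (h s k)) < p" using pos hit_pos[OF Del.hyps(2)[OF s]] Del.IH[OF s] by blast
 from touch_up[OF valid_s_node[OF v s(1)] _ this] have t: "tsupp (Gam (J s) (K s) (h s)) \<inter> R ~= {} & Min (tsupp (Gam (J s) (K s) (h s))) < p" using s(2) by simp
 show ?case by (rule touch_up[OF v _ t]) (use s(1) in simp)
qed

end

text \<open>An abstract skeleton: cells \<open>R v\<close> with positions \<open>p v\<close>, in
  regions \<open>reg v\<close> ending at \<open>P\<close>, of region weights \<open>q\<close> and
  cell weights \<open>r\<close>. Only \<open>X\<close>, giving the coordinates of an almost norming
  functional on each cell, will differ between the two sequences. \<open>kappa_item\<close> provides
  one tree for cells of equal weight \<open>r\<close>; \<open>region_item\<close> provides a family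
  for one region, small enough to be added to a node of weight \<open>q\<close>.\<close>

locale cells = cr_space +
 fixes V :: "'v set" and reg :: "'v => nat" and R :: "'v => nat set" and p :: "'v => nat"
  and q :: "nat => nat" and r :: "'v => nat" and P :: "nat => nat" and X :: "'v => vec"
 assumes R_disj: "\<And>u v. u : V ==> v : V ==> u ~= v ==> R u \<inter> R v = {}"
  and p_le: "\<And>v n. v : V ==> n : R v ==> p v <= n"
  and q_L1: "\<And>i. EX j:L1. q i = 2 * j" and r_L1: "\<And>v. v : V ==> EX j:L1. r v = 2 * j"
  and q_mono: "\<And>i i'. i < i' ==> q i < q i'" and q_less_r: "\<And>v. v : V ==> q (reg v) < r v"
  and P_le: "\<And>v. v : V ==> R v \<subseteq> {..P (reg v)}"
  and P_less: "\<And>v i n. v : V ==> i < reg v ==> n : R v ==> P i < n"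
  and R_large: "\<And>v n. v : V ==> n : R v ==> nseq (q (reg v)) < n"
  and X_nonneg: "\<And>v n. v : V ==> 0 <= X v n"
  and kappa_item: "\<And>w H. H \<subseteq> {v\<in>V. r v = w} ==> finite H ==> EX T. valid T & tsupp T \<subseteq> (UN v:H. R v) &
    (ALL v:H. ALL n:R v. X v n / rm w <= eval T n)"
  and region_item: "\<And>i H. H \<subseteq> {v\<in>V. reg v = i} ==> finite H ==> EX I c. finite (I::nat set) & (ALL k:I. valid (c k)) &
    disjoint_family_on (%k. tsupp (c k)) I & min_set I (%k. tsupp (c k)) : schreier (nseq (q i) - 1) &
    (UN k:I. tsupp (c k)) \<subseteq> (UN v:H. R v) &
    (ALL v:H. EX k:I. ALL n:R v. X v n / rm (r v) <= eval (c k) n)"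
begin

abbreviation ch2 :: "'v => tree => real" where
 "ch2 v T \<equiv> pmx (q (reg v)) (hit (r v) (R v) (p v)) T"

abbreviation ch1 :: "'v => tree => real" where
 "ch1 v T \<equiv> ch (q (reg v)) (r v) (P (reg v)) (p v) (R v) T"

lemma q_ge_2: "2 <= q i" using q_L1[of i] L1_pos by fastforce

lemma q_inj: "q i = q i' ==> i = i'" using q_mono by (metis less_irrefl linorder_neqE_nat)

lemma touched_finite: assumes "finite S" shows "finite {v\<in>V. S \<inter> R v ~= {}}"
proof (rule finite_imageD)
 let ?f = "%v. SOME n. n : S \<inter> R v"
 have f: "?f v : S \<inter> R v" if "S \<inter> R v ~= {}" for v using that by (metis some_in_eq)
 show "finite (?f ` {v\<in>V. S \<inter> R v ~= {}})" by (rule finite_subset[OF _ assms]) (use f in blast)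
 show "inj_on ?f {v\<in>V. S \<inter> R v ~= {}}"
 proof (rule inj_onI)
  fix u v assume h: "u : {v\<in>V. S \<inter> R v ~= {}}" "v : {v\<in>V. S \<inter> R v ~= {}}" "?f u = ?f v"
  have "S \<inter> R u ~= {}" "S \<inter> R v ~= {}" "u : V" "v : V" using h by auto
  hence "?f u : R u" "?f v : R v" using f by auto
  hence "?f u : R u \<inter> R v" using h(3) by (metis IntI)
  thus "u = v" using R_disj[of u v] \<open>u : V\<close> \<open>v : V\<close> by blast
 qed
qed

definition cellset :: "'v set => nat set" where "cellset H = (UN v:H. R v)"

lemma restrict_tree:
 assumes "valid T" "H \<subseteq> V"
 shows "EX T'. valid T' & tsupp T' = tsupp T \<inter> cellset H & (ALL v:H. ALL n:R v. eval T' n = eval T n) & (ALL n. eval T' n <= eval T n)"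
proof -
 obtain T' where "valid T'" "eval T' = proj (cellset H) (eval T)" using valid_proj[OF assms(1)] by blast
 note T' = this
 show ?thesis
 proof (intro exI[of _ T'] conjI ballI allI)
  show "tsupp T' = tsupp T \<inter> cellset H" unfolding T'(2) supp_proj by blast
  show "eval T' n = eval T n" if "v : H" "n : R v" for v n using that unfolding T'(2) proj_def cellset_def by auto
  show "eval T' n <= eval T n" for n unfolding T'(2) proj_def by (simp add: eval_nonneg)
 qed (rule T'(1))
qed

lemma Min_less_cells:
 assumes "S \<subseteq> cellset H" "H \<subseteq> V" "finite S" "S ~= {}" "\<And>v. v : H ==> a < p v" shows "a < Min S"
proof -
 have "Min S : S" using assms by simp
 then obtain v where v: "v : H" "Min S : R v" using assms(1) unfolding cellset_def by blast
 hence "p v <= Min S" using p_le assms(2) by blast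
 thus ?thesis using assms(5)[OF v(1)] by simp
qed

text \<open>
  Below a first slot only cells of one region matter. There a dependent node has at most two relevant
  children, because the weights of the later ones are forced up by the coding function, and so it
  can be replaced by a node of weight 2.
\<close>

lemma relevant_slots:
 assumes dc: "depc j d J K A E (%s k. tsupp (h s k))" and v: "valid (Del j d J K h A E)"
  and s: "s : {1..d}" "s' : {1..d}" "s' < s" "3 <= s"
  and u: "u : V" "0 < ch2 u (Gam (J s) (K s) (h s))" and u': "u' : V" "reg u' = reg u" "0 < ch2 u' (Gam (J s') (K s') (h s'))"
 shows False
proof -
 let ?G = "%s. Gam (J s) (K s) (h s)"
 have "J s : L2" by (rule slot_L2[OF dc s(1)]) (use s in simp)
 hence "2 * J s ~= r u" using r_L1[OF u(1)] L12(2) by auto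
 hence small: "2 * J s < q (reg u)" using u(2) by (auto simp: hit_def split: if_splits)
 have "tsupp (?G s') \<inter> R u' ~= {}" using hit_pos[OF valid_s_node[OF v s(2)] u'(3)] by blast
 then obtain x where x: "x : tsupp (?G s')" "x : R u'" by blast
 have "2 <= wt (?G s')" using depcD(3)[OF dc] s(2) by force
 then obtain c where "c : chs (?G s')" "x : tsupp c" using chs_supp[OF valid_s_node[OF v s(2)]] x(1) by blast
 then obtain k where k: "k : K s'" "x : tsupp (h s' k)" by auto
 hence "x : (UN r:A k. E r)" using depcD(12)[OF dc] s(2) by blast
 hence "x <= nseq (2 * J s)" by (rule slot_growth[OF dc s(1,4,2,3) k(1)])
 also have "... <= nseq (q (reg u'))" by (rule nseq_mono) (use small u' in simp)
 also have "... < x" by (rule R_large[OF u'(1) x(2)])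
 finally show False by simp
qed

definition dominates :: "'v set => ('v => real) => tree => bool" where
 "dominates H \<phi> G \<longleftrightarrow> valid G & tsupp G \<subseteq> cellset H & (ALL v:H. ALL n:R v. \<phi> v * X v n <= eval G n)"

lemma dominatesI:
 assumes "valid G" "tsupp G \<subseteq> cellset H" "\<And>v n. v : H ==> n : R v ==> \<phi> v * X v n <= eval G n"
 shows "dominates H \<phi> G" using assms unfolding dominates_def by blast

lemma dominatesD:
 assumes "dominates H \<phi> G"
 shows "valid G" "tsupp G \<subseteq> cellset H" "v : H ==> n : R v ==> \<phi> v * X v n <= eval G n" using assms unfolding dominates_def by blast+

lemma dominates_restrict:
 assumes "dominates H \<phi> G" "H' \<subseteq> H" "H' \<subseteq> V" shows "EX G. dominates H' \<phi> G"
proof -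
 obtain G' where G': "valid G'" "tsupp G' = tsupp G \<inter> cellset H'" "ALL v:H'. ALL n:R v. eval G' n = eval G n"
  using restrict_tree[OF dominatesD(1)[OF assms(1)] assms(3)] by blast
 have "dominates H' \<phi> G'"
 proof (rule dominatesI[OF G'(1)])
  show "tsupp G' \<subseteq> cellset H'" unfolding G'(2) by blast
  fix v n assume v: "v : H'" "n : R v"
  hence "eval G' n = eval G n" using G'(3) by blast
  thus "\<phi> v * X v n <= eval G' n" using dominatesD(3)[OF assms(1) subsetD[OF assms(2) v(1)] v(2)] by simp
 qed
 thus ?thesis ..
qed

lemma cellset_disjoint: "H \<subseteq> V ==> H' \<subseteq> V ==> H \<inter> H' = {} ==> cellset H \<inter> cellset H' = {}" unfolding cellset_def using R_disj by blast

lemma cellset_mono: "H \<subseteq> H' ==> cellset H \<subseteq> cellset H'" unfolding cellset_def by blast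

abbreviation charged :: "tree => 'v set" where "charged T \<equiv> {v\<in>V. 0 < ch1 v T}"

lemma charged_touch: "valid T ==> v : charged T ==> tsupp T \<inter> R v ~= {} & Min (tsupp T) < p v" by (rule ch_range_pos) auto

lemma charged_finite: assumes "valid T" shows "finite (charged T)" by (rule finite_subset[OF _ touched_finite[OF valid_finite[OF assms]]]) (use charged_touch[OF assms] in blast)

text \<open>
  The regions whose weight is that of the node contribute a \<open>schreier (n - 1)\<close> family of new starting
  points; the old children are a union of \<open>k\<close> such families, where \<open>k\<close> is at most the
  first coordinate of the node and hence smaller than every new starting point.
\<close>

lemma dominates_Gam:
 assumes T: "valid (Gam j I c)" and HV: "H0 \<subseteq> V" "H1 \<subseteq> V" and dis: "H1 \<inter> H0 = {}"
  and sel: "\<And>v. v : H1 ==> sel v : I & tsupp (c (sel v)) \<inter> R v ~= {} & Min (tsupp (c (sel v))) < p v & \<phi> v = \<psi> (sel v) v / rm (2 * j)"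
  and ex: "\<And>i. i : I ==> EX G. dominates {v\<in>H1. sel v = i} (\<psi> i) G"
  and touch: "\<And>v. v : H0 ==> tsupp (Gam j I c) \<inter> R v ~= {} & Min (tsupp (Gam j I c)) < p v"
  and I0: "finite (I0::nat set)" "\<And>k. k : I0 ==> valid (c0 k)" "disjoint_family_on (%k. tsupp (c0 k)) I0"
   "min_set I0 (%k. tsupp (c0 k)) : schreier (nseq (2 * j) - 1)" "(UN k:I0. tsupp (c0 k)) \<subseteq> cellset H0"
   "\<And>v. v : H0 ==> EX k:I0. ALL n:R v. \<phi> v * X v n <= eval (c0 k) n / rm (2 * j)"
 shows "EX G. dominates (H0 \<union> H1) \<phi> G"
proof -
 let ?T = "Gam j I c" let ?m = "rm (2 * j)" let ?S = "%i. {v\<in>H1. sel v = i}"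
 have al: "1 <= j" "finite I" "allowable (SN (2 * j)) I (%k. tsupp (c k))" "\<And>i. i : I ==> valid (c i)" using T by (auto elim: valid.cases)
 have np: "0 < nseq (2 * j)" using al(1) nseq_pos[of "2 * j"] by simp
 have S_V: "?S i \<subseteq> V" for i using HV(2) by blast
 have "ALL i:I. EX G. dominates (?S i) (\<psi> i) G" using ex by blast
 from bchoice[OF this] obtain g where g: "ALL i:I. dominates (?S i) (\<psi> i) (g i)" ..
 have gv: "valid (g i)" "tsupp (g i) \<subseteq> cellset (?S i)" if "i : I" for i using dominatesD(1,2) bspec[OF g that] by blast+
 have mins: "tsupp (c i) ~= {} & Min (tsupp (c i)) < Min (tsupp (g i))" if i: "i : I" "tsupp (g i) ~= {}" for i
 proof -
  have tch: "tsupp (c i) \<inter> R v ~= {} & Min (tsupp (c i)) < p v" if "v : ?S i" for v using sel that by blast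
  have "Min (tsupp (c i)) < Min (tsupp (g i))" by (rule Min_less_cells[OF gv(2)[OF i(1)] S_V valid_finite[OF gv(1)[OF i(1)]] i(2)]) (use tch in blast)
  moreover have "?S i ~= {}" using gv(2)[OF i(1)] i(2) unfolding cellset_def by blast
  ultimately show ?thesis using tch by blast
 qed
 \<comment> \<open>Even indices carry the rebuilt old children, odd indices the new pieces
   \<open>c0\<close>.\<close>
 define J where "J = (%i. 2 * i) ` I \<union> (%i. 2 * i + 1) ` I0"
 define c' where "c' = (%k. if even k then g (k div 2) else c0 (k div 2))"
 have c': "c' (2 * i) = g i" "c' (2 * i + 1) = c0 i" for i unfolding c'_def by simp_all
 have finJ: "finite J" unfolding J_def using al(2) I0(1) by simp
 have JE: "(EX i:I. k = 2 * i) \<or> (EX i:I0. k = 2 * i + 1)" if "k : J" for k using that unfolding J_def by blast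
 have vc': "valid (c' k)" if "k : J" for k using JE[OF that] gv(1) I0(2) c' by metis
 have fc': "finite (tsupp (c' k))" if "k : J" for k by (rule valid_finite[OF vc'[OF that]])
 have sc0: "tsupp (c0 i) \<subseteq> cellset H0" if "i : I0" for i using I0(5) that by blast
 have dis01: "cellset (?S i) \<inter> cellset H0 = {}" for i by (rule cellset_disjoint[OF S_V HV(1)]) (use dis in blast)
 have disS: "cellset (?S i) \<inter> cellset (?S i') = {}" if "i ~= i'" for i i' by (rule cellset_disjoint[OF S_V S_V]) (use that in auto)
 have disj: "disjoint_family_on (%k. tsupp (c' k)) J" unfolding disjoint_family_on_def
 proof (intro ballI impI)
  fix k k' assume k: "k : J" "k' : J" "k ~= k'"
  consider i i' where "i : I" "i' : I" "k = 2 * i" "k' = 2 * i'" | i i' where "i : I" "i' : I0" "k = 2 * i" "k' = 2 * i' + 1"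
   | i i' where "i : I0" "i' : I" "k = 2 * i + 1" "k' = 2 * i'" | i i' where "i : I0" "i' : I0" "k = 2 * i + 1" "k' = 2 * i' + 1" using JE[OF k(1)] JE[OF k(2)] by blast
  thus "tsupp (c' k) \<inter> tsupp (c' k') = {}"
  proof cases
   case 1
   hence "i ~= i'" using k(3) by simp
   thus ?thesis using disS gv(2)[OF 1(1)] gv(2)[OF 1(2)] unfolding 1 c' by blast
  next
   case 2
   thus ?thesis using dis01[of i] gv(2)[OF 2(1)] sc0[OF 2(2)] unfolding 2 c' by blast
  next
   case 3
   thus ?thesis using dis01[of i'] gv(2)[OF 3(2)] sc0[OF 3(1)] unfolding 3 c' by blast
  next
   case 4
   hence "i ~= i'" using k(3) by simp
   thus ?thesis using I0(3) 4(1,2) unfolding 4 c' disjoint_family_on_def by blast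
  qed
 qed
 have ms: "min_set J (%k. tsupp (c' k)) : SN (2 * j)"
 proof -
  let ?n = "nseq (2 * j) - 1"
  have Sn: "nseq (2 * j) = Suc ?n" using np by simp
  have "min_set I (%k. tsupp (c k)) : schreier (Suc ?n)" using al(3) np unfolding allowable_def by simp
  then obtain k where k: "covered ?n k (min_set I (%k. tsupp (c k)))" "ALL t:min_set I (%k. tsupp (c k)). k <= t" unfolding schreier_Suc_iff by blast
  let ?Ig = "{i\<in>I. tsupp (g i) ~= {}}"
  have Igc: "?Ig \<subseteq> {i\<in>I. tsupp (c i) ~= {}}" using mins by blast
  have kle: "k <= Min (tsupp (c i))" if "i : I" "tsupp (c i) ~= {}" for i using k(2) that unfolding min_set_def by blast
  have fin: "finite (tsupp (c i))" if "i : I" for i by (rule valid_finite[OF al(4)[OF that]])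
  have "covered ?n k ((%i. Min (tsupp (g i))) ` ?Ig)"
  proof (rule covered_spread)
   show "inj_on (%i. Min (tsupp (c i))) ?Ig" by (rule inj_on_subset[OF Min_inj_disjoint[OF fin] Igc]) (use al(3) in "simp_all add: allowable_def")
   show "covered ?n k ((%i. Min (tsupp (c i))) ` ?Ig)" by (rule covered_mono[OF k(1)]) (use Igc in "unfold min_set_eq, blast")
   show "Min (tsupp (c i)) <= Min (tsupp (g i))" if "i : ?Ig" for i using mins[of i] that by simp
  qed (use al(2) in simp)
  hence cov: "covered ?n (k + 1) ((%i. Min (tsupp (g i))) ` ?Ig \<union> min_set I0 (%k. tsupp (c0 k)))" by (rule covered_Un[OF _ covered_1[OF I0(4)]])
  \<comment> \<open>The minimum of the old node is at least \<open>k\<close>, and every rebuilt or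
    new piece starts strictly after the minimum of an old child or of the old node. This gains the
    unit needed for one more member of the smaller family.\<close>
  have lower: "k + 1 <= t" if t: "t : (%i. Min (tsupp (g i))) ` ?Ig \<union> min_set I0 (%k. tsupp (c0 k))" for t using t
  proof
   assume "t : (%i. Min (tsupp (g i))) ` ?Ig"
   then obtain i where i: "i : I" "tsupp (g i) ~= {}" "t = Min (tsupp (g i))" by blast
   show ?thesis using mins[OF i(1,2)] kle[OF i(1)] i(3) by linarith
  next
   assume "t : min_set I0 (%k. tsupp (c0 k))"
   then obtain i where i: "i : I0" "tsupp (c0 i) ~= {}" "t = Min (tsupp (c0 i))" unfolding min_set_def by blast
   have "Min (tsupp (c0 i)) : tsupp (c0 i)" by (rule Min_in[OF valid_finite[OF I0(2)[OF i(1)]] i(2)])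
   hence "t : cellset H0" using sc0[OF i(1)] i(3) by blast
   then obtain v where v: "v : H0" "t : R v" unfolding cellset_def by blast
   note tv = touch[OF v(1)]
   have "Min (tsupp ?T) : tsupp ?T" by (rule Min_in[OF valid_finite[OF T]]) (use tv in blast)
   then obtain i where i: "i : I" "Min (tsupp ?T) : tsupp (c i)" using chs_supp[OF T] al(1) by auto
   have "k <= Min (tsupp (c i))" by (rule kle[OF i(1)]) (use i(2) in blast)
   also have "... <= Min (tsupp ?T)" by (rule Min_le[OF fin[OF i(1)] i(2)])
   also have "... < p v" using tv by blast
   also have "... <= t" by (rule p_le[OF subsetD[OF HV(1) v(1)] v(2)])
   finally show ?thesis by simp
  qed
  have in': "(%i. Min (tsupp (g i))) ` ?Ig \<union> min_set I0 (%k. tsupp (c0 k)) : schreier (Suc ?n)" unfolding schreier_Suc_iff using cov lower by blast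
  have "min_set J (%k. tsupp (c' k)) \<subseteq> (%i. Min (tsupp (g i))) ` ?Ig \<union> min_set I0 (%k. tsupp (c0 k))"
  proof
   fix t assume "t : min_set J (%k. tsupp (c' k))"
   then obtain k where k: "k : J" "tsupp (c' k) ~= {}" "t = Min (tsupp (c' k))" unfolding min_set_def by blast
   from JE[OF k(1)] show "t : (%i. Min (tsupp (g i))) ` ?Ig \<union> min_set I0 (%k. tsupp (c0 k))"
   proof
    assume "EX i:I. k = 2 * i"
    then obtain i where i: "i : I" "k = 2 * i" by blast
    show ?thesis using k(2,3) i(1) unfolding i(2) c' by blast
   next
    assume "EX i:I0. k = 2 * i + 1"
    then obtain i where i: "i : I0" "k = 2 * i + 1" by blast
    show ?thesis using k(2,3) i(1) unfolding i(2) c' min_set_def by blast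
   qed
  qed
  thus ?thesis by (subst Sn) (rule schreier_subset[OF in'])
 qed
 have G: "valid (Gam j J c')" by (rule valid.Gam[OF al(1) finJ vc']) (use finJ fc' disj ms in "simp_all add: allowable_def")
 have "dominates (H0 \<union> H1) \<phi> (Gam j J c')"
 proof (rule dominatesI[OF G])
  show "tsupp (Gam j J c') \<subseteq> cellset (H0 \<union> H1)"
  proof
   fix n assume "n : tsupp (Gam j J c')"
   then obtain k where k: "k : J" "n : tsupp (c' k)" using chs_supp[OF G] al(1) by auto
   from JE[OF k(1)] have "n : cellset H1 \<or> n : cellset H0"
   proof
    assume "EX i:I. k = 2 * i"
    then obtain i where i: "i : I" "k = 2 * i" by blast
    have "?S i \<subseteq> H1" by blast
    thus ?thesis using k(2) gv(2)[OF i(1)] cellset_mono unfolding i(2) c' by blast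
   next
    assume "EX i:I0. k = 2 * i + 1"
    then obtain i where i: "i : I0" "k = 2 * i + 1" by blast
    thus ?thesis using k(2) sc0[OF i(1)] unfolding i(2) c' by blast
   qed
   thus "n : cellset (H0 \<union> H1)" unfolding cellset_def by blast
  qed
  have ge: "eval (c' k) n / ?m <= eval (Gam j J c') n" if "k : J" for k n using chs_eval_ge[OF G, of "c' k" n] that by simp
  fix v n assume v: "v : H0 \<union> H1" "n : R v"
  from v(1) show "\<phi> v * X v n <= eval (Gam j J c') n"
  proof
   assume "v : H0"
   then obtain k where k: "k : I0" "ALL n:R v. \<phi> v * X v n <= eval (c0 k) n / ?m" using I0(6) by blast
   have "2 * k + 1 : J" unfolding J_def using k(1) by blast
   from ge[OF this, of n] show ?thesis using bspec[OF k(2) v(2)] unfolding c' by linarith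
  next
   assume v1: "v : H1"
   note s = sel[OF v1]
   have kJ: "2 * sel v : J" and sI: "sel v : I" and vS: "v : ?S (sel v)" and e: "\<phi> v = \<psi> (sel v) v / ?m" unfolding J_def using s v1 by blast+
   have "\<phi> v * X v n = \<psi> (sel v) v * X v n / ?m" unfolding e by simp
   also have "... <= eval (g (sel v)) n / ?m" by (rule divide_right_mono[OF dominatesD(3)[OF bspec[OF g sI] vS v(2)]]) simp
   also have "... <= eval (Gam j J c') n" using ge[OF kJ, of n] unfolding c' .
   finally show ?thesis .
  qed
 qed
 thus ?thesis ..
qed

text \<open>Below a first slot the dependent structure is not needed any more.\<close>

lemma realize_region:
 assumes "valid T"
 shows "EX G. dominates {v\<in>V. reg v = i & 0 < ch2 v T} (%v. ch2 v T / rm (r v)) G" using assms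
proof (induction T rule: valid_chs_induct)
 case (step T)
 note T = step.hyps
 define \<phi> where "\<phi> = (%c v. ch2 v c / rm (r v))"
 define H where "H = {v\<in>V. reg v = i & 0 < ch2 v T}"
 have HV: "H \<subseteq> V" unfolding H_def by blast
 have finH: "finite H" by (rule finite_subset[OF _ touched_finite[OF valid_finite[OF T]]]) (use hit_pos[OF T] H_def in blast)
 have "EX G. dominates H (\<phi> T) G"
 proof (cases "2 <= wt T & wt T < q i")
  case False
  \<comment> \<open>At this node every branch is already scored, and a positive score
    \<open>hit\<close> forces the weight of the node to be \<open>r v\<close>. All charged cells
    thus share one weight and \<open>kappa_item\<close> applies.\<close>
  have one: "ch2 v T <= 1 & r v = wt T & v : V" if v: "v : H" for v
  proof -
   have pos: "0 < ch2 v T" "reg v = i" "v : V" using v unfolding H_def by blast+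
   hence "2 <= wt T" using pmx_leaf[OF T] by (metis not_le less_irrefl)
   hence "ch2 v T = hit (r v) (R v) (p v) (wt T) (tsupp T)" using pmx_stop False pos(2) by simp
   thus ?thesis using pos(1,3) by (simp add: hit_def split: if_splits)
  qed
  hence sub: "H \<subseteq> {v\<in>V. r v = wt T}" by blast
  obtain G where G: "valid G" "tsupp G \<subseteq> (UN v:H. R v)" "ALL v:H. ALL n:R v. X v n / rm (wt T) <= eval G n" using kappa_item[OF sub finH] by blast
  have "dominates H (\<phi> T) G"
  proof (rule dominatesI[OF G(1) G(2)[folded cellset_def]])
   fix v n assume v: "v : H" "n : R v"
   note o = one[OF v(1)]
   have "\<phi> T v * X v n = ch2 v T * (X v n / rm (wt T))" unfolding \<phi>_def using o by simp
   also have "... <= 1 * (X v n / rm (wt T))" using o X_nonneg by (intro mult_right_mono) auto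
   also have "... <= eval G n" using G(3) v by simp
   finally show "\<phi> T v * X v n <= eval G n" .
  qed
  thus ?thesis ..
 next
  case True
  hence w: "2 <= wt T" and wq: "wt T < q i" by auto
  have "ALL v:H. EX c. c : chs T & ch2 v T = ch2 v c / rm (wt T) & ch2 v c > 0"
  proof
   fix v assume v: "v : H"
   have "wt T < q (reg v)" "ch2 v T ~= 0" using v wq unfolding H_def by auto
   thus "EX c. c : chs T & ch2 v T = ch2 v c / rm (wt T) & ch2 v c > 0" by (rule pmx_attained[OF T w, unfolded Bex_def])
  qed
  from bchoice[OF this] obtain sel where ss: "ALL v:H. sel v : chs T & ch2 v T = ch2 v (sel v) / rm (wt T) & ch2 v (sel v) > 0" ..
  have sel: "sel v : chs T" "\<phi> T v = \<phi> (sel v) v / rm (wt T)" "0 < ch2 v (sel v)" if "v : H" for v using bspec[OF ss that] unfolding \<phi>_def by simp_all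
  have touch: "tsupp (sel v) \<inter> R v ~= {} & Min (tsupp (sel v)) < p v" if "v : H" for v by (rule hit_pos[OF chs_valid[OF T sel(1)[OF that]] sel(3)[OF that]])
  have ex: "EX G. dominates {v\<in>H. sel v = c} (\<phi> c) G" if c: "c : chs T" for c
  proof -
   obtain G where G: "dominates {v\<in>V. reg v = i & 0 < ch2 v c} (\<phi> c) G" using step.IH[OF c] unfolding \<phi>_def ..
   have "{v\<in>H. sel v = c} \<subseteq> {v\<in>V. reg v = i & 0 < ch2 v c}" using sel(3) H_def by blast
   from dominates_restrict[OF G this] show ?thesis using HV by blast
  qed
  show ?thesis
  proof (cases T)
   case (Leaf n)
   thus ?thesis using w by simp
  next
   case (Gam j I c)
   have "ALL v:H. EX k. k : I & c k = sel v" using sel(1) Gam by fastforce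
   from bchoice[OF this] obtain f where f: "ALL v:H. f v : I & c (f v) = sel v" ..
   have "EX G. dominates ({} \<union> H) (\<phi> T) G"
   proof (rule dominates_Gam[where sel = f and \<psi> = "%k. \<phi> (c k)" and ?I0.0 = "{}"])
    show "valid (Gam j I c)" using T Gam by simp
    show "f v : I & tsupp (c (f v)) \<inter> R v ~= {} & Min (tsupp (c (f v))) < p v & \<phi> T v = \<phi> (c (f v)) v / rm (2 * j)" if "v : H" for v
     using bspec[OF f that] sel(2)[OF that] touch[OF that] Gam by simp
    fix k assume k: "k : I"
    have "c k : chs T" using Gam k by simp
    then obtain G where G: "dominates {v\<in>H. sel v = c k} (\<phi> (c k)) G" using ex by blast
    have "{v\<in>H. f v = k} \<subseteq> {v\<in>H. sel v = c k}" using f by force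
    from dominates_restrict[OF G this] show "EX G. dominates {v\<in>H. f v = k} (\<phi> (c k)) G" using HV by blast
   qed (use HV in "simp_all add: disjoint_family_on_def min_set_def empty_in_schreier")
   thus ?thesis by simp
  next
   case (Del j d J K h A E)
   have v: "valid (Del j d J K h A E)" using T Del by simp
   have dc: "depc j d J K A E (%s k. tsupp (h s k))" using v by (auto elim: valid.cases)
   let ?n = "%s. Gam (J s) (K s) (h s)"
   have "ALL v:H. EX s. s : {1..d} & ?n s = sel v" using sel(1) Del by fastforce
   from bchoice[OF this] obtain f where f: "ALL v:H. f v : {1..d} & ?n (f v) = sel v" ..
   define I where "I = f ` H"
   have sI: "I \<subseteq> {1..d}" unfolding I_def using f by blast
   have finI: "finite I" unfolding I_def using finH by simp
   have no: False if h: "s : I" "s' : I" "s' < s" "3 <= s" for s s'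
   proof -
    obtain u u' where u: "u : H" "s = f u" "u' : H" "s' = f u'" using h(1,2) unfolding I_def by blast
    have e: "?n s = sel u" "?n s' = sel u'" using bspec[OF f u(1)] bspec[OF f u(3)] u(2,4) by simp_all
    show False
    proof (rule relevant_slots[OF dc v subsetD[OF sI h(1)] subsetD[OF sI h(2)] h(3,4), of u u'])
     show "0 < ch2 u (?n s)" unfolding e(1) by (rule sel(3)[OF u(1)])
     show "0 < ch2 u' (?n s')" unfolding e(2) by (rule sel(3)[OF u(3)])
    qed (use u(1,3) in "simp_all add: H_def")
   qed
   \<comment> \<open>If a slot from the third on is relevant, no slot before it is, so it is then
     the only relevant one; otherwise all relevant slots are among the first two.\<close>
   have card: "card I <= 2"
   proof (cases "EX s:I. 3 <= s")
    case True
    then obtain s where s: "s : I" "3 <= s" by blast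
    have "s' = s" if "s' : I" for s' using no[OF s(1) that _ s(2)] no[OF that s(1)] s(2) by (cases s s' rule: linorder_cases) auto
    hence "I \<subseteq> {s}" by blast
    from card_mono[OF _ this] show ?thesis by simp
   next
    case False
    hence "I \<subseteq> {1..2}" using sI by fastforce
    from card_mono[OF _ this] show ?thesis by simp
   qed
   have "ALL s:I. EX G. dominates {v\<in>H. f v = s} (\<phi> (?n s)) G"
   proof
    fix s assume s: "s : I"
    have "?n s : chs T" using Del subsetD[OF sI s] by simp
    then obtain G where G: "dominates {v\<in>H. sel v = ?n s} (\<phi> (?n s)) G" using ex by blast
    have "{v\<in>H. f v = s} \<subseteq> {v\<in>H. sel v = ?n s}" using f by force
    from dominates_restrict[OF G this] show "EX G. dominates {v\<in>H. f v = s} (\<phi> (?n s)) G" using HV by blast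
   qed
   from bchoice[OF this] obtain g where g: "ALL s:I. dominates {v\<in>H. f v = s} (\<phi> (?n s)) (g s)" ..
   note gD = dominatesD[OF bspec[OF g]]
   have fing: "finite (tsupp (g s))" if "s : I" for s by (rule valid_finite[OF gD(1)[OF that]])
   let ?M = "min_set I (%s. tsupp (g s))"
   \<comment> \<open>Two pieces in cells beyond 2 are S_1-allowable, so the weight 2 is available.
     Replacing the weight of the dependent node by it only increases the value.\<close>
   have G: "valid (Gam 1 I g)"
   proof (rule valid.Gam)
    have "disjoint_family_on (%s. tsupp (g s)) I" unfolding disjoint_family_on_def
    proof (intro ballI impI)
     fix s s' assume s: "s : I" "s' : I" "s ~= s'"
     have "cellset {v\<in>H. f v = s} \<inter> cellset {v\<in>H. f v = s'} = {}" by (rule cellset_disjoint) (use HV s(3) in blast)+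
     thus "tsupp (g s) \<inter> tsupp (g s') = {}" using gD(2)[OF s(1)] gD(2)[OF s(2)] by blast
    qed
    moreover have "?M : SN (2 * 1)"
    proof -
     have "card ?M <= card {s\<in>I. tsupp (g s) ~= {}}" unfolding min_set_eq by (rule card_image_le) (use finI in simp)
     also have "... <= card I" by (rule card_mono[OF finI]) auto
     finally have cM: "card ?M <= 2" using card by simp
     have "2 <= t" if t: "t : ?M" for t
     proof -
      obtain s where s: "s : I" "tsupp (g s) ~= {}" "t = Min (tsupp (g s))" using t unfolding min_set_def by blast
      have "t : cellset {v\<in>H. f v = s}" using Min_in[OF fing[OF s(1)] s(2)] gD(2)[OF s(1)] s(3) by blast
      then obtain v where v: "v : H" "t : R v" unfolding cellset_def by blast
      have "v : V" using v(1) HV by blast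
      from R_large[OF this v(2)] nseq_pos[of "q (reg v)"] q_ge_2[of "reg v"] show ?thesis by simp
     qed
     hence "?M : schreier (Suc 0)" by (intro schreier_1I) (use finI cM in "force simp: min_set_eq")+
     moreover have "schreier (Suc 0) \<subseteq> SN (2 * 1)" by (rule schreier_mono) (use nseq_pos[of 2] in simp)
     ultimately show ?thesis by blast
    qed
    ultimately show "allowable (SN (2 * 1)) I (%s. tsupp (g s))" unfolding allowable_def using finI fing by blast
   qed (use finI gD(1) in simp_all)
   have "dominates H (\<phi> T) (Gam 1 I g)"
   proof (rule dominatesI[OF G])
    show "tsupp (Gam 1 I g) \<subseteq> cellset H"
    proof -
     have "tsupp (Gam 1 I g) \<subseteq> (UN s:I. tsupp (g s))" unfolding eval.simps by (rule supp_lincomb)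
     also have "... \<subseteq> cellset H" using gD(2) unfolding cellset_def by blast
     finally show ?thesis .
    qed
    fix v n assume v: "v : H" "n : R v"
    have s: "f v : I" "?n (f v) = sel v" using v(1) f unfolding I_def by blast+
    have m: "0 < rm 2" "rm 2 <= rm (wt T)" using mseq_pos[of 2] mseq_mono[OF w] by simp_all
    have "\<phi> T v * X v n = \<phi> (?n (f v)) v * X v n / rm (wt T)" unfolding sel(2)[OF v(1)] s(2) by simp
    also have "... <= eval (g (f v)) n / rm (wt T)" by (rule divide_right_mono[OF gD(3)[OF s(1)]]) (use v in simp_all)
    also have "... <= eval (g (f v)) n / rm 2" using m eval_nonneg by (intro divide_left_mono) auto
    also have "... <= eval (Gam 1 I g) n" using chs_eval_ge[OF G, of "g (f v)" n] s(1) by simp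
    finally show "\<phi> T v * X v n <= eval (Gam 1 I g) n" .
   qed
   thus ?thesis ..
  qed
 qed
 thus ?case unfolding H_def \<phi>_def .
qed

abbreviation charge :: "tree => 'v => real" where
 "charge T \<equiv> %v. ch1 v T / rm (q (reg v)) / rm (r v)"

text \<open>Cells whose region weight equals that of the node form part of one region, since
  \<open>q\<close> is injective, and their trees are added as new children from
  \<open>region_item\<close>. All other charged cells are handed down to the child attaining their
  charge.\<close>

lemma realize_Gam:
 assumes T: "valid (Gam j I c)" and IH: "\<And>i. i : I ==> EX G. dominates (charged (c i)) (charge (c i)) G"
 shows "EX G. dominates (charged (Gam j I c)) (charge (Gam j I c)) G"
proof -
 let ?T = "Gam j I c" let ?m = "rm (2 * j)"
 define H where "H = charged ?T"
 define H0 where "H0 = {v\<in>H. q (reg v) = 2 * j}"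
 define H1 where "H1 = {v\<in>H. q (reg v) ~= 2 * j}"
 have HV: "H0 \<subseteq> V" "H1 \<subseteq> V" "H0 \<union> H1 = H" unfolding H_def H0_def H1_def by blast+
 have finI: "finite I" and vc: "\<And>i. i : I ==> valid (c i)" using T by (auto elim: valid.cases)
 have H0: "ch1 v ?T = 1" if "v : H0" for v using ch_Gam_attained[OF finI, of "q (reg v)" "r v" "P (reg v)" "p v" "R v" j c] that unfolding H0_def H_def by auto
 have "ALL v:H1. EX i. i : I & ch1 v ?T = ch1 v (c i) / ?m & 0 < ch1 v (c i)"
 proof
  fix v assume v: "v : H1"
  have "0 < ch1 v ?T" "q (reg v) ~= 2 * j" using v unfolding H1_def H_def by blast+
  from ch_Gam_attained[OF finI this(1)] this(2) show "EX i. i : I & ch1 v ?T = ch1 v (c i) / ?m & 0 < ch1 v (c i)" by metis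
 qed
 from bchoice[OF this] obtain sel where sel: "ALL v:H1. sel v : I & ch1 v ?T = ch1 v (c (sel v)) / ?m & 0 < ch1 v (c (sel v))" ..
 have S_sub: "{v\<in>H1. sel v = i} \<subseteq> charged (c i)" for i using sel HV(2) by blast
 obtain I0 c0 where I0: "finite (I0::nat set)" "\<And>k. k : I0 ==> valid (c0 k)" "disjoint_family_on (%k. tsupp (c0 k)) I0"
   "min_set I0 (%k. tsupp (c0 k)) : schreier (nseq (2 * j) - 1)" "(UN k:I0. tsupp (c0 k)) \<subseteq> cellset H0"
   "\<And>v. v : H0 ==> EX k:I0. ALL n:R v. X v n / rm (r v) <= eval (c0 k) n"
 proof (cases "H0 = {}")
  case True
  show thesis by (rule that[of "{}"]) (use True in "simp_all add: disjoint_family_on_def min_set_def empty_in_schreier")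
 next
  case False
  then obtain v where v: "v : H0" by blast
  have "H0 \<subseteq> {u\<in>V. reg u = reg v}"
  proof
   fix u assume u: "u : H0"
   have "q (reg u) = 2 * j" "q (reg v) = 2 * j" using u v unfolding H0_def by blast+
   hence "q (reg u) = q (reg v)" by (metis)
   hence "reg u = reg v" by (rule q_inj)
   thus "u : {u\<in>V. reg u = reg v}" using subsetD[OF HV(1) u] by blast
  qed
  hence ex: "EX I c. finite (I::nat set) & (ALL k:I. valid (c k)) &
    disjoint_family_on (%k. tsupp (c k)) I & min_set I (%k. tsupp (c k)) : schreier (nseq (q (reg v)) - 1) &
    (UN k:I. tsupp (c k)) \<subseteq> (UN v:H0. R v) &
    (ALL v:H0. EX k:I. ALL n:R v. X v n / rm (r v) <= eval (c k) n)" by (rule region_item) (rule finite_subset[OF _ charged_finite[OF T]], use H0_def H_def in blast)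
  obtain I0 c0 where R: "finite (I0::nat set) & (ALL k:I0. valid (c0 k)) &
    disjoint_family_on (%k. tsupp (c0 k)) I0 & min_set I0 (%k. tsupp (c0 k)) : schreier (nseq (q (reg v)) - 1) &
    (UN k:I0. tsupp (c0 k)) \<subseteq> (UN v:H0. R v) &
    (ALL v:H0. EX k:I0. ALL n:R v. X v n / rm (r v) <= eval (c0 k) n)" using ex by (elim exE)
  have qv: "q (reg v) = 2 * j" using v unfolding H0_def by blast
  show thesis
  proof (rule that[of I0 c0])
   show "finite I0" "disjoint_family_on (%k. tsupp (c0 k)) I0" "\<And>k. k : I0 ==> valid (c0 k)" using R by simp_all
   show "min_set I0 (%k. tsupp (c0 k)) : schreier (nseq (2 * j) - 1)" using R unfolding qv by (elim conjE)
   show "(UN k:I0. tsupp (c0 k)) \<subseteq> cellset H0" using R unfolding cellset_def by (elim conjE)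
   show "EX k:I0. ALL n:R v. X v n / rm (r v) <= eval (c0 k) n" if "v : H0" for v using R that by (elim conjE) (rule bspec)
  qed
 qed
 have "EX G. dominates (H0 \<union> H1) (charge ?T) G"
 proof (rule dominates_Gam[OF T HV(1,2) _ _ _ _ I0(1-5), where sel = sel and \<psi> = "%i. charge (c i)"])
  show "H1 \<inter> H0 = {}" unfolding H0_def H1_def by blast
  show "tsupp ?T \<inter> R v ~= {} & Min (tsupp ?T) < p v" if "v : H0" for v by (rule charged_touch[OF T]) (use that H0_def H_def in blast)
  show "sel v : I & tsupp (c (sel v)) \<inter> R v ~= {} & Min (tsupp (c (sel v))) < p v & charge ?T v = charge (c (sel v)) v / ?m" if v: "v : H1" for v
  proof -
   have s: "sel v : I" "ch1 v ?T = ch1 v (c (sel v)) / ?m" "v : charged (c (sel v))" using bspec[OF sel v] S_sub v by blast+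
   show ?thesis using charged_touch[OF vc[OF s(1)] s(3)] s(1) unfolding s(2) by (simp only: divide_inverse mult_ac simp_thms)
  qed
  show "EX G. dominates {v\<in>H1. sel v = i} (charge (c i)) G" if i: "i : I" for i
  proof -
   obtain G where "dominates (charged (c i)) (charge (c i)) G" using IH[OF i] ..
   from dominates_restrict[OF this S_sub] show ?thesis using HV(2) by blast
  qed
  show "EX k:I0. ALL n:R v. charge ?T v * X v n <= eval (c0 k) n / ?m" if v: "v : H0" for v
  proof -
   obtain k where k: "k : I0" "ALL n:R v. X v n / rm (r v) <= eval (c0 k) n" using I0(6)[OF v] by blast
   have qv: "q (reg v) = 2 * j" using v unfolding H0_def by blast
   have "charge ?T v * X v n <= eval (c0 k) n / ?m" if n: "n : R v" for n
   proof -
    have "charge ?T v * X v n = X v n / rm (r v) / ?m" unfolding H0[OF v] unfolding qv by simp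
    also have "... <= eval (c0 k) n / ?m" by (rule divide_right_mono[OF bspec[OF k(2) n]]) simp
    finally show ?thesis .
   qed
   thus ?thesis using k(1) by blast
  qed
 qed
 thus ?thesis unfolding HV(3) H_def .
qed

text \<open>Only the pieces \<open>h\<close> are replaced, by trees supported on the cells assigned
  to them. Charged cells lie inside the intervals of their pieces and beyond the starting points of
  these, so \<open>depc_spread\<close> keeps the node dependent with the same slot weights.\<close>

lemma realize_Del:
 assumes T: "valid (Del j d J K h A E)"
  and IH: "\<And>s k. s : {1..d} ==> k : K s ==> EX G. dominates (charged (h s k)) (charge (h s k)) G"
 shows "EX G. dominates (charged (Del j d J K h A E)) (charge (Del j d J K h A E)) G"
proof -
 let ?T = "Del j d J K h A E" let ?m = "rm (2 * j + 1)"
 define H where "H = charged ?T"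
 have HV: "H \<subseteq> V" unfolding H_def by blast
 have dc: "depc j d J K A E (%s k. tsupp (h s k))" and j: "1 <= j" using T by (auto elim: valid.cases)
 have vh: "valid (h s k)" if "s : {1..d}" "k : K s" for s k using T that by (auto elim: valid.cases)
 \<comment> \<open>The two ways in which a dependent node can be charged: \<open>alt1\<close> inside
   a first slot that has the weight of the region, \<open>alt2\<close> by passing on the charge of a
   piece in a slot of smaller weight.\<close>
 define alt1 where "alt1 = (%v s k. s = (1::nat) & 2 * J 1 = q (reg v) & tsupp (h 1 k) \<subseteq> {..P (reg v)} & 0 < ch2 v (h 1 k) &
    ch1 v ?T = ch2 v (h 1 k) / ?m)"
 define alt2 where "alt2 = (%v s k. 2 * J s < q (reg v) & 0 < ch1 v (h s k) & ch1 v ?T = ch1 v (h s k) / rm (2 * J s) / ?m)"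
 define ok where "ok = (%v s k. s : {1..d} & k : K s & R v \<subseteq> (UN r:A k. E r) & (alt1 v s k \<or> alt2 v s k))"
 have "ALL v:H. EX sk. ok v (fst sk) (snd sk)"
 proof
  fix v assume "v : H"
  hence "0 < ch1 v ?T" unfolding H_def by blast
  from ch_Del_attained[OF dc this] obtain s k where "ok v s k" unfolding ok_def alt1_def alt2_def by blast
  thus "EX sk. ok v (fst sk) (snd sk)" by (intro exI[of _ "(s, k)"]) simp
 qed
 from bchoice[OF this] obtain sel where sel: "ALL v:H. ok v (fst (sel v)) (snd (sel v))" ..
 let ?S = "%s k. {v\<in>H. sel v = (s, k)}"
 have S_V: "?S s k \<subseteq> V" for s k using HV by blast
 have S_ok: "ok v s k" if "v : ?S s k" for v s k
 proof -
  have "v : H" "sel v = (s, k)" using that by blast+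
  thus ?thesis using bspec[OF sel] by fastforce
 qed
 have touch: "tsupp (h s k) \<inter> R v ~= {} & Min (tsupp (h s k)) < p v" if "v : ?S s k" for v s k
 proof -
  have o: "ok v s k" by (rule S_ok[OF that])
  hence val: "valid (h s k)" using vh unfolding ok_def by blast
  have "alt1 v s k \<or> alt2 v s k" using o unfolding ok_def by blast
  thus ?thesis
  proof
   assume "alt1 v s k"
   hence "0 < ch2 v (h s k)" unfolding alt1_def by blast
   thus ?thesis by (rule hit_pos[OF val])
  next
   assume "alt2 v s k"
   hence "0 < ch1 v (h s k)" unfolding alt2_def by blast
   thus ?thesis by (rule ch_range_pos[OF val])
  qed
 qed
 define good where "good = (%s k g. valid g & tsupp g \<subseteq> cellset (?S s k) & (ALL v:?S s k. ALL n:R v.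
   charge ?T v * X v n <= eval g n / rm (2 * J s) / ?m))"
 have ex: "EX g. good s k g" if sk: "s : {1..d}" "k : K s" for s k
 proof (cases "EX u:?S s k. alt1 u s k")
  case True
  then obtain u where u: "u : ?S s k" "alt1 u s k" by blast
  have s1: "s = 1" "2 * J s = q (reg u)" "tsupp (h s k) \<subseteq> {..P (reg u)}" using u(2) unfolding alt1_def by auto
  \<comment> \<open>The two alternatives cannot mix at one piece. A cell charged there through
    \<open>alt2\<close> would belong to a later region and lie beyond \<open>P (reg u)\<close>,
    while the piece ends before that point. So a single region is involved and
    \<open>realize_region\<close> applies.\<close>
  have a1: "reg v = reg u & ch1 v ?T = ch2 v (h s k) / ?m & 0 < ch2 v (h s k)" if v: "v : ?S s k" for v
  proof -
   have "alt1 v s k \<or> alt2 v s k" using S_ok[OF v] unfolding ok_def by blast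
   thus ?thesis
   proof
    assume a: "alt1 v s k"
    hence "q (reg v) = q (reg u)" using s1 unfolding alt1_def by simp
    hence "reg v = reg u" by (rule q_inj)
    thus ?thesis using a s1(1) unfolding alt1_def by blast
   next
    assume a: "alt2 v s k"
    hence "q (reg u) < q (reg v)" using s1(2) unfolding alt2_def by simp
    hence lt: "reg u < reg v" using q_mono by (metis less_asym linorder_neqE_nat)
    obtain n where n: "n : tsupp (h s k)" "n : R v" using touch[OF v] by blast
    have "P (reg u) < n" by (rule P_less[OF subsetD[OF S_V v] lt n(2)])
    thus ?thesis using subsetD[OF s1(3) n(1)] by simp
   qed
  qed
  obtain G where G: "dominates {v\<in>V. reg v = reg u & 0 < ch2 v (h s k)} (%v. ch2 v (h s k) / rm (r v)) G" using realize_region[OF vh[OF sk], of "reg u"] ..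
  have "?S s k \<subseteq> {v\<in>V. reg v = reg u & 0 < ch2 v (h s k)}" using a1 S_V by blast
  from dominates_restrict[OF G this S_V] obtain G' where G': "dominates (?S s k) (%v. ch2 v (h s k) / rm (r v)) G'" ..
  have "good s k G'" unfolding good_def
  proof (intro conjI ballI)
   fix v n assume v: "v : ?S s k" "n : R v"
   have e: "reg v = reg u" "ch1 v ?T = ch2 v (h s k) / ?m" using a1[OF v(1)] by (blast, elim conjE)
   note le = dominatesD(3)[OF G' v]
   have qv: "q (reg v) = 2 * J s" using e(1) s1(2) by simp
   have "charge ?T v * X v n =
    (ch2 v (h s k) / rm (r v) * X v n) / rm (2 * J s) / ?m" unfolding e(2) unfolding qv by (simp only: divide_inverse mult_ac)
   also have "... <= eval G' n / rm (2 * J s) / ?m" by (intro divide_right_mono le) simp_all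
   finally show "charge ?T v * X v n <= eval G' n / rm (2 * J s) / ?m" .
  qed (rule dominatesD(1)[OF G'], rule dominatesD(2)[OF G'])
  thus ?thesis ..
 next
  case False
  hence a2: "alt2 v s k" if "v : ?S s k" for v using S_ok[OF that] that unfolding ok_def by blast
  have sub: "?S s k \<subseteq> charged (h s k)"
  proof
   fix v assume v: "v : ?S s k"
   have "0 < ch1 v (h s k)" using a2[OF v] unfolding alt2_def by blast
   thus "v : charged (h s k)" using subsetD[OF S_V v] by blast
  qed
  obtain G0 where "dominates (charged (h s k)) (charge (h s k)) G0" using IH[OF sk] ..
  from dominates_restrict[OF this sub S_V] obtain G where G: "dominates (?S s k) (charge (h s k)) G" ..
  have "good s k G" unfolding good_def
  proof (intro conjI ballI)
   fix v n assume v: "v : ?S s k" "n : R v"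
   have "ch1 v ?T = ch1 v (h s k) / rm (2 * J s) / ?m" using a2[OF v(1)] unfolding alt2_def by blast
   hence "charge ?T v * X v n =
    (ch1 v (h s k) / rm (q (reg v)) / rm (r v) * X v n) / rm (2 * J s) / ?m" by (simp only: divide_inverse mult_ac)
   also have "... <= eval G n / rm (2 * J s) / ?m" by (intro divide_right_mono dominatesD(3)[OF G v]) simp_all
   finally show "charge ?T v * X v n <= eval G n / rm (2 * J s) / ?m" .
  qed (rule dominatesD(1)[OF G], rule dominatesD(2)[OF G])
  thus ?thesis ..
 qed
 define h' where "h' = (%s k. SOME g. good s k g)"
 have h': "good s k (h' s k)" if "s : {1..d}" "k : K s" for s k unfolding h'_def by (rule someI_ex[OF ex[OF that]])
 have gv: "valid (h' s k)" "tsupp (h' s k) \<subseteq> cellset (?S s k)" if "s : {1..d}" "k : K s" for s k using h'[OF that] unfolding good_def by blast+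
 have dc': "depc j d J K A E (%s k. tsupp (h' s k))"
 proof (rule depc_spread[OF dc])
  fix s k assume sk: "s : {1..d}" "k : K s"
  have "cellset (?S s k) \<subseteq> (UN r:A k. E r)"
  proof
   fix n assume "n : cellset (?S s k)"
   then obtain v where v: "v : ?S s k" "n : R v" unfolding cellset_def by blast
   have "R v \<subseteq> (UN r:A k. E r)" using S_ok[OF v(1)] unfolding ok_def by blast
   thus "n : (UN r:A k. E r)" using v(2) by blast
  qed
  thus "finite (tsupp (h' s k)) & tsupp (h' s k) \<subseteq> (UN r:A k. E r)" using valid_finite[OF gv(1)[OF sk]] gv(2)[OF sk] by blast
  assume ne: "tsupp (h' s k) ~= {}"
  have "Min (tsupp (h s k)) < Min (tsupp (h' s k))" by (rule Min_less_cells[OF gv(2)[OF sk] S_V valid_finite[OF gv(1)[OF sk]] ne]) (use touch in blast)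
  moreover have "?S s k ~= {}" using gv(2)[OF sk] ne unfolding cellset_def by blast
  ultimately show "tsupp (h s k) ~= {} & Min (tsupp (h s k)) <= Min (tsupp (h' s k))" using touch by fastforce
 qed
 let ?G = "Del j d J K h' A E"
 have G: "valid ?G" by (rule valid.Del[OF j gv(1) dc'])
 have "dominates H (charge ?T) ?G"
 proof (rule dominatesI[OF G])
  show "tsupp ?G \<subseteq> cellset H"
  proof
   fix n assume "n : tsupp ?G"
   then obtain c where c: "c : chs ?G" "n : tsupp c"
   proof -
    have "2 <= wt ?G" using j by simp
    from chs_supp[OF G this] \<open>n : tsupp ?G\<close> show thesis using that by blast
   qed
   obtain s where s: "s : {1..d}" "c = Gam (J s) (K s) (h' s)" using c(1) by auto
   have "n : (UN k:K s. tsupp (h' s k))" using c(2) supp_lincomb[of "K s"] unfolding s(2) eval.simps by blast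
   then obtain k where k: "k : K s" "n : tsupp (h' s k)" by blast
   have "?S s k \<subseteq> H" by blast
   thus "n : cellset H" using gv(2)[OF s(1) k(1)] k(2) cellset_mono by blast
  qed
  fix v n assume v: "v : H" "n : R v"
  obtain s k where sk: "sel v = (s, k)" by (cases "sel v")
  have vS: "v : ?S s k" using v(1) sk by blast
  have s: "s : {1..d}" "k : K s" using S_ok[OF vS] unfolding ok_def by blast+
  have "charge ?T v * X v n <= eval (h' s k) n / rm (2 * J s) / ?m" using h'[OF s] vS v(2) unfolding good_def by blast
  also have "... <= eval (Gam (J s) (K s) (h' s)) n / ?m" using chs_eval_ge[OF valid_s_node[OF G s(1)], of "h' s k" n] s(2) by (intro divide_right_mono) simp_all
  also have "... <= eval ?G n" using chs_eval_ge[OF G, of "Gam (J s) (K s) (h' s)" n] s(1) by simp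
  finally show "charge ?T v * X v n <= eval ?G n" .
 qed
 thus ?thesis unfolding H_def ..
qed

text \<open>The tree \<open>G\<close> depends on \<open>X\<close>, but the charges it dominates
  depend on \<open>T\<close> and the skeleton only. This is the bridge between two sequences with a
  common skeleton.\<close>

theorem realize: "valid T ==> EX G. dominates (charged T) (charge T) G"
proof (induction T rule: valid.induct)
 case (Leaf n)
 have "dominates (charged (Leaf n)) (charge (Leaf n)) (Gam 1 {} Leaf)" by (rule dominatesI[OF valid_zero]) (simp_all add: lincomb_def)
 thus ?case ..
next
 case (Gam j I c)
 have "valid (Gam j I c)" by (rule valid.Gam[OF Gam.hyps(1,2) _ Gam.hyps(4)]) (rule Gam.hyps(3))
 thus ?case by (rule realize_Gam) (rule Gam.IH)
next
 case (Del j d K h J A E)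
 have "valid (Del j d J K h A E)" by (rule valid.Del[OF Del.hyps(1) _ Del.hyps(3)]) (rule Del.hyps(2))
 thus ?case by (rule realize_Del) (rule Del.IH)
qed

end

section \<open>Iterated averages\<close>

text \<open>One point of \<open>S\<close> is selected in each interval met. The intervals are
  disjoint, so the selection is injective and \<open>scc_on_selection\<close> applies.\<close>

lemma scc_on_hits:
 assumes scc: "scc_on n eps p F b" and e: "\<And>k k'. k : F ==> k' : F ==> k < k' ==> e k < p k'"
  and S: "S : schreier m" "m <= n - 1"
 shows "(SUM k:{k\<in>F. S \<inter> {p k..e k} ~= {}}. b k) <= 2 * eps"
proof -
 define \<phi> where "\<phi> = (%k. SOME x. x : S \<inter> {p k..e k})"
 have \<phi>: "\<phi> k : S \<inter> {p k..e k}" if "S \<inter> {p k..e k} ~= {}" for k unfolding \<phi>_def by (rule some_in_eq[THEN iffD2, OF that])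
 let ?X = "{k\<in>F. S \<inter> {p k..e k} ~= {}}"
 have X\<phi>: "\<phi> k : S" "p k <= \<phi> k" "\<phi> k <= e k" "k : F" if "k : ?X" for k using \<phi>[of k] that by auto
 show ?thesis
 proof (rule scc_on_selection[OF scc e _ _ _ S(2)])
  show "inj_on \<phi> ?X"
  proof (rule inj_onI)
   fix k k' assume k: "k : ?X" "k' : ?X" "\<phi> k = \<phi> k'"
   have no: "\<not> u < v" if "u : ?X" "v : ?X" "\<phi> u = \<phi> v" for u v using e[of u v] X\<phi>[OF that(1)] X\<phi>[OF that(2)] that(3) by auto
   show "k = k'" using no[OF k] no[OF k(2,1) k(3)[symmetric]] by linarith
  qed
  show "\<phi> ` ?X : schreier m" by (rule schreier_subset[OF S(1)]) (use X\<phi>(1) in blast)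
 qed (use X\<phi>(3) in auto)
qed

definition ind :: "bool => real" where "ind P = (if P then 1 else 0)"

lemma ind: "P ==> ind P = 1" "\<not> P ==> ind P = 0" "0 <= ind P" by (simp_all add: ind_def)

lemma ind_sum_0: "\<not> (ind P = 0 & ind Q = 0) ==> 1 <= ind P + ind Q" by (simp add: ind_def split: if_splits)

lemma ind_0D: "ind P = 0 ==> \<not> P" by (auto simp: ind_def)

lemma max_le_sum3: "0 <= a ==> 0 <= b ==> 0 <= c ==> max a (max b c) <= a + (b + c)" for a b c :: real by linarith

definition avg :: "nat set => (nat => real) => (nat => real) => real" where
 "avg F b f = (SUM k:F. b k * f k)"

lemma avg_add: "avg F b (%k. f k + g k) = avg F b f + avg F b g" by (simp add: avg_def distrib_left sum.distrib)

lemma avg_cmult: "avg F b (%k. c * f k) = c * avg F b f" by (simp add: avg_def sum_distrib_left mult_ac)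

lemma avg_const: "scc_on n eps p F b ==> avg F b (%_. c) = c" by (simp add: avg_def scc_on_def flip: sum_distrib_right)

lemma avg_mono:
 assumes "scc_on n eps p F b" "\<And>k. k : F ==> f k <= g k" shows "avg F b f <= avg F b g"
 unfolding avg_def by (rule sum_mono, rule mult_left_mono) (use assms in "auto simp: scc_on_def")

lemma avg_indicator:
 assumes "scc_on n eps p F b" shows "avg F b (%k. ind (Q k)) = (SUM k:{k\<in>F. Q k}. b k)"
 using assms unfolding avg_def scc_on_def ind_def by (simp add: sum.inter_filter if_distrib cong: if_cong)

text \<open>
  \<open>micro\<close>: an average of pairs of vectors in successive slots, almost attaining the norm on both sides,
  with a window \<open>{lo..hi}\<close> of relevant weights. \<open>meso\<close>: an average of such, of weight \<open>wm\<close>.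
  \<open>macro\<close>: an average of \<open>meso\<close> objects, of weight \<open>wq\<close>.
\<close>

datatype micro = Micro (lo: nat) (hi: nat) (beg: nat) (fin: nat) (slots: "nat set") (coef1: "nat => real")
 (lft: "nat => nat") (rgt: "nat => nat") (xv: "nat => vec") (yv: "nat => vec")

datatype meso = Meso (wm: nat) (mbeg: nat) (mfin: nat) (mics: "nat set") (coef2: "nat => real") (mic: "nat => micro")

datatype macro = Macro (wq: nat) (qbeg: nat) (qfin: nat) (mesos: "nat set") (coef3: "nat => real") (mes: "nat => meso")

abbreviation cell :: "micro => nat => nat set" where "cell M c \<equiv> {lft M c..rgt M c}"

definition xa :: "micro => nat => vec" where "xa M c = (%t. \<bar>xv M c t\<bar>)"
definition ya :: "micro => nat => vec" where "ya M c = (%t. \<bar>yv M c t\<bar>)"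

definition mic_vec :: "(micro => nat => vec) => micro => vec" where
 "mic_vec v M = lincomb (slots M) (coef1 M) (v M)"

text \<open>The factors m_wm, and m_wq in \<open>mac_vec\<close>, compensate the weights of the
  nodes which collect the almost norming trees of the smaller averages. This keeps the norms away
  from 0.\<close>

definition mes_vec :: "(micro => nat => vec) => meso => vec" where
 "mes_vec v K = lincomb (mics K) (%b. rm (wm K) * coef2 K b) (%b. mic_vec v (mic K b))"

definition mac_vec :: "(micro => nat => vec) => macro => vec" where
 "mac_vec v Q = lincomb (mesos Q) (%a. rm (wq Q) * coef3 Q a) (%a. mes_vec v (mes Q a))"

context cr_space begin

text \<open>The bound on the sum of the coordinates makes nodes of weight above the window harmless:
  each coordinate of such a node is at most 1/m_(hi+1), so it contributes at most \<mu>.\<close>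

definition cell_vec :: "real => (micro => nat => vec) => micro => nat => bool" where
 "cell_vec \<mu> v M c \<longleftrightarrow> v M c : c00 & (ALL n. 0 <= v M c n) & supp (v M c) \<subseteq> cell M c & N (v M c) <= 1 &
   (SUM n:supp (v M c). v M c n) <= \<mu> * rm (Suc (hi M))"

definition normed_by :: "real => (micro => nat => vec) => micro => tree => bool" where
 "normed_by \<eta> v M T \<longleftrightarrow> valid T & tsupp T \<subseteq> (UN c:slots M. cell M c) & 1 - \<eta> <= dot (eval T) (mic_vec v M)"

text \<open>The order \<open>n\<close> of the average exceeds the orders of both sets that may spoil
  a slot: the starting points of a frontier below \<open>lo M\<close> of depth \<open>L1\<close>,
  and the interval ends, of order \<rho> + 2 by \<open>Ends_schreier\<close>. All tolerances carry
  the factor m_q m_r by which the vectors are scaled later. The last clause provides almost norming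
  trees on the common slots for both sides.\<close>

definition micro_ok :: "nat => nat => nat => real => micro => bool" where
 "micro_ok q r L \<eta> M \<longleftrightarrow> r < lo M & lo M <= hi M & 2 * L <= beg M &
   (ALL c:slots M. beg M <= lft M c & lft M c <= rgt M c & rgt M c <= fin M) &
   (ALL c:slots M. ALL c':slots M. c < c' --> rgt M c < lft M c') &
   (EX n eps \<mu> L1 \<rho>. scc_on n eps (lft M) (slots M) (coef1 M) & rm q * rm r * eps <= \<eta> &
    rm q * rm r * (1/2)^L1 <= \<eta> & rm q * rm r * \<mu> <= \<eta> &
    L1 * nseq (lo M - 1) <= n - 1 & \<rho> + 2 <= n - 1 & (ALL e<beg M. rho l e <= \<rho>) &
    (ALL v:{xa, ya}. ALL c:slots M. cell_vec \<mu> v M c)) &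
   (ALL v:{xa, ya}. EX T. normed_by \<eta> v M T)"

text \<open>The order \<open>n\<close> is bounded on both sides: large enough for the starting
  points of frontiers below \<open>wm K\<close> to be negligible, and below n_wm, so that one node
  of weight \<open>wm K\<close> can collect the norming trees of all micro averages. The disjoint
  windows make the weights of different micro averages distinguishable.\<close>

definition meso_ok :: "nat => nat => real => meso => bool" where
 "meso_ok q L \<eta> K \<longleftrightarrow> (EX j:L1. wm K = 2 * j) & q < wm K &
   (ALL b:mics K. micro_ok q (wm K) L \<eta> (mic K b) & mbeg K <= beg (mic K b) & fin (mic K b) <= mfin K) &
   (ALL b:mics K. ALL b':mics K. b < b' --> fin (mic K b) < beg (mic K b') & hi (mic K b) < lo (mic K b')) &
   (EX n eps L2. scc_on n eps (%b. beg (mic K b)) (mics K) (coef2 K) & rm q * rm (wm K) * eps <= \<eta> &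
    rm q * rm (wm K) * (1/2)^L2 <= \<eta> & L2 * nseq (wm K - 1) <= n - 1 & n <= nseq (wm K) - 1) &
   rm q * rm (wm K) / rm (Suc (wm K)) <= \<eta>"

text \<open>The order is at most n_q - 1: the one missing unit is used up when the trees of the meso
  averages are added to the children of an existing node of weight q. Starting beyond n_q
  contradicts the growth of the coding in \<open>relevant_slots\<close>.\<close>

definition macro_ok :: "real => macro => bool" where
 "macro_ok \<eta> Q \<longleftrightarrow> (EX j:L1. wq Q = 2 * j) & 1 / rm (wq Q) <= \<eta> & nseq (wq Q) < qbeg Q &
   (ALL a:mesos Q. ALL a':mesos Q. a < a' --> mfin (mes Q a) < mbeg (mes Q a') & wm (mes Q a) < wm (mes Q a')) &
   (EX n eps L. scc_on n eps (%a. mbeg (mes Q a)) (mesos Q) (coef3 Q) & rm (wq Q) * eps <= \<eta> &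
    rm (wq Q) * (1/2)^L <= \<eta> & L * nseq (wq Q - 1) <= n - 1 & n <= nseq (wq Q) - 1 &
    (ALL a:mesos Q. meso_ok (wq Q) L \<eta> (mes Q a) & qbeg Q <= mbeg (mes Q a) & mfin (mes Q a) <= qfin Q))"

section \<open>Errors of the three averages\<close>

lemma Fr_mins:
 assumes "good_step step n" "valid T"
 shows "(%t. Min (tsupp t)) ` {t\<in>Fr step L T. tsupp t ~= {}} : schreier (L * n)"
  "t : Fr step L T ==> t' : Fr step L T ==> t ~= t' ==> tsupp t \<inter> tsupp t' = {}"
  "t : Fr step L T ==> valid t" using Fr_props[OF assms, of L] by blast+

lemma Min_touch:
 assumes "valid t" "tsupp t \<inter> {p..e} ~= {}" shows "Min (tsupp t) <= e"
proof -
 obtain x where "x : tsupp t" "x <= e" using assms(2) by auto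
 thus ?thesis using Min_le[OF valid_finite[OF assms(1)]] by (meson order_trans)
qed

text \<open>A bad index has a frontier starting point inside its interval, and all these starting
  points together form a set of order \<open>L * m\<close>, below that of the average.\<close>

lemma starts_small:
 assumes scc: "scc_on n eps p F b" and e: "\<And>k k'. k : F ==> k' : F ==> k < k' ==> e k < p k'"
  and g: "good_step step m" "valid T" "L * m <= n - 1"
 shows "avg F b (%k. ind (EX t:Fr step L T. tsupp t \<inter> {p k..e k} ~= {} & p k <= Min (tsupp t))) <= 2 * eps"
proof -
 let ?S = "(%t. Min (tsupp t)) ` {t\<in>Fr step L T. tsupp t ~= {}}"
 have sub: "?S \<inter> {p k..e k} ~= {}" if "EX t:Fr step L T. tsupp t \<inter> {p k..e k} ~= {} & p k <= Min (tsupp t)" for k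
 proof -
  from that obtain t where t: "t : Fr step L T" "tsupp t \<inter> {p k..e k} ~= {}" "p k <= Min (tsupp t)" by blast
  have "Min (tsupp t) : ?S" using t(1,2) by blast
  moreover have "Min (tsupp t) : {p k..e k}" using t(3) Min_touch[OF Fr_mins(3)[OF g(1,2) t(1)] t(2)] by simp
  ultimately show ?thesis by blast
 qed
 have "avg F b (%k. ind (EX t:Fr step L T. tsupp t \<inter> {p k..e k} ~= {} & p k <= Min (tsupp t)))
   <= avg F b (%k. ind (?S \<inter> {p k..e k} ~= {}))"
 proof (rule avg_mono[OF scc])
  fix k
  show "ind (EX t:Fr step L T. tsupp t \<inter> {p k..e k} ~= {} & p k <= Min (tsupp t)) <= ind (?S \<inter> {p k..e k} ~= {})"
  proof (cases "EX t:Fr step L T. tsupp t \<inter> {p k..e k} ~= {} & p k <= Min (tsupp t)")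
   case True
   show ?thesis unfolding ind(1)[OF sub[OF True]] by (simp add: ind_def)
  next
   case False
   show ?thesis unfolding ind(2)[OF False] by (rule ind(3))
  qed
 qed
 also have "... <= 2 * eps" unfolding avg_indicator[OF scc] by (rule scc_on_hits[OF scc e Fr_mins(1)[OF g(1,2)] g(3)])
 finally show ?thesis .
qed

text \<open>Nodes of distinct weights are distinct, so few indices can see a frontier node of their own weights.\<close>

lemma own_weights_small:
 assumes scc: "scc_on n eps p F b" and e: "\<And>k k'. k : F ==> k' : F ==> k < k' ==> e k < p k'"
  and g: "good_step step m" "valid T" "L * m <= n - 1"
  and w: "\<And>k k' t. k : F ==> k' : F ==> Q k (wt t) ==> Q k' (wt t) ==> k = k'"
 shows "avg F b (%k. ind (EX t:Fr step L T. tsupp t \<inter> {p k..e k} ~= {} & Q k (wt t))) <= 2 * eps"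
proof -
 let ?P = "%k t. t : Fr step L T & tsupp t \<inter> {p k..e k} ~= {} & Q k (wt t)"
 let ?X = "{k\<in>F. EX t:Fr step L T. tsupp t \<inter> {p k..e k} ~= {} & Q k (wt t)}"
 define \<tau> where "\<tau> = (%k. SOME t. ?P k t)"
 have \<tau>: "?P k (\<tau> k)" if "k : ?X" for k
 proof -
  have "EX t. ?P k t" using that by blast
  thus ?thesis unfolding \<tau>_def by (rule someI_ex)
 qed
 have ne: "tsupp (\<tau> k) ~= {}" if "k : ?X" for k using \<tau>[OF that] by blast
 show ?thesis unfolding avg_indicator[OF scc]
 proof (rule scc_on_selection[OF scc e _ _ _ g(3)])
  show "inj_on (%k. Min (tsupp (\<tau> k))) ?X"
  proof (rule inj_onI)
   fix k k' assume k: "k : ?X" "k' : ?X" "Min (tsupp (\<tau> k)) = Min (tsupp (\<tau> k'))"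
   have mem: "Min (tsupp (\<tau> u)) : tsupp (\<tau> u)" if "u : ?X" for u using \<tau>[OF that] by (intro Min_in[OF _ ne[OF that]] valid_finite Fr_mins(3)[OF g(1,2)]) blast
   have "Min (tsupp (\<tau> k)) : tsupp (\<tau> k)" "Min (tsupp (\<tau> k')) : tsupp (\<tau> k')" by (rule mem[OF k(1)], rule mem[OF k(2)])
   hence "tsupp (\<tau> k) \<inter> tsupp (\<tau> k') ~= {}" using k(3) by auto
   hence "\<tau> k = \<tau> k'" using Fr_mins(2)[OF g(1,2)] \<tau>[OF k(1)] \<tau>[OF k(2)] by blast
   moreover have "Q k (wt (\<tau> k))" "Q k' (wt (\<tau> k'))" "k : F" "k' : F" using \<tau>[OF k(1)] \<tau>[OF k(2)] k(1,2) by blast+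
   ultimately show "k = k'" using w[of k k' "\<tau> k"] by simp
  qed
  show "(%k. Min (tsupp (\<tau> k))) ` ?X : schreier (L * m)" by (rule schreier_subset[OF Fr_mins(1)[OF g(1,2)]]) (use \<tau> ne in blast)
  show "Min (tsupp (\<tau> k)) <= e k" if "k : ?X" for k using \<tau>[OF that] Min_touch[OF Fr_mins(3)[OF g(1,2)]] by blast
 qed auto
qed

abbreviation hitv :: "meso => nat => nat => tree => real" where
 "hitv K b c T \<equiv> pmx (wm K) (hit (wm K) (cell (mic K b) c) (beg (mic K b))) T"

text \<open>Slots containing a start of a relevant node are rare, the other slots are handled by
  \<open>cell_estimate\<close>. The constant is 35 = 2 + 32 + 1, from the rare slots, the long
  branches and the weights above the window.\<close>

lemma micro_estimate:
 assumes M: "micro_ok q r L \<eta> M" and T: "valid T" and v: "v : {xa, ya}" and r: "2 <= r"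
 shows "rm q * rm r * avg (slots M) (coef1 M) (%c. dot (eval T) (v M c))
  <= 35 * \<eta> + 32 * rm q * rm r * avg (slots M) (coef1 M) (%c. pmx (lo M) (win (hi M) (cell M c)) T)"
proof -
 obtain n eps \<mu> L1 where scc: "scc_on n eps (lft M) (slots M) (coef1 M)" and sm: "rm q * rm r * eps <= \<eta>"
   "rm q * rm r * (1/2)^L1 <= \<eta>" "rm q * rm r * \<mu> <= \<eta>"
   and n: "L1 * nseq (lo M - 1) <= n - 1" and cv: "ALL v:{xa, ya}. ALL c:slots M. cell_vec \<mu> v M c" using M unfolding micro_ok_def by blast
 have sep: "rgt M c < lft M c'" if "c : slots M" "c' : slots M" "c < c'" for c c' using M that unfolding micro_ok_def by blast
 have lohi: "2 <= lo M" "lo M <= hi M" using M r unfolding micro_ok_def by auto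
 let ?bad = "%c. ind (EX t:Fr (below (lo M)) L1 T. tsupp t \<inter> cell M c ~= {} & lft M c <= Min (tsupp t))"
 let ?w = "%c. pmx (lo M) (win (hi M) (cell M c)) T"
 have bound: "dot (eval T) (v M c) <= ?bad c + (32 * (1/2)^L1 + \<mu>) + 32 * ?w c" if c: "c : slots M" for c
 proof -
  have V: "v M c : c00" "\<And>n. 0 <= v M c n" "supp (v M c) \<subseteq> cell M c" "N (v M c) <= 1"
    "(SUM n:supp (v M c). v M c n) <= \<mu> * rm (Suc (hi M))" using bspec[OF bspec[OF cv v] c] unfolding cell_vec_def by blast+
  have M1: "0 < rm (Suc (hi M))" using mseq_pos[of "Suc (hi M)"] by simp
  have lam: "(SUM n:supp (v M c). v M c n) / rm (Suc (hi M)) <= \<mu>" using V(5) M1 by (simp add: pos_divide_le_eq)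
  have w0: "0 <= ?w c" using pmx_range[OF T] win_range by blast
  have l0: "0 <= \<mu>" using lam sum_nonneg[of "supp (v M c)" "v M c"] V(2) M1 by (meson divide_nonneg_pos order_trans)
  show ?thesis
  proof (cases "EX t:Fr (below (lo M)) L1 T. tsupp t \<inter> cell M c ~= {} & lft M c <= Min (tsupp t)")
   case True
   have "dot (eval T) (v M c) <= 1" using N_tree_upper[OF T, of "v M c"] V(4) by linarith
   moreover have "?bad c = 1" using True by (rule ind(1))
   moreover have "(0::real) <= (1/2)^L1" by simp
   ultimately show ?thesis using w0 l0 by linarith
  next
   case False
   have "dot (eval T) (v M c) <= 32 * ((1/2)^L1 + pmx (lo M) (%w S. if w <= hi M & S \<inter> cell M c ~= {} then 1 else 0) T)
    + (SUM n:supp (v M c). v M c n) / rm (Suc (hi M))" by (rule cell_estimate[OF T V(1-4) _ lohi]) (use False in "meson not_less")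
   hence "dot (eval T) (v M c) <= 32 * ((1/2)^L1 + ?w c) + \<mu>" using lam unfolding win_def by linarith
   moreover have "?bad c = 0" using False by (rule ind(2))
   ultimately show ?thesis by (simp only: distrib_left)
  qed
 qed
 have "avg (slots M) (coef1 M) (%c. dot (eval T) (v M c)) <= avg (slots M) (coef1 M) (%c. ?bad c + (32 * (1/2)^L1 + \<mu>) + 32 * ?w c)" by (rule avg_mono[OF scc bound])
 also have "... = avg (slots M) (coef1 M) ?bad + (32 * (1/2)^L1 + \<mu>) + 32 * avg (slots M) (coef1 M) ?w" by (simp only: avg_add avg_cmult avg_const[OF scc])
 also have "avg (slots M) (coef1 M) ?bad <= 2 * eps" by (rule starts_small[OF scc sep good_below T n])
 finally have "avg (slots M) (coef1 M) (%c. dot (eval T) (v M c)) <= 2 * eps + (32 * (1/2)^L1 + \<mu>) + 32 * avg (slots M) (coef1 M) ?w" by simp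
 hence "rm q * rm r * avg (slots M) (coef1 M) (%c. dot (eval T) (v M c)) <=
  rm q * rm r * (2 * eps + (32 * (1/2)^L1 + \<mu>) + 32 * avg (slots M) (coef1 M) ?w)" by (rule mult_left_mono) simp
 also have "... = 2 * (rm q * rm r * eps) + 32 * (rm q * rm r * (1/2)^L1) + rm q * rm r * \<mu>
   + 32 * rm q * rm r * avg (slots M) (coef1 M) ?w" by (simp add: algebra_simps)
 also have "... <= 35 * \<eta> + 32 * rm q * rm r * avg (slots M) (coef1 M) ?w" using sm by linarith
 finally show ?thesis .
qed

text \<open>A micro average is bad if a frontier node starts in it or meets it with a weight of its
  own window; both are rare, the second because windows are disjoint. Otherwise
  \<open>window_to_hit\<close> applies. The constant is 227 = 35 + 32 + 32 + 64 + 64, the last two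
  for the bad averages.\<close>

lemma meso_estimate:
 assumes K: "meso_ok q L \<eta> K" and T: "valid T" and v: "v : {xa, ya}"
 shows "rm q * dot (eval T) (mes_vec v K)
  <= 227 * \<eta> + 32 * rm q * avg (mics K) (coef2 K) (%b. avg (slots (mic K b)) (coef1 (mic K b)) (%c. hitv K b c T))"
proof -
 let ?r = "wm K" let ?q = "rm q" let ?m = "rm (wm K)"
 obtain n eps L2 where scc: "scc_on n eps (%b. beg (mic K b)) (mics K) (coef2 K)" and sm: "?q * ?m * eps <= \<eta>" "?q * ?m * (1/2)^L2 <= \<eta>"
   and n: "L2 * nseq (?r - 1) <= n - 1" using K unfolding meso_ok_def by blast
 have sm3: "?q * ?m / rm (Suc ?r) <= \<eta>" using K unfolding meso_ok_def by blast
 have ok: "micro_ok q ?r L \<eta> (mic K b)" if "b : mics K" for b using K that unfolding meso_ok_def by blast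
 have sep: "fin (mic K b) < beg (mic K b')" "hi (mic K b) < lo (mic K b')" if "b : mics K" "b' : mics K" "b < b'" for b b' using K that unfolding meso_ok_def by blast+
 have r2: "2 <= ?r" using K L1_pos unfolding meso_ok_def by fastforce
 have m1: "32 <= ?m" by (rule real_mseq_ge[OF r2])
 have fK: "finite (mics K)" using scc unfolding scc_on_def by blast
 have sc1: "EX n eps. scc_on n eps (lft (mic K b)) (slots (mic K b)) (coef1 (mic K b))" if "b : mics K" for b using ok[OF that] unfolding micro_ok_def by blast
 let ?S = "%b. {beg (mic K b)..fin (mic K b)}"
 let ?bad1 = "%b. ind (EX t:Fr (below ?r) L2 T. tsupp t \<inter> ?S b ~= {} & beg (mic K b) <= Min (tsupp t))"
 let ?bad2 = "%b. ind (EX t:Fr (below ?r) L2 T. tsupp t \<inter> ?S b ~= {} & (lo (mic K b) <= wt t & wt t <= hi (mic K b)))"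
 have wb: "pmx (lo (mic K b)) (win (hi (mic K b)) (cell (mic K b) c)) T <= ?bad1 b + ?bad2 b + (1 / rm (Suc ?r) + (1/2)^L2) + (1 / ?m) * hitv K b c T"
  if b: "b : mics K" and c: "c : slots (mic K b)" for b c
 proof -
  let ?w = "pmx (lo (mic K b)) (win (hi (mic K b)) (cell (mic K b) c)) T" let ?h = "hitv K b c T"
  have h0: "0 <= ?h / ?m" using pmx_range[OF T] hit_range by (metis divide_nonneg_nonneg of_nat_0_le_iff)
  have p0: "0 <= 1 / rm (Suc ?r)" "(0::real) <= (1/2)^L2" by simp_all
  have w1: "?w <= 1" using pmx_range[OF T] win_range by blast
  show ?thesis
  proof (cases "?bad1 b = 0 & ?bad2 b = 0")
   case False
   hence "1 <= ?bad1 b + ?bad2 b" by (rule ind_sum_0)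
   moreover have "0 <= (1 / ?m) * ?h" using h0 by simp
   ultimately show ?thesis using w1 p0 by linarith
  next
   case True
   have n1: "\<not> (EX t:Fr (below ?r) L2 T. tsupp t \<inter> ?S b ~= {} & beg (mic K b) <= Min (tsupp t))" using conjunct1[OF True] by (rule ind_0D)
   have n2: "\<not> (EX t:Fr (below ?r) L2 T. tsupp t \<inter> ?S b ~= {} & (lo (mic K b) <= wt t & wt t <= hi (mic K b)))" using conjunct2[OF True] by (rule ind_0D)
   have sub: "cell (mic K b) c \<subseteq> ?S b" using ok[OF b] c unfolding micro_ok_def by (meson atLeastatMost_subset_iff)
   have lo: "?r < lo (mic K b)" using ok[OF b] unfolding micro_ok_def by blast
   have "?w <= max (?h / ?m) (max (1 / rm (Suc ?r)) ((1/2)^L2))"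
   proof (rule window_to_hit[OF T r2 lo])
    fix t assume t: "t : Fr (below ?r) L2 T"
    show "tsupp t \<inter> cell (mic K b) c = {}" if "lo (mic K b) <= wt t" "wt t <= hi (mic K b)" using n2 t that sub by blast
    show "Min (tsupp t) < beg (mic K b)" if "tsupp t \<inter> cell (mic K b) c ~= {}"
    proof (rule ccontr)
     assume "\<not> ?thesis"
     hence "beg (mic K b) <= Min (tsupp t)" by simp
     moreover have "tsupp t \<inter> ?S b ~= {}" using that sub by blast
     ultimately show False using n1 t by blast
    qed
   qed
   also have "... <= ?h / ?m + (1 / rm (Suc ?r) + (1/2)^L2)" by (rule max_le_sum3[OF h0 p0])
   finally have "?w <= ?h / ?m + (1 / rm (Suc ?r) + (1/2)^L2)" .
   thus ?thesis using True by simp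
  qed
 qed
 have mb: "?q * ?m * avg (slots (mic K b)) (coef1 (mic K b)) (%c. dot (eval T) (v (mic K b) c)) <=
   32 * ?q * ?m * ?bad1 b + 32 * ?q * ?m * ?bad2 b + (99 * \<eta>) + 32 * ?q * avg (slots (mic K b)) (coef1 (mic K b)) (%c. hitv K b c T)"
  if b: "b : mics K" for b
 proof -
  let ?a = "avg (slots (mic K b)) (coef1 (mic K b))"
  obtain n' eps' where s: "scc_on n' eps' (lft (mic K b)) (slots (mic K b)) (coef1 (mic K b))" using sc1[OF b] by blast
  have "?a (%c. pmx (lo (mic K b)) (win (hi (mic K b)) (cell (mic K b) c)) T) <=
    ?a (%c. ?bad1 b + ?bad2 b + (1 / rm (Suc ?r) + (1/2)^L2) + (1 / ?m) * hitv K b c T)" by (rule avg_mono[OF s wb[OF b]])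
  also have "... = ?bad1 b + ?bad2 b + (1 / rm (Suc ?r) + (1/2)^L2) + (1 / ?m) * ?a (%c. hitv K b c T)" by (simp only: avg_add avg_cmult avg_const[OF s])
  finally have "32 * ?q * ?m * ?a (%c. pmx (lo (mic K b)) (win (hi (mic K b)) (cell (mic K b) c)) T) <=
    32 * ?q * ?m * (?bad1 b + ?bad2 b + (1 / rm (Suc ?r) + (1/2)^L2) + (1 / ?m) * ?a (%c. hitv K b c T))" by (rule mult_left_mono) simp
  also have "... = 32 * ?q * ?m * ?bad1 b + 32 * ?q * ?m * ?bad2 b + 32 * (?q * ?m / rm (Suc ?r)) + 32 * (?q * ?m * (1/2)^L2)
    + 32 * ?q * (?m * (1 / ?m)) * ?a (%c. hitv K b c T)" by (simp add: algebra_simps del: if_split)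
  also have "... = 32 * ?q * ?m * ?bad1 b + 32 * ?q * ?m * ?bad2 b + 32 * (?q * ?m / rm (Suc ?r)) + 32 * (?q * ?m * (1/2)^L2)
    + 32 * ?q * ?a (%c. hitv K b c T)" using m1 by simp
  finally show ?thesis using micro_estimate[OF ok[OF b] T v r2] sm(2) sm3 by linarith
 qed
 have c00m: "v (mic K b) c : c00" if bc: "b : mics K" "c : slots (mic K b)" for b c
 proof -
  obtain \<mu> where "ALL v:{xa, ya}. ALL c:slots (mic K b). cell_vec \<mu> v (mic K b) c" using ok[OF bc(1)] unfolding micro_ok_def by blast
  thus ?thesis using v bc(2) unfolding cell_vec_def by blast
 qed
 have fc: "finite (slots (mic K b))" if "b : mics K" for b using sc1[OF that] unfolding scc_on_def by blast
 have dm: "dot (eval T) (mic_vec v (mic K b)) = avg (slots (mic K b)) (coef1 (mic K b)) (%c. dot (eval T) (v (mic K b) c))" if "b : mics K" for b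
  unfolding mic_vec_def avg_def by (rule dot_lincomb[OF fc[OF that] c00m[OF that]])
 have "dot (eval T) (mes_vec v K) = (SUM b:mics K. ?m * coef2 K b * dot (eval T) (mic_vec v (mic K b)))" unfolding mes_vec_def
 proof (rule dot_lincomb[OF fK])
  show "mic_vec v (mic K b) : c00" if "b : mics K" for b unfolding mic_vec_def by (rule c00_lincomb[OF fc[OF that] c00m[OF that]])
 qed
 also have "... = (SUM b:mics K. ?m * coef2 K b * avg (slots (mic K b)) (coef1 (mic K b)) (%c. dot (eval T) (v (mic K b) c)))" by (rule sum.cong[OF refl]) (simp add: dm)
 finally have "?q * dot (eval T) (mes_vec v K) =
   avg (mics K) (coef2 K) (%b. ?q * ?m * avg (slots (mic K b)) (coef1 (mic K b)) (%c. dot (eval T) (v (mic K b) c)))"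
  unfolding avg_def[of "mics K"] by (simp add: sum_distrib_left mult_ac)
 also have "... <= avg (mics K) (coef2 K) (%b. 32 * ?q * ?m * ?bad1 b + 32 * ?q * ?m * ?bad2 b + (99 * \<eta>) + 32 * ?q * avg (slots (mic K b)) (coef1 (mic K b)) (%c. hitv K b c T))"
  by (rule avg_mono[OF scc mb])
 also have "... = 32 * ?q * ?m * avg (mics K) (coef2 K) ?bad1 + 32 * ?q * ?m * avg (mics K) (coef2 K) ?bad2 + 99 * \<eta>
   + 32 * ?q * avg (mics K) (coef2 K) (%b. avg (slots (mic K b)) (coef1 (mic K b)) (%c. hitv K b c T))" by (simp only: avg_add avg_cmult avg_const[OF scc])
 finally have main: "?q * dot (eval T) (mes_vec v K) <= 32 * ?q * ?m * avg (mics K) (coef2 K) ?bad1 + 32 * ?q * ?m * avg (mics K) (coef2 K) ?bad2 + 99 * \<eta>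
   + 32 * ?q * avg (mics K) (coef2 K) (%b. avg (slots (mic K b)) (coef1 (mic K b)) (%c. hitv K b c T))" .
 have b1: "avg (mics K) (coef2 K) ?bad1 <= 2 * eps" by (rule starts_small[OF scc sep(1) good_below T n])
 have b2: "avg (mics K) (coef2 K) ?bad2 <= 2 * eps"
 proof (rule own_weights_small[OF scc sep(1) good_below T n])
  fix b b' t assume b: "b : mics K" "b' : mics K" and t: "lo (mic K b) <= wt t & wt t <= hi (mic K b)" "lo (mic K b') <= wt t & wt t <= hi (mic K b')"
  show "b = b'" using sep(2)[OF b] sep(2)[OF b(2,1)] t by (metis leD le_trans linorder_neqE_nat)
 qed
 have "32 * ?q * ?m * avg (mics K) (coef2 K) ?bad1 <= 32 * ?q * ?m * (2 * eps)" by (rule mult_left_mono[OF b1]) simp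
 moreover have "32 * ?q * ?m * avg (mics K) (coef2 K) ?bad2 <= 32 * ?q * ?m * (2 * eps)" by (rule mult_left_mono[OF b2]) simp
 moreover have "32 * ?q * ?m * (2 * eps) = 64 * (?q * ?m * eps)" by simp
 ultimately show ?thesis using main sm(1) by linarith
qed

lemma ch_nonneg: assumes "valid T" shows "0 <= ch q r P p R T" using assms
proof (cases T rule: valid.cases)
 case (Gam j I c)
 thus ?thesis by (auto simp: hit_def intro!: divide_nonneg_nonneg Max_ge)
next
 case (Del j d K h J A E)
 thus ?thesis by (auto intro!: divide_nonneg_nonneg Max_ge)
qed simp

abbreviation chv :: "macro => nat => nat => nat => tree => real" where
 "chv Q a b c T \<equiv> ch (wq Q) (wm (mes Q a)) (qfin Q) (beg (mic (mes Q a) b)) (cell (mic (mes Q a) b) c) T"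

definition avg3 :: "macro => (nat => nat => nat => real) => real" where
 "avg3 Q f = avg (mesos Q) (coef3 Q) (%a. avg (mics (mes Q a)) (coef2 (mes Q a))
   (%b. avg (slots (mic (mes Q a) b)) (coef1 (mic (mes Q a) b)) (f a b)))"

text \<open>A cell is bad if a frontier node of the weight of its meso average meets that average,
  or if an interval end falls into the cell. For all others \<open>hit_to_charge\<close> turns hits
  into charges with a gain of 1/m_q, which cancels the scaling. The constant is 419 = 227 + 64 + 64
  + 64: the errors of \<open>hit_to_charge\<close>, the interval ends and the bad meso
  averages.\<close>

theorem macro_estimate:
 assumes Q: "macro_ok \<eta> Q" and T: "valid T" and v: "v : {xa, ya}"
 shows "dot (eval T) (mac_vec v Q) <= 419 * \<eta> + 32 * avg3 Q (%a b c. chv Q a b c T)"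
proof -
 let ?q = "wq Q" let ?m = "rm (wq Q)"
 obtain n eps L where scc: "scc_on n eps (%a. mbeg (mes Q a)) (mesos Q) (coef3 Q)" and sm: "?m * eps <= \<eta>" "?m * (1/2)^L <= \<eta>"
   and n: "L * nseq (?q - 1) <= n - 1" and
   ok: "ALL a:mesos Q. meso_ok ?q L \<eta> (mes Q a) & qbeg Q <= mbeg (mes Q a) & mfin (mes Q a) <= qfin Q" using Q unfolding macro_ok_def by blast
 have sm3: "1 / ?m <= \<eta>" using Q unfolding macro_ok_def by blast
 obtain j0 where j0: "j0 : L1" "?q = 2 * j0" using Q unfolding macro_ok_def by blast
 have q2: "2 <= ?q" using j0 L1_pos[of j0] by simp
 have m1: "32 <= ?m" by (rule real_mseq_ge[OF q2])
 have sep: "mfin (mes Q a) < mbeg (mes Q a')" "wm (mes Q a) < wm (mes Q a')" if "a : mesos Q" "a' : mesos Q" "a < a'" for a a' using Q that unfolding macro_ok_def by blast+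
 have fQ: "finite (mesos Q)" using scc unfolding scc_on_def by blast
 let ?S = "%a. {mbeg (mes Q a)..mfin (mes Q a)}"
 let ?bad3 = "%a. ind (EX t:Fr (xstep ?q (qfin Q)) L T. tsupp t \<inter> ?S a ~= {} & wt t = wm (mes Q a))"
 let ?bad4 = "%a b c. ind (Ends (wm (mes Q a)) (beg (mic (mes Q a) b)) L T \<inter> {beg (mic (mes Q a) b)..} \<inter> cell (mic (mes Q a) b) c ~= {})"
 have mio: "micro_ok ?q (wm (mes Q a)) L \<eta> (mic (mes Q a) b)" "mbeg (mes Q a) <= beg (mic (mes Q a) b)" "fin (mic (mes Q a) b) <= mfin (mes Q a)"
  if "a : mesos Q" "b : mics (mes Q a)" for a b using bspec[OF ok that(1)] that(2) unfolding meso_ok_def by blast+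
 have sc2: "EX n eps. scc_on n eps (%b. beg (mic (mes Q a) b)) (mics (mes Q a)) (coef2 (mes Q a))" if "a : mesos Q" for a
  using bspec[OF ok that] unfolding meso_ok_def by blast
 have qr: "?q < wm (mes Q a)" if "a : mesos Q" for a using bspec[OF ok that] unfolding meso_ok_def by blast
 have hb: "?m * hitv (mes Q a) b c T <= ?m * ?bad3 a + ?m * ?bad4 a b c + 2 * \<eta> + chv Q a b c T"
  if a: "a : mesos Q" and b: "b : mics (mes Q a)" and c: "c : slots (mic (mes Q a) b)" for a b c
 proof -
  let ?h = "hitv (mes Q a) b c T" let ?M = "mic (mes Q a) b"
  have h1: "?h <= 1" using pmx_range[OF T] hit_range by blast
  have c0: "0 <= chv Q a b c T" by (rule ch_nonneg[OF T])
  have e0: "0 <= \<eta>" using sm3 m1 by (meson divide_nonneg_nonneg of_nat_0_le_iff order_trans zero_le_one)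
  have rg: "beg ?M <= lft ?M c" "rgt ?M c <= fin ?M" using mio(1)[OF a b] c unfolding micro_ok_def by blast+
  show ?thesis
  proof (cases "?bad3 a = 0 & ?bad4 a b c = 0")
   case False
   hence "1 <= ?bad3 a + ?bad4 a b c" by (rule ind_sum_0)
   hence "?m * 1 <= ?m * (?bad3 a + ?bad4 a b c)" by (rule mult_left_mono) simp
   moreover have "?m * ?h <= ?m * 1" using h1 by (intro mult_left_mono) simp_all
   ultimately show ?thesis using c0 e0 by (simp add: distrib_left del: if_split)
  next
   case True
   have n3: "\<not> (EX t:Fr (xstep ?q (qfin Q)) L T. tsupp t \<inter> ?S a ~= {} & wt t = wm (mes Q a))" using conjunct1[OF True] by (rule ind_0D)
   have n4: "\<not> (Ends (wm (mes Q a)) (beg ?M) L T \<inter> {beg ?M..} \<inter> cell ?M c ~= {})" using conjunct2[OF True] by (rule ind_0D)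
   have "?h <= max (chv Q a b c T / ?m) (max (1 / ?m\<^sup>2) ((1/2)^L))"
   proof (rule hit_to_charge[OF T j0(2,1) qr[OF a] refl])
    show "rgt ?M c <= qfin Q" using rg(2) mio(3)[OF a b] bspec[OF ok a] by linarith
    have "cell ?M c \<subseteq> ?S a" using rg mio(2,3)[OF a b] by auto
    thus "tsupp t \<inter> cell ?M c = {}" if "t : Fr (xstep ?q (qfin Q)) L T" "wt t = wm (mes Q a)" for t using n3 that by blast
    have "cell ?M c \<subseteq> {beg ?M..}" using rg by auto
    thus "Ends (wm (mes Q a)) (beg ?M) L T \<inter> cell ?M c = {}" using n4 by blast
   qed
   also have "... <= chv Q a b c T / ?m + (1 / ?m\<^sup>2 + (1/2)^L)" by (rule max_le_sum3) (use c0 in simp_all)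
   finally have "?m * ?h <= ?m * (chv Q a b c T / ?m + (1 / ?m\<^sup>2 + (1/2)^L))" by (rule mult_left_mono) simp
   also have "... = chv Q a b c T + 1 / ?m + ?m * (1/2)^L" using m1 by (simp add: field_simps power2_eq_square)
   finally show ?thesis using sm(2) sm3 True by simp
  qed
 qed
 have dm: "dot (eval T) (mac_vec v Q) = avg (mesos Q) (coef3 Q) (%a. ?m * dot (eval T) (mes_vec v (mes Q a)))"
 proof -
  have "dot (eval T) (mac_vec v Q) = (SUM a:mesos Q. ?m * coef3 Q a * dot (eval T) (mes_vec v (mes Q a)))" unfolding mac_vec_def
  proof (rule dot_lincomb[OF fQ])
   fix a assume a: "a : mesos Q"
   show "mes_vec v (mes Q a) : c00" unfolding mes_vec_def mic_vec_def
   proof (rule c00_lincomb)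
    show "finite (mics (mes Q a))" using sc2[OF a] unfolding scc_on_def by blast
    fix b assume b: "b : mics (mes Q a)"
    have "EX \<mu> n eps. scc_on n eps (lft (mic (mes Q a) b)) (slots (mic (mes Q a) b)) (coef1 (mic (mes Q a) b)) &
       (ALL v:{xa, ya}. ALL c:slots (mic (mes Q a) b). cell_vec \<mu> v (mic (mes Q a) b) c)" using mio(1)[OF a b] unfolding micro_ok_def by blast
    thus "lincomb (slots (mic (mes Q a) b)) (coef1 (mic (mes Q a) b)) (v (mic (mes Q a) b)) : c00" using v unfolding cell_vec_def scc_on_def by (elim exE conjE) (rule c00_lincomb, blast+)
   qed
  qed
  thus ?thesis unfolding avg_def by (simp add: mult_ac)
 qed
 have ma: "?m * dot (eval T) (mes_vec v (mes Q a)) <= (227 + 64 + 64) * \<eta> + 32 * ?m * ?bad3 a + 32 * avg (mics (mes Q a)) (coef2 (mes Q a))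
   (%b. avg (slots (mic (mes Q a) b)) (coef1 (mic (mes Q a) b)) (%c. chv Q a b c T))" if a: "a : mesos Q" for a
 proof -
  let ?K = "mes Q a"
  let ?A = "%b. avg (slots (mic ?K b)) (coef1 (mic ?K b))"
  obtain n2 eps2 where s2: "scc_on n2 eps2 (%b. beg (mic ?K b)) (mics ?K) (coef2 ?K)" using sc2[OF a] by blast
  have mm: "1 <= rm (wm ?K)" using real_mseq_ge[of "wm ?K"] qr[OF a] q2 by linarith
  have inner: "?m * ?A b (%c. hitv ?K b c T) <= ?m * ?bad3 a + 4 * \<eta> + ?A b (%c. chv Q a b c T)" if b: "b : mics ?K" for b
  proof -
   let ?M = "mic ?K b"
   obtain n1 eps1 \<rho> where s1: "scc_on n1 eps1 (lft ?M) (slots ?M) (coef1 ?M)" and e1: "?m * rm (wm ?K) * eps1 <= \<eta>"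
     and rho: "\<rho> + 2 <= n1 - 1" "ALL e<beg ?M. rho l e <= \<rho>" using mio(1)[OF a b] unfolding micro_ok_def by blast
   have L: "2 * L <= beg ?M" using mio(1)[OF a b] unfolding micro_ok_def by blast
   have sep1: "rgt ?M c < lft ?M c'" if "c : slots ?M" "c' : slots ?M" "c < c'" for c c' using mio(1)[OF a b] that unfolding micro_ok_def by blast
   have ES: "Ends (wm ?K) (beg ?M) L T \<inter> {beg ?M..} : schreier (\<rho> + 2)" by (rule Ends_schreier[OF T _ L]) (use rho(2) in blast)
   have b4: "?A b (?bad4 a b) <= 2 * eps1" unfolding avg_indicator[OF s1] by (rule scc_on_hits[OF s1 sep1 ES rho(1)])
   have "0 <= ?A b (?bad4 a b)" unfolding avg_def using s1 by (intro sum_nonneg mult_nonneg_nonneg ind(3)) (simp add: scc_on_def)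
   hence e10: "0 <= eps1" using b4 by simp
   have "?m * eps1 * 1 <= ?m * eps1 * rm (wm ?K)" using e10 mm by (intro mult_left_mono) simp_all
   hence e1': "?m * eps1 <= \<eta>" using e1 by (simp add: mult_ac)
   have "?m * ?A b (%c. hitv ?K b c T) = ?A b (%c. ?m * hitv ?K b c T)" by (simp only: avg_cmult)
   also have "... <= ?A b (%c. ?m * ?bad3 a + ?m * ?bad4 a b c + 2 * \<eta> + chv Q a b c T)" by (rule avg_mono[OF s1 hb[OF a b]])
   also have "... = ?m * ?bad3 a + ?m * ?A b (?bad4 a b) + 2 * \<eta> + ?A b (%c. chv Q a b c T)" by (simp only: avg_add avg_cmult avg_const[OF s1])
   also have "?m * ?A b (?bad4 a b) <= ?m * (2 * eps1)" by (rule mult_left_mono[OF b4]) simp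
   finally show ?thesis using e1' by simp
  qed
  have "32 * ?m * avg (mics ?K) (coef2 ?K) (%b. ?A b (%c. hitv ?K b c T)) = 32 * avg (mics ?K) (coef2 ?K) (%b. ?m * ?A b (%c. hitv ?K b c T))"
   by (simp only: avg_cmult mult.assoc)
  also have "... <= 32 * avg (mics ?K) (coef2 ?K) (%b. ?m * ?bad3 a + 4 * \<eta> + ?A b (%c. chv Q a b c T))" using avg_mono[OF s2 inner] by simp
  also have "... = 32 * (?m * ?bad3 a + 4 * \<eta> + avg (mics ?K) (coef2 ?K) (%b. ?A b (%c. chv Q a b c T)))" by (simp only: avg_add avg_cmult avg_const[OF s2])
  finally show ?thesis using meso_estimate[OF _ T v, of ?q L \<eta> ?K] bspec[OF ok a] by (simp add: algebra_simps del: if_split)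
 qed
 have "avg (mesos Q) (coef3 Q) (%a. ?m * dot (eval T) (mes_vec v (mes Q a))) <= avg (mesos Q) (coef3 Q)
   (%a. (227 + 64 + 64) * \<eta> + 32 * ?m * ?bad3 a + 32 * avg (mics (mes Q a)) (coef2 (mes Q a))
   (%b. avg (slots (mic (mes Q a) b)) (coef1 (mic (mes Q a) b)) (%c. chv Q a b c T)))" by (rule avg_mono[OF scc ma])
 also have "... = (227 + 64 + 64) * \<eta> + 32 * ?m * avg (mesos Q) (coef3 Q) ?bad3 + 32 * avg3 Q (%a b c. chv Q a b c T)"
  unfolding avg3_def by (simp only: avg_add avg_cmult avg_const[OF scc])
 also have "avg (mesos Q) (coef3 Q) ?bad3 <= 2 * eps"
 proof (rule own_weights_small[OF scc sep(1) good_xstep T n, where Q = "%a w. w = wm (mes Q a)"])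
  fix a a' t assume "a : mesos Q" "a' : mesos Q" "wt t = wm (mes Q a)" "wt t = wm (mes Q a')"
  thus "a = a'" using sep(2)[of a a'] sep(2)[of a' a] by (metis less_irrefl linorder_neqE_nat)
 qed
 finally have "avg (mesos Q) (coef3 Q) (%a. ?m * dot (eval T) (mes_vec v (mes Q a))) <=
   (227 + 64 + 64) * \<eta> + 32 * ?m * (2 * eps) + 32 * avg3 Q (%a b c. chv Q a b c T)" using m1 by (simp add: mult_left_mono)
 thus ?thesis unfolding dm using sm(1) by simp
qed

end

section \<open>Sequences of iterated averages\<close>

lemma lincomb_cong: "(\<And>i. i : I ==> a i = a' i) ==> (\<And>i. i : I ==> f i = f' i) ==> lincomb I a f = lincomb I a' f'" unfolding lincomb_def by (auto intro!: sum.cong ext)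

lemma family_mins:
 assumes I: "finite I" and c: "\<And>k. k : I ==> finite (S k)" "\<And>k. k : I ==> S k \<subseteq> {s k..e k}"
  and sep: "\<And>k k'. k : I ==> k' : I ==> k < k' ==> e k < s k'" and sch: "s ` I : schreier m"
 shows "disjoint_family_on S I" "min_set I S : schreier m"
proof -
 have lt: "x < y" if "k : I" "k' : I" "k < k'" "x : S k" "y : S k'" for k k' x y using sep[OF that(1-3)] c(2)[OF that(1)] c(2)[OF that(2)] that(4,5) by fastforce
 show "disjoint_family_on S I" unfolding disjoint_family_on_def
 proof (intro ballI impI, rule ccontr)
  fix k k' assume k: "k : I" "k' : I" "k ~= k'" "S k \<inter> S k' ~= {}"
  then obtain x where "x : S k" "x : S k'" by blast
  thus False using lt[of k k' x x] lt[of k' k x x] k by (meson less_irrefl linorder_neqE_nat)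
 qed
 let ?I = "{k\<in>I. S k ~= {}}"
 have se: "s k <= e k" if "k : ?I" for k using c(2)[of k] that by fastforce
 show "min_set I S : schreier m" unfolding min_set_eq
 proof (rule schreier_spread[where \<beta> = s])
  show "inj_on s ?I"
  proof (rule inj_onI)
   fix k k' assume k: "k : ?I" "k' : ?I" "s k = s k'"
   have "\<not> k < k'" "\<not> k' < k" using sep[of k k'] sep[of k' k] se[OF k(1)] se[OF k(2)] k by auto
   thus "k = k'" by simp
  qed
  show "s ` ?I : schreier m" by (rule schreier_subset[OF sch]) blast
  fix k assume k: "k : ?I"
  have "Min (S k) : S k" by (rule Min_in) (use c(1) k in auto)
  thus "s k <= Min (S k)" using c(2)[of k] k by auto
 qed (use I in simp)
qed

context cr_space begin

lemma sum_disjoint_abs: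
 assumes "finite I" "disjoint_family_on (%i. supp (f i)) I"
 shows "(%t. \<bar>lincomb I a f t\<bar>) = lincomb I (%i. \<bar>a i\<bar>) (%i t. \<bar>f i t\<bar>)"
proof
 fix t
 obtain i0 where i0: "\<And>i. i : I ==> i ~= i0 ==> f i t = 0" using disjoint_one_nonzero[OF assms(2)] by blast
 show "\<bar>lincomb I a f t\<bar> = lincomb I (%i. \<bar>a i\<bar>) (%i t. \<bar>f i t\<bar>) t" unfolding lincomb_def
  by (subst (1 2) sum_one_nonzero[OF assms(1), of i0]) (use i0 in "auto simp: abs_mult")
qed

lemma ch_le_1: "valid T ==> ch q r P p R T <= 1"
proof (induction T rule: valid.induct)
 case (Leaf n)
 thus ?case by simp
next
 case (Gam j I c)
 show ?case
 proof (cases "0 < ch q r P p R (Gam j I c)")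
  case True
  have m: "1 <= rm (2 * j)" using mseq_pos[of "2 * j"] Gam.hyps(1) by simp
  show ?thesis using ch_Gam_attained[OF Gam.hyps(2) True]
  proof (elim disjE conjE bexE)
   fix i assume i: "i : I" "ch q r P p R (Gam j I c) = ch q r P p R (c i) / rm (2 * j)" "0 < ch q r P p R (c i)"
   have "ch q r P p R (c i) / rm (2 * j) <= 1 / 1" by (rule frac_le) (use Gam.IH[OF i(1)] i(3) m in auto)
   thus ?thesis unfolding i(2) by simp
  qed simp
 qed simp
next
 case (Del j d K h J A E)
 let ?T = "Del j d J K h A E"
 show ?case
 proof (cases "0 < ch q r P p R ?T")
  case True
  have m: "1 <= rm w" if "1 <= w" for w using mseq_pos[OF that] by simp
  from ch_Del_attained[OF Del.hyps(3) True] obtain s k where sk: "s : {1..d}" "k : K s" and alt: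
   "(s = 1 & 0 < pmx q (hit r R p) (h 1 k) & ch q r P p R ?T = pmx q (hit r R p) (h 1 k) / rm (2 * j + 1)) \<or>
   (0 < ch q r P p R (h s k) & ch q r P p R ?T = ch q r P p R (h s k) / rm (2 * J s) / rm (2 * j + 1))" by blast
  have J: "1 <= 2 * J s" using depcD(3)[OF Del.hyps(3)] sk(1) by force
  from alt show ?thesis
  proof
   assume a: "s = 1 & 0 < pmx q (hit r R p) (h 1 k) & ch q r P p R ?T = pmx q (hit r R p) (h 1 k) / rm (2 * j + 1)"
   have "pmx q (hit r R p) (h s k) <= 1" using pmx_range[OF Del.hyps(2)[OF sk]] hit_range by blast
   hence "pmx q (hit r R p) (h 1 k) / rm (2 * j + 1) <= 1 / 1" by (intro frac_le) (use a m[of "2 * j + 1"] in auto)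
   thus ?thesis using a by linarith
  next
   assume a: "0 < ch q r P p R (h s k) & ch q r P p R ?T = ch q r P p R (h s k) / rm (2 * J s) / rm (2 * j + 1)"
   have "ch q r P p R (h s k) / rm (2 * J s) <= 1 / 1" by (rule frac_le) (use a Del.IH[OF sk] m[OF J] in auto)
   hence "ch q r P p R (h s k) / rm (2 * J s) / rm (2 * j + 1) <= 1 / 1" by (intro frac_le) (use a m[of "2 * j + 1"] in auto)
   thus ?thesis using a by linarith
  qed
 qed simp
qed

section \<open>Norming trees of the iterated averages\<close>

definition nf :: "real => (micro => nat => vec) => micro => tree" where
 "nf \<eta> v M = (SOME T. normed_by \<eta> v M T)"

lemma nf: "micro_ok q r L \<eta> M ==> v : {xa, ya} ==> normed_by \<eta> v M (nf \<eta> v M)" unfolding nf_def by (rule someI_ex) (unfold micro_ok_def, blast)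

lemma micro_cell:
 assumes "micro_ok q r L \<eta> M" "c : slots M"
 shows "cell M c \<subseteq> {beg M..fin M}" "beg M <= fin M" "c' : slots M ==> c < c' ==> rgt M c < lft M c'"
proof -
 have r: "beg M <= lft M c & lft M c <= rgt M c & rgt M c <= fin M" and
  s: "ALL c:slots M. ALL c':slots M. c < c' --> rgt M c < lft M c'" using assms unfolding micro_ok_def by blast+
 show "cell M c \<subseteq> {beg M..fin M}" "beg M <= fin M" using r by auto
 show "c' : slots M ==> c < c' ==> rgt M c < lft M c'" using s assms(2) by blast
qed

lemma meso_mic:
 assumes "meso_ok q L \<eta> K" "b : mics K"
 shows "micro_ok q (wm K) L \<eta> (mic K b)" "mbeg K <= beg (mic K b)" "fin (mic K b) <= mfin K"
  "b' : mics K ==> b < b' ==> fin (mic K b) < beg (mic K b')" using assms unfolding meso_ok_def by blast+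

lemma macro_mes:
 assumes "macro_ok \<eta> Q" "a : mesos Q"
 shows "EX L. meso_ok (wq Q) L \<eta> (mes Q a)" "qbeg Q <= mbeg (mes Q a)" "mfin (mes Q a) <= qfin Q"
  "a' : mesos Q ==> a < a' ==> mfin (mes Q a) < mbeg (mes Q a')"
  "a' : mesos Q ==> a < a' ==> wm (mes Q a) < wm (mes Q a')" using assms unfolding macro_ok_def by blast+

text \<open>The norming trees of the micro averages are restricted to \<open>G\<close> and put under
  one node of weight \<open>wm K\<close>; their starting points are a spread of part of the left
  ends of the micro averages. This yields \<open>kappa_item\<close> of the locale
  \<open>cells\<close>.\<close>

lemma meso_item:
 assumes K: "meso_ok q L \<eta> K" and v: "v : {xa, ya}"
 shows "EX T. valid T & tsupp T \<subseteq> G \<inter> {mbeg K..mfin K} &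
  (ALL b:mics K. ALL n:G. eval (nf \<eta> v (mic K b)) n / rm (wm K) <= eval T n)"
proof -
 obtain j where j: "j : L1" "wm K = 2 * j" using K unfolding meso_ok_def by blast
 have j1: "1 <= j" by (rule L1_pos[OF j(1)])
 obtain n eps where scc: "scc_on n eps (%b. beg (mic K b)) (mics K) (coef2 K)" and n: "n <= nseq (wm K) - 1" using K unfolding meso_ok_def by blast
 have fK: "finite (mics K)" and sch: "(%b. beg (mic K b)) ` mics K : schreier n" using scc unfolding scc_on_def by blast+
 have nfb: "normed_by \<eta> v (mic K b) (nf \<eta> v (mic K b))" if "b : mics K" for b by (rule nf[OF meso_mic(1)[OF K that] v])
 have "ALL b:mics K. EX T. valid T & eval T = proj G (eval (nf \<eta> v (mic K b)))" using valid_proj nfb unfolding normed_by_def by blast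
 from bchoice[OF this] obtain c where c: "ALL b:mics K. valid (c b) & eval (c b) = proj G (eval (nf \<eta> v (mic K b)))" ..
 have sub: "tsupp (c b) \<subseteq> G \<inter> {beg (mic K b)..fin (mic K b)}" if b: "b : mics K" for b
 proof -
  have "tsupp (c b) = tsupp (nf \<eta> v (mic K b)) \<inter> G" using bspec[OF c b] by (simp add: supp_proj)
  moreover have "tsupp (nf \<eta> v (mic K b)) \<subseteq> (UN k:slots (mic K b). cell (mic K b) k)" using nfb[OF b] unfolding normed_by_def by blast
  moreover have "(UN k:slots (mic K b). cell (mic K b) k) \<subseteq> {beg (mic K b)..fin (mic K b)}" by (intro UN_least micro_cell(1)[OF meso_mic(1)[OF K b]])
  ultimately show ?thesis by blast
 qed
 have vc: "valid (c b)" if "b : mics K" for b using bspec[OF c that] ..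
 note fm = family_mins[OF fK, of "%b. tsupp (c b)" "%b. beg (mic K b)" "%b. fin (mic K b)" n]
 have al: "allowable (SN (2 * j)) (mics K) (%b. tsupp (c b))" unfolding allowable_def
 proof (intro conjI ballI)
  show fin: "finite (tsupp (c b))" if "b : mics K" for b by (rule valid_finite[OF vc[OF that]])
  have s2: "tsupp (c b) \<subseteq> {beg (mic K b)..fin (mic K b)}" if "b : mics K" for b using sub[OF that] by blast
  show "disjoint_family_on (%b. tsupp (c b)) (mics K)" by (rule fm(1)[OF fin s2 meso_mic(4)[OF K] sch])
  have "min_set (mics K) (%b. tsupp (c b)) : schreier n" by (rule fm(2)[OF fin s2 meso_mic(4)[OF K] sch])
  moreover have "schreier n \<subseteq> SN (2 * j)" by (rule schreier_mono) (use n j(2) in simp)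
  ultimately show "min_set (mics K) (%b. tsupp (c b)) : SN (2 * j)" by blast
 qed (rule fK)
 let ?T = "Gam j (mics K) c"
 have T: "valid ?T" by (rule valid.Gam[OF j1 fK vc al])
 show ?thesis
 proof (intro exI[of _ ?T] conjI ballI)
  show "tsupp ?T \<subseteq> G \<inter> {mbeg K..mfin K}"
  proof
   fix t assume "t : tsupp ?T"
   then obtain b where b: "b : mics K" "t : tsupp (c b)" using chs_supp[OF T] j1 by auto
   thus "t : G \<inter> {mbeg K..mfin K}" using sub[OF b(1)] meso_mic(2,3)[OF K b(1)] by fastforce
  qed
  fix b n assume b: "b : mics K" "n : G"
  have "eval (nf \<eta> v (mic K b)) n = eval (c b) n" using bspec[OF c b(1)] b(2) by (simp add: proj_def)
  thus "eval (nf \<eta> v (mic K b)) n / rm (wm K) <= eval ?T n" using chs_eval_ge[OF T, of "c b" n] b(1) j(2) by simp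
 qed (rule T)
qed

text \<open>The trees of \<open>meso_item\<close> are left as a family of order n_q - 1 instead of
  being joined, since they will be inserted into a node which has children already. This yields
  \<open>region_item\<close> of the locale \<open>cells\<close>.\<close>

lemma macro_item:
 assumes Q: "macro_ok \<eta> Q" and v: "v : {xa, ya}"
 shows "EX c. finite (mesos Q) & (ALL a:mesos Q. valid (c a)) & disjoint_family_on (%a. tsupp (c a)) (mesos Q) &
  min_set (mesos Q) (%a. tsupp (c a)) : schreier (nseq (wq Q) - 1) & (UN a:mesos Q. tsupp (c a)) \<subseteq> G &
  (ALL a:mesos Q. ALL b:mics (mes Q a). ALL n:G. eval (nf \<eta> v (mic (mes Q a) b)) n / rm (wm (mes Q a)) <= eval (c a) n)"
proof -
 obtain n eps where scc: "scc_on n eps (%a. mbeg (mes Q a)) (mesos Q) (coef3 Q)" and n: "n <= nseq (wq Q) - 1" using Q unfolding macro_ok_def by blast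
 have fQ: "finite (mesos Q)" and sch: "(%a. mbeg (mes Q a)) ` mesos Q : schreier n" using scc unfolding scc_on_def by blast+
 have "ALL a:mesos Q. EX T. valid T & tsupp T \<subseteq> G \<inter> {mbeg (mes Q a)..mfin (mes Q a)} &
  (ALL b:mics (mes Q a). ALL n:G. eval (nf \<eta> v (mic (mes Q a) b)) n / rm (wm (mes Q a)) <= eval T n)" using macro_mes(1)[OF Q] meso_item[OF _ v] by blast
 from bchoice[OF this] obtain c where c: "ALL a:mesos Q. valid (c a) & tsupp (c a) \<subseteq> G \<inter> {mbeg (mes Q a)..mfin (mes Q a)} &
  (ALL b:mics (mes Q a). ALL n:G. eval (nf \<eta> v (mic (mes Q a) b)) n / rm (wm (mes Q a)) <= eval (c a) n)" ..
 have vc: "valid (c a)" and sub: "tsupp (c a) \<subseteq> {mbeg (mes Q a)..mfin (mes Q a)}" "tsupp (c a) \<subseteq> G" if "a : mesos Q" for a using bspec[OF c that] by blast+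
 note fm = family_mins[OF fQ, of "%a. tsupp (c a)" "%a. mbeg (mes Q a)" "%a. mfin (mes Q a)" n, OF valid_finite[OF vc] sub(1) macro_mes(4)[OF Q] sch]
 have "schreier n \<subseteq> schreier (nseq (wq Q) - 1)" by (rule schreier_mono[OF n])
 hence "min_set (mesos Q) (%a. tsupp (c a)) : schreier (nseq (wq Q) - 1)" using fm(2) by blast
 thus ?thesis using fQ vc sub(2) fm(1) c by (intro exI[of _ c]) blast
qed

lemma macro_cell_vec:
 assumes Q: "macro_ok \<eta> Q" and v: "v : {xa, ya}" and a: "a : mesos Q" "b : mics (mes Q a)" "c : slots (mic (mes Q a) b)"
 shows "v (mic (mes Q a) b) c : c00" "\<And>n. 0 <= v (mic (mes Q a) b) c n" "supp (v (mic (mes Q a) b) c) \<subseteq> cell (mic (mes Q a) b) c"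
  "N (v (mic (mes Q a) b) c) <= 1"
proof -
 obtain L where K: "meso_ok (wq Q) L \<eta> (mes Q a)" using macro_mes(1)[OF Q a(1)] ..
 note M = meso_mic(1)[OF K a(2)]
 obtain \<mu> where "ALL v:{xa, ya}. ALL c:slots (mic (mes Q a) b). cell_vec \<mu> v (mic (mes Q a) b) c" using M unfolding micro_ok_def by blast
 hence "cell_vec \<mu> v (mic (mes Q a) b) c" using v a(3) by blast
 thus "v (mic (mes Q a) b) c : c00" "\<And>n. 0 <= v (mic (mes Q a) b) c n" "supp (v (mic (mes Q a) b) c) \<subseteq> cell (mic (mes Q a) b) c"
  "N (v (mic (mes Q a) b) c) <= 1" unfolding cell_vec_def by blast+
qed

lemma macro_scc:
 assumes Q: "macro_ok \<eta> Q"
 shows "EX n eps. scc_on n eps (%a. mbeg (mes Q a)) (mesos Q) (coef3 Q)"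
  "a : mesos Q ==> EX n eps. scc_on n eps (%b. beg (mic (mes Q a) b)) (mics (mes Q a)) (coef2 (mes Q a))"
  "a : mesos Q ==> b : mics (mes Q a) ==> EX n eps. scc_on n eps (lft (mic (mes Q a) b)) (slots (mic (mes Q a) b)) (coef1 (mic (mes Q a) b))"
proof -
 show "EX n eps. scc_on n eps (%a. mbeg (mes Q a)) (mesos Q) (coef3 Q)" using Q unfolding macro_ok_def by blast
 assume a: "a : mesos Q"
 obtain L where K: "meso_ok (wq Q) L \<eta> (mes Q a)" using macro_mes(1)[OF Q a] ..
 show "EX n eps. scc_on n eps (%b. beg (mic (mes Q a) b)) (mics (mes Q a)) (coef2 (mes Q a))" using K unfolding meso_ok_def by blast
 assume b: "b : mics (mes Q a)"
 show "EX n eps. scc_on n eps (lft (mic (mes Q a) b)) (slots (mic (mes Q a) b)) (coef1 (mic (mes Q a) b))" using meso_mic(1)[OF K b] unfolding micro_ok_def by blast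
qed

lemma scc_finite: "scc_on n eps p F b ==> finite F" by (simp add: scc_on_def)

lemma macro_dot:
 assumes Q: "macro_ok \<eta> Q" and v: "v : {xa, ya}"
 shows "dot f (mac_vec v Q) = avg3 Q (%a b c. rm (wq Q) * rm (wm (mes Q a)) * dot f (v (mic (mes Q a) b) c))"
  "mac_vec v Q : c00"
proof -
 let ?M = "%a b. mic (mes Q a) b"
 have f3: "finite (mesos Q)" using macro_scc(1)[OF Q] scc_finite by blast
 have f2: "finite (mics (mes Q a))" if "a : mesos Q" for a using macro_scc(2)[OF Q that] scc_finite by blast
 have f1: "finite (slots (?M a b))" if "a : mesos Q" "b : mics (mes Q a)" for a b using macro_scc(3)[OF Q that] scc_finite by blast
 have c1: "mic_vec v (?M a b) : c00" if "a : mesos Q" "b : mics (mes Q a)" for a b unfolding mic_vec_def by (rule c00_lincomb[OF f1[OF that] macro_cell_vec(1)[OF Q v that]])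
 have c2: "mes_vec v (mes Q a) : c00" if "a : mesos Q" for a unfolding mes_vec_def by (rule c00_lincomb[OF f2[OF that] c1[OF that]])
 show "mac_vec v Q : c00" unfolding mac_vec_def by (rule c00_lincomb[OF f3 c2])
 have d1: "dot f (mic_vec v (?M a b)) = avg (slots (?M a b)) (coef1 (?M a b)) (%c. dot f (v (?M a b) c))" if "a : mesos Q" "b : mics (mes Q a)" for a b
  unfolding mic_vec_def avg_def by (rule dot_lincomb[OF f1[OF that] macro_cell_vec(1)[OF Q v that]])
 have d2: "dot f (mes_vec v (mes Q a)) = rm (wm (mes Q a)) * avg (mics (mes Q a)) (coef2 (mes Q a)) (%b. avg (slots (?M a b)) (coef1 (?M a b)) (%c. dot f (v (?M a b) c)))"
  if a: "a : mesos Q" for a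
 proof -
  have "dot f (mes_vec v (mes Q a)) = (SUM b:mics (mes Q a). rm (wm (mes Q a)) * coef2 (mes Q a) b * dot f (mic_vec v (?M a b)))"
   unfolding mes_vec_def by (rule dot_lincomb[OF f2[OF a] c1[OF a]])
  also have "... = (SUM b:mics (mes Q a). rm (wm (mes Q a)) * (coef2 (mes Q a) b * avg (slots (?M a b)) (coef1 (?M a b)) (%c. dot f (v (?M a b) c))))"
   by (rule sum.cong[OF refl]) (simp add: d1[OF a])
  finally show ?thesis unfolding avg_def[of "mics (mes Q a)"] sum_distrib_left .
 qed
 have "dot f (mac_vec v Q) = (SUM a:mesos Q. rm (wq Q) * coef3 Q a * dot f (mes_vec v (mes Q a)))" unfolding mac_vec_def by (rule dot_lincomb[OF f3 c2])
 also have "... = (SUM a:mesos Q. coef3 Q a * (rm (wq Q) * rm (wm (mes Q a)) * avg (mics (mes Q a)) (coef2 (mes Q a)) (%b. avg (slots (?M a b)) (coef1 (?M a b)) (%c. dot f (v (?M a b) c)))))"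
  by (rule sum.cong[OF refl]) (simp add: d2)
 finally show "dot f (mac_vec v Q) = avg3 Q (%a b c. rm (wq Q) * rm (wm (mes Q a)) * dot f (v (?M a b) c))" unfolding avg3_def avg_cmult avg_def[of "mesos Q"] .
qed

lemma avg3_mono:
 assumes Q: "macro_ok \<eta> Q" and h: "\<And>a b. a : mesos Q ==> b : mics (mes Q a) ==>
   avg (slots (mic (mes Q a) b)) (coef1 (mic (mes Q a) b)) (f a b) <= avg (slots (mic (mes Q a) b)) (coef1 (mic (mes Q a) b)) (g a b) + e"
 shows "avg3 Q f <= avg3 Q g + e"
proof -
 let ?A = "%a b f. avg (slots (mic (mes Q a) b)) (coef1 (mic (mes Q a) b)) f"
 obtain n eps where s3: "scc_on n eps (%a. mbeg (mes Q a)) (mesos Q) (coef3 Q)" using macro_scc(1)[OF Q] by blast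
 have "avg3 Q f <= avg (mesos Q) (coef3 Q) (%a. avg (mics (mes Q a)) (coef2 (mes Q a)) (%b. ?A a b (g a b)) + e)" unfolding avg3_def
 proof (rule avg_mono[OF s3])
  fix a assume a: "a : mesos Q"
  obtain n' eps' where s2: "scc_on n' eps' (%b. beg (mic (mes Q a) b)) (mics (mes Q a)) (coef2 (mes Q a))" using macro_scc(2)[OF Q a] by blast
  have "avg (mics (mes Q a)) (coef2 (mes Q a)) (%b. ?A a b (f a b)) <= avg (mics (mes Q a)) (coef2 (mes Q a)) (%b. ?A a b (g a b) + e)" by (rule avg_mono[OF s2 h[OF a]])
  thus "avg (mics (mes Q a)) (coef2 (mes Q a)) (%b. ?A a b (f a b)) <= avg (mics (mes Q a)) (coef2 (mes Q a)) (%b. ?A a b (g a b)) + e" by (simp only: avg_add avg_const[OF s2])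
 qed
 thus ?thesis unfolding avg3_def by (simp only: avg_add avg_const[OF s3])
qed

text \<open>The almost norming functionals of the \<open>micro\<close> averages may be damped by factors in \<open>[0, 1]\<close>.\<close>

lemma macro_lower:
 assumes Q: "macro_ok \<eta> Q" and v: "v : {xa, ya}" and G: "valid G"
  and h: "\<And>a b c. 0 <= h a b c & h a b c <= 1"
  and ge: "\<And>a b c n. a : mesos Q ==> b : mics (mes Q a) ==> c : slots (mic (mes Q a) b) ==> n : cell (mic (mes Q a) b) c ==>
   h a b c / rm (wq Q) / rm (wm (mes Q a)) * eval (nf \<eta> v (mic (mes Q a) b)) n <= eval G n"
 shows "avg3 Q h <= dot (eval G) (mac_vec v Q) + \<eta>" unfolding macro_dot(1)[OF Q v]
proof (rule avg3_mono[OF Q])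
 fix a b assume a: "a : mesos Q" and b: "b : mics (mes Q a)"
 let ?M = "mic (mes Q a) b" let ?q = "rm (wq Q)" let ?r = "rm (wm (mes Q a))"
 let ?f = "eval (nf \<eta> v ?M)"
 obtain L where K: "meso_ok (wq Q) L \<eta> (mes Q a)" using macro_mes(1)[OF Q a] ..
 note M = meso_mic(1)[OF K b]
 obtain n1 eps1 where s1: "scc_on n1 eps1 (lft ?M) (slots ?M) (coef1 ?M)" using macro_scc(3)[OF Q a b] by blast
 note nb = nf[OF M v, unfolded normed_by_def]
 note cv = macro_cell_vec[OF Q v a b]
 have w: "1 <= wm (mes Q a)" "1 <= wq Q" using K Q L1_pos unfolding meso_ok_def macro_ok_def by fastforce+
 have qr: "0 < ?q * ?r" using mseq_pos[OF w(1)] mseq_pos[OF w(2)] by simp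
 \<comment> \<open>Each pairing of the norming tree with a single slot vector is at most 1, but only
   their average is known to be at least 1 - \<eta>. The inequality h + \<xi> <= h \<xi> + 1, for h
   and \<xi> at most 1, lets the average be used even though \<open>h\<close> varies.\<close>
 have pt: "h a b c * 1 + dot ?f (v ?M c) <= ?q * ?r * dot (eval G) (v ?M c) + 1" if c: "c : slots ?M" for c
 proof -
  let ?\<xi> = "dot ?f (v ?M c)"
  have x1: "?\<xi> <= 1" using N_tree_upper[of "nf \<eta> v ?M" "v ?M c"] nb cv(4)[OF c] by linarith
  have "dot (%n. h a b c / ?q / ?r * ?f n) (v ?M c) <= dot (eval G) (v ?M c)" by (rule dot_nonneg_mono[OF cv(2)[OF c]]) (rule ge[OF a b c], use cv(3)[OF c] in blast)
  moreover have "dot (%n. h a b c / ?q / ?r * ?f n) (v ?M c) = h a b c * ?\<xi> / (?q * ?r)" unfolding dot_def by (simp add: sum_distrib_left sum_divide_distrib mult_ac)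
  ultimately have "h a b c * ?\<xi> <= ?q * ?r * dot (eval G) (v ?M c)" using qr by (simp add: pos_divide_le_eq mult.commute)
  moreover have "h a b c * (1 - ?\<xi>) <= 1 * (1 - ?\<xi>)" by (rule mult_right_mono) (use h x1 in auto)
  ultimately show ?thesis by (simp add: algebra_simps)
 qed
 have "avg (slots ?M) (coef1 ?M) (%c. h a b c * 1 + dot ?f (v ?M c)) <= avg (slots ?M) (coef1 ?M) (%c. ?q * ?r * dot (eval G) (v ?M c) + 1)" by (rule avg_mono[OF s1 pt])
 hence "avg (slots ?M) (coef1 ?M) (h a b) + avg (slots ?M) (coef1 ?M) (%c. dot ?f (v ?M c)) <= avg (slots ?M) (coef1 ?M) (%c. ?q * ?r * dot (eval G) (v ?M c)) + 1"
  unfolding avg_add avg_const[OF s1] by simp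
 moreover have "avg (slots ?M) (coef1 ?M) (%c. dot ?f (v ?M c)) = dot ?f (mic_vec v ?M)" unfolding mic_vec_def avg_def by (rule dot_lincomb[symmetric, OF scc_finite[OF s1] cv(1)])
 ultimately show "avg (slots ?M) (coef1 ?M) (h a b) <= avg (slots ?M) (coef1 ?M) (%c. ?q * ?r * dot (eval G) (v ?M c)) + \<eta>" using nb by linarith
qed

text \<open>The trees of \<open>macro_item\<close> under one node of weight \<open>wq Q\<close>
  recover the almost norming trees with all factors equal to 1.\<close>

lemma macro_norm:
 assumes Q: "macro_ok \<eta> Q" and v: "v : {xa, ya}"
 shows "1 - \<eta> <= N (mac_vec v Q)"
proof -
 obtain j where j: "j : L1" "wq Q = 2 * j" using Q unfolding macro_ok_def by blast
 have j1: "1 <= j" by (rule L1_pos[OF j(1)])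
 obtain c where c: "finite (mesos Q)" "ALL a:mesos Q. valid (c a)" "disjoint_family_on (%a. tsupp (c a)) (mesos Q)"
  "min_set (mesos Q) (%a. tsupp (c a)) : schreier (nseq (wq Q) - 1)"
  "ALL a:mesos Q. ALL b:mics (mes Q a). ALL n:UNIV. eval (nf \<eta> v (mic (mes Q a) b)) n / rm (wm (mes Q a)) <= eval (c a) n" using macro_item[OF Q v, of UNIV] by blast
 have "schreier (nseq (wq Q) - 1) \<subseteq> SN (2 * j)" by (rule schreier_mono) (simp add: j(2))
 hence al: "allowable (SN (2 * j)) (mesos Q) (%a. tsupp (c a))" unfolding allowable_def using c(1,3,4) valid_finite c(2) by blast
 have G: "valid (Gam j (mesos Q) c)" by (rule valid.Gam[OF j1 c(1) _ al]) (use c(2) in blast)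
 have "avg3 Q (%a b c. 1) <= dot (eval (Gam j (mesos Q) c)) (mac_vec v Q) + \<eta>"
 proof (rule macro_lower[OF Q v G])
  fix a b ca n assume a: "a : mesos Q" "b : mics (mes Q a)"
  have "eval (nf \<eta> v (mic (mes Q a) b)) n / rm (wm (mes Q a)) / rm (wq Q) <= eval (c a) n / rm (wq Q)" using c(5) a by (intro divide_right_mono) auto
  also have "... <= eval (Gam j (mesos Q) c) n" using chs_eval_ge[OF G, of "c a" n] a(1) j(2) by simp
  finally show "1 / rm (wq Q) / rm (wm (mes Q a)) * eval (nf \<eta> v (mic (mes Q a) b)) n <= eval (Gam j (mesos Q) c) n" by (simp add: mult.commute)
 qed simp
 moreover have "avg3 Q (%a b c. 0) <= avg3 Q (%a b c. 1) + - 1"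
 proof (rule avg3_mono[OF Q])
  fix a b assume "a : mesos Q" "b : mics (mes Q a)"
  from macro_scc(3)[OF Q this] show "avg (slots (mic (mes Q a) b)) (coef1 (mic (mes Q a) b)) (%c. 0) <=
   avg (slots (mic (mes Q a) b)) (coef1 (mic (mes Q a) b)) (%c. 1) + - 1" by (elim exE) (simp add: avg_const)
 qed
 moreover have "avg3 Q (%a b c. 0) = 0" by (simp add: avg3_def avg_def)
 ultimately show ?thesis using N_tree_upper[OF G, of "mac_vec v Q"] by linarith
qed

end

text \<open>The tolerances 2^(-i-1) have sum 1. All weights of one macro average lie below those of
  the next, so a weight determines the meso or macro average to which it belongs.\<close>

locale tower = cr_space +
 fixes Q :: "nat => macro"
 assumes Q_ok: "\<And>i. macro_ok ((1/2)^(i + 1)) (Q i)"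
  and Q_sep: "\<And>i i'. i < i' ==> qfin (Q i) < qbeg (Q i')"
  and Q_wt: "\<And>i i'. i < i' ==> wq (Q i) < wq (Q i')" "\<And>i i' a. i < i' ==> a : mesos (Q i) ==> wm (mes (Q i) a) < wq (Q i')"
begin

definition VV :: "(nat \<times> nat \<times> nat \<times> nat) set" where
 "VV = {(i, a, b, c). a : mesos (Q i) & b : mics (mes (Q i) a) & c : slots (mic (mes (Q i) a) b)}"

abbreviation KK :: "nat \<times> nat \<times> nat \<times> nat => meso" where "KK \<nu> \<equiv> mes (Q (fst \<nu>)) (fst (snd \<nu>))"
abbreviation MM :: "nat \<times> nat \<times> nat \<times> nat => micro" where "MM \<nu> \<equiv> mic (KK \<nu>) (fst (snd (snd \<nu>)))"
abbreviation RR :: "nat \<times> nat \<times> nat \<times> nat => nat set" where "RR \<nu> \<equiv> cell (MM \<nu>) (snd (snd (snd \<nu>)))"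
abbreviation rr :: "nat \<times> nat \<times> nat \<times> nat => nat" where "rr \<nu> \<equiv> wm (KK \<nu>)"

abbreviation FF :: "(micro => nat => vec) => nat \<times> nat \<times> nat \<times> nat => nat => real" where
 "FF v \<nu> \<equiv> eval (nf ((1/2)^(fst \<nu> + 1)) v (MM \<nu>))"

lemma VVI: "a : mesos (Q i) ==> b : mics (mes (Q i) a) ==> c : slots (mic (mes (Q i) a) b) ==> (i, a, b, c) : VV" by (simp add: VV_def)

lemma VVD:
 assumes "\<nu> : VV"
 shows "fst (snd \<nu>) : mesos (Q (fst \<nu>))" "fst (snd (snd \<nu>)) : mics (KK \<nu>)" "snd (snd (snd \<nu>)) : slots (MM \<nu>)" using assms by (auto simp: VV_def)

lemma VV_meso: "\<nu> : VV ==> EX L. meso_ok (wq (Q (fst \<nu>))) L ((1/2)^(fst \<nu> + 1)) (KK \<nu>)" by (rule macro_mes(1)[OF Q_ok VVD(1)])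

lemma VV_sub:
 assumes "\<nu> : VV"
 shows "RR \<nu> \<subseteq> {beg (MM \<nu>)..fin (MM \<nu>)}" "RR \<nu> \<subseteq> {mbeg (KK \<nu>)..mfin (KK \<nu>)}"
  "RR \<nu> \<subseteq> {qbeg (Q (fst \<nu>))..qfin (Q (fst \<nu>))}"
proof -
 obtain L where K: "meso_ok (wq (Q (fst \<nu>))) L ((1/2)^(fst \<nu> + 1)) (KK \<nu>)" using VV_meso[OF assms] ..
 note M = meso_mic[OF K VVD(2)[OF assms]]
 show 1: "RR \<nu> \<subseteq> {beg (MM \<nu>)..fin (MM \<nu>)}" by (rule micro_cell(1)[OF M(1) VVD(3)[OF assms]])
 have "{beg (MM \<nu>)..fin (MM \<nu>)} \<subseteq> {mbeg (KK \<nu>)..mfin (KK \<nu>)}" using M(2,3) by auto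
 with 1 show 2: "RR \<nu> \<subseteq> {mbeg (KK \<nu>)..mfin (KK \<nu>)}" by (rule order_trans)
 have "{mbeg (KK \<nu>)..mfin (KK \<nu>)} \<subseteq> {qbeg (Q (fst \<nu>))..qfin (Q (fst \<nu>))}" using macro_mes(2,3)[OF Q_ok VVD(1)[OF assms]] by auto
 with 2 show "RR \<nu> \<subseteq> {qbeg (Q (fst \<nu>))..qfin (Q (fst \<nu>))}" by (rule order_trans)
qed

lemma RR_disj:
 assumes u: "u : VV" and v: "v : VV" and ne: "u ~= v" shows "RR u \<inter> RR v = {}"
proof -
 obtain i a b c where ue: "u = (i, a, b, c)" by (cases u)
 obtain i' a' b' c' where ve: "v = (i', a', b', c')" by (cases v)
 have int: "A \<inter> B = {}" if "A \<subseteq> {s..e}" "B \<subseteq> {s'..e'}" "e < s' \<or> e' < s" for A B :: "nat set" and s e s' e' using that by fastforce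
 note Su = VV_sub[OF u] and Sv = VV_sub[OF v]
 show ?thesis
 proof (cases "i = i'")
  case False
  hence "qfin (Q i) < qbeg (Q i') \<or> qfin (Q i') < qbeg (Q i)" using Q_sep by (meson linorder_neqE_nat)
  thus ?thesis using int[OF Su(3) Sv(3)] by (simp add: ue ve)
 next
  case i: True
  show ?thesis
  proof (cases "a = a'")
   case False
   have "mfin (mes (Q i) a) < mbeg (mes (Q i) a') \<or> mfin (mes (Q i) a') < mbeg (mes (Q i) a)"
    using macro_mes(4)[OF Q_ok, of _ i] VVD(1)[OF u] VVD(1)[OF v] False i ue ve by (metis fst_conv linorder_neqE_nat snd_conv)
   thus ?thesis using int[OF Su(2) Sv(2)] by (simp add: ue ve i)
  next
   case a: True
   obtain L where K: "meso_ok (wq (Q i)) L ((1/2)^(i + 1)) (mes (Q i) a)" using VV_meso[OF u] by (auto simp: ue)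
   show ?thesis
   proof (cases "b = b'")
    case False
    have "fin (mic (mes (Q i) a) b) < beg (mic (mes (Q i) a) b') \<or> fin (mic (mes (Q i) a) b') < beg (mic (mes (Q i) a) b)"
     using meso_mic(4)[OF K] VVD(2)[OF u] VVD(2)[OF v] False i a ue ve by (metis fst_conv linorder_neqE_nat snd_conv)
    thus ?thesis using int[OF Su(1) Sv(1)] by (simp add: ue ve i a)
   next
    case b: True
    let ?M = "mic (mes (Q i) a) b"
    have M: "micro_ok (wq (Q i)) (wm (mes (Q i) a)) L ((1/2)^(i + 1)) ?M" by (rule meso_mic(1)[OF K]) (use VVD(2)[OF u] in "simp add: ue")
    have cc: "c : slots ?M" "c' : slots ?M" using VVD(3)[OF u] VVD(3)[OF v] by (simp_all add: ue ve i a b)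
    have "c ~= c'" using ne ue ve i a b by simp
    hence "rgt ?M c < lft ?M c' \<or> rgt ?M c' < lft ?M c" using micro_cell(3)[OF M cc(1) cc(2)] micro_cell(3)[OF M cc(2) cc(1)] by (meson linorder_neqE_nat)
    thus ?thesis using int[OF order_refl order_refl] by (simp add: ue ve i a b)
   qed
  qed
 qed
qed

text \<open>Meso weights exceed the weight of their macro average, stay below that of the next one
  and increase inside it. Cells of equal weight therefore lie in one meso average, where
  \<open>meso_item\<close> serves them simultaneously.\<close>

lemma rr_inj:
 assumes u: "u : VV" and v: "v : VV" and eq: "rr u = rr v" shows "fst u = fst v & fst (snd u) = fst (snd v)"
proof -
 have q: "wq (Q (fst w)) < rr w" if "w : VV" for w using VV_meso[OF that] unfolding meso_ok_def by blast
 have "\<not> fst w < fst w'" if "w : VV" "w' : VV" "rr w = rr w'" for w w' using Q_wt(2)[OF _ VVD(1)[OF that(1)], of "fst w'"] q[OF that(2)] that(3) by linarith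
 hence i: "fst u = fst v" using u v eq by (metis linorder_neqE_nat)
 moreover have "fst (snd u) = fst (snd v)" using macro_mes(5)[OF Q_ok VVD(1)[OF u], of "fst (snd v)"] macro_mes(5)[OF Q_ok VVD(1)[OF v], of "fst (snd u)"] VVD(1)[OF u] VVD(1)[OF v] eq i
  by (metis less_irrefl linorder_neqE_nat)
 ultimately show ?thesis ..
qed

text \<open>Regions are the macro averages and cells are the slots. Between the left and the right
  sequence only \<open>FF v\<close> changes, while positions, weights and hence the charges
  coincide.\<close>

lemma cells_tower:
 assumes v: "v : {xa, ya}"
 shows "cells l L1 L2 \<sigma> VV fst RR (%\<nu>. beg (MM \<nu>)) (%i. wq (Q i)) rr (%i. qfin (Q i)) (FF v)"
proof (unfold_locales)
 show "RR u \<inter> RR w = {}" if "u : VV" "w : VV" "u ~= w" for u w by (rule RR_disj[OF that])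
 show "beg (MM \<nu>) <= n" if "\<nu> : VV" "n : RR \<nu>" for \<nu> n using VV_sub(1)[OF that(1)] that(2) by auto
 show "EX j:L1. wq (Q i) = 2 * j" for i using Q_ok[of i] unfolding macro_ok_def by blast
 show "EX j:L1. rr \<nu> = 2 * j" "wq (Q (fst \<nu>)) < rr \<nu>" if "\<nu> : VV" for \<nu> using VV_meso[OF that] unfolding meso_ok_def by blast+
 show "wq (Q i) < wq (Q i')" if "i < i'" for i i' by (rule Q_wt(1)[OF that])
 show "RR \<nu> \<subseteq> {..qfin (Q (fst \<nu>))}" if "\<nu> : VV" for \<nu> using VV_sub(3)[OF that] by auto
 show "qfin (Q i) < n" if "\<nu> : VV" "i < fst \<nu>" "n : RR \<nu>" for \<nu> i n using Q_sep[OF that(2)] VV_sub(3)[OF that(1)] that(3) by fastforce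
 show "nseq (wq (Q (fst \<nu>))) < n" if "\<nu> : VV" "n : RR \<nu>" for \<nu> n
 proof -
  have "nseq (wq (Q (fst \<nu>))) < qbeg (Q (fst \<nu>))" using Q_ok[of "fst \<nu>"] unfolding macro_ok_def by blast
  also have "... <= n" using VV_sub(3)[OF that(1)] that(2) by auto
  finally show ?thesis .
 qed
 show "0 <= FF v \<nu> n" for \<nu> n by (rule eval_nonneg)
 show "EX T. valid T & tsupp T \<subseteq> (UN \<nu>:H. RR \<nu>) & (ALL \<nu>:H. ALL n:RR \<nu>. FF v \<nu> n / rm w <= eval T n)"
  if H: "H \<subseteq> {\<nu>\<in>VV. rr \<nu> = w}" "finite H" for w H
 proof (cases "H = {}")
  case True
  thus ?thesis using valid_zero[of Leaf] by (intro exI[of _ "Gam 1 {} Leaf"]) (simp add: lincomb_def)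
 next
  case False
  then obtain u where u: "u : H" by blast
  have uV: "u : VV" "rr u = w" using u H(1) by blast+
  obtain L where K: "meso_ok (wq (Q (fst u))) L ((1/2)^(fst u + 1)) (KK u)" using VV_meso[OF uV(1)] ..
  obtain T where T: "valid T" "tsupp T \<subseteq> (UN \<nu>:H. RR \<nu>) \<inter> {mbeg (KK u)..mfin (KK u)}"
    "ALL b:mics (KK u). ALL n:(UN \<nu>:H. RR \<nu>). eval (nf ((1/2)^(fst u + 1)) v (mic (KK u) b)) n / rm (rr u) <= eval T n"
   using meso_item[OF K v, of "UN \<nu>:H. RR \<nu>"] by (elim exE conjE)
  show ?thesis
  proof (intro exI[of _ T] conjI ballI)
   show "tsupp T \<subseteq> (UN \<nu>:H. RR \<nu>)" using T(2) by blast
   fix \<nu> n assume n: "\<nu> : H" "n : RR \<nu>"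
   have \<nu>: "\<nu> : VV" "rr \<nu> = w" using n(1) H(1) by blast+
   have "rr \<nu> = rr u" using \<nu>(2) uV(2) by simp
   from rr_inj[OF \<nu>(1) uV(1) this] have e: "fst \<nu> = fst u" "fst (snd \<nu>) = fst (snd u)" by blast+
   have b: "fst (snd (snd \<nu>)) : mics (KK u)" using VVD(2)[OF \<nu>(1)] unfolding e .
   have nU: "n : (UN \<nu>:H. RR \<nu>)" using n by blast
   show "FF v \<nu> n / rm w <= eval T n" using bspec[OF bspec[OF T(3) b] nU] unfolding e uV(2) .
  qed (rule T(1))
 qed
 show "EX I c. finite (I::nat set) & (ALL k:I. valid (c k)) & disjoint_family_on (%k. tsupp (c k)) I &
    min_set I (%k. tsupp (c k)) : schreier (nseq (wq (Q i)) - 1) & (UN k:I. tsupp (c k)) \<subseteq> (UN \<nu>:H. RR \<nu>) &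
    (ALL \<nu>:H. EX k:I. ALL n:RR \<nu>. FF v \<nu> n / rm (rr \<nu>) <= eval (c k) n)"
  if H: "H \<subseteq> {\<nu>\<in>VV. fst \<nu> = i}" "finite H" for i H
 proof -
  obtain c where cc: "finite (mesos (Q i))"
   "ALL a:mesos (Q i). valid (c a)"
   "disjoint_family_on (%a. tsupp (c a)) (mesos (Q i))"
   "min_set (mesos (Q i)) (%a. tsupp (c a)) : schreier (nseq (wq (Q i)) - 1)"
   "(UN a:mesos (Q i). tsupp (c a)) \<subseteq> (UN \<nu>:H. RR \<nu>)"
   "ALL a:mesos (Q i). ALL b:mics (mes (Q i) a). ALL n:(UN \<nu>:H. RR \<nu>). eval (nf ((1/2)^(i + 1)) v (mic (mes (Q i) a) b)) n / rm (wm (mes (Q i) a)) <= eval (c a) n"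
   using macro_item[OF Q_ok v, of i "UN \<nu>:H. RR \<nu>"] by (elim exE conjE)
  show ?thesis
  proof (intro exI[of _ "mesos (Q i)"] exI[of _ c] conjI)
   show "ALL \<nu>:H. EX k:mesos (Q i). ALL n:RR \<nu>. FF v \<nu> n / rm (rr \<nu>) <= eval (c k) n"
   proof
    fix \<nu> assume n: "\<nu> : H"
    have \<nu>: "\<nu> : VV" "fst \<nu> = i" using n H(1) by blast+
    note D = VVD[OF \<nu>(1), unfolded \<nu>(2)]
    show "EX k:mesos (Q i). ALL n:RR \<nu>. FF v \<nu> n / rm (rr \<nu>) <= eval (c k) n"
    proof (intro bexI[OF _ D(1)] ballI)
     fix k assume "k : RR \<nu>"
     hence "k : (UN \<nu>:H. RR \<nu>)" using n by blast
     from bspec[OF bspec[OF bspec[OF cc(6) D(1)] D(2)] this]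
     show "FF v \<nu> k / rm (rr \<nu>) <= eval (c (fst (snd \<nu>))) k" unfolding \<nu>(2) .
    qed
   qed
  qed (rule cc(1), rule cc(2), rule cc(3), rule cc(4), rule cc(5))
 qed
qed

text \<open>\<open>realize\<close> provides a tree whose value on every cell is at least the charge
  times the almost norming functional, and \<open>macro_lower\<close> converts this into the average
  charge up to the tolerance.\<close>

lemma charge_dominated:
 assumes v: "v : {xa, ya}" and T: "valid T" and I: "finite I" "\<And>i. i : I ==> 0 <= \<alpha> i"
 shows "(SUM i:I. \<alpha> i * avg3 (Q i) (%a b c. chv (Q i) a b c T)) <= N (lincomb I \<alpha> (%i. mac_vec v (Q i))) + (SUM i:I. \<alpha> i * (1/2)^(i + 1))"
proof -
 interpret c: cells l L1 L2 \<sigma> VV fst RR "%\<nu>. beg (MM \<nu>)" "%i. wq (Q i)" rr "%i. qfin (Q i)" "FF v" by (rule cells_tower[OF v])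
 obtain G where G: "c.dominates (c.charged T) (c.charge T) G" using c.realize[OF T] ..
 note GD = c.dominatesD[OF G]
 have "(SUM i:I. \<alpha> i * avg3 (Q i) (%a b c. chv (Q i) a b c T)) <= (SUM i:I. \<alpha> i * (dot (eval G) (mac_vec v (Q i)) + (1/2)^(i + 1)))"
 proof (rule sum_mono, rule mult_left_mono)
  fix i
  show "avg3 (Q i) (%a b c. chv (Q i) a b c T) <= dot (eval G) (mac_vec v (Q i)) + (1/2)^(i + 1)"
  proof (rule macro_lower[OF Q_ok v GD(1)])
   show "0 <= chv (Q i) a b c T & chv (Q i) a b c T <= 1" for a b c using ch_nonneg[OF T] ch_le_1[OF T] by blast
   fix a b c n assume a: "a : mesos (Q i)" "b : mics (mes (Q i) a)" "c : slots (mic (mes (Q i) a) b)" and n: "n : cell (mic (mes (Q i) a) b) c"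
   have \<nu>: "(i, a, b, c) : VV" by (rule VVI[OF a])
   show "chv (Q i) a b c T / rm (wq (Q i)) / rm (wm (mes (Q i) a)) * eval (nf ((1/2)^(i + 1)) v (mic (mes (Q i) a) b)) n <= eval G n"
   proof (cases "0 < chv (Q i) a b c T")
    case True
    hence "(i, a, b, c) : {\<nu>\<in>VV. 0 < c.ch1 \<nu> T}" using \<nu> by simp
    from GD(3)[OF this, of n] n show ?thesis by simp
   next
    case False
    hence "chv (Q i) a b c T = 0" using ch_nonneg[OF T] by (meson antisym_conv1 not_le)
    thus ?thesis by (simp add: eval_nonneg)
   qed
  qed
 qed (use I in simp)
 also have "... = dot (eval G) (lincomb I \<alpha> (%i. mac_vec v (Q i))) + (SUM i:I. \<alpha> i * (1/2)^(i + 1))"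
  by (subst dot_lincomb[OF I(1) macro_dot(2)[OF Q_ok v]]) (simp add: distrib_left sum.distrib)
 also have "dot (eval G) (lincomb I \<alpha> (%i. mac_vec v (Q i))) <= N (lincomb I \<alpha> (%i. mac_vec v (Q i)))" by (rule N_tree_upper[OF GD(1)])
 finally show ?thesis by simp
qed

lemma mac_vec_nonneg: assumes "v : {xa, ya}" shows "0 <= mac_vec v (Q i) t"
proof -
 have c3: "0 <= coef3 (Q i) a" if "a : mesos (Q i)" for a using macro_scc(1)[OF Q_ok] that by (auto simp: scc_on_def)
 have c2: "0 <= coef2 (mes (Q i) a) b" if "a : mesos (Q i)" "b : mics (mes (Q i) a)" for a b using macro_scc(2)[OF Q_ok that(1)] that(2) by (auto simp: scc_on_def)
 have c1: "0 <= coef1 (mic (mes (Q i) a) b) c" if "a : mesos (Q i)" "b : mics (mes (Q i) a)" "c : slots (mic (mes (Q i) a) b)" for a b c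
  using macro_scc(3)[OF Q_ok that(1,2)] that(3) by (auto simp: scc_on_def)
 show ?thesis unfolding mac_vec_def mes_vec_def mic_vec_def lincomb_def by (intro sum_nonneg mult_nonneg_nonneg of_nat_0_le_iff c1 c2 c3 macro_cell_vec(2)[OF Q_ok assms]; assumption)
qed

text \<open>The norm of each term is at least 1/2, so unconditionality gives \<alpha>_i <= 2 N and
  the tolerances add up to at most 2 N. Together with \<open>macro_estimate\<close> the value of a
  tree is at most 419 * 2 N + 32 * (N + 2 N) = 934 N.\<close>

lemma domination_nonneg:
 assumes u: "u : {xa, ya}" and v: "v : {xa, ya}" and I: "finite I" "\<And>i. i : I ==> 0 <= \<alpha> i"
 shows "N (lincomb I \<alpha> (%i. mac_vec u (Q i))) <= 1000 * N (lincomb I \<alpha> (%i. mac_vec v (Q i)))"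
proof -
 let ?X = "lincomb I \<alpha> (%i. mac_vec v (Q i))" let ?Y = "lincomb I \<alpha> (%i. mac_vec u (Q i))"
 have Xc: "?X : c00" and Yc: "?Y : c00" by (rule c00_lincomb[OF I(1) macro_dot(2)[OF Q_ok v]], rule c00_lincomb[OF I(1) macro_dot(2)[OF Q_ok u]])
 have \<alpha>: "\<alpha> i <= 2 * N ?X" if i: "i : I" for i
 proof -
  have "\<alpha> i * (1/2) <= \<alpha> i * N (mac_vec v (Q i))"
  proof (rule mult_left_mono[OF _ I(2)[OF i]])
   have "(1/2::real)^(i + 1) <= 1/2" using power_decreasing[of 1 "i + 1" "1/2::real"] by simp
   thus "1/2 <= N (mac_vec v (Q i))" using macro_norm[OF Q_ok v, of i] by linarith
  qed
  also have "... = N (%t. \<alpha> i * mac_vec v (Q i) t)" using N_scale[OF macro_dot(2)[OF Q_ok v]] I(2)[OF i] by simp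
  also have "... <= N ?X"
  proof (rule N_mono_abs[OF c00_scale[OF macro_dot(2)[OF Q_ok v]] Xc])
   fix t
   have nn: "0 <= \<alpha> k * mac_vec v (Q k) t" if "k : I" for k by (rule mult_nonneg_nonneg[OF I(2)[OF that] mac_vec_nonneg[OF v]])
   have "\<alpha> i * mac_vec v (Q i) t <= ?X t" unfolding lincomb_def by (rule member_le_sum[OF i _ I(1)]) (rule nn, elim DiffD1)
   thus "\<bar>\<alpha> i * mac_vec v (Q i) t\<bar> <= \<bar>?X t\<bar>" using nn[OF i] by linarith
  qed
  finally show ?thesis by simp
 qed
 have geo: "(SUM i:I. (1/2::real)^(i + 1)) <= 1"
 proof -
  have "(SUM i:I. (1/2::real)^(i + 1)) <= (\<Sum>i. (1/2::real)^(i + 1))" by (rule sum_le_suminf[OF _ I(1)]) (auto intro: summable_mult2 simp: power_add summable_mult2 summable_geometric)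
  also have "... = 1" using sums_unique[OF power_half_series] by simp
  finally show ?thesis .
 qed
 have err: "(SUM i:I. \<alpha> i * (1/2)^(i + 1)) <= 2 * N ?X"
 proof -
  have "(SUM i:I. \<alpha> i * (1/2)^(i + 1)) <= (SUM i:I. 2 * N ?X * (1/2)^(i + 1))" by (intro sum_mono mult_right_mono \<alpha>) simp_all
  also have "... = 2 * N ?X * (SUM i:I. (1/2::real)^(i + 1))" by (simp only: sum_distrib_left)
  also have "... <= 2 * N ?X * 1" by (rule mult_left_mono[OF geo]) (simp add: N_nonneg)
  finally show ?thesis by simp
 qed
 have main: "dot (eval T) ?Y <= 1000 * N ?X" if T: "valid T" for T
 proof -
  have "dot (eval T) ?Y = (SUM i:I. \<alpha> i * dot (eval T) (mac_vec u (Q i)))" by (rule dot_lincomb[OF I(1) macro_dot(2)[OF Q_ok u]])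
  also have "... <= (SUM i:I. \<alpha> i * (419 * (1/2)^(i + 1) + 32 * avg3 (Q i) (%a b c. chv (Q i) a b c T)))" by (intro sum_mono mult_left_mono macro_estimate[OF Q_ok T u] I(2))
  also have "... = 419 * (SUM i:I. \<alpha> i * (1/2)^(i + 1)) + 32 * (SUM i:I. \<alpha> i * avg3 (Q i) (%a b c. chv (Q i) a b c T))"
   by (simp add: distrib_left sum.distrib sum_distrib_left mult_ac)
  also have "... <= 1000 * N ?X" using charge_dominated[OF v T I(1), of \<alpha>, OF I(2)] err N_nonneg[of ?X] by linarith
  finally show ?thesis .
 qed
 show ?thesis
 proof (rule ccontr)
  assume "\<not> ?thesis"
  then obtain T where T: "valid T" "1000 * N ?X < dot (eval T) (%t. \<bar>?Y t\<bar>)" using N_tree_approx[OF Yc] by (meson not_le)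
  have "(%t. \<bar>?Y t\<bar>) = ?Y" using I(2) mac_vec_nonneg[OF u] unfolding lincomb_def by (intro ext abs_of_nonneg sum_nonneg) simp
  thus False using T main[OF T(1)] by simp
 qed
qed

lemma supp_mac:
 shows "supp (mac_vec xv (Q i)) \<subseteq> {qbeg (Q i)..qfin (Q i)}" "supp (mac_vec yv (Q i)) \<subseteq> {qbeg (Q i)..qfin (Q i)}"
  "(%t. \<bar>mac_vec xv (Q i) t\<bar>) = mac_vec xa (Q i)" "(%t. \<bar>mac_vec yv (Q i) t\<bar>) = mac_vec ya (Q i)"
proof -
 have gen: "supp (mac_vec w (Q i)) \<subseteq> {qbeg (Q i)..qfin (Q i)} & (%t. \<bar>mac_vec w (Q i) t\<bar>) = mac_vec v (Q i)"
  if v: "v : {xa, ya}" and w: "\<And>M c. v M c = (%t. \<bar>w M c t\<bar>)" for v w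
 proof -
  let ?M = "%a b. mic (mes (Q i) a) b"
  obtain n3 eps3 where s3: "scc_on n3 eps3 (%a. mbeg (mes (Q i) a)) (mesos (Q i)) (coef3 (Q i))" using macro_scc(1)[OF Q_ok] by blast
  have S1: "supp (w (?M a b) c) \<subseteq> cell (?M a b) c" if "a : mesos (Q i)" "b : mics (mes (Q i) a)" "c : slots (?M a b)" for a b c
   using macro_cell_vec(3)[OF Q_ok v that] unfolding w supp_abs .
  have dis: "disjoint_family_on f J" if "\<And>j. j : J ==> f j \<subseteq> {s j..e j}" "\<And>j j'. j : J ==> j' : J ==> j < j' ==> e j < s j'"
   for f :: "nat => nat set" and J and s e :: "nat => nat" unfolding disjoint_family_on_def
  proof (intro ballI impI, rule ccontr)
   fix j j' assume j: "j : J" "j' : J" "j ~= j'" "f j \<inter> f j' ~= {}"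
   then obtain x where x: "x : f j" "x : f j'" by blast
   have "s j <= x" "x <= e j" "s j' <= x" "x <= e j'" using that(1)[OF j(1)] that(1)[OF j(2)] x by auto
   moreover have "e j < s j' \<or> e j' < s j" using that(2)[OF j(1,2)] that(2)[OF j(2,1)] j(3) by linarith
   ultimately show False by linarith
  qed
  have m1: "supp (mic_vec w (?M a b)) \<subseteq> {beg (?M a b)..fin (?M a b)} & (%t. \<bar>mic_vec w (?M a b) t\<bar>) = mic_vec v (?M a b)"
   if a: "a : mesos (Q i)" and b: "b : mics (mes (Q i) a)" for a b
  proof -
   obtain L where K: "meso_ok (wq (Q i)) L ((1/2)^(i + 1)) (mes (Q i) a)" using macro_mes(1)[OF Q_ok a] ..
   note M = meso_mic(1)[OF K b]
   obtain n1 eps1 where s1: "scc_on n1 eps1 (lft (?M a b)) (slots (?M a b)) (coef1 (?M a b))" using macro_scc(3)[OF Q_ok a b] by blast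
   have d: "disjoint_family_on (%c. supp (w (?M a b) c)) (slots (?M a b))" by (rule dis[OF S1[OF a b]]) (assumption, rule micro_cell(3)[OF M])
   have "(%t. \<bar>mic_vec w (?M a b) t\<bar>) = mic_vec v (?M a b)" unfolding mic_vec_def sum_disjoint_abs[OF scc_finite[OF s1] d]
    by (rule lincomb_cong) (use s1 in "simp_all add: w scc_on_def")
   moreover have "supp (mic_vec w (?M a b)) \<subseteq> {beg (?M a b)..fin (?M a b)}"
    unfolding mic_vec_def using supp_lincomb[of "slots (?M a b)" "coef1 (?M a b)" "w (?M a b)"] S1[OF a b] micro_cell(1)[OF M] by fast
   ultimately show ?thesis by blast
  qed
  have m2: "supp (mes_vec w (mes (Q i) a)) \<subseteq> {mbeg (mes (Q i) a)..mfin (mes (Q i) a)} & (%t. \<bar>mes_vec w (mes (Q i) a) t\<bar>) = mes_vec v (mes (Q i) a)"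
   if a: "a : mesos (Q i)" for a
  proof -
   let ?K = "mes (Q i) a"
   obtain L where K: "meso_ok (wq (Q i)) L ((1/2)^(i + 1)) ?K" using macro_mes(1)[OF Q_ok a] ..
   obtain n1 eps1 where s1: "scc_on n1 eps1 (%b. beg (mic ?K b)) (mics ?K) (coef2 ?K)" using macro_scc(2)[OF Q_ok a] by blast
   have d: "disjoint_family_on (%b. supp (mic_vec w (mic ?K b))) (mics ?K)" by (rule dis[OF conjunct1[OF m1[OF a]]]) (assumption, rule meso_mic(4)[OF K])
   have "(%t. \<bar>mes_vec w ?K t\<bar>) = mes_vec v ?K" unfolding mes_vec_def sum_disjoint_abs[OF scc_finite[OF s1] d]
    by (rule lincomb_cong) (use s1 m1[OF a] in "simp_all add: scc_on_def")
   moreover have "supp (mes_vec w ?K) \<subseteq> {mbeg ?K..mfin ?K}" unfolding mes_vec_def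
   proof (rule order_trans[OF supp_lincomb], rule UN_least)
    fix b assume b: "b : mics ?K"
    show "supp (mic_vec w (mic ?K b)) \<subseteq> {mbeg ?K..mfin ?K}" using conjunct1[OF m1[OF a b]] meso_mic(2,3)[OF K b] by fastforce
   qed
   ultimately show ?thesis by blast
  qed
  have d: "disjoint_family_on (%a. supp (mes_vec w (mes (Q i) a))) (mesos (Q i))" by (rule dis[OF conjunct1[OF m2]]) (assumption, rule macro_mes(4)[OF Q_ok])
  have "(%t. \<bar>mac_vec w (Q i) t\<bar>) = mac_vec v (Q i)" unfolding mac_vec_def sum_disjoint_abs[OF scc_finite[OF s3] d]
   by (rule lincomb_cong) (use s3 m2 in "simp_all add: scc_on_def")
  moreover have "supp (mac_vec w (Q i)) \<subseteq> {qbeg (Q i)..qfin (Q i)}" unfolding mac_vec_def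
  proof (rule order_trans[OF supp_lincomb], rule UN_least)
   fix a assume a: "a : mesos (Q i)"
   show "supp (mes_vec w (mes (Q i) a)) \<subseteq> {qbeg (Q i)..qfin (Q i)}" using conjunct1[OF m2[OF a]] macro_mes(2,3)[OF Q_ok a] by fastforce
  qed
  ultimately show ?thesis by blast
 qed
 show "supp (mac_vec xv (Q i)) \<subseteq> {qbeg (Q i)..qfin (Q i)}" "(%t. \<bar>mac_vec xv (Q i) t\<bar>) = mac_vec xa (Q i)" using gen[of xa xv] by (simp_all add: xa_def)
 show "supp (mac_vec yv (Q i)) \<subseteq> {qbeg (Q i)..qfin (Q i)}" "(%t. \<bar>mac_vec yv (Q i) t\<bar>) = mac_vec ya (Q i)" using gen[of ya yv] by (simp_all add: ya_def)
qed

text \<open>Terms have disjoint supports, so by unconditionality both norms depend only on the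
  absolute values of coefficients and coordinates, to which \<open>domination_nonneg\<close> applies
  in either direction.\<close>

theorem tower_equiv:
 assumes I: "finite I"
 shows "N (lincomb I \<alpha> (%i. mac_vec yv (Q i))) <= 1000 * N (lincomb I \<alpha> (%i. mac_vec xv (Q i)))"
  "N (lincomb I \<alpha> (%i. mac_vec xv (Q i))) <= 1000 * N (lincomb I \<alpha> (%i. mac_vec yv (Q i)))"
proof -
 have red: "N (lincomb I \<alpha> (%i. mac_vec w (Q i))) = N (lincomb I (%i. \<bar>\<alpha> i\<bar>) (%i. mac_vec v (Q i)))"
  if s: "\<And>i. supp (mac_vec w (Q i)) \<subseteq> {qbeg (Q i)..qfin (Q i)}" and a: "\<And>i. (%t. \<bar>mac_vec w (Q i) t\<bar>) = mac_vec v (Q i)" and v: "v : {xa, ya}" for v w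
 proof -
  have d: "disjoint_family_on (%i. supp (mac_vec w (Q i))) I" unfolding disjoint_family_on_def
  proof (intro ballI impI, rule ccontr)
   fix j j' assume j: "j ~= j'" "supp (mac_vec w (Q j)) \<inter> supp (mac_vec w (Q j')) ~= {}"
   then obtain x where x: "x : supp (mac_vec w (Q j))" "x : supp (mac_vec w (Q j'))" by blast
   have "qbeg (Q j) <= x" "x <= qfin (Q j)" "qbeg (Q j') <= x" "x <= qfin (Q j')" using subsetD[OF s x(1)] subsetD[OF s x(2)] by auto
   moreover have "qfin (Q j) < qbeg (Q j') \<or> qfin (Q j') < qbeg (Q j)" using Q_sep[of j j'] Q_sep[of j' j] j(1) by linarith
   ultimately show False by linarith
  qed
  have "supp (mac_vec w (Q i)) = supp (mac_vec v (Q i))" for i unfolding a[symmetric] supp_abs ..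
  moreover have "mac_vec w (Q i) 0 = 0" for i
  proof -
   have "mac_vec v (Q i) 0 = 0" using macro_dot(2)[OF Q_ok v] unfolding c00_def by blast
   thus ?thesis unfolding a[symmetric] by simp
  qed
  ultimately have "mac_vec w (Q i) : c00" for i using macro_dot(2)[OF Q_ok v, of i] unfolding c00_def by simp
  hence c: "lincomb I \<alpha> (%i. mac_vec w (Q i)) : c00" by (intro c00_lincomb[OF I])
  have "N (lincomb I \<alpha> (%i. mac_vec w (Q i))) = N (%t. \<bar>lincomb I \<alpha> (%i. mac_vec w (Q i)) t\<bar>)" by (rule N_abs[OF c, symmetric])
  also have "... = N (lincomb I (%i. \<bar>\<alpha> i\<bar>) (%i. mac_vec v (Q i)))" unfolding sum_disjoint_abs[OF I d] a ..
  finally show ?thesis .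
 qed
 have x: "N (lincomb I \<alpha> (%i. mac_vec xv (Q i))) = N (lincomb I (%i. \<bar>\<alpha> i\<bar>) (%i. mac_vec xa (Q i)))" by (rule red[OF supp_mac(1,3)]) simp
 have y: "N (lincomb I \<alpha> (%i. mac_vec yv (Q i))) = N (lincomb I (%i. \<bar>\<alpha> i\<bar>) (%i. mac_vec ya (Q i)))" by (rule red[OF supp_mac(2,4)]) simp
 show "N (lincomb I \<alpha> (%i. mac_vec yv (Q i))) <= 1000 * N (lincomb I \<alpha> (%i. mac_vec xv (Q i)))"
  "N (lincomb I \<alpha> (%i. mac_vec xv (Q i))) <= 1000 * N (lincomb I \<alpha> (%i. mac_vec yv (Q i)))" unfolding x y by (rule domination_nonneg[OF _ _ I]; simp)+
qed

end

section \<open>Pairs of vectors almost attaining the norm\<close>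

context cr_space begin

text \<open>The features of the linear span of a block sequence that the construction uses: linear
  combinations stay inside, and there are nonzero elements supported arbitrarily far out.\<close>

definition rich :: "vec set => bool" where
 "rich Z \<longleftrightarrow> Z \<subseteq> c00 & (ALL I a x. finite I --> (ALL i:I. x i : Z) --> lincomb I a x : Z) &
   (ALL s. EX x:Z. supp x ~= {} & supp x \<subseteq> {s..})"

lemma richD:
 assumes "rich Z"
 shows "x : Z ==> x : c00" "finite I ==> (\<And>i. i : I ==> v i : Z) ==> lincomb I a v : Z"
  "EX x:Z. supp x ~= {} & supp x \<subseteq> {s..}"
proof -
 note R = assms[unfolded rich_def]
 show "x : Z ==> x : c00" by (rule subsetD[OF R[THEN conjunct1]])
 show "finite I ==> (\<And>i. i : I ==> v i : Z) ==> lincomb I a v : Z" using R[THEN conjunct2, THEN conjunct1, rule_format, of I v a] by simp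
 show "EX x:Z. supp x ~= {} & supp x \<subseteq> {s..}" by (rule R[THEN conjunct2, THEN conjunct2, rule_format])
qed

definition tree_family :: "nat => nat => nat => tree set => bool" where
 "tree_family m s e F \<longleftrightarrow> finite F & (ALL t:F. valid t & tsupp t ~= {} & tsupp t \<subseteq> {s..e}) &
   (ALL t:F. ALL t':F. t ~= t' --> tsupp t \<inter> tsupp t' = {}) & (%t. Min (tsupp t)) ` F : schreier m"

text \<open>A lower bound \<open>c\<close> for the total action on \<open>x\<close> of finitely many
  disjoint trees of Schreier order \<open>m\<close>. It may greatly exceed the norm, since no weight
  has been divided out yet.\<close>

definition heavy :: "nat => real => nat => nat => vec => bool" where
 "heavy m c s e x \<longleftrightarrow> (EX F. tree_family m s e F & c <= (SUM t:F. dot (eval t) (%n. \<bar>x n\<bar>)))"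

lemma dot_mono_right:
 assumes "x : c00" "y : c00" "\<And>n. 0 <= x n" "\<And>n. x n <= y n" "\<And>n. 0 <= f n" shows "dot f x <= dot f y"
proof -
 have fy: "finite (supp y)" using assms(2) by (simp add: c00_def)
 have sub: "supp x \<subseteq> supp y" using assms(3,4) by (auto simp: supp_def) (metis antisym)
 have "dot f x = (SUM n:supp y. f n * x n)" by (rule dot_superset[OF fy sub])
 also have "... <= (SUM n:supp y. f n * y n)" by (intro sum_mono mult_left_mono assms)
 finally show ?thesis by (simp add: dot_def)
qed

text \<open>The trees are put under a single node of weight \<open>2 * j\<close>, which is possible
  as long as their order does not exceed n_(2j).\<close>

lemma heavy_norm:
 assumes x: "x : c00" and F: "heavy m c s e x" and m: "m <= nseq (2 * j)" "1 <= j"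
 shows "c / rm (2 * j) <= N x"
proof -
 obtain F where F: "tree_family m s e F" "c <= (SUM t:F. dot (eval t) (%n. \<bar>x n\<bar>))" using F unfolding heavy_def by blast
 have fin: "finite F" and F1: "\<And>t. t : F ==> valid t" "\<And>t. t : F ==> tsupp t ~= {}"
  "\<And>t t'. t : F ==> t' : F ==> t ~= t' ==> tsupp t \<inter> tsupp t' = {}" and sch: "(%t. Min (tsupp t)) ` F : schreier m" using F(1) unfolding tree_family_def by blast+
 obtain g where g: "bij_betw g {0..<card F} F" using ex_bij_betw_nat_finite[OF fin] ..
 let ?I = "{0..<card F}"
 have gF: "g i : F" if "i : ?I" for i using g that unfolding bij_betw_def by blast
 have inj: "inj_on g ?I" and im: "g ` ?I = F" using g unfolding bij_betw_def by blast+
 have al: "allowable (SN (2 * j)) ?I (%i. tsupp (g i))" unfolding allowable_def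
 proof (intro conjI ballI)
  show "finite (tsupp (g i))" if "i : ?I" for i by (rule valid_finite[OF F1(1)[OF gF[OF that]]])
  show "disjoint_family_on (%i. tsupp (g i)) ?I" unfolding disjoint_family_on_def
  proof (intro ballI impI)
   fix i k assume i: "i : ?I" "k : ?I" "i ~= k"
   hence "g i ~= g k" using inj_on_eq_iff[OF inj i(1,2)] by simp
   thus "tsupp (g i) \<inter> tsupp (g k) = {}" by (rule F1(3)[OF gF[OF i(1)] gF[OF i(2)]])
  qed
  have "min_set ?I (%i. tsupp (g i)) \<subseteq> (%t. Min (tsupp t)) ` F" unfolding min_set_def using gF by blast
  hence "min_set ?I (%i. tsupp (g i)) : schreier m" by (rule schreier_subset[OF sch])
  thus "min_set ?I (%i. tsupp (g i)) : SN (2 * j)" using schreier_mono[OF m(1)] by blast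
 qed simp
 have T: "valid (Gam j ?I g)" by (rule valid.Gam[OF m(2) _ F1(1)[OF gF] al]) simp
 have "c / rm (2 * j) <= (SUM t:F. dot (eval t) (%n. \<bar>x n\<bar>)) / rm (2 * j)" by (rule divide_right_mono[OF F(2)]) simp
 also have "(SUM t:F. dot (eval t) (%n. \<bar>x n\<bar>)) = (SUM i:?I. dot (eval (g i)) (%n. \<bar>x n\<bar>))" by (rule sum.reindex_bij_betw[OF g, symmetric])
 also have "(SUM i:?I. dot (eval (g i)) (%n. \<bar>x n\<bar>)) / rm (2 * j) = dot (eval (Gam j ?I g)) (%n. \<bar>x n\<bar>)" by (simp add: dot_lincomb_left sum_divide_distrib)
 also have "... <= N (%n. \<bar>x n\<bar>)" by (rule N_tree_upper[OF T])
 finally show ?thesis unfolding N_abs[OF x] .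
qed

lemma heavy_start:
 assumes x: "x : c00" "N x = 1" "supp x \<subseteq> {s..e}" "1 <= s"
 shows "heavy 0 (1/2) s e x"
proof -
 obtain T where T: "valid T" "1/2 < dot (eval T) (%n. \<bar>x n\<bar>)" using N_tree_approx[OF x(1), of "1/2"] x(2) by auto
 obtain T' where T': "valid T'" "eval T' = proj {s..e} (eval T)" using valid_proj[OF T(1)] by blast
 have eq: "dot (eval T') (%n. \<bar>x n\<bar>) = dot (eval T) (%n. \<bar>x n\<bar>)" unfolding dot_def T'(2) proj_def supp_abs by (rule sum.cong[OF refl]) (use x(3) in auto)
 have sub: "tsupp T' \<subseteq> {s..e}" unfolding T'(2) supp_proj by blast
 have ne: "tsupp T' ~= {}"
 proof
  assume "tsupp T' = {}"
  hence "eval T' n = 0" for n unfolding supp_def by blast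
  hence "dot (eval T') (%n. \<bar>x n\<bar>) = 0" unfolding dot_def by simp
  thus False using eq T(2) by simp
 qed
 have "Min (tsupp T') : tsupp T'" by (rule Min_in[OF valid_finite[OF T'(1)] ne])
 hence "1 <= Min (tsupp T')" using sub x(4) by fastforce
 hence "(%t. Min (tsupp t)) ` {T'} : schreier 0" by (simp add: schreier_0_iff)
 hence "tree_family 0 s e {T'}" unfolding tree_family_def using T'(1) ne sub by blast
 thus ?thesis unfolding heavy_def using eq T(2) by (intro exI[of _ "{T'}"]) simp
qed

lemma lincomb_ge_piece:
 assumes D: "finite D" "disjoint_family_on (%i. supp (x i)) D" "i : D" "\<And>i. i : D ==> 0 <= a i"
 shows "a i * \<bar>x i n\<bar> <= \<bar>lincomb D a x n\<bar>"
proof -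
 have "\<bar>lincomb D a x n\<bar> = lincomb D (%i. \<bar>a i\<bar>) (%i t. \<bar>x i t\<bar>) n" using sum_disjoint_abs[OF D(1,2)] by metis
 also have "... = (SUM i:D. a i * \<bar>x i n\<bar>)" unfolding lincomb_def by (rule sum.cong[OF refl]) (use D(4) in simp)
 finally show ?thesis using member_le_sum[OF D(3), of "%i. a i * \<bar>x i n\<bar>"] D(1,4) by simp
qed

text \<open>The tree families of the terms are united: their orders add by
  \<open>schreier_compose\<close>, and on its own term each family acts with the coefficient of that
  term, so the bounds average with total mass \<beta>.\<close>

lemma heavy_combine:
 assumes D: "finite D" and x: "\<And>i. i : D ==> x i : c00" "\<And>i. i : D ==> supp (x i) \<subseteq> {st i..en i}"
  and sep: "\<And>i i'. i : D ==> i' : D ==> i < i' ==> en i < st i'" "\<And>i. i : D ==> s <= st i & st i <= en i & en i <= e"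
  and h: "\<And>i. i : D ==> heavy m c (st i) (en i) (x i)" and b: "\<And>i. i : D ==> 0 <= b i" "(SUM i:D. b i) = \<beta>"
  and sch: "st ` D : schreier k"
 shows "heavy (m + k) (\<beta> * c) s e (lincomb D b x)"
proof -
 have "ALL i:D. EX F. tree_family m (st i) (en i) F & c <= (SUM t:F. dot (eval t) (%n. \<bar>x i n\<bar>))" using h unfolding heavy_def by blast
 from bchoice[OF this] obtain F where F: "ALL i:D. tree_family m (st i) (en i) (F i) & c <= (SUM t:F i. dot (eval t) (%n. \<bar>x i n\<bar>))" ..
 have tf: "finite (F i)" "\<And>t. t : F i ==> valid t" "\<And>t. t : F i ==> tsupp t ~= {}" "\<And>t. t : F i ==> tsupp t \<subseteq> {st i..en i}"
  "\<And>t t'. t : F i ==> t' : F i ==> t ~= t' ==> tsupp t \<inter> tsupp t' = {}" "(%t. Min (tsupp t)) ` F i : schreier m"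
  "c <= (SUM t:F i. dot (eval t) (%n. \<bar>x i n\<bar>))" if "i : D" for i using bspec[OF F that] unfolding tree_family_def by blast+
 have apart: "A \<inter> B = {}" if "i : D" "i' : D" "i ~= i'" "A \<subseteq> {st i..en i}" "B \<subseteq> {st i'..en i'}" for A B :: "nat set" and i i'
 proof -
  have "en i < st i' \<or> en i' < st i" using sep(1)[OF that(1,2)] sep(1)[OF that(2,1)] that(3) by linarith
  thus ?thesis using that(4,5) by fastforce
 qed
 let ?F = "UN i:D. F i"
 have fam: "tree_family (m + k) s e ?F" unfolding tree_family_def
 proof (intro conjI ballI impI)
  show "finite ?F" using D tf(1) by blast
  fix t assume "t : ?F"
  then obtain i where i: "i : D" "t : F i" by blast
  show "valid t" "tsupp t ~= {}" by (rule tf(2)[OF i], rule tf(3)[OF i])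
  show "tsupp t \<subseteq> {s..e}" using tf(4)[OF i] sep(2)[OF i(1)] by fastforce
  fix t' assume "t' : ?F" and ne: "t ~= t'"
  then obtain i' where i': "i' : D" "t' : F i'" by blast
  show "tsupp t \<inter> tsupp t' = {}"
  proof (cases "i = i'")
   case True
   thus ?thesis using tf(5)[OF i(1) i(2) _ ne] i'(2) by blast
  next
   case False
   show ?thesis by (rule apart[OF i(1) i'(1) False tf(4)[OF i] tf(4)[OF i']])
  qed
 next
  have "(%t. Min (tsupp t)) ` ?F = (UN i:D. (%t. Min (tsupp t)) ` F i)" by blast
  also have "... : schreier (m + k)"
  proof (rule schreier_compose[OF D tf(6) _ _ sch])
   show "inj_on st D"
   proof (rule inj_onI)
    fix i i' assume i: "i : D" "i' : D" "st i = st i'"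
    have "\<not> i < i'" "\<not> i' < i" using sep(1)[OF i(1,2)] sep(1)[OF i(2,1)] sep(2)[OF i(1)] sep(2)[OF i(2)] i(3) by auto
    thus "i = i'" by simp
   qed
   fix i u assume i: "i : D" "u : (%t. Min (tsupp t)) ` F i"
   then obtain t where t: "t : F i" "u = Min (tsupp t)" by blast
   have "Min (tsupp t) : tsupp t" by (rule Min_in[OF valid_finite[OF tf(2)[OF i(1) t(1)]] tf(3)[OF i(1) t(1)]])
   thus "st i <= u" using tf(4)[OF i(1) t(1)] t(2) by fastforce
  qed
  finally show "(%t. Min (tsupp t)) ` ?F : schreier (m + k)" .
 qed
 have disF: "F i \<inter> F i' = {}" if "i : D" "i' : D" "i ~= i'" for i i'
 proof (rule ccontr)
  assume "\<not> ?thesis"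
  then obtain t where t: "t : F i" "t : F i'" by blast
  have "tsupp t \<inter> tsupp t = {}" by (rule apart[OF that tf(4)[OF that(1) t(1)] tf(4)[OF that(2) t(2)]])
  thus False using tf(3)[OF that(1) t(1)] by blast
 qed
 have disx: "disjoint_family_on (%i. supp (x i)) D" unfolding disjoint_family_on_def using apart x(2) by blast
 have xc: "lincomb D b x : c00" by (rule c00_lincomb[OF D x(1)])
 have piece: "b i * dot (eval t) (%n. \<bar>x i n\<bar>) <= dot (eval t) (%n. \<bar>lincomb D b x n\<bar>)" if i: "i : D" for i t
 proof -
  have "b i * dot (eval t) (%n. \<bar>x i n\<bar>) = (SUM n:supp (x i). eval t n * (b i * \<bar>x i n\<bar>))" unfolding dot_def supp_abs sum_distrib_left by (simp add: mult_ac)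
  also have "... = dot (eval t) (%n. b i * \<bar>x i n\<bar>)" by (rule dot_superset[symmetric]) (use x(1)[OF i] in "auto simp: c00_def supp_def")
  also have "... <= dot (eval t) (%n. \<bar>lincomb D b x n\<bar>)"
   by (rule dot_mono_right[OF c00_scale[OF c00_abs[OF x(1)[OF i]]] c00_abs[OF xc] _ lincomb_ge_piece[OF D disx i b(1)] eval_nonneg])
    (use b(1)[OF i] in simp_all)
  finally show ?thesis .
 qed
 have "\<beta> * c = (SUM i:D. b i * c)" unfolding b(2)[symmetric] by (rule sum_distrib_right)
 also have "... <= (SUM i:D. b i * (SUM t:F i. dot (eval t) (%n. \<bar>x i n\<bar>)))" by (intro sum_mono mult_left_mono tf(7) b(1))
 also have "... = (SUM i:D. SUM t:F i. b i * dot (eval t) (%n. \<bar>x i n\<bar>))" by (simp only: sum_distrib_left)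
 also have "... <= (SUM i:D. SUM t:F i. dot (eval t) (%n. \<bar>lincomb D b x n\<bar>))" by (intro sum_mono piece)
 also have "... = (SUM t:?F. dot (eval t) (%n. \<bar>lincomb D b x n\<bar>))" by (rule sum.UNION_disjoint[symmetric]) (use D tf(1) disF in auto)
 finally show ?thesis unfolding heavy_def using fam by blast
qed

lemma heavy_mono: "heavy m c s e x ==> c' <= c ==> m <= m' ==> heavy m' c' s e x"
proof -
 assume h: "heavy m c s e x" "c' <= c" "m <= m'"
 obtain F where F: "tree_family m s e F" "c <= (SUM t:F. dot (eval t) (%n. \<bar>x n\<bar>))" using h(1) unfolding heavy_def by (elim exE conjE)
 have "tree_family m' s e F" using F(1) subsetD[OF schreier_mono[OF h(3)]] unfolding tree_family_def by blast
 thus ?thesis unfolding heavy_def using order_trans[OF h(2) F(2)] by (intro exI[of _ F] conjI)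
qed

text \<open>
  If no averages of normalised pairs almost attained the norm on both sides, then normalising the failing
  ones would multiply the weight of one of the two sides by a fixed factor at each of many steps;
  \<open>heavy_norm\<close> bounds that weight.
\<close>

definition heavy_pair :: "vec set => vec set => nat => real => nat => nat => nat => nat => vec => vec => bool" where
 "heavy_pair Z1 Z2 n0 \<gamma> t1 t2 s e x y \<longleftrightarrow> s <= e & x : Z1 & y : Z2 & N x = 1 & N y = 1 & supp x \<subseteq> {s..e} & supp y \<subseteq> {s..e} &
   heavy ((t1 + t2) * n0) (\<gamma>^t1 / 2) s e x & heavy ((t1 + t2) * n0) (\<gamma>^t2 / 2) s e y"

definition attaining :: "vec set => vec set => nat => real => real => nat => nat set => (nat => real) => (nat => nat) => (nat => nat) => (nat => vec) => (nat => vec) => bool" where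
 "attaining Z1 Z2 n0 eps \<delta> s D b st en x y \<longleftrightarrow> scc_on n0 eps st D b &
   (ALL c:D. s <= st c & st c <= en c & x c : Z1 & y c : Z2 & N (x c) = 1 & N (y c) = 1 & supp (x c) \<subseteq> {st c..en c} & supp (y c) \<subseteq> {st c..en c}) &
   (ALL c:D. ALL c':D. c < c' --> en c < st c') & 1 - \<delta> <= N (lincomb D b x) & 1 - \<delta> <= N (lincomb D b y)"

text \<open>Normalising an average divides its heaviness by its norm. A norm at most \<Lambda> thus
  multiplies the heaviness by at least 1/\<Lambda>, at the price of the order
  \<open>n0\<close>.\<close>

lemma normalise_heavy:
 assumes Z: "rich Z" and scc: "scc_on n0 eps st D b" and sep: "\<And>i i'. i : D ==> i' : D ==> i < i' ==> en i < st i'"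
  and P: "\<And>i. i : D ==> s <= st i & st i <= en i & en i <= e & x i : Z & N (x i) = 1 & supp (x i) \<subseteq> {st i..en i} & heavy m c (st i) (en i) (x i)"
  and c: "0 <= c" and \<Lambda>: "N (lincomb D b x) <= \<Lambda>" "0 < \<Lambda>"
 shows "EX x':Z. N x' = 1 & supp x' \<subseteq> {s..e} & heavy (m + n0) (c / \<Lambda>) s e x'"
proof -
 have fD: "finite D" and b: "\<And>i. i : D ==> 0 <= b i" "(SUM i:D. b i) = 1" and sch: "st ` D : schreier n0" using scc unfolding scc_on_def by blast+
 let ?z = "lincomb D b x" let ?\<nu> = "N (lincomb D b x)"
 have xc: "x i : c00" if "i : D" for i using P[OF that] richD(1)[OF Z] by blast
 have zc: "?z : c00" by (rule c00_lincomb[OF fD xc])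
 have dis: "disjoint_family_on (%i. supp (x i)) D" unfolding disjoint_family_on_def
 proof (intro ballI impI, rule ccontr)
  fix j j' assume j: "j : D" "j' : D" "j ~= j'" "supp (x j) \<inter> supp (x j') ~= {}"
  then obtain t where t: "t : supp (x j)" "t : supp (x j')" by blast
  have "st j <= t" "t <= en j" "st j' <= t" "t <= en j'" using P[OF j(1)] P[OF j(2)] t by auto
  moreover have "en j < st j' \<or> en j' < st j" using sep[OF j(1,2)] sep[OF j(2,1)] j(3) by linarith
  ultimately show False by linarith
 qed
 have "EX i:D. b i ~= 0"
 proof (rule ccontr)
  assume "\<not> ?thesis"
  hence "(SUM i:D. b i) = 0" by (intro sum.neutral) blast
  thus False using b(2) by simp
 qed
 then obtain i where i: "i : D" "b i ~= 0" by blast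
 hence bi: "0 < b i" using b(1)[OF i(1)] by linarith
 have "b i = N (%t. b i * x i t)" using N_scale[OF xc[OF i(1)], of "b i"] P[OF i(1)] bi by simp
 also have "... <= ?\<nu>"
 proof (rule N_mono_abs[OF c00_scale[OF xc[OF i(1)]] zc])
  show "\<bar>b i * x i t\<bar> <= \<bar>?z t\<bar>" for t using lincomb_ge_piece[where n = t, OF fD dis i(1) b(1)] bi by (simp add: abs_mult)
 qed
 finally have pos: "0 < ?\<nu>" using bi by linarith
 let ?x = "lincomb D (%i. b i / ?\<nu>) x"
 have "lincomb D (%i. b i / \<nu>) x = (%t. (1 / \<nu>) * ?z t)" for \<nu> unfolding lincomb_def by (simp add: sum_distrib_left mult_ac divide_inverse)
 hence e: "?x = (%t. (1 / ?\<nu>) * ?z t)" .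
 show ?thesis
 proof (intro bexI[of _ ?x] conjI)
  show "?x : Z" by (rule richD(2)[OF Z fD]) (use P in blast)
  show "N ?x = 1" unfolding e using N_scale[OF zc, of "1 / ?\<nu>"] pos by simp
  show "supp ?x \<subseteq> {s..e}"
  proof (rule order_trans[OF supp_lincomb], rule UN_least)
   show "supp (x i) \<subseteq> {s..e}" if "i : D" for i using P[OF that] by fastforce
  qed
  have "heavy (m + n0) ((1 / ?\<nu>) * c) s e ?x"
  proof (rule heavy_combine[OF fD xc _ sep _ _ _ _ sch])
   show "supp (x i) \<subseteq> {st i..en i}" "s <= st i & st i <= en i & en i <= e" "heavy m c (st i) (en i) (x i)" if "i : D" for i using P[OF that] by blast+
   show "0 <= b i / ?\<nu>" if "i : D" for i using b(1)[OF that] pos by simp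
   show "(SUM i:D. b i / ?\<nu>) = 1 / ?\<nu>" using b(2) by (simp flip: sum_divide_distrib)
  qed
  moreover have "c / \<Lambda> <= (1 / ?\<nu>) * c"
  proof -
   have "c / \<Lambda> <= c / ?\<nu>" by (rule divide_left_mono[OF \<Lambda>(1) c]) (use pos \<Lambda>(2) in simp)
   thus ?thesis by simp
  qed
  ultimately show "heavy (m + n0) (c / \<Lambda>) s e ?x" by (rule heavy_mono) simp
 qed
qed

text \<open>A special convex combination is taken over pairs further and further out. By
  \<open>no\<close> one of the two averages has norm at most 1 - \<delta> and gains the factor 1/(1
  - \<delta>) when normalised; the other has norm at most 1 and loses nothing. Which side gains may
  still depend on \<open>s\<close>.\<close>

lemma pair_step:
 assumes Z: "rich Z1" "rich Z2" and n0: "1 <= n0" and \<delta>: "0 < \<delta>" "\<delta> < 1" and eps: "0 < eps"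
  and no: "\<not> (EX D b st en x y. attaining Z1 Z2 n0 eps \<delta> s0 D b st en x y)"
  and all: "\<And>s. 1 <= s ==> EX e x y. heavy_pair Z1 Z2 n0 (1 / (1 - \<delta>)) t1 t2 s e x y" and s: "s0 <= s" "1 <= s"
 shows "(EX e x y. heavy_pair Z1 Z2 n0 (1 / (1 - \<delta>)) (Suc t1) t2 s e x y) \<or> (EX e x y. heavy_pair Z1 Z2 n0 (1 / (1 - \<delta>)) t1 (Suc t2) s e x y)"
proof -
 let ?\<gamma> = "1 / (1 - \<delta>)"
 let ?HP = "%p. heavy_pair Z1 Z2 n0 ?\<gamma> t1 t2 (fst p) (fst (snd p)) (fst (snd (snd p))) (snd (snd (snd p)))"
 have "EX f. ALL n. (?HP (f n) & s <= fst (f n)) & fst (snd (f n)) < fst (f (Suc n))"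
 proof (rule dependent_nat_choice)
  show "EX p. ?HP p & s <= fst p"
  proof -
   obtain e x y where "heavy_pair Z1 Z2 n0 ?\<gamma> t1 t2 s e x y" using all[OF s(2)] by blast
   thus ?thesis by (intro exI[of _ "(s, e, x, y)"]) simp
  qed
  fix p :: "nat \<times> nat \<times> vec \<times> vec" and n :: nat assume p: "?HP p & s <= fst p"
  obtain e x y where h: "heavy_pair Z1 Z2 n0 ?\<gamma> t1 t2 (fst p + fst (snd p) + 1) e x y" using all[of "fst p + fst (snd p) + 1"] by auto
  have "s <= fst p + fst (snd p) + 1" using p by linarith
  thus "EX p'. (?HP p' & s <= fst p') & fst (snd p) < fst p'" using h by (intro exI[of _ "(fst p + fst (snd p) + 1, e, x, y)"]) simp
 qed
 then obtain f where f: "\<And>n. ?HP (f n)" "\<And>n. s <= fst (f n)" "\<And>n. fst (snd (f n)) < fst (f (Suc n))" by blast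
 define st where "st = (%n. fst (f n))"
 define en where "en = (%n. fst (snd (f n)))"
 define x where "x = (%n. fst (snd (snd (f n))))"
 define y where "y = (%n. snd (snd (snd (f n))))"
 have hp: "heavy_pair Z1 Z2 n0 ?\<gamma> t1 t2 (st n) (en n) (x n) (y n)" "s <= st n" "en n < st (Suc n)" "st n <= en n" for n
  using f[of n] unfolding st_def en_def x_def y_def heavy_pair_def by blast+
 have mono: "strict_mono st" by (rule strict_mono_Suc_iff[THEN iffD2]) (use hp in "meson le_less_trans")
 have sep: "en i < st i'" if "i < i'" for i i'
 proof -
  have "en i < st (Suc i)" by (rule hp(3))
  also have "... <= st i'" using that strict_mono_mono[OF mono] by (simp add: mono_def Suc_leI)
  finally show ?thesis .
 qed
 have st1: "1 <= st k" for k using hp(2)[of k] s(2) by linarith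
 obtain D b where scc: "scc_on n0 eps st D b" using ex_scc_on[OF mono st1 eps n0, of 0] by (elim exE conjE)
 have fD: "finite D" and b0: "\<And>i. i : D ==> 0 <= b i" and b1: "(SUM i:D. b i) = 1" using scc unfolding scc_on_def by blast+
 have fe: "finite (en ` D)" using fD by simp
 define e where "e = Max (insert s (en ` D))"
 have e: "s <= e" "\<And>i. i : D ==> en i <= e" unfolding e_def using fe by auto
 have px: "s <= st i & st i <= en i & en i <= e & x i : Z1 & N (x i) = 1 & supp (x i) \<subseteq> {st i..en i} & heavy ((t1 + t2) * n0) (?\<gamma>^t1 / 2) (st i) (en i) (x i)"
  and py: "s <= st i & st i <= en i & en i <= e & y i : Z2 & N (y i) = 1 & supp (y i) \<subseteq> {st i..en i} & heavy ((t1 + t2) * n0) (?\<gamma>^t2 / 2) (st i) (en i) (y i)"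
  if "i : D" for i using hp[of i] e(2)[OF that] unfolding heavy_pair_def by blast+
 have N1: "N (lincomb D b z) <= 1" if "\<And>i. i : D ==> z i : c00 & N (z i) = 1" for z
 proof -
  have "N (lincomb D b z) <= (SUM i:D. \<bar>b i\<bar> * N (z i))" by (rule N_lincomb_le[OF fD]) (use that in blast)
  also have "... = (SUM i:D. b i)" by (rule sum.cong[OF refl]) (use that b0 in simp)
  finally show ?thesis using b1 by simp
 qed
 have xc: "x i : c00 & N (x i) = 1" and yc: "y i : c00 & N (y i) = 1" if "i : D" for i using px[OF that] py[OF that] richD(1)[OF Z(1)] richD(1)[OF Z(2)] by simp_all
 have g0: "0 <= ?\<gamma>^t / 2" for t using \<delta> by simp
 have ar: "(t1 + t2) * n0 + n0 = (Suc t1 + t2) * n0" "(t1 + t2) * n0 + n0 = (t1 + Suc t2) * n0" by simp_all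
 have gS: "?\<gamma>^t / 2 / (1 - \<delta>) = ?\<gamma>^Suc t / 2" for t by simp
 have cond: "ALL c:D. s0 <= st c & st c <= en c & x c : Z1 & y c : Z2 & N (x c) = 1 & N (y c) = 1 & supp (x c) \<subseteq> {st c..en c} & supp (y c) \<subseteq> {st c..en c}"
  using px py s(1) by (meson order_trans)
 have "\<not> (1 - \<delta> <= N (lincomb D b x) & 1 - \<delta> <= N (lincomb D b y))"
 proof
  assume "1 - \<delta> <= N (lincomb D b x) & 1 - \<delta> <= N (lincomb D b y)"
  hence "attaining Z1 Z2 n0 eps \<delta> s0 D b st en x y" unfolding attaining_def using scc cond sep by blast
  thus False using no by blast
 qed
 hence "N (lincomb D b x) <= 1 - \<delta> \<or> N (lincomb D b y) <= 1 - \<delta>" by linarith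
 thus ?thesis
 proof
  assume le: "N (lincomb D b x) <= 1 - \<delta>"
  obtain x' where x': "x' : Z1" "N x' = 1" "supp x' \<subseteq> {s..e}" "heavy ((Suc t1 + t2) * n0) (?\<gamma>^Suc t1 / 2) s e x'"
   using normalise_heavy[OF Z(1) scc sep px g0 le] \<delta>(2) unfolding ar(1) gS by auto
  obtain y' where y': "y' : Z2" "N y' = 1" "supp y' \<subseteq> {s..e}" "heavy ((Suc t1 + t2) * n0) (?\<gamma>^t2 / 2) s e y'"
   using normalise_heavy[OF Z(2) scc sep py g0 N1[OF yc]] unfolding ar(1) by auto
  have "heavy_pair Z1 Z2 n0 ?\<gamma> (Suc t1) t2 s e x' y'" unfolding heavy_pair_def by (intro conjI) (fact e(1) x' y')+
  thus ?thesis by blast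
 next
  assume le: "N (lincomb D b y) <= 1 - \<delta>"
  obtain x' where x': "x' : Z1" "N x' = 1" "supp x' \<subseteq> {s..e}" "heavy ((t1 + Suc t2) * n0) (?\<gamma>^t1 / 2) s e x'"
   using normalise_heavy[OF Z(1) scc sep px g0 N1[OF xc]] unfolding ar(2) by auto
  obtain y' where y': "y' : Z2" "N y' = 1" "supp y' \<subseteq> {s..e}" "heavy ((t1 + Suc t2) * n0) (?\<gamma>^Suc t2 / 2) s e y'"
   using normalise_heavy[OF Z(2) scc sep py g0 le] \<delta>(2) unfolding ar(2) gS by auto
  have "heavy_pair Z1 Z2 n0 ?\<gamma> t1 (Suc t2) s e x' y'" unfolding heavy_pair_def by (intro conjI) (fact e(1) x' y')+
  thus ?thesis by blast
 qed
qed

lemma rich_normalised: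
 assumes "rich Z" shows "EX x e. x : Z & N x = 1 & s <= e & supp x \<subseteq> {s..e}"
proof -
 obtain x where x: "x : Z" "supp x ~= {}" "supp x \<subseteq> {s..}" using richD(3)[OF assms, of s] by (elim bexE conjE)
 have xc: "x : c00" by (rule richD(1)[OF assms x(1)])
 have pos: "0 < N x" by (rule N_pos[OF xc x(2)])
 have fs: "finite (supp x)" using xc unfolding c00_def by simp
 let ?x = "lincomb {0::nat} (%_. 1 / N x) (%_. x)"
 have e: "?x = (%t. (1 / N x) * x t)" by (simp add: lincomb_def)
 have "?x : Z" by (rule richD(2)[OF assms _ x(1)]) simp
 moreover have "N ?x = 1" unfolding e N_scale[OF xc] using pos by simp
 moreover have "supp ?x \<subseteq> {s..max s (Max (supp x))}"
 proof
  fix t assume "t : supp ?x"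
  hence t: "t : supp x" unfolding e supp_def by simp
  hence "t <= Max (supp x)" by (rule Max_ge[OF fs])
  thus "t : {s..max s (Max (supp x))}" using x(3) t by auto
 qed
 ultimately show ?thesis by (intro exI[of _ ?x] exI[of _ "max s (Max (supp x))"]) simp
qed

lemma pairs_all:
 assumes Z: "rich Z1" "rich Z2" and n0: "1 <= n0" and \<delta>: "0 < \<delta>" "\<delta> < 1" and eps: "0 < eps"
  and no: "\<not> (EX D b st en x y. attaining Z1 Z2 n0 eps \<delta> s0 D b st en x y)"
 shows "EX t1 t2. t1 + t2 = t & (ALL s. s0 <= s & 1 <= s --> (EX e x y. heavy_pair Z1 Z2 n0 (1 / (1 - \<delta>)) t1 t2 s e x y))"
proof (induction t)
 case 0
 have "EX e x y. heavy_pair Z1 Z2 n0 (1 / (1 - \<delta>)) 0 0 s e x y" if s: "1 <= s" for s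
 proof -
  obtain x e1 where x: "x : Z1" "N x = 1" "s <= e1" "supp x \<subseteq> {s..e1}" using rich_normalised[OF Z(1)] by blast
  obtain y e2 where y: "y : Z2" "N y = 1" "s <= e2" "supp y \<subseteq> {s..e2}" using rich_normalised[OF Z(2)] by blast
  let ?e = "max e1 e2"
  have sx: "supp x \<subseteq> {s..?e}" and sy: "supp y \<subseteq> {s..?e}" using x(4) y(4) by fastforce+
  have c: "x : c00" "y : c00" by (rule richD(1)[OF Z(1) x(1)], rule richD(1)[OF Z(2) y(1)])
  have "heavy_pair Z1 Z2 n0 (1 / (1 - \<delta>)) 0 0 s ?e x y" unfolding heavy_pair_def using x y sx sy heavy_start[OF c(1) x(2) sx s] heavy_start[OF c(2) y(2) sy s] by simp
  thus ?thesis by blast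
 qed
 thus ?case by (intro exI[of _ 0]) simp
next
 case (Suc t)
 then obtain t1 t2 where t: "t1 + t2 = t" "ALL s. s0 <= s & 1 <= s --> (EX e x y. heavy_pair Z1 Z2 n0 (1 / (1 - \<delta>)) t1 t2 s e x y)" by blast
 let ?A = "%t1 t2 s. EX e x y. heavy_pair Z1 Z2 n0 (1 / (1 - \<delta>)) t1 t2 s e x y"
 have down: "?A u1 u2 s" if h: "?A u1 u2 s'" "s <= s'" for u1 u2 s s'
 proof -
  obtain e x y where h: "heavy_pair Z1 Z2 n0 (1 / (1 - \<delta>)) u1 u2 s' e x y" using h(1) by blast
  have sub: "{s'..e} \<subseteq> {s..e}" using \<open>s <= s'\<close> by simp
  have hv: "heavy m c s e z" if hh: "heavy m c s' e z" for m c z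
  proof -
   obtain F where F: "tree_family m s' e F" "c <= (SUM t:F. dot (eval t) (%n. \<bar>z n\<bar>))" using hh unfolding heavy_def by (elim exE conjE)
   have "tree_family m s e F" using F(1) sub unfolding tree_family_def by blast
   thus ?thesis unfolding heavy_def using F(2) by (intro exI[of _ F] conjI)
  qed
  have "s <= e" using h \<open>s <= s'\<close> unfolding heavy_pair_def by linarith
  moreover have "supp x \<subseteq> {s..e}" "supp y \<subseteq> {s..e}" using h sub unfolding heavy_pair_def by blast+
  moreover have "heavy ((u1 + u2) * n0) ((1 / (1 - \<delta>))^u1 / 2) s e x" "heavy ((u1 + u2) * n0) ((1 / (1 - \<delta>))^u2 / 2) s e y"
   by (rule hv, use h in "simp add: heavy_pair_def")+
  ultimately have "heavy_pair Z1 Z2 n0 (1 / (1 - \<delta>)) u1 u2 s e x y" using h unfolding heavy_pair_def by simp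
  thus ?thesis by blast
 qed
 have all: "?A t1 t2 s" if "1 <= s" for s by (rule down[of t1 t2 "max s s0"]) (use t(2) that in auto)
 have step: "?A (Suc t1) t2 s \<or> ?A t1 (Suc t2) s" if "s0 <= s" "1 <= s" for s by (rule pair_step[OF Z n0 \<delta> eps no all that])
 \<comment> \<open>The gaining side can be chosen independently of \<open>s\<close>. If the first
   side fails from some \<open>s1\<close> on, the second gains for all larger starting points, and
   by \<open>down\<close> also for the smaller ones.\<close>
 show ?case
 proof (cases "ALL s. s0 <= s & 1 <= s --> ?A (Suc t1) t2 s")
  case True
  thus ?thesis using t(1) by (intro exI[of _ "Suc t1"] exI[of _ t2]) simp
 next
  case False
  then obtain s1 where s1: "s0 <= s1" "1 <= s1" "\<not> ?A (Suc t1) t2 s1" by blast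
  have "?A t1 (Suc t2) s" if "s0 <= s & 1 <= s" for s
  proof (rule down[of _ _ "max s s1"])
   have "\<not> ?A (Suc t1) t2 (max s s1)" using down[of "Suc t1" t2 "max s s1" s1] s1(3) by auto
   thus "?A t1 (Suc t2) (max s s1)" using step[of "max s s1"] s1 by auto
  qed simp
  thus ?thesis using t(1) by (intro exI[of _ t1] exI[of _ "Suc t2"]) simp
 qed
qed

text \<open>The heaviness grows geometrically with the number of steps while the order grows only
  linearly. The order n_(w+1) admits 4 K 5^w steps, but m_(w+1) has binary logarithm only 5^w, so
  \<open>heavy_norm\<close> must fail for one of the two sides.\<close>

theorem ex_attaining:
 assumes Z: "rich Z1" "rich Z2" and n0: "1 <= n0" and \<delta>: "0 < \<delta>" "\<delta> < 1" and eps: "0 < eps"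
 shows "EX D b st en x y. attaining Z1 Z2 n0 eps \<delta> s0 D b st en x y"
proof (rule ccontr)
 assume no: "\<not> ?thesis"
 let ?\<gamma> = "1 / (1 - \<delta>)"
 have g1: "1 < ?\<gamma>" using \<delta> by simp
 obtain K where K: "2 < ?\<gamma>^K" using real_arch_pow[OF g1] by blast
 have K1: "1 <= K" using K by (cases K) auto
 \<comment> \<open>K steps double the heaviness. The choice makes \<open>w\<close> odd, so that w +
   1 is an even weight, and at least n0 * K, so that 4 K 5^w steps have order at most n_(w+1). One
   side gains at least 2 K 5^w times, which exceeds 2 m_(w+1).\<close>
 define w where "w = 2 * (n0 * K) + 1"
 have w1: "1 <= w" unfolding w_def by simp
 define j where "j = n0 * K + 1"
 have j: "2 * j = Suc w" "1 <= j" unfolding w_def j_def by simp_all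
 define t where "t = 4 * K * 5^w"
 have nw: "w <= nseq w"
 proof -
  have "v <= nseq v" for v
  proof (induction v)
   case (Suc v)
   show ?case
   proof (cases "1 <= v")
    case True
    have "Suc v <= 2 * nseq v" using Suc True nseq_pos[OF True] by linarith
    also have "... <= 45 * 5^v * nseq v" by (rule mult_le_mono1) (simp add: numeral_le_iff order_trans[of 2 45])
    finally show ?thesis unfolding nseq_Suc[OF True] .
   next
    case False
    thus ?thesis by (cases v) simp_all
   qed
  qed simp
  thus ?thesis .
 qed
 have m: "t * n0 <= nseq (2 * j)"
 proof -
  have "t * n0 = 4 * 5^w * (n0 * K)" unfolding t_def by simp
  also have "... <= 4 * 5^w * nseq w" using nw unfolding w_def by (intro mult_le_mono2) simp
  also have "... <= 45 * 5^w * nseq w" by (intro mult_le_mono1) simp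
  finally show ?thesis unfolding j(1) nseq_Suc[OF w1] .
 qed
 have big: "2 * rm (2 * j) < ?\<gamma>^(2 * K * 5^w)"
 proof -
  have "(2::real)^(2 * 5^w) <= (?\<gamma>^K)^(2 * 5^w)" by (rule power_mono) (use K in simp_all)
  also have "... = ?\<gamma>^(2 * K * 5^w)" by (simp add: power_mult[symmetric] mult_ac)
  finally have "(2::real)^(2 * 5^w) <= ?\<gamma>^(2 * K * 5^w)" .
  moreover have "2 * rm (2 * j) = 2^(5^w + 1)" unfolding j(1) mseq_Suc by simp
  moreover have "(2::real)^(5^w + 1) < 2^(2 * 5^w)"
  proof (rule power_strict_increasing)
   have "(5::nat) ^ 1 <= 5 ^ w" by (rule power_increasing[OF w1]) simp
   thus "5 ^ w + 1 < 2 * (5::nat) ^ w" by simp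
  qed simp
  ultimately show ?thesis by linarith
 qed
 obtain t1 t2 where t: "t1 + t2 = t" "ALL s. s0 <= s & 1 <= s --> (EX e x y. heavy_pair Z1 Z2 n0 ?\<gamma> t1 t2 s e x y)" using pairs_all[OF Z n0 \<delta> eps no] by blast
 obtain e x y where h: "heavy_pair Z1 Z2 n0 ?\<gamma> t1 t2 (max s0 1) e x y"
 proof -
  have "s0 <= max s0 1 & 1 <= max s0 1" by simp
  from t(2)[rule_format, OF this] show thesis using that by (elim exE)
 qed
 have c: "x : c00" "y : c00" using h richD(1)[OF Z(1)] richD(1)[OF Z(2)] unfolding heavy_pair_def by blast+
 have bound: "?\<gamma>^u / 2 / rm (2 * j) <= 1" if "heavy ((t1 + t2) * n0) (?\<gamma>^u / 2) (max s0 1) e z" "z : c00" "N z = 1" for u z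
  using heavy_norm[OF that(2,1) _ j(2)] m t(1) that(3) by simp
 have mp: "0 < rm (2 * j)" using mseq_pos[of "2 * j"] j(2) by simp
 have contra: False if "2 * K * 5^w <= u" "?\<gamma>^u / 2 / rm (2 * j) <= 1" for u
 proof -
  have "?\<gamma>^(2 * K * 5^w) <= ?\<gamma>^u" by (rule power_increasing[OF that(1)]) (use g1 in simp)
  moreover have "?\<gamma>^u <= 2 * rm (2 * j)" using that(2) mp by (simp add: divide_le_eq)
  ultimately show False using big by linarith
 qed
 have "2 * K * 5^w <= t1 \<or> 2 * K * 5^w <= t2" using t(1) unfolding t_def by linarith
 thus False
 proof
  assume a: "2 * K * 5^w <= t1"
  show False by (rule contra[OF a bound[of t1 x]]) (use h c in "auto simp: heavy_pair_def")
 next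
  assume a: "2 * K * 5^w <= t2"
  show False by (rule contra[OF a bound[of t2 y]]) (use h c in "auto simp: heavy_pair_def")
 qed
qed

end

section \<open>Equivalent sequences\<close>

lemma chain_less:
 fixes e s :: "nat => nat"
 assumes "\<And>n. e n < s (Suc n)" "\<And>n. s n <= e n" "i < i'" shows "e i < s i'" using assms(3)
proof (induction i')
 case (Suc i')
 show ?case
 proof (cases "i = i'")
  case True
  thus ?thesis using assms(1) by simp
 next
  case False
  hence "e i < s i'" using Suc by simp
  also have "... <= e i'" by (rule assms(2))
  also have "... < s (Suc i')" by (rule assms(1))
  finally show ?thesis .
 qed
qed simp

text \<open>Frontiers of depth 4 * 5^(r - 1) suit both needs. The corresponding power of 1/2 is
  m_r^(-4), which outweighs the scaling by m_q m_r, while the order of such a frontier still fits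
  below n_r because n_r = 45 * 5^(r - 1) * n_(r - 1).\<close>

lemma weight_numerics:
 assumes r: "2 <= r" and \<eta>: "1 / rm r <= \<eta>"
 shows "rm r * (1/2)^(4 * 5^(r - 1)) <= \<eta>"
  "q < r ==> rm q * rm r * (1/2)^(4 * 5^(r - 1)) <= \<eta>"
  "q < r ==> rm q * rm r / rm (Suc r) <= \<eta>"
  "4 * 5^(r - 1) * nseq (r - 1) <= nseq r - 1 - 1"
proof -
 let ?m = "rm r"
 have m1: "1 <= ?m" using mseq_pos[of r] r by simp
 have S: "Suc (r - 1) = r" using r by simp
 have m: "?m = 2^5^(r - 1)" using mseq_Suc[of "r - 1"] S by simp
 have p: "(1/2::real)^(4 * 5^(r - 1)) = 1 / ?m^4" unfolding m by (simp add: power_one_over power_mult[symmetric] mult.commute)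
 have "?m * (1 / ?m^4) = 1 / ?m^3" using m1 by (simp add: field_simps eval_nat_numeral)
 also have "... <= 1 / ?m^1" using m1 by (intro divide_left_mono power_increasing) auto
 finally show "?m * (1/2)^(4 * 5^(r - 1)) <= \<eta>" unfolding p using \<eta> by simp
 show "4 * 5^(r - 1) * nseq (r - 1) <= nseq r - 1 - 1"
 proof -
  have r1: "1 <= r - 1" using r by simp
  have "nseq r = 45 * 5^(r - 1) * nseq (r - 1)" using nseq_Suc[OF r1] S by simp
  moreover have "1 <= 5^(r - 1) * nseq (r - 1)" using nseq_pos[OF r1] by simp
  ultimately show ?thesis by linarith
 qed
 assume q: "q < r"
 have qm: "rm q <= ?m" using mseq_mono[of q r] q by simp
 have "rm q * ?m * (1 / ?m^4) <= ?m * ?m * (1 / ?m^4)" by (intro mult_right_mono qm) simp_all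
 also have "... = 1 / ?m^2" using m1 by (simp add: field_simps eval_nat_numeral)
 also have "... <= 1 / ?m^1" using m1 by (intro divide_left_mono power_increasing) auto
 finally show "rm q * ?m * (1/2)^(4 * 5^(r - 1)) <= \<eta>" unfolding p using \<eta> by simp
 have "rm q * ?m / rm (Suc r) <= ?m * ?m / rm (Suc r)" by (intro divide_right_mono mult_right_mono qm) simp_all
 also have "... = 1 / ?m^3" using m1 r by (simp add: mseq_Suc' field_simps eval_nat_numeral)
 also have "... <= 1 / ?m^1" using m1 by (intro divide_left_mono power_increasing) auto
 finally show "rm q * ?m / rm (Suc r) <= \<eta>" using \<eta> by simp
qed

context cr_space begin

section \<open>Construction of micro, meso and macro averages\<close>

definition in_spans :: "vec set => vec set => micro => bool" where
 "in_spans Z1 Z2 M \<longleftrightarrow> (ALL c:slots M. xv M c : Z1 & yv M c : Z2)"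

text \<open>The order of the choices matters: the lower end of the window and the position come
  before the order \<open>n0\<close>, which has to exceed the orders of frontiers and interval ends
  determined by them. Half of \<eta> is kept in reserve since the norm is only approximated by
  trees.\<close>

lemma ex_micro:
 assumes Z: "rich Z1" "rich Z2" and \<eta>: "0 < \<eta>" "\<eta> <= 1" and qr: "1 <= q" "1 <= r"
 shows "EX M. micro_ok q r L \<eta> M & s <= beg M & 1 <= beg M & w <= lo M & in_spans Z1 Z2 M"
proof -
 let ?m = "rm q * rm r"
 have m: "0 < ?m" using mseq_pos[OF qr(1)] mseq_pos[OF qr(2)] by simp
 define lw where "lw = max w (Suc r)"
 define p where "p = max s (max (2 * L) 1)"
 obtain L1 where L1: "(1/2::real)^L1 < \<eta> / ?m" using real_arch_pow_inv[of "\<eta> / ?m" "1/2"] \<eta> m by auto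
 define \<rho> where "\<rho> = Max (rho l ` {..<p})"
 have \<rho>: "rho l e <= \<rho>" if "e < p" for e unfolding \<rho>_def by (rule Max_ge) (use that in auto)
 define n0 where "n0 = max (L1 * nseq (lw - 1)) (\<rho> + 2) + 1"
 define eps where "eps = \<eta> / ?m"
 have e0: "0 < eps" unfolding eps_def using \<eta> m by simp
 have n01: "1 <= n0" and d: "0 < \<eta> / 2" "\<eta> / 2 < 1" unfolding n0_def using \<eta> by simp_all
 obtain D b st en x y where at: "attaining Z1 Z2 n0 eps (\<eta> / 2) p D b st en x y" using ex_attaining[OF Z n01 d e0] by blast
 have scc: "scc_on n0 eps st D b" and
  A: "\<And>c. c : D ==> p <= st c & st c <= en c & x c : Z1 & y c : Z2 & N (x c) = 1 & N (y c) = 1 & supp (x c) \<subseteq> {st c..en c} & supp (y c) \<subseteq> {st c..en c}"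
  and sep: "\<And>c c'. c : D ==> c' : D ==> c < c' ==> en c < st c'"
  and low: "1 - \<eta> / 2 <= N (lincomb D b x)" "1 - \<eta> / 2 <= N (lincomb D b y)" using at unfolding attaining_def by blast+
 have fD: "finite D" and b0: "\<And>c. c : D ==> 0 <= b c" using scc unfolding scc_on_def by blast+
 have As: "supp (x c) \<subseteq> {st c..en c}" "supp (y c) \<subseteq> {st c..en c}" if "c : D" for c using A[OF that] by simp_all
 have xc: "x c : c00" and yc: "y c : c00" if "c : D" for c using A[OF that] richD(1)[OF Z(1)] richD(1)[OF Z(2)] by blast+
 define l1 where "l1 = (%z::vec. SUM n:supp z. \<bar>z n\<bar>)"
 have l10: "0 <= l1 z" for z unfolding l1_def by (rule sum_nonneg) simp
 let ?S = "SUM c:D. l1 (x c) + l1 (y c)"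
 obtain k where k: "?S / eps <= real k" using real_arch_simple by blast
 \<comment> \<open>The upper end of the window is fixed last, when the vectors and their coordinate
   sums are known; beyond it m_(hw+1) exceeds all these sums divided by \<open>eps\<close>.\<close>
 define hw where "hw = max lw k"
 have S: "?S <= eps * rm (Suc hw)"
 proof -
  have "real k <= rm (Suc hw)" using less_mseq[of "Suc hw"] unfolding hw_def by simp
  hence "?S / eps <= rm (Suc hw)" using k by linarith
  thus ?thesis using e0 by (simp add: pos_divide_le_eq mult.commute)
 qed
 have l1b: "l1 (x c) <= eps * rm (Suc hw)" "l1 (y c) <= eps * rm (Suc hw)" if c: "c : D" for c
 proof -
  have "l1 (x c) + l1 (y c) <= ?S" by (rule member_le_sum[OF c _ fD]) (use l10 in "simp add: add_nonneg_nonneg")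
  thus "l1 (x c) <= eps * rm (Suc hw)" "l1 (y c) <= eps * rm (Suc hw)" using S l10[of "x c"] l10[of "y c"] by linarith+
 qed
 define M where "M = Micro lw hw p (Max (insert p (en ` D))) D b st en x y"
 have M: "lo M = lw" "hi M = hw" "beg M = p" "fin M = Max (insert p (en ` D))" "slots M = D" "coef1 M = b" "lft M = st" "rgt M = en" "xv M = x" "yv M = y" unfolding M_def by simp_all
 have xaM: "xa M c = (%t. \<bar>x c t\<bar>)" "ya M c = (%t. \<bar>y c t\<bar>)" for c unfolding xa_def ya_def M by simp_all
 have cvz: "cell_vec eps v M c" if v: "v M c = (%t. \<bar>z t\<bar>)" and z: "z : c00" "N z = 1" "supp z \<subseteq> {st c..en c}" "l1 z <= eps * rm (Suc hw)" for v c z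
  unfolding cell_vec_def v supp_abs N_abs[OF z(1)] M using c00_abs[OF z(1)] z(2-4) unfolding l1_def by simp
 have cv: "ALL v:{xa, ya}. ALL c:slots M. cell_vec eps v M c"
 proof (intro ballI)
  fix v c assume v: "v : {xa, ya}" and "c : slots M"
  hence c: "c : D" unfolding M by simp
  from v consider "v = xa" | "v = ya" by blast
  thus "cell_vec eps v M c"
  proof cases
   case 1
   show ?thesis unfolding 1 using A[OF c] by (intro cvz[of xa c "x c"] xaM xc[OF c] l1b(1)[OF c]) simp_all
  next
   case 2
   show ?thesis unfolding 2 using A[OF c] by (intro cvz[of ya c "y c"] xaM yc[OF c] l1b(2)[OF c]) simp_all
  qed
 qed
 have nz: "EX T. normed_by \<eta> v M T" if v: "\<And>c. v M c = (%t. \<bar>z c t\<bar>)" and z: "\<And>c. c : D ==> z c : c00" "\<And>c. c : D ==> supp (z c) \<subseteq> {st c..en c}" "1 - \<eta> / 2 <= N (lincomb D b z)" for v z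
 proof -
  have zc: "lincomb D b z : c00" by (rule c00_lincomb[OF fD z(1)])
  have "1 - \<eta> < N (lincomb D b z)" using z(3) \<eta>(1) by simp
  from N_tree_approx[OF zc this] obtain T where T: "valid T" "1 - \<eta> < dot (eval T) (%t. \<bar>lincomb D b z t\<bar>)" by blast
  obtain T' where T': "valid T'" "eval T' = proj (UN c:D. {st c..en c}) (eval T)" using valid_proj[OF T(1)] by blast
  have dis: "disjoint_family_on (%c. supp (z c)) D" unfolding disjoint_family_on_def
  proof (intro ballI impI, rule ccontr)
   fix j j' assume j: "j : D" "j' : D" "j ~= j'" "supp (z j) \<inter> supp (z j') ~= {}"
   then obtain t where t: "t : supp (z j)" "t : supp (z j')" by blast
   have "st j <= t" "t <= en j" "st j' <= t" "t <= en j'" using subsetD[OF z(2)[OF j(1)] t(1)] subsetD[OF z(2)[OF j(2)] t(2)] by auto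
   moreover have "en j < st j' \<or> en j' < st j" using sep[OF j(1,2)] sep[OF j(2,1)] j(3) by linarith
   ultimately show False by linarith
  qed
  have mv: "mic_vec v M = (%t. \<bar>lincomb D b z t\<bar>)" unfolding mic_vec_def M sum_disjoint_abs[OF fD dis] by (rule lincomb_cong) (use b0 v in simp_all)
  have sub: "supp (lincomb D b z) \<subseteq> (UN c:D. {st c..en c})" by (rule order_trans[OF supp_lincomb UN_mono[OF order_refl z(2)]])
  have "dot (eval T') (%t. \<bar>lincomb D b z t\<bar>) = dot (eval T) (%t. \<bar>lincomb D b z t\<bar>)" unfolding dot_def T'(2) proj_def supp_abs
  proof (rule sum.cong[OF refl])
   fix t assume "t : supp (lincomb D b z)"
   hence "t : (UN c:D. {st c..en c})" by (rule subsetD[OF sub])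
   thus "(if t : (UN c:D. {st c..en c}) then eval T t else 0) * \<bar>lincomb D b z t\<bar> = eval T t * \<bar>lincomb D b z t\<bar>" by (simp only: if_True)
  qed
  hence "normed_by \<eta> v M T'" unfolding normed_by_def mv M using T(2) T' by (simp add: supp_proj)
  thus ?thesis ..
 qed
 have nb: "ALL v:{xa, ya}. EX T. normed_by \<eta> v M T"
 proof
  fix v assume "v : {xa, ya}"
  then consider "v = xa" | "v = ya" by blast
  thus "EX T. normed_by \<eta> v M T"
  proof cases
   case 1
   show ?thesis unfolding 1 by (rule nz[of xa x, OF xaM(1) xc As(1) low(1)])
  next
   case 2
   show ?thesis unfolding 2 by (rule nz[of ya y, OF xaM(2) yc As(2) low(2)])
  qed
 qed
 have "micro_ok q r L \<eta> M" unfolding micro_ok_def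
 proof (intro conjI)
  show "r < lo M" "lo M <= hi M" "2 * L <= beg M" unfolding M lw_def hw_def p_def by simp_all
  show "ALL c:slots M. beg M <= lft M c & lft M c <= rgt M c & rgt M c <= fin M" unfolding M using A fD by simp
  show "ALL c:slots M. ALL c':slots M. c < c' --> rgt M c < lft M c'" unfolding M using sep by simp
  show "EX n eps \<mu> L1 \<rho>. scc_on n eps (lft M) (slots M) (coef1 M) & ?m * eps <= \<eta> & ?m * (1/2)^L1 <= \<eta> & ?m * \<mu> <= \<eta> &
    L1 * nseq (lo M - 1) <= n - 1 & \<rho> + 2 <= n - 1 & (ALL e<beg M. rho l e <= \<rho>) &
    (ALL v:{xa, ya}. ALL c:slots M. cell_vec \<mu> v M c)"
  proof (rule exI[of _ n0], rule exI[of _ eps], rule exI[of _ eps], rule exI[of _ L1], rule exI[of _ \<rho>], intro conjI)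
   show "scc_on n0 eps (lft M) (slots M) (coef1 M)" unfolding M by (rule scc)
   show "?m * eps <= \<eta>" "?m * eps <= \<eta>" unfolding eps_def using m \<eta> by simp_all
   show "?m * (1/2)^L1 <= \<eta>" using L1 m by (simp add: pos_less_divide_eq mult.commute)
   show "L1 * nseq (lo M - 1) <= n0 - 1" "\<rho> + 2 <= n0 - 1" unfolding M n0_def by simp_all
   show "ALL e<beg M. rho l e <= \<rho>" unfolding M using \<rho> by blast
  qed (rule cv)
 qed (rule nb)
 moreover have "s <= beg M" "1 <= beg M" "w <= lo M" unfolding M p_def lw_def by simp_all
 moreover have "in_spans Z1 Z2 M" unfolding in_spans_def M using A by blast
 ultimately show ?thesis by blast
qed

lemma ex_weight:
 assumes "0 < \<eta>" shows "EX j:L1. k < 2 * j & 1 / rm (2 * j) <= \<eta>"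
proof -
 obtain k' where k': "1 / \<eta> <= real k'" using real_arch_simple by blast
 obtain j where j: "j : L1" "k + k' < j" using ex_L1_gt by blast
 have "real k' <= rm (2 * j)" using less_mseq[of "2 * j"] j(2) by simp
 hence le: "1 / \<eta> <= rm (2 * j)" using k' by linarith
 hence "1 <= \<eta> * rm (2 * j)" using assms by (simp add: pos_divide_le_eq mult.commute)
 moreover have "0 < rm (2 * j)" using mseq_pos[of "2 * j"] j(2) by simp
 ultimately have "1 / rm (2 * j) <= \<eta>" by (simp add: pos_divide_le_eq)
 thus ?thesis using j by (intro bexI[of _ j]) simp_all
qed

text \<open>The order n_r - 1 meets both bounds of \<open>meso_ok\<close>: frontiers of the depth
  given by \<open>weight_numerics\<close> stay below it, and the node of weight r can take the
  family. The micro averages are built successively, each with its window above the previous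
  one.\<close>

lemma ex_meso:
 assumes Z: "rich Z1" "rich Z2" and \<eta>: "0 < \<eta>" "\<eta> <= 1" and q: "1 <= q" and s: "1 <= s"
 shows "EX K. meso_ok q L \<eta> K & s <= mbeg K & mbeg K <= mfin K & w <= wm K & (ALL b:mics K. in_spans Z1 Z2 (mic K b))"
proof -
 obtain j where j: "j : L1" "max q w < 2 * j" "1 / rm (2 * j) <= \<eta>" using ex_weight[OF \<eta>(1)] by blast
 define r where "r = 2 * j"
 have r: "2 <= r" "q < r" "w <= r" "1 <= r" using j L1_pos[OF j(1)] unfolding r_def by simp_all
 have r\<eta>: "1 / rm r <= \<eta>" using j(3) unfolding r_def .
 note num = weight_numerics[OF r(1) r\<eta>]
 let ?m = "rm q * rm r"
 have m: "0 < ?m" using mseq_pos[OF q] mseq_pos[OF r(4)] by simp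
 let ?P = "%M. micro_ok q r L \<eta> M & s <= beg M & 1 <= beg M & in_spans Z1 Z2 M"
 have "EX f. ALL n. ?P (f n) & (fin (f n) < beg (f (Suc n)) & hi (f n) < lo (f (Suc n)))"
 proof (rule dependent_nat_choice)
  show "EX M. ?P M" using ex_micro[OF Z \<eta> q r(4), of L s 0] by blast
  fix M and n :: nat assume "?P M"
  obtain M' where "micro_ok q r L \<eta> M' & s + Suc (fin M) <= beg M' & 1 <= beg M' & Suc (hi M) <= lo M' & in_spans Z1 Z2 M'"
   using ex_micro[OF Z \<eta> q r(4), of L "s + Suc (fin M)" "Suc (hi M)"] by blast
  thus "EX M'. ?P M' & (fin M < beg M' & hi M < lo M')" by (intro exI[of _ M']) auto
 qed
 then obtain f where f: "\<And>n. micro_ok q r L \<eta> (f n)" "\<And>n. s <= beg (f n)" "\<And>n. 1 <= beg (f n)" "\<And>n. in_spans Z1 Z2 (f n)"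
   "\<And>n. fin (f n) < beg (f (Suc n))" "\<And>n. hi (f n) < lo (f (Suc n))" by blast
 have be: "beg (f n) <= fin (f n)" for n
 proof -
  obtain n' eps' where "scc_on n' eps' (lft (f n)) (slots (f n)) (coef1 (f n))" using f(1)[of n] unfolding micro_ok_def by blast
  hence "slots (f n) ~= {}" by (rule scc_on_nonempty)
  then obtain c where "c : slots (f n)" by blast
  thus ?thesis by (rule micro_cell(2)[OF f(1)])
 qed
 have lh: "lo (f n) <= hi (f n)" for n using f(1)[of n] unfolding micro_ok_def by blast
 have mono: "strict_mono (%n. beg (f n))" by (rule strict_mono_Suc_iff[THEN iffD2]) (use f(5) be in "meson le_less_trans")
 have n1: "1 <= nseq r - 1" using nseq_pos[OF r(4)] by simp
 have e0: "0 < \<eta> / ?m" using \<eta> m by simp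
 obtain B b where scc: "scc_on (nseq r - 1) (\<eta> / ?m) (%n. beg (f n)) B b" using ex_scc_on[OF mono f(3) e0 n1, of 0] by (elim exE conjE)
 have fB: "finite B" using scc unfolding scc_on_def by blast
 define K where "K = Meso r s (Max (insert s ((%n. fin (f n)) ` B))) B b f"
 have K: "wm K = r" "mbeg K = s" "mfin K = Max (insert s ((%n. fin (f n)) ` B))" "mics K = B" "coef2 K = b" "mic K = f" unfolding K_def by simp_all
 have fe: "fin (f n) <= mfin K" if "n : B" for n unfolding K(3) by (rule Max_ge) (use fB that in auto)
 have "meso_ok q L \<eta> K" unfolding meso_ok_def K(1)
 proof (intro conjI)
  show "EX j:L1. r = 2 * j" using j(1) r_def by blast
  show "ALL b:mics K. micro_ok q r L \<eta> (mic K b) & mbeg K <= beg (mic K b) & fin (mic K b) <= mfin K" using f(1,2) fe unfolding K(2,4,6) by blast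
  show "ALL b:mics K. ALL b':mics K. b < b' --> fin (mic K b) < beg (mic K b') & hi (mic K b) < lo (mic K b')"
   unfolding K(4,6) using chain_less[of "%n. fin (f n)" "%n. beg (f n)", OF f(5) be] chain_less[of "%n. hi (f n)" "%n. lo (f n)", OF f(6) lh] by blast
  show "EX n eps L2. scc_on n eps (%b. beg (mic K b)) (mics K) (coef2 K) & ?m * eps <= \<eta> & ?m * (1/2)^L2 <= \<eta> & L2 * nseq (r - 1) <= n - 1 & n <= nseq r - 1"
  proof (rule exI[of _ "nseq r - 1"], rule exI[of _ "\<eta> / ?m"], rule exI[of _ "4 * 5^(r - 1)"], intro conjI)
   show "scc_on (nseq r - 1) (\<eta> / ?m) (%b. beg (mic K b)) (mics K) (coef2 K)" unfolding K(4-6) by (rule scc)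
   show "?m * (\<eta> / ?m) <= \<eta>" using m \<eta> by simp
  qed (rule num(2)[OF r(2)], rule num(4), rule order_refl)
 qed (rule r(2), rule num(3)[OF r(2)])
 moreover have "mbeg K <= mfin K" unfolding K(2,3) by (rule Max_ge) (use fB in auto)
 moreover have "s <= mbeg K" "w <= wm K" unfolding K(1,2) using r(3) by simp_all
 moreover have "ALL b:mics K. in_spans Z1 Z2 (mic K b)" unfolding K(6) using f(4) by blast
 ultimately show ?thesis by blast
qed

text \<open>The weight q is fixed before anything else, so that the average can start beyond n_q and
  the depth 4 * 5^(q - 1) can be prescribed to all its micro averages.\<close>

lemma ex_macro:
 assumes Z: "rich Z1" "rich Z2" and \<eta>: "0 < \<eta>" "\<eta> <= 1"
 shows "EX Q. macro_ok \<eta> Q & s <= qbeg Q & w <= wq Q & (ALL a:mesos Q. ALL b:mics (mes Q a). in_spans Z1 Z2 (mic (mes Q a) b))"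
proof -
 obtain j where j: "j : L1" "w < 2 * j" "1 / rm (2 * j) <= \<eta>" using ex_weight[OF \<eta>(1)] by blast
 define q where "q = 2 * j"
 have q: "2 <= q" "w <= q" "1 <= q" using j L1_pos[OF j(1)] unfolding q_def by simp_all
 have q\<eta>: "1 / rm q <= \<eta>" using j(3) unfolding q_def .
 note num = weight_numerics[OF q(1) q\<eta>]
 let ?m = "rm q" let ?L = "4 * 5^(q - 1)"
 have m: "0 < ?m" using mseq_pos[OF q(3)] by simp
 define p where "p = max s (Suc (nseq q))"
 have p1: "1 <= p" unfolding p_def by simp
 let ?P = "%K. meso_ok q ?L \<eta> K & p <= mbeg K & mbeg K <= mfin K & (ALL b:mics K. in_spans Z1 Z2 (mic K b))"
 have "EX f. ALL n. ?P (f n) & (mfin (f n) < mbeg (f (Suc n)) & wm (f n) < wm (f (Suc n)))"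
 proof (rule dependent_nat_choice)
  show "EX K. ?P K" using ex_meso[OF Z \<eta> q(3) p1, of ?L 0] by blast
  fix K and n :: nat assume "?P K"
  have "1 <= p + Suc (mfin K)" by simp
  from ex_meso[OF Z \<eta> q(3) this, of ?L "Suc (wm K)"]
  obtain K' where "meso_ok q ?L \<eta> K' & p + Suc (mfin K) <= mbeg K' & mbeg K' <= mfin K' & Suc (wm K) <= wm K' & (ALL b:mics K'. in_spans Z1 Z2 (mic K' b))" by blast
  thus "EX K'. ?P K' & (mfin K < mbeg K' & wm K < wm K')" by (intro exI[of _ K']) auto
 qed
 then obtain f where f: "\<And>n. meso_ok q ?L \<eta> (f n)" "\<And>n. p <= mbeg (f n)" "\<And>n. mbeg (f n) <= mfin (f n)" "\<And>n b. b : mics (f n) ==> in_spans Z1 Z2 (mic (f n) b)"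
   "\<And>n. mfin (f n) < mbeg (f (Suc n))" "\<And>n. wm (f n) < wm (f (Suc n))" by blast
 have mono: "strict_mono (%n. mbeg (f n))" by (rule strict_mono_Suc_iff[THEN iffD2]) (use f(3,5) in "meson le_less_trans")
 have n1: "1 <= nseq q - 1" using nseq_pos[OF q(3)] by simp
 have e0: "0 < \<eta> / ?m" using \<eta> m by simp
 have f1: "1 <= mbeg (f n)" for n using f(2)[of n] p1 by linarith
 obtain C b where scc: "scc_on (nseq q - 1) (\<eta> / ?m) (%n. mbeg (f n)) C b" using ex_scc_on[OF mono f1 e0 n1, of 0] by (elim exE conjE)
 have fC: "finite C" using scc unfolding scc_on_def by blast
 define Q where "Q = Macro q p (Max (insert p ((%n. mfin (f n)) ` C))) C b f"
 have Q: "wq Q = q" "qbeg Q = p" "qfin Q = Max (insert p ((%n. mfin (f n)) ` C))" "mesos Q = C" "coef3 Q = b" "mes Q = f" unfolding Q_def by simp_all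
 have fe: "mfin (f n) <= qfin Q" if "n : C" for n unfolding Q(3) by (rule Max_ge) (use fC that in auto)
 have "macro_ok \<eta> Q" unfolding macro_ok_def Q(1)
 proof (intro conjI)
  show "EX j:L1. q = 2 * j" using j(1) q_def by blast
  show "nseq q < qbeg Q" unfolding Q(2) p_def by simp
  show "ALL a:mesos Q. ALL a':mesos Q. a < a' --> mfin (mes Q a) < mbeg (mes Q a') & wm (mes Q a) < wm (mes Q a')"
   unfolding Q(4,6) using chain_less[of "%n. mfin (f n)" "%n. mbeg (f n)", OF f(5,3)] chain_less[of "%n. wm (f n)" "%n. wm (f n)", OF f(6) order_refl] by blast
  show "EX n eps L. scc_on n eps (%a. mbeg (mes Q a)) (mesos Q) (coef3 Q) & ?m * eps <= \<eta> & ?m * (1/2)^L <= \<eta> & L * nseq (q - 1) <= n - 1 & n <= nseq q - 1 &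
    (ALL a:mesos Q. meso_ok q L \<eta> (mes Q a) & qbeg Q <= mbeg (mes Q a) & mfin (mes Q a) <= qfin Q)"
  proof (rule exI[of _ "nseq q - 1"], rule exI[of _ "\<eta> / ?m"], rule exI[of _ ?L], intro conjI)
   show "scc_on (nseq q - 1) (\<eta> / ?m) (%a. mbeg (mes Q a)) (mesos Q) (coef3 Q)" unfolding Q(4-6) by (rule scc)
   show "?m * (\<eta> / ?m) <= \<eta>" using m \<eta> by simp
   show "ALL a:mesos Q. meso_ok q ?L \<eta> (mes Q a) & qbeg Q <= mbeg (mes Q a) & mfin (mes Q a) <= qfin Q" using f(1,2) fe unfolding Q(2,4,6) by blast
  qed (rule num(1), rule num(4), rule order_refl)
 qed (rule q\<eta>)
 moreover have "s <= qbeg Q" "w <= wq Q" unfolding Q(1,2) p_def using q(2) by simp_all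
 moreover have "ALL a:mesos Q. ALL b:mics (mes Q a). in_spans Z1 Z2 (mic (mes Q a) b)" unfolding Q(6) using f(4) by blast
 ultimately show ?thesis by blast
qed

text \<open>Besides the equivalence, a bound for each coefficient is recorded. It comes from the
  norms being at least 1/2 and from unconditionality, and later makes the linear maps between the
  spans well defined.\<close>

theorem ex_equivalent_sequences:
 assumes Z: "rich Z1" "rich Z2"
 shows "EX x y. (ALL i::nat. x i : Z1 & y i : Z2) &
  (ALL I \<alpha>. finite I --> N (lincomb I \<alpha> y) <= 1000 * N (lincomb I \<alpha> x) & N (lincomb I \<alpha> x) <= 1000 * N (lincomb I \<alpha> y) &
   (ALL i:I. \<bar>\<alpha> i\<bar> <= 2 * N (lincomb I \<alpha> x)))"
proof -
 let ?sp = "%Q. ALL a:mesos Q. ALL b:mics (mes Q a). in_spans Z1 Z2 (mic (mes Q a) b)"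
 let ?R = "%Q Q'. qfin Q < qbeg Q' & wq Q < wq Q' & (ALL a:mesos Q. wm (mes Q a) < wq Q')"
 have half: "0 < (1/2::real)^(n + 1)" "(1/2::real)^(n + 1) <= 1" for n using power_le_one[of "1/2::real" "n + 1"] by simp_all
 have "EX f. ALL n. (macro_ok ((1/2)^(n + 1)) (f n) & ?sp (f n)) & ?R (f n) (f (Suc n))"
 proof (rule dependent_nat_choice)
  show "EX Q. macro_ok ((1/2)^(0 + 1)) Q & ?sp Q" using ex_macro[OF Z half(1)[of 0] half(2)[of 0]] by blast
  fix Q and n :: nat assume Q: "macro_ok ((1/2)^(n + 1)) Q & ?sp Q"
  have fQ: "finite (mesos Q)" using macro_scc(1)[OF conjunct1[OF Q]] scc_finite by blast
  \<comment> \<open>The next macro average has to exceed both the macro weight and all meso weights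
    of the present one, as the locale \<open>tower\<close> demands.\<close>
  define w where "w = Suc (Max (insert (wq Q) ((%a. wm (mes Q a)) ` mesos Q)))"
  have w: "wq Q < w" "\<And>a. a : mesos Q ==> wm (mes Q a) < w" unfolding w_def less_Suc_eq_le by (rule Max_ge; use fQ in auto)+
  obtain Q' where Q': "macro_ok ((1/2)^(Suc n + 1)) Q'" "Suc (qfin Q) <= qbeg Q'" "w <= wq Q'" "?sp Q'" using ex_macro[OF Z half(1)[of "Suc n"] half(2)[of "Suc n"], of "Suc (qfin Q)" w] by blast
  have "?R Q Q'" using Q'(2,3) w by fastforce
  thus "EX Q'. (macro_ok ((1/2)^(Suc n + 1)) Q' & ?sp Q') & ?R Q Q'" using Q'(1,4) by blast
 qed
 then obtain Q where Q: "\<And>n. macro_ok ((1/2)^(n + 1)) (Q n)" "\<And>n. ?sp (Q n)" "\<And>n. qfin (Q n) < qbeg (Q (Suc n))" "\<And>n. wq (Q n) < wq (Q (Suc n))"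
   "\<And>n a. a : mesos (Q n) ==> wm (mes (Q n) a) < wq (Q (Suc n))" by blast
 have be: "qbeg (Q n) <= qfin (Q n)" for n
 proof -
  obtain m eps where "scc_on m eps (%a. mbeg (mes (Q n) a)) (mesos (Q n)) (coef3 (Q n))" using macro_scc(1)[OF Q(1)] by blast
  hence "mesos (Q n) ~= {}" by (rule scc_on_nonempty)
  then obtain a where a: "a : mesos (Q n)" by blast
  obtain L where K: "meso_ok (wq (Q n)) L ((1/2)^(n + 1)) (mes (Q n) a)" using macro_mes(1)[OF Q(1) a] by blast
  obtain m' eps' where "scc_on m' eps' (%b. beg (mic (mes (Q n) a) b)) (mics (mes (Q n) a)) (coef2 (mes (Q n) a))" using macro_scc(2)[OF Q(1) a] by blast
  hence "mics (mes (Q n) a) ~= {}" by (rule scc_on_nonempty)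
  then obtain b where b: "b : mics (mes (Q n) a)" by blast
  obtain m'' eps'' where "scc_on m'' eps'' (lft (mic (mes (Q n) a) b)) (slots (mic (mes (Q n) a) b)) (coef1 (mic (mes (Q n) a) b))" using macro_scc(3)[OF Q(1) a b] by blast
  hence "slots (mic (mes (Q n) a) b) ~= {}" by (rule scc_on_nonempty)
  then obtain c where c: "c : slots (mic (mes (Q n) a) b)" by blast
  show ?thesis using micro_cell(2)[OF meso_mic(1)[OF K b] c] meso_mic(2,3)[OF K b] macro_mes(2,3)[OF Q(1) a] by linarith
 qed
 have wmono: "wq (Q i) <= wq (Q i')" if "i <= i'" for i i' by (rule lift_Suc_mono_le[of "%n. wq (Q n)"]) (use Q(4) that less_imp_le in auto)
 interpret tower l L1 L2 \<sigma> Q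
 proof (unfold_locales)
  show "macro_ok ((1/2)^(i + 1)) (Q i)" for i by (rule Q(1))
  show "qfin (Q i) < qbeg (Q i')" if "i < i'" for i i' by (rule chain_less[of "%n. qfin (Q n)" "%n. qbeg (Q n)", OF Q(3) be that])
  show "wq (Q i) < wq (Q i')" if "i < i'" for i i' using Q(4)[of i] wmono[of "Suc i" i'] that by simp
  show "wm (mes (Q i) a) < wq (Q i')" if "i < i'" "a : mesos (Q i)" for i i' a using Q(5)[OF that(2)] wmono[of "Suc i" i'] that(1) by simp
 qed
 have mem: "mac_vec v (Q i) : Z" if Z: "rich Z" and v: "\<And>M c. in_spans Z1 Z2 M ==> c : slots M ==> v M c : Z" for v Z i unfolding mac_vec_def
 proof (rule richD(2)[OF Z])
  show "finite (mesos (Q i))" using macro_scc(1)[OF Q(1)] scc_finite by blast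
  fix a assume a: "a : mesos (Q i)"
  show "mes_vec v (mes (Q i) a) : Z" unfolding mes_vec_def
  proof (rule richD(2)[OF Z])
   show "finite (mics (mes (Q i) a))" using macro_scc(2)[OF Q(1) a] scc_finite by blast
   fix b assume b: "b : mics (mes (Q i) a)"
   have sp: "in_spans Z1 Z2 (mic (mes (Q i) a) b)" using Q(2) a b by blast
   show "mic_vec v (mic (mes (Q i) a) b) : Z" unfolding mic_vec_def
   proof (rule richD(2)[OF Z])
    show "finite (slots (mic (mes (Q i) a) b))" using macro_scc(3)[OF Q(1) a b] scc_finite by blast
   qed (rule v[OF sp])
  qed
 qed
 define x where "x = (%i. mac_vec xv (Q i))"
 define y where "y = (%i. mac_vec yv (Q i))"
 have xZ: "x i : Z1" for i unfolding x_def by (rule mem[OF Z(1)]) (simp add: in_spans_def)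
 have yZ: "y i : Z2" for i unfolding y_def by (rule mem[OF Z(2)]) (simp add: in_spans_def)
 have xc: "x i : c00" for i by (rule richD(1)[OF Z(1) xZ])
 have nx: "1/2 <= N (x i)" for i
 proof -
  have "N (mac_vec xa (Q i)) = N (x i)" using N_abs[OF xc[of i]] supp_mac(3)[of i] unfolding x_def by simp
  moreover have "1 - (1/2)^(i + 1) <= N (mac_vec xa (Q i))" by (rule macro_norm[OF Q(1)]) simp
  moreover have "(1/2::real)^(i + 1) <= 1/2" using power_decreasing[of 1 "i + 1" "1/2::real"] by simp
  ultimately show ?thesis by linarith
 qed
 have low: "\<bar>\<alpha> i\<bar> <= 2 * N (lincomb I \<alpha> x)" if I: "finite I" "i : I" for I i \<alpha>
 proof -
  have d: "disjoint_family_on (%i. supp (x i)) I" unfolding disjoint_family_on_def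
  proof (intro ballI impI, rule ccontr)
   fix j j' assume j: "j ~= j'" "supp (x j) \<inter> supp (x j') ~= {}"
   then obtain t where t: "t : supp (x j)" "t : supp (x j')" by blast
   have "qbeg (Q j) <= t" "t <= qfin (Q j)" "qbeg (Q j') <= t" "t <= qfin (Q j')" using subsetD[OF supp_mac(1)] t unfolding x_def by fastforce+
   moreover have "qfin (Q j) < qbeg (Q j') \<or> qfin (Q j') < qbeg (Q j)" using Q_sep[of j j'] Q_sep[of j' j] j(1) by linarith
   ultimately show False by linarith
  qed
  have "\<bar>\<alpha> i\<bar> * (1/2) <= \<bar>\<alpha> i\<bar> * N (x i)" by (rule mult_left_mono[OF nx]) simp
  also have "... = N (%t. \<alpha> i * x i t)" by (rule N_scale[OF xc, symmetric])
  also have "... <= N (lincomb I \<alpha> x)"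
  proof (rule N_mono_abs[OF c00_scale[OF xc] c00_lincomb[OF I(1) xc]])
   fix t
   have "\<bar>\<alpha> i\<bar> * \<bar>x i t\<bar> <= (SUM k:I. \<bar>\<alpha> k\<bar> * \<bar>x k t\<bar>)" by (rule member_le_sum[OF I(2) _ I(1)]) simp
   also have "... = \<bar>lincomb I \<alpha> x t\<bar>" using fun_cong[OF sum_disjoint_abs[OF I(1) d, of \<alpha>], of t] unfolding lincomb_def by simp
   finally show "\<bar>\<alpha> i * x i t\<bar> <= \<bar>lincomb I \<alpha> x t\<bar>" by (simp add: abs_mult)
  qed
  finally show ?thesis by simp
 qed
 show ?thesis by (rule exI[of _ x], rule exI[of _ y]) (use xZ yZ low tower_equiv x_def y_def in auto)
qed

end

section \<open>Isomorphic subspaces\<close>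

lemma subspace_closure_normed:
 fixes S :: "'a::real_normed_vector set"
 assumes S: "subspace S" shows "subspace (closure S)"
proof (rule subspaceI)
 show "0 : closure S" using subspace_0[OF S] closure_subset by blast
 fix x assume "x : closure S"
 then obtain u where u: "ALL n. u n : S" "u \<longlonglongrightarrow> x" unfolding closure_sequential by blast
 have "ALL n. c *\<^sub>R u n : S" for c using u(1) subspace_scale[OF S] by blast
 moreover have "(%n. c *\<^sub>R u n) \<longlonglongrightarrow> c *\<^sub>R x" for c by (intro tendsto_intros u(2))
 ultimately show "c *\<^sub>R x : closure S" for c unfolding closure_sequential by (intro exI conjI)
 fix y assume "y : closure S"
 then obtain v where v: "ALL n. v n : S" "v \<longlonglongrightarrow> y" unfolding closure_sequential by blast
 have "ALL n. u n + v n : S" using u(1) v(1) subspace_add[OF S] by blast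
 moreover have "(%n. u n + v n) \<longlonglongrightarrow> x + y" by (intro tendsto_intros u(2) v(2))
 ultimately show "x + y : closure S" unfolding closure_sequential by (intro exI conjI)
qed

text \<open>The values are limits along approximating sequences, well defined by the Lipschitz
  bound. The last clause, convergence along every such sequence, is what shows two mutually inverse
  maps to have mutually inverse extensions.\<close>

lemma bounded_extension:
 fixes f :: "'a::real_normed_vector => 'b::banach"
 assumes S: "subspace S" and add: "\<And>x y. x : S ==> y : S ==> f (x + y) = f x + f y"
  and scale: "\<And>x c. x : S ==> f (c *\<^sub>R x) = c *\<^sub>R f x"
  and bound: "\<And>x. x : S ==> norm (f x) <= C * norm x" and C: "0 <= C"
 shows "EX g. (ALL x:S. g x = f x) & (ALL x:closure S. ALL y:closure S. g (x + y) = g x + g y) &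
  (ALL x:closure S. ALL c. g (c *\<^sub>R x) = c *\<^sub>R g x) & (ALL x:closure S. norm (g x) <= C * norm x) &
  (ALL u x. (ALL n::nat. u n : S) --> u \<longlonglongrightarrow> x --> (%n. f (u n)) \<longlonglongrightarrow> g x)"
proof -
 have diff: "f (x - y) = f x - f y" if "x : S" "y : S" for x y using add[OF that(1) subspace_scale[OF S that(2), of "-1"]] scale[OF that(2), of "-1"] by simp
 have lip: "dist (f x) (f y) <= C * dist x y" if "x : S" "y : S" for x y using bound[OF subspace_diff[OF S that]] diff[OF that] by (simp add: dist_norm)
 have conv: "EX z. (%n. f (u n)) \<longlonglongrightarrow> z" if u: "\<And>n::nat. u n : S" "u \<longlonglongrightarrow> x" for u x
 proof -
  have "Cauchy (%n. f (u n))"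
  proof (rule metric_CauchyI)
   fix r :: real assume r: "0 < r"
   have "Cauchy u" using u(2) by (rule LIMSEQ_imp_Cauchy)
   then obtain M where M: "\<And>m n. M <= m ==> M <= n ==> dist (u m) (u n) < r / (C + 1)" using metric_CauchyD[of u "r / (C + 1)"] r C by auto
   have "dist (f (u m)) (f (u n)) < r" if "M <= m" "M <= n" for m n
   proof -
    have "dist (f (u m)) (f (u n)) <= C * dist (u m) (u n)" by (rule lip[OF u(1) u(1)])
    also have "... <= (C + 1) * dist (u m) (u n)" by (rule mult_right_mono) simp_all
    also have "... < (C + 1) * (r / (C + 1))" by (rule mult_strict_left_mono[OF M[OF that]]) (use C in simp)
    also have "... = r" using C by simp
    finally show ?thesis .
   qed
   thus "EX M. ALL m>=M. ALL n>=M. dist (f (u m)) (f (u n)) < r" by blast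
  qed
  thus ?thesis by (metis Cauchy_convergent convergent_def)
 qed
 define U where "U = (%x. SOME u. (ALL n::nat. u n : S) & u \<longlonglongrightarrow> x)"
 have U: "(ALL n::nat. U x n : S) & U x \<longlonglongrightarrow> x" if "x : closure S" for x unfolding U_def by (rule someI_ex[OF closure_sequential[THEN iffD1, OF that]])
 define g where "g = (%x. lim (%n. f (U x n)))"
 have key: "(%n. f (u n)) \<longlonglongrightarrow> g x" if u: "\<And>n::nat. u n : S" "u \<longlonglongrightarrow> x" for u x
 proof -
  have x: "x : closure S" by (rule closure_sequential[THEN iffD2]) (use u in blast)
  have U1: "\<And>n. U x n : S" "U x \<longlonglongrightarrow> x" using U[OF x] by blast+
  obtain z where z: "(%n. f (U x n)) \<longlonglongrightarrow> z" using conv[OF U1] by blast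
  have gz: "g x = z" unfolding g_def by (rule limI[OF z])
  have "(%n. u n - U x n) \<longlonglongrightarrow> x - x" by (rule tendsto_diff[OF u(2) U1(2)])
  hence "(%n. norm (u n - U x n)) \<longlonglongrightarrow> 0" by (simp add: tendsto_norm_zero)
  hence "(%n. C * norm (u n - U x n)) \<longlonglongrightarrow> 0" by (rule tendsto_mult_right_zero)
  hence "(%n. f (u n) - f (U x n)) \<longlonglongrightarrow> 0" by (rule Lim_null_comparison[rotated]) (use lip[OF u(1) U1(1)] in "simp add: dist_norm")
  from tendsto_add[OF this z] show ?thesis unfolding gz by simp
 qed
 show ?thesis
 proof (intro exI[of _ g] conjI ballI allI impI)
  show "g x = f x" if "x : S" for x using key[of "%_. x" x] that by (simp add: LIMSEQ_const_iff)
  show "(%n. f (u n)) \<longlonglongrightarrow> g x" if "ALL n. u n : S" "u \<longlonglongrightarrow> x" for u x using key[of u x] that by blast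
  fix x assume x: "x : closure S"
  have Ux: "\<And>n. U x n : S" "U x \<longlonglongrightarrow> x" using U[OF x] by blast+
  show "g (c *\<^sub>R x) = c *\<^sub>R g x" for c
  proof (rule LIMSEQ_unique)
   show "(%n. f (c *\<^sub>R U x n)) \<longlonglongrightarrow> g (c *\<^sub>R x)" by (rule key) (auto intro: subspace_scale[OF S] Ux tendsto_intros)
   show "(%n. f (c *\<^sub>R U x n)) \<longlonglongrightarrow> c *\<^sub>R g x" using tendsto_scaleR[OF tendsto_const key[OF Ux]] scale[OF Ux(1)] by simp
  qed
  show "norm (g x) <= C * norm x"
  proof (rule LIMSEQ_le)
   show "(%n. norm (f (U x n))) \<longlonglongrightarrow> norm (g x)" by (rule tendsto_norm[OF key[OF Ux]])
   show "(%n. C * norm (U x n)) \<longlonglongrightarrow> C * norm x" by (intro tendsto_intros Ux)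
   show "EX N. ALL n>=N. norm (f (U x n)) <= C * norm (U x n)" using bound[OF Ux(1)] by blast
  qed
  fix y assume y: "y : closure S"
  have Uy: "\<And>n. U y n : S" "U y \<longlonglongrightarrow> y" using U[OF y] by blast+
  show "g (x + y) = g x + g y"
  proof (rule LIMSEQ_unique)
   show "(%n. f (U x n + U y n)) \<longlonglongrightarrow> g (x + y)" by (rule key) (auto intro: subspace_add[OF S] Ux Uy tendsto_add)
   show "(%n. f (U x n + U y n)) \<longlonglongrightarrow> g x + g y" using tendsto_add[OF key[OF Ux] key[OF Uy]] add[OF Ux(1) Uy(1)] by simp
  qed
 qed
qed

text \<open>The coefficient bound yields injectivity and independence of the sequence at once, so
  its closed span is infinite-dimensional and maps are freely defined on its members.\<close>

context
 fixes a :: "nat => 'b::banach" and C :: real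
 assumes coef: "\<And>I \<alpha> i. finite I ==> i : I ==> \<bar>\<alpha> i\<bar> <= C * norm (SUM i:I. \<alpha> i *\<^sub>R a i)"
begin

lemma coef_inj: "inj a"
proof (rule injI, rule ccontr)
 fix i j assume h: "a i = a j" "i ~= j"
 have "\<bar>(%k. if k = i then 1 else -1) i\<bar> <= C * norm (SUM k:{i, j}. (%k. if k = i then 1 else -1::real) k *\<^sub>R a k)" by (rule coef) simp_all
 thus False using h by simp
qed

lemma coef_independent: "independent (range a)" unfolding independent_explicit_finite_subsets
proof (intro allI impI ballI)
 fix S u v assume S: "S \<subseteq> range a" "finite S" "(SUM v:S. u v *\<^sub>R v) = 0" and v: "v : S"
 let ?I = "a -` S"
 have fI: "finite ?I" by (rule finite_vimageI[OF S(2) coef_inj])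
 have im: "a ` ?I = S" using S(1) by (simp add: image_vimage_eq inf_absorb1)
 have "(SUM v:S. u v *\<^sub>R v) = (SUM i:?I. u (a i) *\<^sub>R a i)" by (rule sum.reindex_cong[OF inj_on_subset[OF coef_inj subset_UNIV] im[symmetric]]) (rule refl)
 moreover obtain i where i: "i : ?I" "v = a i" using v im by blast
 ultimately have "\<bar>u (a i)\<bar> <= C * norm (0::'b)" using coef[OF fI i(1), of "%i. u (a i)"] S(3) by simp
 thus "u v = 0" using i(2) by simp
qed

lemma coef_span:
 assumes "x : span (range a)" shows "EX I \<alpha>. finite I & x = (SUM i:I. \<alpha> i *\<^sub>R a i)"
proof -
 obtain S u where S: "finite S" "S \<subseteq> range a" "x = (SUM v:S. u v *\<^sub>R v)" using assms unfolding span_explicit by blast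
 have fI: "finite (a -` S)" by (rule finite_vimageI[OF S(1) coef_inj])
 have im: "a ` (a -` S) = S" using S(2) by (simp add: image_vimage_eq inf_absorb1)
 have "x = (SUM i:a -` S. u (a i) *\<^sub>R a i)" unfolding S(3) by (rule sum.reindex_cong[OF inj_on_subset[OF coef_inj subset_UNIV] im[symmetric]]) (rule refl)
 thus ?thesis using fI by (intro exI[of _ "a -` S"] exI[of _ "%i. u (a i)"]) simp
qed

lemma coef_infinite_dimensional: "infinite_dimensional (closure (span (range a)))" unfolding infinite_dimensional_def
proof
 assume "EX B. finite B & closure (span (range a)) \<subseteq> span B"
 then obtain B where B: "finite B" "closure (span (range a)) \<subseteq> span B" by blast
 have "range a \<subseteq> span B" using B(2) closure_subset span_superset by (meson order_trans)
 hence "finite (range a)" using independent_span_bound[OF B(1) coef_independent] by blast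
 thus False using finite_imageD[OF _ coef_inj] by simp
qed

lemma coef_linear_map:
 fixes b :: "nat => 'b"
 shows "EX f. linear f & (ALL I \<alpha>. f (SUM i:I. \<alpha> i *\<^sub>R a i) = (SUM i:I. \<alpha> i *\<^sub>R b i))"
proof -
 obtain f :: "'b => 'b" where f: "linear f" "ALL x:range a. f x = b (inv a x)" using linear_independent_extend[OF coef_independent, of "%x. b (inv a x)"] by blast
 have "f (a i) = b i" for i using f(2) inv_f_f[OF coef_inj] by simp
 hence "f (SUM i:I. \<alpha> i *\<^sub>R a i) = (SUM i:I. \<alpha> i *\<^sub>R b i)" for I \<alpha> by (simp add: linear_sum[OF f(1)] linear_scale[OF f(1)])
 thus ?thesis using f(1) by blast
qed

end

text \<open>Sending one sequence to the other is bounded in both directions on finite combinations;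
  both maps extend to the closures, where they remain inverse to each other by density.\<close>

lemma equivalent_sequences_isomorphic:
 fixes a b :: "nat => 'b::banach"
 assumes a: "\<And>I \<alpha> i. finite I ==> i : I ==> \<bar>\<alpha> i\<bar> <= C * norm (SUM i:I. \<alpha> i *\<^sub>R a i)"
  and b: "\<And>I \<alpha> i. finite I ==> i : I ==> \<bar>\<alpha> i\<bar> <= C * norm (SUM i:I. \<alpha> i *\<^sub>R b i)"
  and ab: "\<And>I \<alpha>. finite I ==> norm (SUM i:I. \<alpha> i *\<^sub>R b i) <= C * norm (SUM i:I. \<alpha> i *\<^sub>R a i)"
  and ba: "\<And>I \<alpha>. finite I ==> norm (SUM i:I. \<alpha> i *\<^sub>R a i) <= C * norm (SUM i:I. \<alpha> i *\<^sub>R b i)"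
  and C: "0 <= C"
 shows "isomorphic_subspaces (closure (span (range a))) (closure (span (range b)))"
proof -
 obtain f where f: "linear f" "\<And>I \<alpha>. f (SUM i:I. \<alpha> i *\<^sub>R a i) = (SUM i:I. \<alpha> i *\<^sub>R b i)" using coef_linear_map[OF a, of b] by blast
 obtain h where h: "linear h" "\<And>I \<alpha>. h (SUM i:I. \<alpha> i *\<^sub>R b i) = (SUM i:I. \<alpha> i *\<^sub>R a i)" using coef_linear_map[OF b, of a] by blast
 have fS: "norm (f x) <= C * norm x" "f x : span (range b)" "h (f x) = x" if x: "x : span (range a)" for x
 proof -
  obtain I \<alpha> where I: "finite I" "x = (SUM i:I. \<alpha> i *\<^sub>R a i)" using coef_span[OF a x] by blast
  show "norm (f x) <= C * norm x" unfolding I(2) f(2) by (rule ab[OF I(1)])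
  show "f x : span (range b)" unfolding I(2) f(2) by (intro span_sum span_scale span_base) simp
  show "h (f x) = x" unfolding I(2) f(2) h(2) ..
 qed
 have hS: "norm (h x) <= C * norm x" "h x : span (range a)" "f (h x) = x" if x: "x : span (range b)" for x
 proof -
  obtain I \<alpha> where I: "finite I" "x = (SUM i:I. \<alpha> i *\<^sub>R b i)" using coef_span[OF b x] by blast
  show "norm (h x) <= C * norm x" unfolding I(2) h(2) by (rule ba[OF I(1)])
  show "h x : span (range a)" unfolding I(2) h(2) by (intro span_sum span_scale span_base) simp
  show "f (h x) = x" unfolding I(2) f(2) h(2) ..
 qed
 let ?A = "closure (span (range a))" let ?B = "closure (span (range b))"
 obtain F where F: "ALL x:?A. ALL y:?A. F (x + y) = F x + F y" "ALL x:?A. ALL c. F (c *\<^sub>R x) = c *\<^sub>R F x" "ALL x:?A. norm (F x) <= C * norm x"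
   "ALL u x. (ALL n::nat. u n : span (range a)) --> u \<longlonglongrightarrow> x --> (%n. f (u n)) \<longlonglongrightarrow> F x"
  using bounded_extension[OF subspace_span, of "range a" f C, OF linear_add[OF f(1)] linear_scale[OF f(1)] fS(1) C] by blast
 obtain H where H: "ALL x:?B. ALL y:?B. H (x + y) = H x + H y" "ALL x:?B. ALL c. H (c *\<^sub>R x) = c *\<^sub>R H x" "ALL x:?B. norm (H x) <= C * norm x"
   "ALL u x. (ALL n::nat. u n : span (range b)) --> u \<longlonglongrightarrow> x --> (%n. h (u n)) \<longlonglongrightarrow> H x"
  using bounded_extension[OF subspace_span, of "range b" h C, OF linear_add[OF h(1)] linear_scale[OF h(1)] hS(1) C] by blast
 have FA: "F x : ?B & H (F x) = x" if xc: "x : ?A" for x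
 proof -
  obtain u where u: "ALL n. u n : span (range a)" "u \<longlonglongrightarrow> x" using closure_sequential[THEN iffD1, OF xc] by (elim exE conjE)
  have fu: "(%n. f (u n)) \<longlonglongrightarrow> F x" by (rule F(4)[rule_format, OF u(1)[rule_format] u(2)])
  have fb: "ALL n. f (u n) : span (range b)" using fS(2) u(1) by blast
  have "(%n. h (f (u n))) \<longlonglongrightarrow> H (F x)" by (rule H(4)[rule_format, OF fb[rule_format] fu])
  moreover have "(%n. h (f (u n))) = u" using fS(3) u(1) by auto
  ultimately have "H (F x) = x" using u(2) LIMSEQ_unique by metis
  moreover have "F x : ?B" by (rule closure_sequential[THEN iffD2], rule exI[of _ "%n. f (u n)"], rule conjI[OF fb fu])
  ultimately show ?thesis by simp
 qed
 have HB: "H x : ?A & F (H x) = x" if xc: "x : ?B" for x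
 proof -
  obtain u where u: "ALL n. u n : span (range b)" "u \<longlonglongrightarrow> x" using closure_sequential[THEN iffD1, OF xc] by (elim exE conjE)
  have hu: "(%n. h (u n)) \<longlonglongrightarrow> H x" by (rule H(4)[rule_format, OF u(1)[rule_format] u(2)])
  have ha: "ALL n. h (u n) : span (range a)" using hS(2) u(1) by blast
  have "(%n. f (h (u n))) \<longlonglongrightarrow> F (H x)" by (rule F(4)[rule_format, OF ha[rule_format] hu])
  moreover have "(%n. f (h (u n))) = u" using hS(3) u(1) by auto
  ultimately have "F (H x) = x" using u(2) LIMSEQ_unique by metis
  moreover have "H x : ?A" by (rule closure_sequential[THEN iffD2], rule exI[of _ "%n. h (u n)"], rule conjI[OF ha hu])
  ultimately show ?thesis by simp
 qed
 have cont: "continuous_on S G" if S: "subspace S" "ALL x:S. ALL y:S. G (x + y) = G x + G y" "ALL x:S. ALL c. G (c *\<^sub>R x) = c *\<^sub>R G x" "ALL x:S. norm (G x) <= C * norm x" for S and G :: "'b => 'b"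
 proof (rule lipschitz_on_continuous_on, rule lipschitz_onI[OF _ C])
  fix x y assume x: "x : S" "y : S"
  have "G (x + (-1) *\<^sub>R y) = G x + G ((-1) *\<^sub>R y)" using S(2) x(1) subspace_scale[OF S(1) x(2), of "-1"] by blast
  moreover have "G ((-1) *\<^sub>R y) = (-1) *\<^sub>R G y" using S(3) x(2) by blast
  ultimately have e: "G (x - y) = G x - G y" by simp
  show "dist (G x) (G y) <= C * dist x y" unfolding dist_norm e[symmetric] by (rule bspec[OF S(4) subspace_diff[OF S(1) x]])
 qed
 have "homeomorphism ?A ?B F H" unfolding homeomorphism_def
 proof (intro conjI ballI)
  show "H (F x) = x" if "x : ?A" for x using FA[OF that] ..
  show "F (H y) = y" if "y : ?B" for y using HB[OF that] ..
  show "F ` ?A = ?B"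
  proof (intro equalityI subsetI)
   show "y : ?B" if "y : F ` ?A" for y using that FA by blast
   show "y : F ` ?A" if "y : ?B" for y using image_eqI[of y F "H y"] HB[OF that] by simp
  qed
  show "H ` ?B = ?A"
  proof (intro equalityI subsetI)
   show "y : ?A" if "y : H ` ?B" for y using that HB by blast
   show "y : H ` ?B" if "y : ?A" for y using image_eqI[of y H "F y"] FA[OF that] by simp
  qed
  show "continuous_on ?A F" by (rule cont[OF subspace_closure_normed[OF subspace_span] F(1-3)])
  show "continuous_on ?B H" by (rule cont[OF subspace_closure_normed[OF subspace_span] H(1-3)])
 qed
 thus ?thesis unfolding isomorphic_subspaces_def using F(1,2) by blast
qed

text \<open>If the kernel lay in the span of finitely many vectors, adding one vector on which the
  functional does not vanish would span all of \<open>Y\<close>.\<close>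

lemma kernel_infinite_dimensional:
 fixes \<phi> :: "'b::real_vector => real"
 assumes Y: "subspace Y" "infinite_dimensional Y" and \<phi>: "\<And>x y. x : Y ==> y : Y ==> \<phi> (x + y) = \<phi> x + \<phi> y" "\<And>x c. x : Y ==> \<phi> (c *\<^sub>R x) = c * \<phi> x"
 shows "subspace {y\<in>Y. \<phi> y = 0}" "infinite_dimensional {y\<in>Y. \<phi> y = 0}"
proof -
 have z: "\<phi> 0 = 0" using \<phi>(2)[OF subspace_0[OF Y(1)], of 0] by simp
 show "subspace {y\<in>Y. \<phi> y = 0}" by (rule subspaceI) (use z \<phi> subspace_0[OF Y(1)] subspace_add[OF Y(1)] subspace_scale[OF Y(1)] in auto)
 show "infinite_dimensional {y\<in>Y. \<phi> y = 0}" unfolding infinite_dimensional_def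
 proof
  assume "EX B. finite B & {y\<in>Y. \<phi> y = 0} \<subseteq> span B"
  then obtain B where B: "finite B" "{y\<in>Y. \<phi> y = 0} \<subseteq> span B" by blast
  show False
  proof (cases "EX v:Y. \<phi> v ~= 0")
   case False
   hence "Y \<subseteq> span B" using B(2) by blast
   thus False using Y(2) B(1) unfolding infinite_dimensional_def by blast
  next
   case True
   then obtain v where v: "v : Y" "\<phi> v ~= 0" by blast
   have "Y \<subseteq> span (insert v B)"
   proof
    fix y assume y: "y : Y"
    let ?c = "\<phi> y / \<phi> v"
    have sv: "(- ?c) *\<^sub>R v : Y" by (rule subspace_scale[OF Y(1) v(1)])
    have "\<phi> (y + (- ?c) *\<^sub>R v) = \<phi> y + (- ?c) * \<phi> v" using \<phi>(1)[OF y sv] unfolding \<phi>(2)[OF v(1)] .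
    hence "y + (- ?c) *\<^sub>R v : span B" using B(2) subspace_add[OF Y(1) y sv] v(2) by auto
    hence "y + (- ?c) *\<^sub>R v : span (insert v B)" using span_mono[of B "insert v B"] by blast
    moreover have "?c *\<^sub>R v : span (insert v B)" by (intro span_scale span_base) simp
    ultimately have "(y + (- ?c) *\<^sub>R v) + ?c *\<^sub>R v : span (insert v B)" by (rule span_add)
    thus "y : span (insert v B)" by simp
   qed
   thus False using Y(2) B(1) unfolding infinite_dimensional_def by blast
  qed
 qed
qed

section \<open>Almost block sequences in subspaces of the completion\<close>

locale cr_completion = cr_space +
 fixes e :: "nat => 'b::banach" and X :: "'b set"
 assumes completion: "completion_c00 N e X"
begin

definition emb :: "vec => 'b" where "emb x = (SUM i:supp x. x i *\<^sub>R e i)"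

lemma emb_superset: "finite S ==> supp x \<subseteq> S ==> emb x = (SUM i:S. x i *\<^sub>R e i)" unfolding emb_def by (rule sum.mono_neutral_left) (auto simp: supp_def)

lemma norm_emb: "x : c00 ==> norm (emb x) = N x" using completion unfolding completion_c00_def emb_def by blast

lemma emb_lincomb:
 assumes I: "finite I" "\<And>i. i : I ==> x i : c00" shows "emb (lincomb I \<alpha> x) = (SUM i:I. \<alpha> i *\<^sub>R emb (x i))"
proof -
 define S where "S = (UN i:I. supp (x i))"
 have S: "finite S" unfolding S_def using assms by (auto simp: c00_def)
 have "emb (lincomb I \<alpha> x) = (SUM t:S. (SUM i:I. \<alpha> i * x i t) *\<^sub>R e t)"
  using emb_superset[OF S, of "lincomb I \<alpha> x"] supp_lincomb[of I \<alpha> x] unfolding S_def[symmetric] lincomb_def by simp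
 also have "... = (SUM t:S. SUM i:I. (\<alpha> i * x i t) *\<^sub>R e t)" by (simp only: scaleR_left.sum)
 also have "... = (SUM i:I. SUM t:S. (\<alpha> i * x i t) *\<^sub>R e t)" by (rule sum.swap)
 also have "... = (SUM i:I. \<alpha> i *\<^sub>R (SUM t:S. x i t *\<^sub>R e t))" by (simp add: scaleR_right.sum)
 also have "... = (SUM i:I. \<alpha> i *\<^sub>R emb (x i))" by (rule sum.cong[OF refl]) (subst emb_superset[OF S], auto simp: S_def)
 finally show ?thesis .
qed

lemma lincomb2: "lincomb {0, Suc 0} (%k. if k = 0 then a else b) (%k. if k = 0 then x else y) = (%t. a * x t + b * y t)" by (simp add: lincomb_def)

lemma emb_comb:
 assumes "x : c00" "y : c00"
 shows "emb (%t. a * x t + b * y t) = a *\<^sub>R emb x + b *\<^sub>R emb y" "(%t. a * x t + b * y t) : c00"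
 using emb_lincomb[of "{0, Suc 0}" "%k. if k = 0 then x else y" "%k. if k = 0 then a else b"]
  c00_lincomb[of "{0, Suc 0}" "%k. if k = 0 then x else y" "%k. if k = 0 then a else b"] assms unfolding lincomb2 by auto

lemma emb_inj: "inj_on emb c00"
proof (rule inj_onI)
 fix x y assume h: "x : c00" "y : c00" "emb x = emb y"
 let ?d = "%t. 1 * x t + (-1) * y t"
 have d: "?d : c00" by (rule emb_comb(2)[OF h(1,2)])
 have "N ?d = norm (emb ?d)" by (rule norm_emb[OF d, symmetric])
 also have "... = 0" unfolding emb_comb(1)[OF h(1,2)] h(3) by simp
 finally have "\<bar>?d t\<bar> <= 0" for t using coord_le_N[OF d, of t] by simp
 thus "x = y" by (intro ext) simp
qed

lemma unit_c00: "1 <= n ==> unit_vec n : c00" by (rule W_c00[OF W_unit])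

lemma supp_unit: "supp (unit_vec n) = {n}" by (auto simp: supp_def indicator_def)

lemma span_emb: "span (e ` {1..}) = emb ` c00"
proof
 show "emb ` c00 \<subseteq> span (e ` {1..})"
 proof
  fix z assume "z : emb ` c00"
  then obtain x where x: "x : c00" "z = emb x" by blast
  show "z : span (e ` {1..})" unfolding x(2) emb_def
  proof (intro span_sum span_scale span_base imageI)
   fix i assume "i : supp x"
   thus "i : {1..}" using x(1) by (cases i) (auto simp: c00_def supp_def)
  qed
 qed
 show "span (e ` {1..}) \<subseteq> emb ` c00"
 proof (rule span_minimal)
  show "e ` {1..} \<subseteq> emb ` c00"
  proof
   fix z assume "z : e ` {1..}"
   then obtain n where n: "1 <= n" "z = e n" by auto
   have "emb (unit_vec n) = z" unfolding emb_def supp_unit n(2) by simp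
   thus "z : emb ` c00" using unit_c00[OF n(1)] by blast
  qed
  show "subspace (emb ` c00)"
  proof (rule subspaceI)
   show "0 : emb ` c00" by (rule image_eqI[of _ _ "%t. 0"]) (simp_all add: emb_def c00_def)
   show "u + v : emb ` c00" if uv: "u : emb ` c00" "v : emb ` c00" for u v
   proof -
    obtain x y where x: "x : c00" "u = emb x" "y : c00" "v = emb y" using uv by blast
    show ?thesis by (rule image_eqI[OF _ emb_comb(2)[OF x(1,3), of 1 1]]) (simp only: emb_comb(1)[OF x(1,3)] x(2,4) scaleR_one)
   qed
   show "c *\<^sub>R u : emb ` c00" if u: "u : emb ` c00" for c u
   proof -
    obtain x where x: "x : c00" "u = emb x" using u by blast
    show ?thesis by (rule image_eqI[OF _ emb_comb(2)[OF x(1) x(1), of c 0]]) (simp only: emb_comb(1)[OF x(1) x(1)] x(2) scaleR_zero_left add_0_right)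
   qed
  qed
 qed
qed

lemma X_eq: "X = closure (emb ` c00)" using completion span_emb unfolding completion_c00_def by simp

lemma subspace_X: "subspace X" "subspace (emb ` c00)"
proof -
 show "subspace (emb ` c00)" unfolding span_emb[symmetric] by (rule subspace_span)
 thus "subspace X" unfolding X_eq by (rule subspace_closure_normed)
qed

text \<open>A coordinate of a finitely supported vector is at most its norm, so the coordinate
  functional extends from the dense subspace to \<open>X\<close>.\<close>

lemma ex_coordinate:
 "EX \<phi>. (ALL x:c00. \<phi> (emb x) = x i) & (ALL y:X. ALL z:X. \<phi> (y + z) = \<phi> y + \<phi> z) & (ALL y:X. ALL c. \<phi> (c *\<^sub>R y) = c * \<phi> y) &
   (ALL y:X. \<bar>\<phi> y\<bar> <= norm y)"
proof -
 let ?f = "%z. inv_into c00 emb z i"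
 have f: "?f (emb x) = x i" if "x : c00" for x using inv_into_f_f[OF emb_inj that] by simp
 have "EX g. (ALL x:emb ` c00. g x = ?f x) & (ALL x:closure (emb ` c00). ALL y:closure (emb ` c00). g (x + y) = g x + g y) &
  (ALL x:closure (emb ` c00). ALL c. g (c *\<^sub>R x) = c *\<^sub>R g x) & (ALL x:closure (emb ` c00). norm (g x) <= 1 * norm x) &
  (ALL u x. (ALL n::nat. u n : emb ` c00) --> u \<longlonglongrightarrow> x --> (%n. ?f (u n)) \<longlonglongrightarrow> g x)"
 proof (rule bounded_extension[OF subspace_X(2)])
  fix u c assume "u : emb ` c00"
  then obtain x where x: "x : c00" "u = emb x" by blast
  show "norm (?f u) <= 1 * norm u" unfolding x(2) f[OF x(1)] norm_emb[OF x(1)] using coord_le_N[OF x(1)] by simp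
  have "c *\<^sub>R u = emb (%t. c * x t + 0 * x t)" unfolding emb_comb(1)[OF x(1) x(1)] x(2) by simp
  thus "?f (c *\<^sub>R u) = c *\<^sub>R ?f u" using f[OF emb_comb(2)[OF x(1) x(1), of c 0]] f[OF x(1)] x(2) by simp
  fix v assume "v : emb ` c00"
  then obtain y where y: "y : c00" "v = emb y" by blast
  have "u + v = emb (%t. 1 * x t + 1 * y t)" unfolding emb_comb(1)[OF x(1) y(1)] x(2) y(2) by simp
  thus "?f (u + v) = ?f u + ?f v" using f[OF emb_comb(2)[OF x(1) y(1), of 1 1]] f[OF x(1)] f[OF y(1)] x(2) y(2) by simp
 qed simp
 then obtain g where g: "ALL x:emb ` c00. g x = ?f x" "ALL x:X. ALL y:X. g (x + y) = g x + g y" "ALL x:X. ALL c. g (c *\<^sub>R x) = c *\<^sub>R g x" "ALL x:X. norm (g x) <= 1 * norm x"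
  unfolding X_eq[symmetric] by (elim exE conjE)
 have "g (emb x) = x i" if "x : c00" for x using bspec[OF g(1) imageI[OF that]] f[OF that] by simp
 thus ?thesis using g(2-4) by (intro exI[of _ g]) simp
qed

lemma infinite_dimensional_tail:
 assumes Y: "subspace Y" "infinite_dimensional Y" "Y \<subseteq> X"
  and \<phi>: "\<And>i y z. y : X ==> z : X ==> \<phi> i (y + z) = \<phi> i y + (\<phi> i z :: real)" "\<And>i y c. y : X ==> \<phi> i (c *\<^sub>R y) = c * \<phi> i y"
 shows "\<exists>Y'\<subseteq>Y. subspace Y' & infinite_dimensional Y' & (ALL y:Y'. ALL i<s::nat. \<phi> i y = 0)"
proof (induction s)
 case 0
 thus ?case using Y by blast
next
 case (Suc s)
 then obtain Y' where Y': "Y' \<subseteq> Y" "subspace Y'" "infinite_dimensional Y'" "ALL y:Y'. ALL i<s. \<phi> i y = 0" by blast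
 have sub: "Y' \<subseteq> X" using Y'(1) Y(3) by blast
 have \<phi>s: "\<And>x y. x : Y' ==> y : Y' ==> \<phi> s (x + y) = \<phi> s x + \<phi> s y" "\<And>x c. x : Y' ==> \<phi> s (c *\<^sub>R x) = c * \<phi> s x" using \<phi> sub by blast+
 have K: "subspace {y\<in>Y'. \<phi> s y = 0}" "infinite_dimensional {y\<in>Y'. \<phi> s y = 0}" by (rule kernel_infinite_dimensional[OF Y'(2,3) \<phi>s]; assumption)+
 show ?case
 proof (intro exI[of _ "{y\<in>Y'. \<phi> s y = 0}"] conjI ballI allI impI)
  show "{y\<in>Y'. \<phi> s y = 0} \<subseteq> Y" using Y'(1) by blast
  show "\<phi> i y = 0" if "y : {y\<in>Y'. \<phi> s y = 0}" "i < Suc s" for y i using that Y'(4) by (cases "i = s") auto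
 qed (rule K(1), rule K(2))
qed

text \<open>The gliding hump: finitely many coordinate functionals have an infinite-dimensional
  common kernel in \<open>Y\<close>; a unit vector in it is approximated by a finitely supported
  one, whose early coordinates are small and can be cut off.\<close>

lemma ex_far_vector:
 assumes Y: "subspace Y" "infinite_dimensional Y" "Y \<subseteq> X" and eps: "0 < eps"
 shows "EX w:Y. EX u:c00. N u = 1 & supp u \<subseteq> {s..} & norm (w - emb u) <= eps"
proof -
 have "ALL i. EX \<phi>. (ALL x:c00. \<phi> (emb x) = x i) & (ALL y:X. ALL z:X. \<phi> (y + z) = \<phi> y + \<phi> z) & (ALL y:X. ALL c. \<phi> (c *\<^sub>R y) = c * \<phi> y) &
   (ALL y:X. \<bar>\<phi> y\<bar> <= norm y)" using ex_coordinate by blast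
 from choice[OF this] obtain \<phi> where \<phi>: "\<And>i x. x : c00 ==> \<phi> i (emb x) = x i" "\<And>i y z. y : X ==> z : X ==> \<phi> i (y + z) = \<phi> i y + \<phi> i z"
   "\<And>i y c. y : X ==> \<phi> i (c *\<^sub>R y) = c * \<phi> i y" "\<And>i y. y : X ==> \<bar>\<phi> i y\<bar> <= norm y" by blast
 obtain Y' where Y': "Y' \<subseteq> Y" "subspace Y'" "infinite_dimensional Y'" "ALL y:Y'. ALL i<s. \<phi> i y = 0"
  using infinite_dimensional_tail[where s = s and \<phi> = \<phi>, OF Y \<phi>(2,3)] by blast
 have "\<not> Y' \<subseteq> span {}" using Y'(3) unfolding infinite_dimensional_def by blast
 then obtain y0 where y0: "y0 : Y'" "y0 ~= 0" by auto
 define y where "y = (1 / norm y0) *\<^sub>R y0"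
 have y: "y : Y'" "norm y = 1" unfolding y_def using subspace_scale[OF Y'(2) y0(1)] y0(2) by simp_all
 have yX: "y : X" using y(1) Y'(1) Y(3) by blast
 \<comment> \<open>Chosen so that (s + 1) \<theta> = \<open>min eps 1 / 4\<close>: one \<theta> for
   the approximation and one for each of the fewer than s coordinates cut off. The final
   normalisation divides by at least 3/4.\<close>
 define \<theta> where "\<theta> = min eps 1 / (4 * (real s + 1))"
 have \<theta>: "0 < \<theta>" unfolding \<theta>_def using eps by simp
 obtain z where z: "z : emb ` c00" "dist z y < \<theta>" using yX \<theta> unfolding X_eq closure_approachable by blast
 then obtain x where x: "x : c00" "z = emb x" by blast
 have zX: "z : X" unfolding X_eq by (rule subsetD[OF closure_subset z(1)])
 have xi: "\<bar>x i\<bar> <= \<theta>" if "i < s" for i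
 proof -
  have m: "(-1) *\<^sub>R y : X" by (rule subspace_scale[OF subspace_X(1) yX])
  have "\<phi> i (z + (-1) *\<^sub>R y) = \<phi> i z + (-1) * \<phi> i y" using \<phi>(2)[OF zX m, of i] unfolding \<phi>(3)[OF yX] .
  also have "... = x i" using \<phi>(1)[OF x(1)] x(2) Y'(4) y(1) that by simp
  finally have "\<bar>x i\<bar> <= norm (z + (-1) *\<^sub>R y)" using \<phi>(4)[OF subspace_add[OF subspace_X(1) zX m], of i] by simp
  thus ?thesis using z(2) by (simp add: dist_norm)
 qed
 define u0 where "u0 = proj {s..} x"
 have u0: "u0 : c00" unfolding u0_def by (rule proj_c00[OF x(1)])
 have d: "(%t. 1 * x t + (-1) * u0 t) = lincomb {1..<s} x unit_vec"
 proof
  fix t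
  have x0: "x 0 = 0" using x(1) by (simp add: c00_def)
  have "lincomb {1..<s} x unit_vec t = (SUM i:{1..<s}. if i = t then x i else 0)" unfolding lincomb_def by (rule sum.cong[OF refl]) (simp add: indicator_def)
  also have "... = (if t : {1..<s} then x t else 0)" by simp
  also have "... = 1 * x t + (-1) * u0 t" unfolding u0_def proj_def using x0 by (cases "t = 0") auto
  finally show "1 * x t + (-1) * u0 t = lincomb {1..<s} x unit_vec t" by simp
 qed
 have Nu: "N (unit_vec i) <= 1" for i
 proof (rule N_least)
  fix f assume "f : W"
  from dot_bound[OF this, of "unit_vec i"] show "\<bar>dot f (unit_vec i)\<bar> <= 1" unfolding supp_unit by simp
 qed
 have "norm (emb x - emb u0) = N (%t. 1 * x t + (-1) * u0 t)" using norm_emb[OF emb_comb(2)[OF x(1) u0, of 1 "-1"]] emb_comb(1)[OF x(1) u0, of 1 "-1"] by simp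
 also have "... <= (SUM i:{1..<s}. \<bar>x i\<bar> * N (unit_vec i))" unfolding d by (rule N_lincomb_le) (auto intro: unit_c00)
 also have "... <= (SUM i:{1..<s}. \<theta> * 1)" by (intro sum_mono mult_mono xi Nu) (use \<theta> N_nonneg in auto)
 also have "... <= real s * \<theta>" using \<theta> by (simp add: mult_right_mono)
 finally have "norm (emb x - emb u0) <= real s * \<theta>" .
 moreover have "norm (y - emb x) < \<theta>" using z(2) x(2) by (simp add: dist_norm norm_minus_commute)
 ultimately have close: "norm (y - emb u0) <= (real s + 1) * \<theta>" using norm_triangle_ineq[of "y - emb x" "emb x - emb u0"] by (simp add: algebra_simps)
 have q: "(real s + 1) * \<theta> = min eps 1 / 4" unfolding \<theta>_def by (simp add: field_simps)
 have Nu0: "3/4 <= N u0"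
 proof -
  have "1 <= norm (y - emb u0) + norm (emb u0)" using norm_triangle_ineq[of "y - emb u0" "emb u0"] y(2) by simp
  thus ?thesis using close q norm_emb[OF u0] by (simp add: min_def split: if_splits)
 qed
 let ?u = "%t. (1 / N u0) * u0 t" let ?w = "(1 / N u0) *\<^sub>R y"
 have uc: "?u : c00" by (rule c00_scale[OF u0])
 have eu: "emb ?u = (1 / N u0) *\<^sub>R emb u0" using emb_comb(1)[OF u0 u0, of "1 / N u0" 0] by simp
 have "norm (?w - emb ?u) = norm (y - emb u0) / N u0" unfolding eu using Nu0 by (simp flip: scaleR_diff_right)
 also have "... <= (min eps 1 / 4) / (3/4)" by (rule frac_le) (use close q Nu0 eps in auto)
 also have "... <= eps" using eps by (simp add: min_def)
 finally have n: "norm (?w - emb ?u) <= eps" .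
 have "?w : Y" using subspace_scale[OF Y'(2) y(1)] Y'(1) by blast
 moreover have "N ?u = 1" using N_scale[OF u0, of "1 / N u0"] Nu0 by simp
 moreover have "supp ?u \<subseteq> {s..}" unfolding u0_def supp_def proj_def by (auto split: if_splits)
 ultimately show ?thesis using uc n by blast
qed

text \<open>The errors 2^(-k-3) add up to 1/4, which leaves the factors 3/4 and 5/4 in
  \<open>transfer_sequence\<close>.\<close>

lemma almost_block_sequence:
 assumes Y: "subspace Y" "infinite_dimensional Y" "Y \<subseteq> X"
 shows "EX w u. (ALL k::nat. w k : Y & u k : c00 & N (u k) = 1 & supp (u k) \<subseteq> {k..} & norm (w k - emb (u k)) <= (1/2)^(k + 3)) &
  (ALL k k'. k ~= k' --> supp (u k) \<inter> supp (u k') = {})"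
proof -
 let ?P = "%k p. fst p : Y & snd p : c00 & N (snd p) = 1 & supp (snd p) \<subseteq> {k..} & norm (fst p - emb (snd p)) <= (1/2)^(k + 3)"
 have "EX f. ALL n. ?P n (f n) & (ALL i:supp (snd (f n)). ALL j:supp (snd (f (Suc n))). i < j)"
 proof (rule dependent_nat_choice)
  obtain w u where "w : Y" "u : c00" "N u = 1" "supp u \<subseteq> {0..}" "norm (w - emb u) <= (1/2)^(0 + 3)" using ex_far_vector[OF Y, of "(1/2)^(0 + 3)" 0] by auto
  thus "EX p. ?P 0 p" by (intro exI[of _ "(w, u)"]) simp
  fix p :: "'b \<times> vec" and n :: nat assume p: "?P n p"
  have fs: "finite (supp (snd p))" using p by (simp add: c00_def)
  have pos: "0 < (1/2::real)^(Suc n + 3)" by simp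
  obtain w u where h: "w : Y" "u : c00" "N u = 1" "supp u \<subseteq> {Suc n + Suc (Max (supp (snd p)))..}" "norm (w - emb u) <= (1/2)^(Suc n + 3)"
   using ex_far_vector[OF Y pos, of "Suc n + Suc (Max (supp (snd p)))"] by blast
  have "supp u \<subseteq> {Suc n..}" using h(4) by fastforce
  moreover have "i < j" if "i : supp (snd p)" "j : supp u" for i j using Max_ge[OF fs that(1)] subsetD[OF h(4) that(2)] by simp
  ultimately show "EX p'. ?P (Suc n) p' & (ALL i:supp (snd p). ALL j:supp (snd p'). i < j)" using h by (intro exI[of _ "(w, u)"]) auto
 qed
 then obtain f where f: "\<And>n. ?P n (f n)" "\<And>n i j. i : supp (snd (f n)) ==> j : supp (snd (f (Suc n))) ==> i < j" by blast
 define u where "u = (%n. snd (f n))"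
 have uc: "u k : c00" "N (u k) = 1" for k using f(1)[of k] unfolding u_def by blast+
 have fin: "finite (supp (u k))" for k using uc(1)[of k] by (simp add: c00_def)
 have ne: "supp (u k) ~= {}" for k
 proof
  assume "supp (u k) = {}"
  hence "dot g (u k) = 0" for g unfolding dot_def by simp
  hence "N (u k) <= 0" by (intro N_least) simp
  thus False using uc(2) by simp
 qed
 have lt: "Max (supp (u i)) < Min (supp (u i'))" if "i < i'" for i i'
 proof (rule chain_less[of "%n. Max (supp (u n))" "%n. Min (supp (u n))", OF _ _ that])
  show "Max (supp (u n)) < Min (supp (u (Suc n)))" for n using f(2)[of "Max (supp (u n))" n "Min (supp (u (Suc n)))"] Max_in[OF fin ne, of n] Min_in[OF fin ne, of "Suc n"] unfolding u_def by blast
  show "Min (supp (u n)) <= Max (supp (u n))" for n using Min_le[OF fin Max_in[OF fin ne]] .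
 qed
 have "supp (u k) \<inter> supp (u k') = {}" if kk: "k ~= k'" for k k'
 proof (rule ccontr)
  assume "\<not> ?thesis"
  then obtain t where t: "t : supp (u k)" "t : supp (u k')" by blast
  have "Min (supp (u k)) <= t" "t <= Max (supp (u k))" "Min (supp (u k')) <= t" "t <= Max (supp (u k'))" using t fin by simp_all
  thus False using lt[of k k'] lt[of k' k] kk by linarith
 qed
 thus ?thesis using f(1) unfolding u_def by (intro exI[of _ "%n. fst (f n)"] exI[of _ "%n. snd (f n)"]) blast
qed

definition fspan :: "(nat => vec) => vec set" where
 "fspan u = {lincomb I c u |I c. finite I}"

lemma sum_extend: "finite J ==> I \<subseteq> J ==> (SUM k:I. g k) = (SUM k:J. if k : I then g k else 0)" for g :: "nat => 'c::comm_monoid_add" by (simp add: sum.If_cases Int_absorb1)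

lemma rich_fspan:
 assumes u: "\<And>k. u k : c00" "\<And>k. N (u k) = 1" "\<And>k. supp (u k) \<subseteq> {k..}"
 shows "rich (fspan u)" unfolding rich_def
proof (intro conjI allI impI)
 show "fspan u \<subseteq> c00" unfolding fspan_def using c00_lincomb u(1) by blast
 fix s
 have "u s = lincomb {s} (%_. 1) u" by (simp add: lincomb_def)
 hence "u s : fspan u" unfolding fspan_def by blast
 moreover have "supp (u s) ~= {}"
 proof
  assume "supp (u s) = {}"
  hence "dot g (u s) = 0" for g unfolding dot_def by simp
  hence "N (u s) <= 0" by (intro N_least) simp
  thus False using u(2)[of s] by simp
 qed
 ultimately show "EX x:fspan u. supp x ~= {} & supp x \<subseteq> {s..}" using u(3) by blast
next
 fix J :: "nat set" and a x assume J: "finite J" and x: "ALL i:J. x i : fspan u"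
 have "ALL i:J. EX Ic. finite (fst Ic) & x i = lincomb (fst Ic) (snd Ic) u" using x unfolding fspan_def by force
 from bchoice[OF this] obtain Ic where Ic: "ALL i:J. finite (fst (Ic i)) & x i = lincomb (fst (Ic i)) (snd (Ic i)) u" ..
 let ?K = "UN i:J. fst (Ic i)"
 have fK: "finite ?K" using J Ic by blast
 have "lincomb J a x = lincomb ?K (%k. SUM i:J. a i * (if k : fst (Ic i) then snd (Ic i) k else 0)) u"
 proof
  fix t
  have "lincomb J a x t = (SUM i:J. a i * (SUM k:fst (Ic i). snd (Ic i) k * u k t))"
   unfolding lincomb_def[of J] by (rule sum.cong[OF refl]) (use Ic in "simp add: lincomb_def")
  also have "... = (SUM i:J. SUM k:?K. a i * (if k : fst (Ic i) then snd (Ic i) k else 0) * u k t)"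
  proof (rule sum.cong[OF refl])
   fix i assume i: "i : J"
   have "(SUM k:fst (Ic i). snd (Ic i) k * u k t) = (SUM k:?K. if k : fst (Ic i) then snd (Ic i) k * u k t else 0)" by (rule sum_extend[OF fK]) (use i in blast)
   thus "a i * (SUM k:fst (Ic i). snd (Ic i) k * u k t) = (SUM k:?K. a i * (if k : fst (Ic i) then snd (Ic i) k else 0) * u k t)"
    by (simp only: sum_distrib_left) (rule sum.cong, simp_all)
  qed
  also have "... = (SUM k:?K. SUM i:J. a i * (if k : fst (Ic i) then snd (Ic i) k else 0) * u k t)" by (rule sum.swap)
  finally show "lincomb J a x t = lincomb ?K (%k. SUM i:J. a i * (if k : fst (Ic i) then snd (Ic i) k else 0)) u t" unfolding lincomb_def[of ?K] by (simp only: sum_distrib_right)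
 qed
 thus "lincomb J a x : fspan u" unfolding fspan_def using fK by blast
qed

text \<open>Finite combinations of the block vectors are copied with the same coefficients onto the
  nearby vectors of \<open>Y\<close>. Disjoint supports bound each coefficient by the norm of the
  combination, so the total error is at most a quarter of that norm.\<close>

lemma transfer_sequence:
 assumes Y: "subspace Y" and w: "\<And>k. w k : Y" and u: "\<And>k. u k : c00" "\<And>k. N (u k) = 1" "\<And>k k'. k ~= k' ==> supp (u k) \<inter> supp (u k') = {}"
  and close: "\<And>k. norm (w k - emb (u k)) <= (1/2)^(k + 3)" and x: "\<And>i. x i : fspan u"
 shows "EX v. (ALL i::nat. v i : Y) & (ALL J \<alpha>. finite J -->
  norm (SUM i:J. \<alpha> i *\<^sub>R v i) <= 5/4 * N (lincomb J \<alpha> x) & 3/4 * N (lincomb J \<alpha> x) <= norm (SUM i:J. \<alpha> i *\<^sub>R v i))"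
proof -
 have "ALL i. EX Ic. finite (fst Ic) & x i = lincomb (fst Ic) (snd Ic) u" using x unfolding fspan_def by force
 from choice[OF this] obtain Ic where Ic: "ALL i. finite (fst (Ic i)) & x i = lincomb (fst (Ic i)) (snd (Ic i)) u" ..
 define c where "c = (%i k. if k : fst (Ic i) then snd (Ic i) k else 0)"
 define v where "v = (%i. SUM k:fst (Ic i). snd (Ic i) k *\<^sub>R w k)"
 have vY: "v i : Y" for i unfolding v_def by (rule subspace_sum[OF Y]) (rule subspace_scale[OF Y w])
 have main: "norm ((SUM i:J. \<alpha> i *\<^sub>R v i) - emb (lincomb J \<alpha> x)) <= 1/4 * N (lincomb J \<alpha> x)" and zc: "lincomb J \<alpha> x : c00" if J: "finite J" for J \<alpha>
 proof -
  let ?K = "UN i:J. fst (Ic i)"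
  have fK: "finite ?K" using J Ic by blast
  define d where "d = (%k. SUM i:J. \<alpha> i * c i k)"
  have xr: "x i t = (SUM k:?K. c i k * u k t)" and vr: "v i = (SUM k:?K. c i k *\<^sub>R w k)" if i: "i : J" for i t
  proof -
   have sub: "fst (Ic i) \<subseteq> ?K" using i by blast
   have "x i t = (SUM k:fst (Ic i). snd (Ic i) k * u k t)" using Ic by (simp add: lincomb_def)
   also have "... = (SUM k:?K. if k : fst (Ic i) then snd (Ic i) k * u k t else 0)" by (rule sum_extend[OF fK sub])
   also have "... = (SUM k:?K. c i k * u k t)" by (rule sum.cong[OF refl]) (simp add: c_def)
   finally show "x i t = (SUM k:?K. c i k * u k t)" .
   have "v i = (SUM k:?K. if k : fst (Ic i) then snd (Ic i) k *\<^sub>R w k else 0)" unfolding v_def by (rule sum_extend[OF fK sub])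
   also have "... = (SUM k:?K. c i k *\<^sub>R w k)" by (rule sum.cong[OF refl]) (simp add: c_def)
   finally show "v i = (SUM k:?K. c i k *\<^sub>R w k)" .
  qed
  have z: "lincomb J \<alpha> x = lincomb ?K d u"
  proof
   fix t
   have "lincomb J \<alpha> x t = (SUM i:J. SUM k:?K. \<alpha> i * c i k * u k t)" unfolding lincomb_def by (rule sum.cong[OF refl]) (simp only: xr sum_distrib_left mult.assoc)
   also have "... = (SUM k:?K. SUM i:J. \<alpha> i * c i k * u k t)" by (rule sum.swap)
   finally show "lincomb J \<alpha> x t = lincomb ?K d u t" unfolding lincomb_def[of ?K] d_def by (simp only: sum_distrib_right)
  qed
  have vs: "(SUM i:J. \<alpha> i *\<^sub>R v i) = (SUM k:?K. d k *\<^sub>R w k)"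
  proof -
   have "(SUM i:J. \<alpha> i *\<^sub>R v i) = (SUM i:J. SUM k:?K. (\<alpha> i * c i k) *\<^sub>R w k)" by (rule sum.cong[OF refl]) (simp only: vr scaleR_right.sum scaleR_scaleR)
   also have "... = (SUM k:?K. SUM i:J. (\<alpha> i * c i k) *\<^sub>R w k)" by (rule sum.swap)
   finally show ?thesis unfolding d_def by (simp only: scaleR_left.sum)
  qed
  show "lincomb J \<alpha> x : c00" unfolding z by (rule c00_lincomb[OF fK u(1)])
  hence zK: "lincomb ?K d u : c00" unfolding z .
  have dis: "disjoint_family_on (%k. supp (u k)) ?K" unfolding disjoint_family_on_def using u(3) by blast
  let ?n = "N (lincomb ?K d u)"
  have dk: "\<bar>d k\<bar> <= ?n" if k: "k : ?K" for k
  proof -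
   have "\<bar>d k\<bar> = N (%t. d k * u k t)" using N_scale[OF u(1)] u(2) by simp
   also have "... <= ?n"
   proof (rule N_mono_abs[OF c00_scale[OF u(1)] zK])
    fix t
    have "\<bar>d k\<bar> * \<bar>u k t\<bar> <= (SUM j:?K. \<bar>d j\<bar> * \<bar>u j t\<bar>)" by (rule member_le_sum[OF k _ fK]) simp
    also have "... = \<bar>lincomb ?K d u t\<bar>" using fun_cong[OF sum_disjoint_abs[OF fK dis, of d], of t] unfolding lincomb_def by simp
    finally show "\<bar>d k * u k t\<bar> <= \<bar>lincomb ?K d u t\<bar>" by (simp add: abs_mult)
   qed
   finally show ?thesis .
  qed
  have geo: "(SUM k:?K. (1/2::real)^(k + 3)) <= 1/4"
  proof -
   have "(SUM k:?K. (1/2::real)^(k + 3)) = 1/4 * (SUM k:?K. (1/2)^Suc k)" by (simp add: sum_distrib_left power_add eval_nat_numeral)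
   also have "(SUM k:?K. (1/2::real)^Suc k) <= (\<Sum>k. (1/2)^Suc k)" by (rule sum_le_suminf[OF _ fK]) (auto intro: sums_summable[OF power_half_series])
   also have "... = 1" by (rule sums_unique[OF power_half_series, symmetric])
   finally show ?thesis by simp
  qed
  have "(SUM i:J. \<alpha> i *\<^sub>R v i) - emb (lincomb J \<alpha> x) = (SUM k:?K. d k *\<^sub>R (w k - emb (u k)))"
   unfolding vs z emb_lincomb[OF fK u(1)] by (simp add: scaleR_diff_right sum_subtractf)
  also have "norm ... <= (SUM k:?K. ?n * (1/2)^(k + 3))"
  proof (rule sum_norm_le)
   fix k assume k: "k : ?K"
   show "norm (d k *\<^sub>R (w k - emb (u k))) <= ?n * (1/2)^(k + 3)" unfolding norm_scaleR by (rule mult_mono[OF dk[OF k] close]) (simp_all add: N_nonneg)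
  qed
  also have "... = ?n * (SUM k:?K. (1/2)^(k + 3))" by (simp only: sum_distrib_left)
  also have "... <= ?n * (1/4)" by (rule mult_left_mono[OF geo N_nonneg])
  finally show "norm ((SUM i:J. \<alpha> i *\<^sub>R v i) - emb (lincomb J \<alpha> x)) <= 1/4 * N (lincomb J \<alpha> x)" unfolding z by simp
 qed
 have "norm (SUM i:J. \<alpha> i *\<^sub>R v i) <= 5/4 * N (lincomb J \<alpha> x) & 3/4 * N (lincomb J \<alpha> x) <= norm (SUM i:J. \<alpha> i *\<^sub>R v i)" if J: "finite J" for J \<alpha>
  using main[OF J, of \<alpha>] norm_emb[OF zc[OF J, of \<alpha>]]
   norm_triangle_ineq2[of "SUM i:J. \<alpha> i *\<^sub>R v i" "emb (lincomb J \<alpha> x)"] norm_triangle_ineq2[of "emb (lincomb J \<alpha> x)" "SUM i:J. \<alpha> i *\<^sub>R v i"]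
  by (simp add: norm_minus_commute)
 thus ?thesis using vY by (intro exI[of _ v]) blast
qed

lemma quasi_minimal_X: "quasi_minimal X" unfolding quasi_minimal_def
proof (intro allI impI)
 fix Y Z assume YZ: "closed_inf_dim_subspace Y X & closed_inf_dim_subspace Z X"
 have Y: "subspace Y" "infinite_dimensional Y" "Y \<subseteq> X" "closed Y" and Z: "subspace Z" "infinite_dimensional Z" "Z \<subseteq> X" "closed Z"
  using YZ unfolding closed_inf_dim_subspace_def by blast+
 obtain w u where wu: "ALL k::nat. w k : Y & u k : c00 & N (u k) = 1 & supp (u k) \<subseteq> {k..} & norm (w k - emb (u k)) <= (1/2)^(k + 3)"
  "ALL k k'. k ~= k' --> supp (u k) \<inter> supp (u k') = {}" using almost_block_sequence[OF Y(1-3)] by (elim exE conjE)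
 obtain w' u' where wu': "ALL k::nat. w' k : Z & u' k : c00 & N (u' k) = 1 & supp (u' k) \<subseteq> {k..} & norm (w' k - emb (u' k)) <= (1/2)^(k + 3)"
  "ALL k k'. k ~= k' --> supp (u' k) \<inter> supp (u' k') = {}" using almost_block_sequence[OF Z(1-3)] by (elim exE conjE)
 have R: "rich (fspan u)" "rich (fspan u')" by (rule rich_fspan; use wu(1) wu'(1) in blast)+
 obtain x y where xy: "ALL i::nat. x i : fspan u & y i : fspan u'"
  "ALL I \<alpha>. finite I --> N (lincomb I \<alpha> y) <= 1000 * N (lincomb I \<alpha> x) & N (lincomb I \<alpha> x) <= 1000 * N (lincomb I \<alpha> y) &
   (ALL i:I. \<bar>\<alpha> i\<bar> <= 2 * N (lincomb I \<alpha> x))" using ex_equivalent_sequences[OF R] by (elim exE conjE)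
 obtain a where a: "ALL i::nat. a i : Y" "ALL J \<alpha>. finite J -->
  norm (SUM i:J. \<alpha> i *\<^sub>R a i) <= 5/4 * N (lincomb J \<alpha> x) & 3/4 * N (lincomb J \<alpha> x) <= norm (SUM i:J. \<alpha> i *\<^sub>R a i)"
  using transfer_sequence[OF Y(1), of w u x] wu xy(1) by blast
 obtain b where b: "ALL i::nat. b i : Z" "ALL J \<alpha>. finite J -->
  norm (SUM i:J. \<alpha> i *\<^sub>R b i) <= 5/4 * N (lincomb J \<alpha> y) & 3/4 * N (lincomb J \<alpha> y) <= norm (SUM i:J. \<alpha> i *\<^sub>R b i)"
  using transfer_sequence[OF Z(1), of w' u' y] wu' xy(1) by blast
 \<comment> \<open>The largest constant that occurs is 2 * 1000 * 4/3, from the coefficient bound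
   passed on to \<open>y\<close>; the equivalence itself needs 1000 * 5/4 * 4/3.\<close>
 have E: "norm (SUM i:I. \<alpha> i *\<^sub>R b i) <= 4000 * norm (SUM i:I. \<alpha> i *\<^sub>R a i)" "norm (SUM i:I. \<alpha> i *\<^sub>R a i) <= 4000 * norm (SUM i:I. \<alpha> i *\<^sub>R b i)"
  "\<And>i. i : I ==> \<bar>\<alpha> i\<bar> <= 4000 * norm (SUM i:I. \<alpha> i *\<^sub>R a i)" "\<And>i. i : I ==> \<bar>\<alpha> i\<bar> <= 4000 * norm (SUM i:I. \<alpha> i *\<^sub>R b i)"
  if I: "finite I" for I \<alpha>
 proof -
  note A = a(2)[rule_format, OF I, of \<alpha>] and B = b(2)[rule_format, OF I, of \<alpha>] and C = xy(2)[rule_format, OF I, of \<alpha>]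
  have D: "0 <= N (lincomb I \<alpha> x)" "0 <= N (lincomb I \<alpha> y)" by (rule N_nonneg)+
  show "norm (SUM i:I. \<alpha> i *\<^sub>R b i) <= 4000 * norm (SUM i:I. \<alpha> i *\<^sub>R a i)" "norm (SUM i:I. \<alpha> i *\<^sub>R a i) <= 4000 * norm (SUM i:I. \<alpha> i *\<^sub>R b i)"
   using A B C D by linarith+
  fix i assume "i : I"
  hence "\<bar>\<alpha> i\<bar> <= 2 * N (lincomb I \<alpha> x)" using C by blast
  thus "\<bar>\<alpha> i\<bar> <= 4000 * norm (SUM i:I. \<alpha> i *\<^sub>R a i)" "\<bar>\<alpha> i\<bar> <= 4000 * norm (SUM i:I. \<alpha> i *\<^sub>R b i)" using A B C D by linarith+
 qed
 have sub: "closed_inf_dim_subspace (closure (span (range c))) S"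
  if S: "subspace S" "closed S" and c: "ALL i. c i : S" and low: "\<And>I \<alpha> i. finite I ==> i : I ==> \<bar>\<alpha> i\<bar> <= 4000 * norm (SUM i:I. \<alpha> i *\<^sub>R c i)"
  for S and c :: "nat => 'b" unfolding closed_inf_dim_subspace_def
 proof (intro conjI)
  have "span (range c) \<subseteq> S" by (rule span_minimal[OF _ S(1)]) (use c in blast)
  thus "closure (span (range c)) \<subseteq> S" by (rule closure_minimal[OF _ S(2)])
  show "subspace (closure (span (range c)))" by (rule subspace_closure_normed[OF subspace_span])
  show "infinite_dimensional (closure (span (range c)))" by (rule coef_infinite_dimensional[OF low])
 qed simp
 show "EX Y' Z'. closed_inf_dim_subspace Y' Y & closed_inf_dim_subspace Z' Z & isomorphic_subspaces Y' Z'"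
 proof (intro exI conjI)
  show "closed_inf_dim_subspace (closure (span (range a))) Y" by (rule sub[OF Y(1,4) a(1) E(3)])
  show "closed_inf_dim_subspace (closure (span (range b))) Z" by (rule sub[OF Z(1,4) b(1) E(4)])
  show "isomorphic_subspaces (closure (span (range a))) (closure (span (range b)))" by (rule equivalent_sequences_isomorphic[OF E(3) E(4) E(1) E(2)]) simp_all
 qed
qed

end

theorem theorem3p3:
  fixes l :: "nat \<Rightarrow> real \<Rightarrow> nat"
    and L1 L2 :: "nat set"
    and \<sigma> :: "nat set list \<Rightarrow> nat"
    and e :: "nat \<Rightarrow> 'b::banach"
    and Xcr :: "'b set"
  assumes "scc_function l"
    and "L1 \<union> L2 = {1..}" "L1 \<inter> L2 = {}" "infinite L1" "infinite L2"
    and "coding_function l L2 \<sigma>"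
    and "completion_c00 (cr_norm (norming_set l L1 \<sigma>)) e Xcr"
  shows "quasi_minimal Xcr"
proof -
  interpret cr_completion l L1 L2 \<sigma> e Xcr
    by unfold_locales (use assms in simp_all)
  show ?thesis by (rule quasi_minimal_X)
qed

end
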